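(* Given $\Lambda$-periodic $u_0\in L^\infty(\Lambda)\cap BV(\Lambda)$, there exists a periodic entropy solution (in the sense defined in the context) of the initial value problem $\partial_tu+\partial_x\cdot f(u)=\mathcal{L}^\mu[u]$ in $D_T$, $u(\cdot,0)=u_0$ in $\Lambda$.
   Context: Let $d\ge1$, $T>0$, $\Lambda=(0,2\pi)^d$, $D_T=\Lambda\times(0,T)$. A function is $\Lambda$-periodic if it is $2\pi$-periodic in each space coordinate; a subscript $p$ on a function space indicates $\Lambda$-periodicity in the space variables. $\partial_x=(\partial_1,\dots,\partial_d)$ is the spatial gradient. Standing assumptions. $f=(f_1,\dots,f_d)$ with $f_j\in C^s(\mathbb{R})$ for an integer $s>4+[d/2]$ ($[\cdot]$ is the integer part). $\mu\ge0$ is a Radon measure on $\mathbb{R}^d\setminus\{0\}$ with $\int_{|z|>0}|z|^2\wedge1\,d\mu(z)<\infty$, where $a\wedge b=\min(a,b)$. It is assumed throughout that for every $\epsilon>0$ the $\Lambda$-periodic viscous problem $\partial_tu_\epsilon+\partial_x\cdot f(u_\epsilon)=\mathcal{L}^\mu[u_\epsilon]+\epsilon\Delta u_\epsilon$ in $D_T$, $u_\epsilon(\cdot,0)=u_0$, admits a unique classical solution. The nonlocal operator is $$\mathcal{L}^\mu[\phi](x)=\int_{|z|>0}\phi(x+z)-\phi(x)-z\cdot\partial_x\phi(x)\mathbf{1}_{|z|<1}\,d\mu(z).$$ For $r>0$ set $$\mathcal{L}^{*,\mu}_r[\phi](x)=\int_{|z|\le r}\phi(x-z)-\phi(x)+z\cdot\partial_x\phi(x)\mathbf{1}_{|z|<1}\,d\mu(z),$$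 $$\mathcal{L}^{\mu,r}[\phi](x)=\int_{|z|>r}\phi(x+z)-\phi(x)\,d\mu(z),\qquad \gamma_\mu^r=\int_{r<|z|<1}z\,d\mu(z)$$ (with $\gamma_\mu^r=0$ if $r>1$), and $\eta(u,k)=|u-k|$, $\eta'(u,k)=\mathrm{sgn}(u-k)$, $q_j(u,k)=\eta'(u,k)(f_j(u)-f_j(k))$, $q=(q_1,\dots,q_d)$. Definition. $u$ is a periodic entropy solution of the initial value problem with datum $u_0$ if: (i) $u\in C([0,T];L^\infty_p(\mathbb{R}^d))$; (ii) for all $k\in\mathbb{R}$, all $r>0$, and all nonnegative $\varphi\in C_p^\infty(\mathbb{R}^d\times(0,T))$ (smooth, $\Lambda$-periodic in $x$) with compact support in time in $(0,T)$, $$\iint_{D_T}\eta(u,k)\partial_t\varphi+q(u,k)\cdot\partial_x\varphi+\eta(u,k)\mathcal{L}^{*,\mu}_r[\varphi]+\eta'(u,k)\mathcal{L}^{\mu,r}[u]\varphi+\eta(u,k)\gamma_\mu^r\cdot\partial_x\varphi\;dx\,dt\ge0;$$ (iii) $\mathrm{esslim}_{t\to0}\|u(\cdot,t)-u_0\|_{L^1(\Lambda)}=0$.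
   Formalization: Condition (i), u in C([0,T];L^∞_p), is read as: u(·,t) in L^∞_p, bounded uniformly in t, and continuous in t in L^1(Λ); continuity in the L^∞ norm fails for moving shocks (Burgers, μ=0). The viscous solutions attain u_0 in L^1(Λ) as t→0. *)

theory Defs
  imports "HOL-Analysis.Analysis"
begin

section \<open>Function spaces\<close>

text \<open>\<open>Ck_on k g S\<close> is meant for open \<open>S\<close>: all partial derivatives of order at most \<open>k\<close> exist and
  are continuous. (For \<open>k > 0\<close> the total differentiability that is asked for follows from this.)\<close>

primrec Ck_on :: "nat \<Rightarrow> ('a::euclidean_space \<Rightarrow> 'b::real_normed_vector) \<Rightarrow> 'a set \<Rightarrow> bool" where
  "Ck_on 0 g S \<longleftrightarrow> continuous_on S g"
| "Ck_on (Suc k) g S \<longleftrightarrow> (\<forall>x\<in>S. g differentiable (at x)) \<and>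
     (\<forall>i\<in>Basis. Ck_on k (\<lambda>x. frechet_derivative g (at x) i) S)"

definition Cinf_on :: "('a::euclidean_space \<Rightarrow> 'b::real_normed_vector) \<Rightarrow> 'a set \<Rightarrow> bool" where
  "Cinf_on g S \<longleftrightarrow> (\<forall>k. Ck_on k g S)"

definition partial :: "'n \<Rightarrow> (real^'n::finite \<Rightarrow> 'b::real_normed_vector) \<Rightarrow> real^'n \<Rightarrow> 'b" where
  "partial j g x = frechet_derivative g (at x) (axis j 1)"

definition grad :: "(real^'n::finite \<Rightarrow> real) \<Rightarrow> real^'n \<Rightarrow> real^'n" where
  "grad g x = (\<chi> j. partial j g x)"

definition laplacian :: "(real^'n::finite \<Rightarrow> real) \<Rightarrow> real^'n \<Rightarrow> real" where
  "laplacian g x = (\<Sum>j\<in>UNIV. partial j (partial j g) x)"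

definition divergence :: "(real^'n::finite \<Rightarrow> real^'n) \<Rightarrow> real^'n \<Rightarrow> real" where
  "divergence g x = (\<Sum>j\<in>UNIV. partial j (\<lambda>y. g y $ j) x)"

definition torus_cell :: "(real^'n::finite) set" where
  "torus_cell = {x. \<forall>j. 0 < x $ j \<and> x $ j < 2 * pi}"

definition periodic :: "(real^'n::finite \<Rightarrow> 'b) \<Rightarrow> bool" where
  "periodic g \<longleftrightarrow> (\<forall>x j. g (x + axis j (2 * pi)) = g x)"

text \<open>Elements of Lebesgue spaces are represented by functions; a periodic class has a
  representative that is periodic everywhere.\<close>

definition Linf_periodic :: "(real^'n::finite \<Rightarrow> real) \<Rightarrow> bool" where
  "Linf_periodic g \<longleftrightarrow> g \<in> borel_measurable lebesgue \<and> periodic g \<and>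
     (\<exists>M. AE x in lebesgue. \<bar>g x\<bar> \<le> M)"

definition total_variation :: "(real^'n::finite) set \<Rightarrow> (real^'n \<Rightarrow> real) \<Rightarrow> ereal" where
  "total_variation \<Omega> g =
     (SUP \<phi> \<in> {\<phi> :: real^'n \<Rightarrow> real^'n. Ck_on 1 \<phi> UNIV \<and> (\<forall>x. norm (\<phi> x) \<le> 1) \<and>
                 compact (closure {x. \<phi> x \<noteq> 0}) \<and> closure {x. \<phi> x \<noteq> 0} \<subseteq> \<Omega>}.
        ereal (LINT x:\<Omega>|lebesgue. g x * divergence \<phi> x))"

definition BV :: "(real^'n::finite) set \<Rightarrow> (real^'n \<Rightarrow> real) \<Rightarrow> bool" where
  "BV \<Omega> g \<longleftrightarrow> set_integrable lebesgue \<Omega> g \<and> total_variation \<Omega> g < \<infinity>"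

definition L1_dist :: "(real^'n::finite \<Rightarrow> real) \<Rightarrow> (real^'n \<Rightarrow> real) \<Rightarrow> real" where
  "L1_dist g h = (LINT x:torus_cell|lebesgue. \<bar>g x - h x\<bar>)"

definition esslim_at_0 :: "(real \<Rightarrow> real) \<Rightarrow> real \<Rightarrow> bool" where
  "esslim_at_0 g l \<longleftrightarrow>
     (\<forall>e>0. \<exists>\<delta>>0. AE t in lebesgue. 0 < t \<and> t < \<delta> \<longrightarrow> \<bar>g t - l\<bar> < e)"


section \<open>The nonlocal operators\<close>

text \<open>The measure lives on the punctured space, so the origin is automatically excluded from all
  integrals below.\<close>

definition levy_measure :: "(real^'n::finite) measure \<Rightarrow> bool" where
  "levy_measure \<mu> \<longleftrightarrow> sets \<mu> = sets (restrict_space borel (- {0})) \<and>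
     (\<forall>K. compact K \<and> K \<subseteq> - {0} \<longrightarrow> emeasure \<mu> K < \<infinity>) \<and>
     (\<integral>\<^sup>+ z. ennreal (min ((norm z)\<^sup>2) 1) \<partial>\<mu>) < \<infinity>"

definition levy_op :: "(real^'n::finite) measure \<Rightarrow> (real^'n \<Rightarrow> real) \<Rightarrow> real^'n \<Rightarrow> real" where
  "levy_op \<mu> \<phi> x =
     (LINT z:{z. norm z > 0}|\<mu>. \<phi> (x + z) - \<phi> x - (z \<bullet> grad \<phi> x) * indicator {z. norm z < 1} z)"

definition levy_inner_adjoint ::
    "(real^'n::finite) measure \<Rightarrow> real \<Rightarrow> (real^'n \<Rightarrow> real) \<Rightarrow> real^'n \<Rightarrow> real" where
  "levy_inner_adjoint \<mu> r \<phi> x =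
     (LINT z:{z. norm z \<le> r}|\<mu>. \<phi> (x - z) - \<phi> x + (z \<bullet> grad \<phi> x) * indicator {z. norm z < 1} z)"

definition levy_outer ::
    "(real^'n::finite) measure \<Rightarrow> real \<Rightarrow> (real^'n \<Rightarrow> real) \<Rightarrow> real^'n \<Rightarrow> real" where
  "levy_outer \<mu> r \<phi> x = (LINT z:{z. norm z > r}|\<mu>. \<phi> (x + z) - \<phi> x)"

definition levy_drift :: "(real^'n::finite) measure \<Rightarrow> real \<Rightarrow> real^'n" where
  "levy_drift \<mu> r = (LINT z:{z. r < norm z \<and> norm z < 1}|\<mu>. z)"


section \<open>Classical solutions of the viscous problem\<close>

text \<open>The solution is of class \<open>C\<^sup>2\<close> in space and \<open>C\<^sup>1\<close> in time for \<open>0 < t < T\<close>. The datum may be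
  discontinuous, so it is attained in \<open>L\<^sup>1\<close>.\<close>

definition classical_viscous_solution ::
    "('n::finite \<Rightarrow> real \<Rightarrow> real) \<Rightarrow> (real^'n) measure \<Rightarrow> real \<Rightarrow> real \<Rightarrow> (real^'n \<Rightarrow> real) \<Rightarrow>
     (real^'n \<Rightarrow> real \<Rightarrow> real) \<Rightarrow> bool" where
  "classical_viscous_solution f \<mu> \<epsilon> T u0 v \<longleftrightarrow>
     (\<forall>t\<in>{0<..<T}. periodic (\<lambda>x. v x t) \<and> Ck_on 2 (\<lambda>x. v x t) UNIV) \<and>
     (\<forall>x. \<forall>t\<in>{0<..<T}. (\<lambda>s. v x s) differentiable (at t)) \<and>
     continuous_on (UNIV \<times> {0<..<T}) (\<lambda>(x, t). v x t) \<and>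
     continuous_on (UNIV \<times> {0<..<T}) (\<lambda>(x, t). deriv (\<lambda>s. v x s) t) \<and>
     (\<forall>i. continuous_on (UNIV \<times> {0<..<T}) (\<lambda>(x, t). partial i (\<lambda>y. v y t) x)) \<and>
     (\<forall>i j. continuous_on (UNIV \<times> {0<..<T})
              (\<lambda>(x, t). partial i (partial j (\<lambda>y. v y t)) x)) \<and>
     (\<forall>x. \<forall>t\<in>{0<..<T}.
        deriv (\<lambda>s. v x s) t + (\<Sum>j\<in>UNIV. partial j (\<lambda>y. f j (v y t)) x)
        = levy_op \<mu> (\<lambda>y. v y t) x + \<epsilon> * laplacian (\<lambda>y. v y t) x) \<and>
     ((\<lambda>t. L1_dist (\<lambda>x. v x t) u0) \<longlongrightarrow> 0) (at_right 0)"

definition viscous_problem_well_posed ::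
    "('n::finite \<Rightarrow> real \<Rightarrow> real) \<Rightarrow> (real^'n) measure \<Rightarrow> real \<Rightarrow> real \<Rightarrow> (real^'n \<Rightarrow> real) \<Rightarrow> bool" where
  "viscous_problem_well_posed f \<mu> \<epsilon> T u0 \<longleftrightarrow>
     (\<exists>v. classical_viscous_solution f \<mu> \<epsilon> T u0 v \<and>
        (\<forall>w. classical_viscous_solution f \<mu> \<epsilon> T u0 w \<longrightarrow> (\<forall>x. \<forall>t\<in>{0<..<T}. w x t = v x t)))"


section \<open>Periodic entropy solutions\<close>

definition entropy :: "real \<Rightarrow> real \<Rightarrow> real" where
  "entropy u k = \<bar>u - k\<bar>"

definition entropy' :: "real \<Rightarrow> real \<Rightarrow> real" where
  "entropy' u k = sgn (u - k)"

definition entropy_flux :: "('n::finite \<Rightarrow> real \<Rightarrow> real) \<Rightarrow> real \<Rightarrow> real \<Rightarrow> real^'n" where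
  "entropy_flux f u k = (\<chi> j. entropy' u k * (f j u - f j k))"

text \<open>Solutions belong to \<open>C([0,T]; L\<^sup>\<infinity>)\<close> in the usual sense for conservation laws: they are bounded
  in \<open>L\<^sup>\<infinity>\<close> uniformly in time, and continuous in time for the \<open>L\<^sup>1\<close> topology (hence also for the
  weak* topology of \<open>L\<^sup>\<infinity>\<close>). Continuity for the \<open>L\<^sup>\<infinity>\<close> norm would rule out moving shocks. The
  representative is jointly Borel, so that \<open>levy_outer\<close>, which integrates translates of the solution
  against \<open>\<mu>\<close>, is defined almost everywhere.\<close>

definition C_Linf_periodic :: "real \<Rightarrow> (real^'n::finite \<Rightarrow> real \<Rightarrow> real) \<Rightarrow> bool" where
  "C_Linf_periodic T u \<longleftrightarrow>
     (\<lambda>(x, t). u x t) \<in> borel_measurable (restrict_space borel (UNIV \<times> {0..T})) \<and>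
     (\<forall>t\<in>{0..T}. Linf_periodic (\<lambda>x. u x t)) \<and>
     (\<exists>M. \<forall>t\<in>{0..T}. AE x in lebesgue. \<bar>u x t\<bar> \<le> M) \<and>
     (\<forall>t\<in>{0..T}. ((\<lambda>s. L1_dist (\<lambda>x. u x s) (\<lambda>x. u x t)) \<longlongrightarrow> 0) (at t within {0..T}))"

definition periodic_test_function :: "real \<Rightarrow> (real^'n::finite \<Rightarrow> real \<Rightarrow> real) \<Rightarrow> bool" where
  "periodic_test_function T \<phi> \<longleftrightarrow>
     Cinf_on (\<lambda>(x, t). \<phi> x t) (UNIV \<times> {0<..<T}) \<and>
     (\<forall>t\<in>{0<..<T}. periodic (\<lambda>x. \<phi> x t)) \<and>
     (\<forall>x. \<forall>t\<in>{0<..<T}. \<phi> x t \<ge> 0) \<and>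
     (\<exists>a b. 0 < a \<and> b < T \<and> (\<forall>x. \<forall>t\<in>{0<..<T} - {a..b}. \<phi> x t = 0))"

definition entropy_integrand ::
    "('n::finite \<Rightarrow> real \<Rightarrow> real) \<Rightarrow> (real^'n) measure \<Rightarrow> real \<Rightarrow> real \<Rightarrow>
     (real^'n \<Rightarrow> real \<Rightarrow> real) \<Rightarrow> (real^'n \<Rightarrow> real \<Rightarrow> real) \<Rightarrow> real^'n \<Rightarrow> real \<Rightarrow> real" where
  "entropy_integrand f \<mu> k r u \<phi> x t =
     entropy (u x t) k * deriv (\<lambda>s. \<phi> x s) t
     + entropy_flux f (u x t) k \<bullet> grad (\<lambda>y. \<phi> y t) x
     + entropy (u x t) k * levy_inner_adjoint \<mu> r (\<lambda>y. \<phi> y t) x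
     + entropy' (u x t) k * levy_outer \<mu> r (\<lambda>y. u y t) x * \<phi> x t
     + entropy (u x t) k * (levy_drift \<mu> r \<bullet> grad (\<lambda>y. \<phi> y t) x)"

definition periodic_entropy_solution ::
    "('n::finite \<Rightarrow> real \<Rightarrow> real) \<Rightarrow> (real^'n) measure \<Rightarrow> real \<Rightarrow> (real^'n \<Rightarrow> real) \<Rightarrow>
     (real^'n \<Rightarrow> real \<Rightarrow> real) \<Rightarrow> bool" where
  "periodic_entropy_solution f \<mu> T u0 u \<longleftrightarrow>
     C_Linf_periodic T u \<and>
     (\<forall>k r \<phi>. r > 0 \<and> periodic_test_function T \<phi> \<longrightarrow>
        (LINT (x, t):torus_cell \<times> {0<..<T}|lebesgue. entropy_integrand f \<mu> k r u \<phi> x t) \<ge> 0) \<and>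
     esslim_at_0 (\<lambda>t. L1_dist (\<lambda>x. u x t) u0) 0"

end

theory Submission
  imports Defs
begin

text \<open>
  The solution is the limit of the classical solutions \<open>V \<epsilon>\<close> of the viscous problems as \<open>\<epsilon> \<rightarrow> 0\<close>. Two
  estimates carry the argument: a comparison of viscous solutions with each other, which yields the limit
  without any compactness theorem, and the entropy inequality for a single viscous solution.

  Comparison. Let \<open>u\<close> and \<open>v\<close> be viscous solutions and \<open>w = u - v\<close>. The difference of the equations is
  multiplied by \<open>\<eta>' w\<close>, for a smooth convex approximation \<open>\<eta>\<close> of the absolute value, and integrated over
  the torus. The nonlocal term is at most the integral of the nonlocal operator applied to \<open>\<eta> w\<close>, by
  convexity, and that integral vanishes because the torus is invariant under translations
  (\<open>levy_int_convex\<close>, \<open>integral_levy_int_zero\<close>). An integration by parts leaves of the flux only the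
  integral of \<open>\<eta>'' w (f u - f v) \<bullet> \<nabla>w\<close>, which is small as soon as \<open>\<bar>s\<bar> \<eta>'' s\<close> is uniformly small; this is
  what the choice of \<open>\<eta>\<close> achieves (\<open>kato_inequality\<close>). If the viscosities agree, the diffusion has a sign
  as well, and the distance in mean decreases in time (\<open>L1_contraction\<close>). Since the equation does not
  depend on \<open>x\<close> and \<open>t\<close>, translates of solutions are solutions, and the contraction bounds the moduli of
  continuity in space and in time by those of the solution near time zero, where all solutions are close
  to the datum. Comparison with the constant solutions \<open>M\<close> and \<open>- M\<close> gives the maximum principle.

  Convergence. If the viscosities \<open>\<epsilon>\<close> and \<open>\<delta>\<close> differ, \<open>u\<close> at \<open>x\<close> is compared with \<open>v\<close> at \<open>x + h\<close>, and the
  result is averaged over \<open>h\<close> with an even mollifier. After a change of variables the Laplacians fall on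
  the mollifier, so that the diffusion contributes at most \<open>(\<epsilon> + \<delta>) C\<close>, where \<open>C\<close> depends on the mollifier
  only (\<open>doubling\<close>). The averaging costs the modulus of continuity in space, which is uniform in the
  viscosity. Choosing first the mollifier and then \<open>\<epsilon>\<close> and \<open>\<delta>\<close> shows that the family is Cauchy in mean,
  uniformly in time (\<open>viscosity_cauchy\<close>).

  Entropy inequality. For a viscous solution the equation is multiplied by \<open>\<eta>' (v - k) p\<close> with a test
  function \<open>p\<close>. Flux, drift and the small jumps are moved onto \<open>p\<close>, the large jumps stay with \<open>v\<close>, and the
  diffusion contributes at most a multiple of \<open>\<epsilon>\<close> (\<open>entropy_production\<close>). The viscosity tends to zero first,
  while \<open>\<eta>\<close> is still smooth, because the sign of \<open>v - k\<close> is not a continuous function of \<open>v\<close>; then \<open>\<eta>\<close>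
  tends to the absolute value (\<open>limit_entropy_inequality\<close>).
\<close>

section \<open>Periodic functions and integration over the torus\<close>

definition lattice_vec :: "('n \<Rightarrow> int) \<Rightarrow> real^'n::finite" where
  "lattice_vec k = (\<chi> j. 2 * pi * of_int (k j))"

lemma periodic_lattice:
  fixes g :: "real^'n::finite \<Rightarrow> 'b"
  assumes "periodic g"
  shows "g (x + lattice_vec k) = g x"
proof -
  have step: "g (x + axis j (2 * pi)) = g x" for x j
    using assms by (simp add: periodic_def)
  have nat1: "g (x + axis j (2 * pi * of_nat m)) = g x" for x j m
  proof (induction m arbitrary: x)
    case 0
    have "axis j (0::real) = (0 :: real^'n)" by (simp add: axis_def vec_eq_iff)
    then show ?case by (metis add.right_neutral mult_zero_right of_nat_0)
  next
    case (Suc m)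
    have "axis j (2 * pi * of_nat (Suc m)) = (axis j (2 * pi * of_nat m) + axis j (2*pi) :: real^'n)"
      by (simp add: axis_def vec_eq_iff algebra_simps)
    then show ?case using Suc step by (metis add.assoc)
  qed
  have int1: "g (x + axis j (2 * pi * of_int m)) = g x" for x j m
  proof (cases "m \<ge> 0")
    case True
    then show ?thesis using nat1[of x j "nat m"] by simp
  next
    case False
    have "axis j (2 * pi * of_int m) + axis j (2 * pi * of_nat (nat (-m))) = (0 :: real^'n)"
      using False by (simp add: axis_def vec_eq_iff)
    then have "(x + axis j (2 * pi * of_int m)) + axis j (2 * pi * of_nat (nat (-m))) = x"
      by (simp add: add.assoc)
    then show ?thesis using nat1[of "x + axis j (2 * pi * of_int m)" j "nat (-m)"] by metis
  qed
  have sum1: "g (x + (\<Sum>j\<in>S. axis j (2 * pi * of_int (k j)))) = g x" if "finite S" for S x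
    using that
  proof (induction S arbitrary: x)
    case (insert j S)
    have "g (x + (\<Sum>j\<in>insert j S. axis j (2 * pi * of_int (k j))))
        = g ((x + axis j (2 * pi * of_int (k j))) + (\<Sum>j\<in>S. axis j (2 * pi * of_int (k j))))"
      using insert.hyps by (simp add: add.assoc)
    then show ?case using insert.IH int1 by simp
  qed simp
  have "lattice_vec k = (\<Sum>j\<in>UNIV. axis j (2 * pi * of_int (k j)))"
    by (simp add: lattice_vec_def vec_eq_iff axis_def if_distrib if_distribR cong: if_cong)
  then show ?thesis using sum1[of UNIV x] by simp
qed

definition half_open_cell :: "(real^'n::finite) set" where
  "half_open_cell = {x. \<forall>j. 0 \<le> x $ j \<and> x $ j < 2 * pi}"

definition cell_index :: "real^'n::finite \<Rightarrow> 'n \<Rightarrow> int" where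
  "cell_index x j = \<lfloor>x $ j / (2 * pi)\<rfloor>"

text \<open>
  Rounding down in each coordinate: the lattice translates of the half open cell tile the space, which is
  what makes translation invariance on the torus work.
\<close>
lemma minus_lattice_in_cell_iff:
  "x - lattice_vec k \<in> half_open_cell \<longleftrightarrow> k = cell_index x"
proof -
  have "0 \<le> (x - lattice_vec k) $ j \<and> (x - lattice_vec k) $ j < 2 * pi \<longleftrightarrow> \<lfloor>x $ j / (2 * pi)\<rfloor> = k j" for j
    unfolding floor_eq_iff by (auto simp: lattice_vec_def field_simps)
  then show ?thesis
    by (auto simp: half_open_cell_def cell_index_def fun_eq_iff)
qed

lemma half_open_cell_sets [measurable]: "half_open_cell \<in> sets borel"
proof -
  have "half_open_cell = (\<Inter>j\<in>UNIV. {x::real^'n. 0 \<le> x $ j} \<inter> {x. x $ j < 2 * pi})"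
    by (auto simp: half_open_cell_def)
  also have "\<dots> \<in> sets borel"
    by (intro sets.finite_INT) (auto intro!: sets.Int borel_closed borel_open open_Collect_less
        closed_Collect_le continuous_intros)
  finally show ?thesis .
qed

lemma torus_cell_box: "torus_cell = box 0 ((\<chi> j. 2 * pi) :: real^'n::finite)"
  by (auto simp: torus_cell_def mem_box_cart)

lemma torus_cell_sets [measurable]: "torus_cell \<in> sets borel"
  by (simp add: torus_cell_box)

text \<open>
  A measure on the Borel sets of the whole space that charges only the cell: functions need not be
  restricted, and translations act on the underlying space.
\<close>
definition torus :: "(real^'n::finite) measure" where
  "torus = density lborel (indicator torus_cell)"

lemma sets_torus [measurable_cong, simp]: "sets torus = sets borel"
  by (simp add: torus_def)

lemma space_torus [simp]: "space torus = UNIV"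
  by (simp add: torus_def)

lemma AE_half_open_cell: "AE x in lborel. x \<in> half_open_cell \<longleftrightarrow> x \<in> torus_cell"
proof -
  have "AE x in lborel. \<forall>j\<in>UNIV. (x::real^'n) \<bullet> axis j 1 \<noteq> 0"
    by (intro AE_finite_allI AE_lborel_inner_neq) (auto simp: axis_in_Basis_iff)
  then show ?thesis
    by eventually_elim
      (auto simp: torus_cell_def half_open_cell_def inner_axis order_less_le; metis)
qed

lemma torus_eq_half_open: "torus = density lborel (indicator half_open_cell)"
  unfolding torus_def
proof (rule density_cong)
  show "AE x in lborel. (indicator torus_cell x :: ennreal) = indicator half_open_cell x"
    using AE_half_open_cell by eventually_elim (auto simp: indicator_def)
qed measurable

lemma finite_measure_torus: "finite_measure torus"
proof
  have "emeasure lborel torus_cell \<noteq> (\<infinity>::ennreal)"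
    unfolding torus_cell_box by (simp add: emeasure_lborel_box_eq)
  then show "emeasure torus (space torus) \<noteq> \<infinity>"
    by (simp add: torus_def emeasure_density)
qed

interpretation torus: finite_measure torus
  by (rule finite_measure_torus)

interpretation torus2: pair_sigma_finite torus torus
  by standard

lemma integrable_torus:
  fixes g :: "real^'n::finite \<Rightarrow> real"
  assumes "g \<in> borel_measurable borel" "\<And>x. \<bar>g x\<bar> \<le> B"
  shows "integrable torus g"
  using assms by (intro torus.integrable_const_bound[where B=B]) auto

lemma integral_torus:
  fixes g :: "real^'n::finite \<Rightarrow> real"
  assumes [measurable]: "g \<in> borel_measurable borel"
  shows "(LINT x:torus_cell|lebesgue. g x) = (LINT x|torus. g x)"
proof -
  have "(LINT x|torus. g x) = (LINT x|lborel. indicator torus_cell x * g x)"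
    unfolding torus_def
    by (subst integral_real_density[symmetric]) (auto intro!: Bochner_Integration.integral_cong simp: ennreal_indicator)
  also have "\<dots> = (LINT x:torus_cell|lebesgue. g x)"
    unfolding set_lebesgue_integral_def by (subst integral_completion) auto
  finally show ?thesis by simp
qed

text \<open>
  The lattice translates of the cell cut the shifted cell into countably many pieces. Periodicity moves
  each piece back into the cell, and the pieces moved back tile it again.
\<close>
lemma nn_integral_torus_shift:
  fixes g :: "real^'n::finite \<Rightarrow> ennreal"
  assumes [measurable]: "g \<in> borel_measurable borel" and "periodic g"
  shows "(\<integral>\<^sup>+x. g (x + h) \<partial>torus) = (\<integral>\<^sup>+x. g x \<partial>torus)"
proof -
  let ?H = "half_open_cell :: (real^'n) set"
  have shift: "(\<integral>\<^sup>+x. F (a + x) \<partial>lborel) = (\<integral>\<^sup>+x. F x \<partial>lborel)"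
    if [measurable]: "F \<in> borel_measurable borel" for F :: "real^'n \<Rightarrow> ennreal" and a
    by (subst (2) lborel_distr_plus[of a, symmetric]) (simp add: nn_integral_distr)
  have tile: "(\<integral>\<^sup>+k. indicator ?H (x - lattice_vec k) \<partial>count_space UNIV) = (1::ennreal)" for x :: "real^'n"
  proof -
    have "(\<lambda>k. indicator ?H (x - lattice_vec k) :: ennreal) = indicator {cell_index x}"
      by (auto simp: fun_eq_iff minus_lattice_in_cell_iff indicator_def)
    then show ?thesis by simp
  qed
  have tile': "(\<integral>\<^sup>+k. indicator ?H (x + lattice_vec k) \<partial>count_space UNIV) = (1::ennreal)" for x :: "real^'n"
  proof -
    have "x + lattice_vec k \<in> ?H \<longleftrightarrow> k = (\<lambda>j. - cell_index x j)" for k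
    proof -
      have "x - lattice_vec (\<lambda>j. - k j) = x + lattice_vec k"
        by (simp add: lattice_vec_def vec_eq_iff)
      then have "x + lattice_vec k \<in> ?H \<longleftrightarrow> (\<lambda>j. - k j) = cell_index x"
        by (metis minus_lattice_in_cell_iff)
      also have "\<dots> \<longleftrightarrow> k = (\<lambda>j. - cell_index x j)"
        unfolding fun_eq_iff by (intro iff_allI) linarith
      finally show ?thesis .
    qed
    then have "(\<lambda>k. indicator ?H (x + lattice_vec k) :: ennreal) = indicator {\<lambda>j. - cell_index x j}"
      by (auto simp: fun_eq_iff indicator_def)
    then show ?thesis by simp
  qed
  have cnt: "countable (UNIV :: ('n \<Rightarrow> int) set)" by simp
  have "(\<integral>\<^sup>+x. g (x + h) \<partial>torus) = (\<integral>\<^sup>+x. indicator ?H x * g (x + h) \<partial>lborel)"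
    unfolding torus_eq_half_open by (simp add: nn_integral_density)
  also have "\<dots> = (\<integral>\<^sup>+x. indicator ?H (x - h) * g x \<partial>lborel)"
    using shift[of "\<lambda>x. indicator ?H (x - h) * g x" h] by (simp add: add.commute)
  also have "\<dots> = (\<integral>\<^sup>+x. (\<integral>\<^sup>+k. indicator ?H (x - lattice_vec k) * (indicator ?H (x - h) * g x)
      \<partial>count_space UNIV) \<partial>lborel)"
    by (simp add: nn_integral_multc tile)
  also have "\<dots> = (\<integral>\<^sup>+k. (\<integral>\<^sup>+x. indicator ?H (x - lattice_vec k) * (indicator ?H (x - h) * g x)
      \<partial>lborel) \<partial>count_space UNIV)"
    by (rule nn_integral_count_space_nn_integral[OF cnt]) measurable
  also have "\<dots> = (\<integral>\<^sup>+k. (\<integral>\<^sup>+x. indicator ?H (x - h + lattice_vec k) * (indicator ?H x * g x)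
      \<partial>lborel) \<partial>count_space UNIV)"
  proof (rule nn_integral_cong)
    fix k :: "'n \<Rightarrow> int"
    show "(\<integral>\<^sup>+x. indicator ?H (x - lattice_vec k) * (indicator ?H (x - h) * g x) \<partial>lborel)
       = (\<integral>\<^sup>+x. indicator ?H (x - h + lattice_vec k) * (indicator ?H x * g x) \<partial>lborel)"
      by (subst shift[symmetric, of _ "lattice_vec k"])
        (auto intro!: nn_integral_cong simp: periodic_lattice[OF assms(2)] algebra_simps indicator_def
          add.commute[of "lattice_vec k"])
  qed
  also have "\<dots> = (\<integral>\<^sup>+x. (\<integral>\<^sup>+k. indicator ?H (x - h + lattice_vec k) * (indicator ?H x * g x)
      \<partial>count_space UNIV) \<partial>lborel)"
    by (rule nn_integral_count_space_nn_integral[OF cnt, symmetric]) measurable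
  also have "\<dots> = (\<integral>\<^sup>+x. indicator ?H x * g x \<partial>lborel)"
    by (simp add: nn_integral_multc tile')
  also have "\<dots> = (\<integral>\<^sup>+x. g x \<partial>torus)"
    unfolding torus_eq_half_open by (simp add: nn_integral_density)
  finally show ?thesis .
qed

lemma periodic_compose: "periodic g \<Longrightarrow> periodic (\<lambda>x. F (g x))"
  by (simp add: periodic_def)

lemma periodic_shift: "periodic g \<Longrightarrow> periodic (\<lambda>x. g (x + h))"
  by (simp add: periodic_def) (metis add.assoc add.commute)

lemma integral_torus_shift:
  fixes g :: "real^'n::finite \<Rightarrow> real"
  assumes [measurable]: "g \<in> borel_measurable borel" and per: "periodic g" and bd: "\<And>x. \<bar>g x\<bar> \<le> B"
  shows "(LINT x|torus. g (x + h)) = (LINT x|torus. g x)"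
proof -
  have i: "integrable torus g" "integrable torus (\<lambda>x. g (x + h))"
    using bd by (auto intro!: integrable_torus[where B=B])
  show ?thesis
    unfolding real_lebesgue_integral_def[OF i(1)] real_lebesgue_integral_def[OF i(2)]
    using nn_integral_torus_shift[of "\<lambda>x. ennreal (g x)" h] nn_integral_torus_shift[of "\<lambda>x. ennreal (- g x)" h]
    by (simp add: periodic_compose[OF per, of "\<lambda>y. ennreal y"] periodic_compose[OF per, of "\<lambda>y. ennreal (- y)"])
qed

text \<open>
  Dominated convergence of the difference quotients, which are bounded by the bound on the derivative.
\<close>
lemma (in finite_measure) has_derivative_integral:
  fixes F F' :: "real \<Rightarrow> 'a \<Rightarrow> real"
  assumes t: "a < t" "t < b"
    and int: "\<And>s. a < s \<Longrightarrow> s < b \<Longrightarrow> integrable M (F s)"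
    and meas: "F' t \<in> borel_measurable M"
    and deriv: "\<And>s x. a < s \<Longrightarrow> s < b \<Longrightarrow> x \<in> space M \<Longrightarrow> ((\<lambda>s. F s x) has_real_derivative F' s x) (at s)"
    and bd: "\<And>s x. a < s \<Longrightarrow> s < b \<Longrightarrow> x \<in> space M \<Longrightarrow> \<bar>F' s x\<bar> \<le> K"
  shows "((\<lambda>s. LINT x|M. F s x) has_real_derivative (LINT x|M. F' t x)) (at t)"
proof -
  have "((\<lambda>y. ((LINT x|M. F y x) - (LINT x|M. F t x)) / (y - t)) \<longlongrightarrow> (LINT x|M. F' t x)) (at t within {a<..<b})"
    unfolding tendsto_at_iff_sequentially comp_def
  proof (intro allI impI)
    fix X assume X: "\<forall>i. X i \<in> {a<..<b} - {t}" "X \<longlonglongrightarrow> t"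
    have Xi: "a < X i" "X i < b" "X i \<noteq> t" for i using X(1) by (auto simp: set_eq_iff)
    have eq: "((LINT x|M. F (X i) x) - (LINT x|M. F t x)) / (X i - t) = (LINT x|M. (F (X i) x - F t x) / (X i - t))" for i
      using int[OF Xi(1,2)[of i]] int[OF t] by simp
    have "(\<lambda>i. LINT x|M. (F (X i) x - F t x) / (X i - t)) \<longlonglongrightarrow> (LINT x|M. F' t x)"
    proof (rule integral_dominated_convergence[where w="\<lambda>_. K"])
      show "(\<lambda>x. (F (X i) x - F t x) / (X i - t)) \<in> borel_measurable M" for i
        using int[OF Xi(1,2)[of i]] int[OF t] by (auto intro: borel_measurable_integrable)
      show "AE x in M. (\<lambda>i. (F (X i) x - F t x) / (X i - t)) \<longlonglongrightarrow> F' t x"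
      proof (rule AE_I2)
        fix x assume x: "x \<in> space M"
        have "((\<lambda>s. (F s x - F t x) / (s - t)) \<longlongrightarrow> F' t x) (at t)"
          using deriv[OF t x] by (simp add: has_field_derivative_iff)
        then show "(\<lambda>i. (F (X i) x - F t x) / (X i - t)) \<longlonglongrightarrow> F' t x"
          unfolding tendsto_at_iff_sequentially comp_def using X Xi by auto
      qed
      show "AE x in M. norm ((F (X i) x - F t x) / (X i - t)) \<le> K" for i
      proof (rule AE_I2)
        fix x assume x: "x \<in> space M"
        have "norm (F (X i) x - F t x) \<le> K * norm (X i - t)"
        proof (rule field_differentiable_bound[where S="{a<..<b}" and f'="\<lambda>s. F' s x"])
          show "((\<lambda>s. F s x) has_field_derivative F' z x) (at z within {a<..<b})" if "z \<in> {a<..<b}" for z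
            using deriv[of z x] that x by (auto intro: has_field_derivative_at_within)
        qed (use bd x t Xi in auto)
        then show "norm ((F (X i) x - F t x) / (X i - t)) \<le> K"
          using Xi(3)[of i] by (simp add: field_simps)
      qed
    qed (use meas in auto)
    then show "(\<lambda>i. ((LINT x|M. F (X i) x) - (LINT x|M. F t x)) / (X i - t)) \<longlonglongrightarrow> (LINT x|M. F' t x)"
      by (simp add: eq)
  qed
  moreover have "at t within {a<..<b} = at t" using t by (intro at_within_open) auto
  ultimately show ?thesis by (simp add: has_field_derivative_iff)
qed

lemma periodic_continuous_bounded:
  fixes g :: "real^'n::finite \<Rightarrow> 'b::real_normed_vector"
  assumes "periodic g" "continuous_on UNIV g"
  obtains B where "\<And>x. norm (g x) \<le> B" "B > 0"
proof -
  have "compact (g ` cbox 0 (\<chi> j. 2 * pi))"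
    by (intro compact_continuous_image compact_cbox continuous_on_subset[OF assms(2)]) auto
  then obtain B where B: "B > 0" "\<forall>y\<in>g ` cbox 0 (\<chi> j. 2 * pi). norm y \<le> B"
    by (meson bounded_pos compact_imp_bounded)
  have "norm (g x) \<le> B" for x
  proof -
    have "x - lattice_vec (cell_index x) \<in> cbox 0 (\<chi> j. 2 * pi)"
      using minus_lattice_in_cell_iff[of x "cell_index x"]
      by (auto simp: half_open_cell_def mem_box_cart intro: less_imp_le)
    then show ?thesis
      using B(2) periodic_lattice[OF assms(1), of "x - lattice_vec (cell_index x)" "cell_index x"] by auto
  qed
  with that B(1) show ?thesis by blast
qed

lemma continuous_borel: "continuous_on UNIV g \<Longrightarrow> g \<in> borel_measurable borel"
  by (rule borel_measurable_continuous_onI)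

text \<open>
  The integral of \<open>p (x + s z)\<close> does not depend on \<open>s\<close>, and its derivative at \<open>s = 0\<close> is the integral in
  question. Applied to products this is integration by parts.
\<close>
lemma integral_torus_directional_derivative:
  fixes p :: "real^'n::finite \<Rightarrow> real"
  assumes per: "periodic p" "periodic P" and cont: "continuous_on UNIV P"
    and deriv: "\<And>x. (p has_derivative (\<lambda>h. h \<bullet> P x)) (at x)"
  shows "(LINT x|torus. z \<bullet> P x) = 0"
proof -
  have cp: "continuous_on UNIV p"
    using deriv by (meson has_derivative_continuous continuous_at_imp_continuous_on)
  obtain B where B: "\<And>x. norm (p x) \<le> B" using periodic_continuous_bounded[OF per(1) cp] by blast
  obtain K where K: "\<And>x. norm (P x) \<le> K" using periodic_continuous_bounded[OF per(2) cont] by blast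
  have [measurable]: "p \<in> borel_measurable borel" "P \<in> borel_measurable borel"
    using cp cont by (auto intro: continuous_borel)
  have "((\<lambda>s. LINT x|torus. p (x + s *\<^sub>R z)) has_real_derivative (LINT x|torus. z \<bullet> P (x + 0 *\<^sub>R z))) (at 0)"
  proof (rule torus.has_derivative_integral[where a="-1" and b=1 and K="norm z * K"])
    show "integrable torus (\<lambda>x. p (x + s *\<^sub>R z))" for s
      using B by (intro integrable_torus[where B=B]) auto
    show "((\<lambda>s. p (x + s *\<^sub>R z)) has_real_derivative z \<bullet> P (x + s *\<^sub>R z)) (at s)" for s x
    proof -
      have "((\<lambda>s. p (x + s *\<^sub>R z)) has_derivative (\<lambda>h. (h *\<^sub>R z) \<bullet> P (x + s *\<^sub>R z))) (at s)"
        by (rule has_derivative_compose[OF _ deriv, of "\<lambda>s. x + s *\<^sub>R z" "\<lambda>h. h *\<^sub>R z"])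
          (auto intro!: derivative_eq_intros)
      then show ?thesis by (simp add: has_field_derivative_def mult.commute[of _ "z \<bullet> _"])
    qed
    show "\<bar>z \<bullet> P (x + s *\<^sub>R z)\<bar> \<le> norm z * K" for s x
      by (rule order_trans[OF Cauchy_Schwarz_ineq2]) (simp add: K mult_left_mono)
  qed auto
  moreover have "(\<lambda>s. LINT x|torus. p (x + s *\<^sub>R z)) = (\<lambda>s. LINT x|torus. p x)"
    using B by (intro ext integral_torus_shift[where B=B] per(1)) auto
  ultimately have "((\<lambda>s::real. LINT x|torus. p x) has_real_derivative (LINT x|torus. z \<bullet> P x)) (at 0)"
    by simp
  then show ?thesis using DERIV_unique[OF _ DERIV_const] by blast
qed

section \<open>Nonlocal operators of Levy type\<close>

text \<open>
  Unlike a Levy measure, which lives on the punctured space, a kernel is a measure on all Borel sets. It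
  can then be combined with the torus in a product and be restricted to jumps of bounded size.
\<close>
definition levy_kernel :: "(real^'n::finite) measure \<Rightarrow> bool" where
  "levy_kernel \<nu> \<longleftrightarrow> sets \<nu> = sets borel \<and> sigma_finite_measure \<nu> \<and>
     integrable \<nu> (\<lambda>z. min ((norm z)\<^sup>2) 1)"

text \<open>
  The gradient is a separate argument. A Lipschitz gradient is what the integrability of the compensated
  increments below requires, and it is preserved by composition with smooth scalar functions.
\<close>
definition periodic_C11 :: "(real^'n::finite \<Rightarrow> real) \<Rightarrow> (real^'n \<Rightarrow> real^'n) \<Rightarrow> bool" where
  "periodic_C11 g G \<longleftrightarrow> periodic g \<and> periodic G \<and>
     (\<forall>x. (g has_derivative (\<lambda>h. h \<bullet> G x)) (at x)) \<and>
     (\<exists>K. \<forall>x y. norm (G x - G y) \<le> K * norm (x - y))"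

text \<open>
  The integrand of the nonlocal operator, and with \<open>- z\<close> in place of \<open>z\<close> that of its adjoint.
\<close>
definition compensated :: "(real^'n::finite \<Rightarrow> real) \<Rightarrow> (real^'n \<Rightarrow> real^'n) \<Rightarrow> real^'n \<Rightarrow> real^'n \<Rightarrow> real" where
  "compensated g G x z = g (x + z) - g x - (z \<bullet> G x) * indicator {z. norm z < 1} z"

definition levy_int :: "(real^'n::finite) measure \<Rightarrow> (real^'n \<Rightarrow> real) \<Rightarrow> (real^'n \<Rightarrow> real^'n) \<Rightarrow> real^'n \<Rightarrow> real" where
  "levy_int \<nu> g G x = (LINT z|\<nu>. compensated g G x z)"

definition levy_adj :: "(real^'n::finite) measure \<Rightarrow> (real^'n \<Rightarrow> real) \<Rightarrow> (real^'n \<Rightarrow> real^'n) \<Rightarrow> real^'n \<Rightarrow> real" where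
  "levy_adj \<nu> g G x = (LINT z|\<nu>. compensated g G x (- z))"

lemma lipschitz_constant_nonneg:
  fixes G :: "real^'n::finite \<Rightarrow> 'b::real_normed_vector"
  assumes "\<And>x y. norm (G x - G y) \<le> K * norm (x - y)"
  shows "0 \<le> K"
proof -
  have "0 \<le> K * norm (axis undefined 1 - 0 :: real^'n)"
    using assms[of "axis undefined 1" 0] by (rule order_trans[OF norm_ge_zero])
  then show ?thesis by simp
qed

lemma periodic_C11_continuous:
  assumes "periodic_C11 g G"
  shows "continuous_on UNIV g" "continuous_on UNIV G"
proof -
  show "continuous_on UNIV g"
    using assms unfolding periodic_C11_def
    by (meson has_derivative_continuous continuous_at_imp_continuous_on)
  obtain K where K: "\<And>x y. norm (G x - G y) \<le> K * norm (x - y)"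
    using assms unfolding periodic_C11_def by blast
  have "K-lipschitz_on UNIV G"
    using K lipschitz_constant_nonneg[of G K] by (intro lipschitz_onI) (auto simp: dist_norm)
  then show "continuous_on UNIV G" by (rule lipschitz_on_continuous_on)
qed

text \<open>
  The mean value theorem on the segment from \<open>x\<close> to \<open>x + z\<close>.
\<close>
lemma taylor_bound:
  fixes g :: "real^'n::finite \<Rightarrow> real"
  assumes d: "\<And>x. (g has_derivative (\<lambda>h. h \<bullet> G x)) (at x)"
    and K: "\<And>x y. norm (G x - G y) \<le> K * norm (x - y)"
  shows "\<bar>g (x + z) - g x - z \<bullet> G x\<bar> \<le> K * (norm z)\<^sup>2"
proof -
  have K0: "K \<ge> 0" using lipschitz_constant_nonneg[of G K] K by blast
  have dd: "((\<lambda>s. g (x + s *\<^sub>R z) - s * (z \<bullet> G x)) has_real_derivative (z \<bullet> (G (x + s *\<^sub>R z) - G x))) (at s)" for s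
  proof -
    have "((\<lambda>s. g (x + s *\<^sub>R z)) has_derivative (\<lambda>h. (h *\<^sub>R z) \<bullet> G (x + s *\<^sub>R z))) (at s)"
      by (rule has_derivative_compose[OF _ d, of "\<lambda>s. x + s *\<^sub>R z" "\<lambda>h. h *\<^sub>R z"])
        (auto intro!: derivative_eq_intros)
    then have "((\<lambda>s. g (x + s *\<^sub>R z)) has_real_derivative z \<bullet> G (x + s *\<^sub>R z)) (at s)"
      by (simp add: has_field_derivative_def mult.commute[of _ "z \<bullet> _"])
    then show ?thesis by (auto intro!: derivative_eq_intros simp: inner_diff_right)
  qed
  obtain s :: real where s: "0 < s" "s < 1" and
    eq: "(g (x + 1 *\<^sub>R z) - 1 * (z \<bullet> G x)) - (g (x + 0 *\<^sub>R z) - 0 * (z \<bullet> G x))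
      = (1 - 0) * (z \<bullet> (G (x + s *\<^sub>R z) - G x))"
    using MVT2[of 0 1 "\<lambda>s. g (x + s *\<^sub>R z) - s * (z \<bullet> G x)" "\<lambda>s. z \<bullet> (G (x + s *\<^sub>R z) - G x)"] dd by auto
  have "\<bar>z \<bullet> (G (x + s *\<^sub>R z) - G x)\<bar> \<le> norm z * norm (G (x + s *\<^sub>R z) - G x)"
    by (rule Cauchy_Schwarz_ineq2)
  also have "\<dots> \<le> norm z * (K * norm (s *\<^sub>R z))"
    using K[of "x + s *\<^sub>R z" x] by (intro mult_left_mono) auto
  also have "\<dots> \<le> norm z * (K * norm z)"
    using s K0 by (intro mult_left_mono) (auto intro: mult_left_le_one_le)
  finally show ?thesis using eq by (simp add: power2_eq_square mult_ac)
qed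

text \<open>
  Taylor's formula for the jumps shorter than one and the bound on \<open>g\<close> for the others. The constant is
  explicit because it has to be uniform in time later on.
\<close>
lemma compensated_bound:
  fixes g :: "real^'n::finite \<Rightarrow> real"
  assumes d: "\<And>x. (g has_derivative (\<lambda>h. h \<bullet> G x)) (at x)"
    and K: "\<And>x y. norm (G x - G y) \<le> K * norm (x - y)"
    and B: "\<And>x. \<bar>g x\<bar> \<le> B"
  shows "\<bar>compensated g G x z\<bar> \<le> (K + 2 * B) * min ((norm z)\<^sup>2) 1"
proof -
  have K0: "K \<ge> 0" using lipschitz_constant_nonneg[of G K] K by blast
  have B0: "B \<ge> 0" using B[of 0] by linarith
  show ?thesis
  proof (cases "norm z < 1")
    case True
    then have "(norm z)\<^sup>2 \<le> 1" by (simp add: power_le_one)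
    then have m: "min ((norm z)\<^sup>2) 1 = (norm z)\<^sup>2" by simp
    have "\<bar>compensated g G x z\<bar> \<le> K * (norm z)\<^sup>2"
      using taylor_bound[OF d K, of x z] True by (simp add: compensated_def)
    also have "\<dots> \<le> (K + 2 * B) * (norm z)\<^sup>2"
      using B0 by (intro mult_right_mono) auto
    finally show ?thesis unfolding m .
  next
    case False
    then have "1 \<le> (norm z)\<^sup>2" by simp
    then have "min ((norm z)\<^sup>2) 1 = 1" by simp
    then show ?thesis using B[of x] B[of "x+z"] K0 False by (simp add: compensated_def)
  qed
qed

lemma periodic_C11_bound:
  assumes "periodic_C11 g G"
  obtains C where "\<And>x z. \<bar>compensated g G x z\<bar> \<le> C * min ((norm z)\<^sup>2) 1" "C \<ge> 0"
proof -
  obtain B where B: "\<And>x. norm (g x) \<le> B" "B > 0"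
    using periodic_continuous_bounded[of g] periodic_C11_continuous[OF assms] assms
    unfolding periodic_C11_def by blast
  obtain K where K: "\<And>x y. norm (G x - G y) \<le> K * norm (x - y)"
    using assms unfolding periodic_C11_def by blast
  have K0: "K \<ge> 0" using lipschitz_constant_nonneg[of G K] K by blast
  have "\<bar>compensated g G x z\<bar> \<le> (K + 2 * B) * min ((norm z)\<^sup>2) 1" for x z
    using assms B K unfolding periodic_C11_def by (intro compensated_bound) auto
  then show ?thesis using that[of "K + 2 * B"] B K0 by simp
qed

lemma compensated_measurable:
  assumes [measurable]: "g \<in> borel_measurable borel" "G \<in> borel_measurable borel"
  shows "(\<lambda>(x, z). compensated g G x z) \<in> borel_measurable (borel \<Otimes>\<^sub>M borel)"
    and "(\<lambda>z. compensated g G x z) \<in> borel_measurable borel"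
    and "(\<lambda>z. compensated g G x (- z)) \<in> borel_measurable borel"
  unfolding compensated_def by measurable

lemma levy_kernel_integrable:
  assumes \<nu>: "levy_kernel \<nu>" and [measurable]: "h \<in> borel_measurable borel"
    and bd: "\<And>z. \<bar>h z\<bar> \<le> C * min ((norm z)\<^sup>2) 1"
  shows "integrable \<nu> (h :: _ \<Rightarrow> real)"
proof (rule Bochner_Integration.integrable_bound)
  show "integrable \<nu> (\<lambda>z. C * min ((norm z)\<^sup>2) 1)"
    using \<nu> by (simp add: levy_kernel_def)
  show "h \<in> borel_measurable \<nu>"
    using \<nu> assms(2) by (simp add: levy_kernel_def cong: measurable_cong_sets)
  show "AE z in \<nu>. norm (h z) \<le> norm (C * min ((norm z)\<^sup>2) 1)"
    using bd by (auto intro!: AE_I2 order_trans[OF bd])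
qed

lemma compensated_integrable:
  assumes "levy_kernel \<nu>" "periodic_C11 g G"
  shows "integrable \<nu> (\<lambda>z. compensated g G x z)" "integrable \<nu> (\<lambda>z. compensated g G x (- z))"
proof -
  obtain C where C: "\<And>x z. \<bar>compensated g G x z\<bar> \<le> C * min ((norm z)\<^sup>2) 1"
    using periodic_C11_bound[OF assms(2)] by blast
  note m = compensated_measurable[OF continuous_borel[OF periodic_C11_continuous(1)[OF assms(2)]]
      continuous_borel[OF periodic_C11_continuous(2)[OF assms(2)]]]
  show "integrable \<nu> (\<lambda>z. compensated g G x z)"
    by (rule levy_kernel_integrable[OF assms(1) m(2) C])
  show "integrable \<nu> (\<lambda>z. compensated g G x (- z))"
    using C[of x "- _"] by (intro levy_kernel_integrable[OF assms(1) m(3), where C=C]) simp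
qed

lemma torus_levy_Fubini:
  fixes F :: "real^'n::finite \<Rightarrow> real^'n \<Rightarrow> real"
  assumes \<nu>: "levy_kernel \<nu>"
    and m: "(\<lambda>(x, z). F x z) \<in> borel_measurable (borel \<Otimes>\<^sub>M borel)"
    and bd: "\<And>x z. \<bar>F x z\<bar> \<le> C * min ((norm z)\<^sup>2) 1"
  shows "(LINT x|torus. LINT z|\<nu>. F x z) = (LINT z|\<nu>. LINT x|torus. F x z)"
    and "(\<lambda>x. LINT z|\<nu>. F x z) \<in> borel_measurable borel"
    and "\<bar>LINT z|\<nu>. F x z\<bar> \<le> C * (LINT z|\<nu>. min ((norm z)\<^sup>2) 1)"
proof -
  have [measurable_cong]: "sets \<nu> = sets borel" and int: "integrable \<nu> (\<lambda>z. min ((norm z)\<^sup>2) 1)"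
    using \<nu> by (auto simp: levy_kernel_def)
  interpret \<nu>: sigma_finite_measure \<nu> using \<nu> by (simp add: levy_kernel_def)
  interpret P: pair_sigma_finite torus \<nu> by standard
  note [measurable] = m
  have "integrable (torus \<Otimes>\<^sub>M \<nu>) (\<lambda>p. 1 * (C * min ((norm (snd p))\<^sup>2) 1))"
  proof (rule P.Fubini_integrable)
    show "AE x in torus. integrable \<nu> (\<lambda>y. 1 * (C * min ((norm (snd (x, y)))\<^sup>2) 1))"
      using int by simp
  qed (auto intro: torus.integrable_const)
  then have I: "integrable (torus \<Otimes>\<^sub>M \<nu>) (\<lambda>(x,z). F x z)"
    by (rule Bochner_Integration.integrable_bound) (auto intro!: AE_I2 order_trans[OF bd])
  show "(LINT x|torus. LINT z|\<nu>. F x z) = (LINT z|\<nu>. LINT x|torus. F x z)"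
    using P.Fubini_integral[OF I] by simp
  show "(\<lambda>x. LINT z|\<nu>. F x z) \<in> borel_measurable borel" by measurable
  have "(\<lambda>z. F x z) \<in> borel_measurable borel" by measurable
  then have "\<bar>LINT z|\<nu>. F x z\<bar> \<le> (LINT z|\<nu>. \<bar>F x z\<bar>)"
    by (intro integral_abs_bound)
  also have "\<dots> \<le> (LINT z|\<nu>. C * min ((norm z)\<^sup>2) 1)"
    by (intro integral_mono' Bochner_Integration.integrable_mult_right int bd order_trans[OF abs_ge_zero bd])
  finally show "\<bar>LINT z|\<nu>. F x z\<bar> \<le> C * (LINT z|\<nu>. min ((norm z)\<^sup>2) 1)" by simp
qed

lemma levy_int_measurable_bounded:
  assumes "levy_kernel \<nu>" "periodic_C11 g G"
  shows "levy_int \<nu> g G \<in> borel_measurable borel" "\<exists>B. \<forall>x. \<bar>levy_int \<nu> g G x\<bar> \<le> B"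
    "levy_adj \<nu> g G \<in> borel_measurable borel" "\<exists>B. \<forall>x. \<bar>levy_adj \<nu> g G x\<bar> \<le> B"
proof -
  obtain C where C: "\<And>x z. \<bar>compensated g G x z\<bar> \<le> C * min ((norm z)\<^sup>2) 1"
    using periodic_C11_bound[OF assms(2)] by blast
  note [measurable] = continuous_borel[OF periodic_C11_continuous(1)[OF assms(2)]]
      continuous_borel[OF periodic_C11_continuous(2)[OF assms(2)]]
  have m1: "(\<lambda>(x, z). compensated g G x z) \<in> borel_measurable (borel \<Otimes>\<^sub>M borel)"
    and m2: "(\<lambda>(x, z). compensated g G x (- z)) \<in> borel_measurable (borel \<Otimes>\<^sub>M borel)"
    unfolding compensated_def by measurable
  have C': "\<bar>compensated g G x (- z)\<bar> \<le> C * min ((norm z)\<^sup>2) 1" for x z using C[of x "-z"] by simp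
  show "levy_int \<nu> g G \<in> borel_measurable borel" "\<exists>B. \<forall>x. \<bar>levy_int \<nu> g G x\<bar> \<le> B"
    using torus_levy_Fubini(2,3)[OF assms(1) m1 C] unfolding levy_int_def[abs_def] by blast+
  show "levy_adj \<nu> g G \<in> borel_measurable borel" "\<exists>B. \<forall>x. \<bar>levy_adj \<nu> g G x\<bar> \<le> B"
    using torus_levy_Fubini(2,3)[OF assms(1) m2 C'] unfolding levy_adj_def[abs_def] by blast+
qed

text \<open>
  For a single jump \<open>z\<close> both sides agree: invariance under translation moves the shift from \<open>g\<close> to \<open>p\<close>, and
  an integration by parts moves the gradient. Fubini's theorem then sums over the jumps.
\<close>
lemma levy_duality:
  assumes \<nu>: "levy_kernel \<nu>" and g: "periodic_C11 g G" and p: "periodic_C11 p P"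
  shows "(LINT x|torus. p x * levy_int \<nu> g G x) = (LINT x|torus. g x * levy_adj \<nu> p P x)"
proof -
  note cont = periodic_C11_continuous[OF g] periodic_C11_continuous[OF p]
  note [measurable] = cont[THEN continuous_borel]
  obtain Bg where Bg: "\<And>x. norm (g x) \<le> Bg" "Bg > 0"
    using periodic_continuous_bounded[OF _ cont(1)] g unfolding periodic_C11_def by blast
  obtain Bp where Bp: "\<And>x. norm (p x) \<le> Bp" "Bp > 0"
    using periodic_continuous_bounded[OF _ cont(3)] p unfolding periodic_C11_def by blast
  obtain BG where BG: "\<And>x. norm (G x) \<le> BG" "BG > 0"
    using periodic_continuous_bounded[OF _ cont(2)] g unfolding periodic_C11_def by blast
  obtain BP where BP: "\<And>x. norm (P x) \<le> BP" "BP > 0"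
    using periodic_continuous_bounded[OF _ cont(4)] p unfolding periodic_C11_def by blast
  obtain C where C: "\<And>x z. \<bar>compensated g G x z\<bar> \<le> C * min ((norm z)\<^sup>2) 1" "C \<ge> 0"
    using periodic_C11_bound[OF g] by blast
  obtain D where D: "\<And>x z. \<bar>compensated p P x z\<bar> \<le> D * min ((norm z)\<^sup>2) 1" "D \<ge> 0"
    using periodic_C11_bound[OF p] by blast
  have bd1: "\<bar>p x * compensated g G x z\<bar> \<le> (Bp * C) * min ((norm z)\<^sup>2) 1" for x z
    unfolding abs_mult mult.assoc using Bp C by (intro mult_mono) (auto intro!: mult_nonneg_nonneg)
  have bd2: "\<bar>g x * compensated p P x (- z)\<bar> \<le> (Bg * D) * min ((norm z)\<^sup>2) 1" for x z
    unfolding abs_mult mult.assoc using Bg D(1)[of x "-z"] D(2)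
    by (intro mult_mono) (auto intro!: mult_nonneg_nonneg)
  have m1: "(\<lambda>(x,z). p x * compensated g G x z) \<in> borel_measurable (borel \<Otimes>\<^sub>M borel)"
    and m2: "(\<lambda>(x,z). g x * compensated p P x (- z)) \<in> borel_measurable (borel \<Otimes>\<^sub>M borel)"
    unfolding compensated_def by measurable
  have slice: "(LINT x|torus. p x * compensated g G x z) = (LINT x|torus. g x * compensated p P x (- z))" for z
  proof -
    let ?i = "indicator {z. norm z < 1} z :: real"
    have i1: "integrable torus (\<lambda>x. p x * g (x + z))"
      using Bp Bg by (intro integrable_torus[where B="Bp * Bg"]) (auto simp: abs_mult intro!: mult_mono)
    have i2: "integrable torus (\<lambda>x. p (x - z) * g x)"
      using Bp Bg by (intro integrable_torus[where B="Bp * Bg"]) (auto simp: abs_mult intro!: mult_mono)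
    have i3: "integrable torus (\<lambda>x. p x * g x)"
      using Bp Bg by (intro integrable_torus[where B="Bp * Bg"]) (auto simp: abs_mult intro!: mult_mono)
    have i4: "integrable torus (\<lambda>x. p x * (z \<bullet> G x))"
      using Bp BG by (intro integrable_torus[where B="Bp * (norm z * BG)"])
        (auto simp: abs_mult intro!: mult_mono order_trans[OF Cauchy_Schwarz_ineq2])
    have i5: "integrable torus (\<lambda>x. g x * (z \<bullet> P x))"
      using Bg BP by (intro integrable_torus[where B="Bg * (norm z * BP)"])
        (auto simp: abs_mult intro!: mult_mono order_trans[OF Cauchy_Schwarz_ineq2])
    have sh: "(LINT x|torus. p x * g (x + z)) = (LINT x|torus. p (x - z) * g x)"
    proof -
      have "periodic (\<lambda>x. p (x - z) * g x)"
        using g p unfolding periodic_C11_def periodic_def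
        by (metis (no_types, lifting) add_diff_eq diff_add_eq)
      from integral_torus_shift[OF _ this, where B="Bp * Bg" and h=z]
      show ?thesis using Bp Bg by (simp add: abs_mult mult_mono)
    qed
    have "(LINT x|torus. z \<bullet> (p x *\<^sub>R G x + g x *\<^sub>R P x)) = 0"
    proof (rule integral_torus_directional_derivative[where p="\<lambda>x. p x * g x"])
      show "periodic (\<lambda>x. p x * g x)" "periodic (\<lambda>x. p x *\<^sub>R G x + g x *\<^sub>R P x)"
        using g p by (auto simp: periodic_C11_def periodic_def)
      show "continuous_on UNIV (\<lambda>x. p x *\<^sub>R G x + g x *\<^sub>R P x)"
        by (intro continuous_intros cont)
      have "(p has_derivative (\<lambda>h. h \<bullet> P x)) (at x)" "(g has_derivative (\<lambda>h. h \<bullet> G x)) (at x)" for x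
        using g p by (auto simp: periodic_C11_def)
      from has_derivative_mult[OF this]
      show "((\<lambda>x. p x * g x) has_derivative (\<lambda>h. h \<bullet> (p x *\<^sub>R G x + g x *\<^sub>R P x))) (at x)" for x
        by (simp add: inner_add_right mult.commute)
    qed
    then have ibp: "(LINT x|torus. p x * (z \<bullet> G x)) = - (LINT x|torus. g x * (z \<bullet> P x))"
      using i4 i5 by (simp add: inner_add_right)
    have "(LINT x|torus. p x * compensated g G x z)
      = (LINT x|torus. p x * g (x + z) - p x * g x - p x * (z \<bullet> G x) * ?i)"
      by (simp add: compensated_def algebra_simps)
    also have "\<dots> = (LINT x|torus. p x * g (x + z)) - (LINT x|torus. p x * g x) - (LINT x|torus. p x * (z \<bullet> G x)) * ?i"
      using i1 i3 i4 by simp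
    also have "\<dots> = (LINT x|torus. p (x - z) * g x) - (LINT x|torus. p x * g x) + (LINT x|torus. g x * (z \<bullet> P x)) * ?i"
      by (simp add: sh ibp)
    also have "\<dots> = (LINT x|torus. p (x - z) * g x - p x * g x + g x * (z \<bullet> P x) * ?i)"
      using i2 i3 i5 by simp
    also have "\<dots> = (LINT x|torus. g x * compensated p P x (- z))"
      by (simp add: compensated_def indicator_def algebra_simps)
    finally show ?thesis .
  qed
  have "(LINT x|torus. p x * levy_int \<nu> g G x) = (LINT x|torus. LINT z|\<nu>. p x * compensated g G x z)"
    by (simp add: levy_int_def)
  also have "\<dots> = (LINT z|\<nu>. LINT x|torus. p x * compensated g G x z)"
    by (rule torus_levy_Fubini(1)[OF \<nu> m1 bd1])
  also have "\<dots> = (LINT z|\<nu>. LINT x|torus. g x * compensated p P x (- z))"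
    by (simp add: slice)
  also have "\<dots> = (LINT x|torus. LINT z|\<nu>. g x * compensated p P x (- z))"
    by (rule torus_levy_Fubini(1)[OF \<nu> m2 bd2, symmetric])
  also have "\<dots> = (LINT x|torus. g x * levy_adj \<nu> p P x)"
    by (simp add: levy_adj_def)
  finally show ?thesis .
qed

text \<open>
  Convexity compares the values at \<open>x\<close> and \<open>x + z\<close> for each jump, and the compensating gradient terms on both
  sides agree by the chain rule.
\<close>
lemma levy_int_convex:
  assumes \<nu>: "levy_kernel \<nu>" and w: "periodic_C11 w W"
    and c: "periodic_C11 (\<lambda>x. \<eta> (w x)) (\<lambda>x. \<eta>' (w x) *\<^sub>R W x)"
    and convex: "\<And>a b. \<eta> b - \<eta> a \<ge> \<eta>' a * (b - a)"
  shows "\<eta>' (w x) * levy_int \<nu> w W x \<le> levy_int \<nu> (\<lambda>x. \<eta> (w x)) (\<lambda>x. \<eta>' (w x) *\<^sub>R W x) x"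
proof -
  have "\<eta>' (w x) * levy_int \<nu> w W x = (LINT z|\<nu>. \<eta>' (w x) * compensated w W x z)"
    by (simp add: levy_int_def)
  also have "\<dots> \<le> levy_int \<nu> (\<lambda>x. \<eta> (w x)) (\<lambda>x. \<eta>' (w x) *\<^sub>R W x) x"
    unfolding levy_int_def
  proof (rule integral_mono)
    show "integrable \<nu> (\<lambda>z. \<eta>' (w x) * compensated w W x z)"
      using compensated_integrable(1)[OF \<nu> w] by simp
    show "integrable \<nu> (\<lambda>z. compensated (\<lambda>x. \<eta> (w x)) (\<lambda>x. \<eta>' (w x) *\<^sub>R W x) x z)"
      by (rule compensated_integrable(1)[OF \<nu> c])
    show "\<eta>' (w x) * compensated w W x z \<le> compensated (\<lambda>x. \<eta> (w x)) (\<lambda>x. \<eta>' (w x) *\<^sub>R W x) x z" for z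
      using convex[of "w x" "w (x + z)"] by (simp add: compensated_def algebra_simps)
  qed
  finally show ?thesis .
qed

lemma levy_int_diff:
  assumes \<nu>: "levy_kernel \<nu>" and g: "periodic_C11 g G" and h: "periodic_C11 h H"
  shows "levy_int \<nu> (\<lambda>x. g x - h x) (\<lambda>x. G x - H x) x = levy_int \<nu> g G x - levy_int \<nu> h H x"
proof -
  have "compensated (\<lambda>x. g x - h x) (\<lambda>x. G x - H x) x z = compensated g G x z - compensated h H x z" for z
    by (simp add: compensated_def algebra_simps)
  then show ?thesis
    using compensated_integrable(1)[OF \<nu> g, of x] compensated_integrable(1)[OF \<nu> h, of x]
    by (simp add: levy_int_def)
qed

definition jump_part :: "(real^'n::finite) measure \<Rightarrow> real \<Rightarrow> (real^'n \<Rightarrow> real) \<Rightarrow> real^'n \<Rightarrow> real" where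
  "jump_part \<nu> r g x = (LINT z:{z. norm z > r}|\<nu>. g (x + z) - g x)"

definition small_jumps :: "(real^'n::finite) measure \<Rightarrow> real \<Rightarrow> (real^'n) measure" where
  "small_jumps \<nu> r = density \<nu> (indicator {z. norm z \<le> r})"

lemma closed_ball_sets: "{z::real^'n::finite. norm z \<le> r} \<in> sets borel" "{z::real^'n. norm z > r} \<in> sets borel"
  "{z::real^'n. r < norm z \<and> norm z < 1} \<in> sets borel" "{z::real^'n. norm z < 1} \<in> sets borel"
  by measurable

lemma levy_int_restr:
  assumes "levy_kernel \<nu>" "h \<in> borel_measurable borel"
  shows "(LINT z|small_jumps \<nu> r. h z) = (LINT z:{z. norm z \<le> r}|\<nu>. (h z :: real))"
proof -
  have [measurable_cong]: "sets \<nu> = sets borel" using assms by (auto simp: levy_kernel_def)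
  note [measurable] = closed_ball_sets assms(2)
  have "small_jumps \<nu> r = density \<nu> (\<lambda>z. ennreal (indicator {z. norm z \<le> r} z))"
    by (simp add: small_jumps_def ennreal_indicator)
  then show ?thesis unfolding set_lebesgue_integral_def
    by (simp add: integral_real_density)
qed

lemma levy_kernel_small_jumps:
  assumes "levy_kernel \<nu>"
  shows "levy_kernel (small_jumps \<nu> r)"
proof -
  have [measurable_cong]: "sets \<nu> = sets borel" and int: "integrable \<nu> (\<lambda>z. min ((norm z)\<^sup>2) 1)"
    using assms by (auto simp: levy_kernel_def)
  interpret \<nu>: sigma_finite_measure \<nu> using assms by (simp add: levy_kernel_def)
  note [measurable] = closed_ball_sets
  have 1: "small_jumps \<nu> r = density \<nu> (\<lambda>z. ennreal (indicator {z. norm z \<le> r} z))"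
    by (simp add: small_jumps_def ennreal_indicator)
  have "sigma_finite_measure (density \<nu> (\<lambda>z. ennreal (indicator {z. norm z \<le> r} z)))"
    by (subst \<nu>.sigma_finite_iff_density_finite) (auto simp: AE_I2)
  moreover have "integrable (small_jumps \<nu> r) (\<lambda>z. min ((norm z)\<^sup>2) 1)"
    unfolding 1
    by (subst integrable_real_density) (auto intro!: Bochner_Integration.integrable_bound[OF int] simp: indicator_def)
  ultimately show ?thesis using 1 assms by (simp add: levy_kernel_def small_jumps_def)
qed

text \<open>
  Away from the origin \<open>min (\<bar>z\<bar>\<^sup>2) 1\<close> is bounded below, so that only finitely much mass lies there.
\<close>
lemma levy_kernel_outer:
  assumes \<nu>: "levy_kernel \<nu>" and r: "r > 0"
    and [measurable]: "h \<in> borel_measurable borel" and bd: "\<And>z. norm (h z) \<le> B"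
  shows "set_integrable \<nu> {z. norm z > r} (h :: _ \<Rightarrow> 'b::{banach, second_countable_topology})"
    and "norm (LINT z:{z. norm z > r}|\<nu>. h z) \<le> B * (LINT z:{z. norm z > r}|\<nu>. 1)"
proof -
  have [measurable_cong]: "sets \<nu> = sets borel" and int: "integrable \<nu> (\<lambda>z. min ((norm z)\<^sup>2) 1)"
    using \<nu> by (auto simp: levy_kernel_def)
  note [measurable] = closed_ball_sets
  have pos: "min (r\<^sup>2) 1 > 0" using r by simp
  have B0: "B \<ge> 0" using norm_ge_zero[of "h 0"] bd[of 0] by linarith
  have key: "indicator {z. norm z > r} z \<le> min ((norm z)\<^sup>2) 1 / min (r\<^sup>2) 1" for z :: "real^'a"
  proof (cases "norm z > r")
    case True
    then have "r\<^sup>2 \<le> (norm z)\<^sup>2" using r by (intro power_mono) auto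
    then have "min (r\<^sup>2) 1 \<le> min ((norm z)\<^sup>2) 1" by auto
    then show ?thesis using True pos by (simp add: field_simps)
  qed (use pos in auto)
  have intd: "integrable \<nu> (\<lambda>z. (B / min (r\<^sup>2) 1) * min ((norm z)\<^sup>2) 1)" using int by simp
  have int1: "set_integrable \<nu> {z. norm z > r} (\<lambda>z. 1::real)"
    unfolding set_integrable_def
    by (rule Bochner_Integration.integrable_bound[of _ "\<lambda>z. (1 / min (r\<^sup>2) 1) * min ((norm z)\<^sup>2) 1"])
      (use int key pos in \<open>auto intro!: AE_I2\<close>)
  show s: "set_integrable \<nu> {z. norm z > r} h"
    unfolding set_integrable_def
  proof (rule Bochner_Integration.integrable_bound[OF intd])
    show "AE z in \<nu>. norm (indicator {z. norm z > r} z *\<^sub>R h z) \<le> norm ((B / min (r\<^sup>2) 1) * min ((norm z)\<^sup>2) 1)"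
    proof (rule AE_I2)
      fix z :: "real^'a"
      have "norm (indicator {z. norm z > r} z *\<^sub>R h z) \<le> indicator {z. norm z > r} z * B"
        using bd[of z] by (simp add: indicator_def)
      also have "\<dots> \<le> (min ((norm z)\<^sup>2) 1 / min (r\<^sup>2) 1) * B"
        by (rule mult_right_mono[OF key B0])
      finally show "norm (indicator {z. norm z > r} z *\<^sub>R h z) \<le> norm ((B / min (r\<^sup>2) 1) * min ((norm z)\<^sup>2) 1)"
        by (simp add: mult_ac abs_if)
    qed
  qed measurable
  have "norm (LINT z:{z. norm z > r}|\<nu>. h z) \<le> (LINT z:{z. norm z > r}|\<nu>. norm (h z))"
    by (rule set_integral_norm_bound[OF s])
  also have "\<dots> \<le> (LINT z:{z. norm z > r}|\<nu>. B)"
    using bd int1 s by (intro set_integral_mono set_integrable_norm) (auto simp: set_integrable_def)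
  finally show "norm (LINT z:{z. norm z > r}|\<nu>. h z) \<le> B * (LINT z:{z. norm z > r}|\<nu>. 1)"
    by (simp add: set_lebesgue_integral_def mult.commute)
qed

definition jump_drift :: "(real^'n::finite) measure \<Rightarrow> real \<Rightarrow> real^'n" where
  "jump_drift \<nu> r = (LINT z:{z. r < norm z \<and> norm z < 1}|\<nu>. z)"

text \<open>
  Large jumps need no compensation; removing it from those between \<open>r\<close> and \<open>1\<close> leaves their mean as a drift.
\<close>
lemma levy_int_split:
  assumes \<nu>: "levy_kernel \<nu>" and g: "periodic_C11 g G" and r: "r > 0"
  shows "levy_int \<nu> g G x = levy_int (small_jumps \<nu> r) g G x + jump_part \<nu> r g x - jump_drift \<nu> r \<bullet> G x"
proof -
  have [measurable_cong]: "sets \<nu> = sets borel" using \<nu> by (auto simp: levy_kernel_def)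
  note [measurable] = closed_ball_sets continuous_borel[OF periodic_C11_continuous(1)[OF g]]
  note cm = compensated_measurable[OF continuous_borel[OF periodic_C11_continuous(1)[OF g]]
      continuous_borel[OF periodic_C11_continuous(2)[OF g]]]
  obtain B where B: "\<And>x. norm (g x) \<le> B" "B > 0"
    using periodic_continuous_bounded[of g] periodic_C11_continuous[OF g] g
    unfolding periodic_C11_def by blast
  have "norm (g (x + z) - g x) \<le> 2 * B" for z
    using B(1)[of "x+z"] B(1)[of x] by (auto simp: abs_le_iff)
  then have i1: "set_integrable \<nu> {z. norm z > r} (\<lambda>z. g (x + z) - g x)"
    by (intro levy_kernel_outer(1)[OF \<nu> r, where B="2*B"]) measurable
  have i2: "set_integrable \<nu> {z. norm z > r} (\<lambda>z. indicator {z. norm z < 1} z *\<^sub>R z)"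
    by (intro levy_kernel_outer(1)[OF \<nu> r, where B=1]) (auto simp: indicator_def)
  have i3: "set_integrable \<nu> {z. norm z \<le> r} (\<lambda>z. compensated g G x z)"
    using compensated_integrable(1)[OF \<nu> g, of x] unfolding set_integrable_def
    by (rule Bochner_Integration.integrable_bound) (use cm(2) in \<open>auto simp: indicator_def\<close>)
  have dr: "jump_drift \<nu> r = (LINT z:{z. norm z > r}|\<nu>. indicator {z. norm z < 1} z *\<^sub>R z)"
    unfolding jump_drift_def set_lebesgue_integral_def
    by (rule Bochner_Integration.integral_cong) (auto simp: indicator_def)
  have i4: "set_integrable \<nu> {z. norm z > r} (\<lambda>z. (indicator {z. norm z < 1} z *\<^sub>R z) \<bullet> G x)"
    using integrable_inner_left[OF i2[unfolded set_integrable_def], of "G x"]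
    by (simp add: set_integrable_def mult.assoc)
  have dr2: "(LINT z:{z. norm z > r}|\<nu>. (indicator {z. norm z < 1} z *\<^sub>R z) \<bullet> G x) = jump_drift \<nu> r \<bullet> G x"
    unfolding dr set_lebesgue_integral_def
    using integral_inner_left[of "G x" \<nu> "\<lambda>z. indicator {z. norm z > r} z *\<^sub>R (indicator {z. norm z < 1} z *\<^sub>R z)"]
      i2 by (simp add: set_integrable_def mult.assoc)
  have "levy_int \<nu> g G x = (LINT z:{z. norm z \<le> r} \<union> {z. norm z > r}|\<nu>. compensated g G x z)"
    unfolding levy_int_def set_lebesgue_integral_def
    by (rule Bochner_Integration.integral_cong) (auto simp: indicator_def)
  also have "\<dots> = (LINT z|\<nu>. indicator {z. norm z \<le> r} z *\<^sub>R compensated g G x z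
      + (indicator {z. norm z > r} z *\<^sub>R (g (x + z) - g x)
       - indicator {z. norm z > r} z *\<^sub>R ((indicator {z. norm z < 1} z *\<^sub>R z) \<bullet> G x)))"
    unfolding set_lebesgue_integral_def
    by (rule Bochner_Integration.integral_cong) (auto simp: indicator_def compensated_def)
  also have "\<dots> = (LINT z:{z. norm z \<le> r}|\<nu>. compensated g G x z)
      + ((LINT z:{z. norm z > r}|\<nu>. g (x + z) - g x)
      - (LINT z:{z. norm z > r}|\<nu>. (indicator {z. norm z < 1} z *\<^sub>R z) \<bullet> G x))"
    unfolding set_lebesgue_integral_def
    using i1 i3 i4 unfolding set_integrable_def
    by (subst Bochner_Integration.integral_add) (auto intro!: Bochner_Integration.integrable_diff)
  finally show ?thesis
    unfolding dr2 levy_int_def levy_int_restr[OF \<nu> cm(2)] jump_part_def by simp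
qed

definition levy_ext :: "(real^'n::finite) measure \<Rightarrow> (real^'n) measure" where
  "levy_ext \<mu> = distr \<mu> borel (\<lambda>z. z)"

lemma levy_measure_space:
  assumes "levy_measure \<mu>"
  shows "space \<mu> = - {0}" "(\<lambda>z. z) \<in> measurable \<mu> borel"
proof -
  have s: "sets \<mu> = sets (restrict_space borel (- {0}))" using assms by (simp add: levy_measure_def)
  from sets_eq_imp_space_eq[OF s] show "space \<mu> = - {0}" by (simp add: space_restrict_space)
  have "(\<lambda>z. z) \<in> measurable (restrict_space borel (- {0})) borel"
    by (intro measurable_restrict_space1) simp
  then show "(\<lambda>z. z) \<in> measurable \<mu> borel"
    using s measurable_cong_sets by blast
qed

text \<open>
  For sigma-finiteness: the set where \<open>n min (\<bar>z\<bar>\<^sup>2) 1 \<ge> 1\<close> has finite measure by Markov's inequality, and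
  these sets exhaust everything but the origin, which is a null set.
\<close>
lemma levy_kernel_ext:
  assumes "levy_measure \<mu>"
  shows "levy_kernel (levy_ext \<mu>)"
proof -
  note sp = levy_measure_space[OF assms]
  have fin: "(\<integral>\<^sup>+ z. ennreal (min ((norm z)\<^sup>2) 1) \<partial>levy_ext \<mu>) < \<infinity>"
    using assms sp(2) by (simp add: levy_ext_def nn_integral_distr levy_measure_def)
  have int: "integrable (levy_ext \<mu>) (\<lambda>z. min ((norm z)\<^sup>2) 1)"
    by (rule integrableI_bounded) (use fin in \<open>auto simp: levy_ext_def\<close>)
  let ?A = "\<lambda>n. {z :: real^'a. 1 \<le> of_nat n * ennreal (min ((norm z)\<^sup>2) 1)}"
  have emA: "emeasure (levy_ext \<mu>) (?A n) \<noteq> \<infinity>" for n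
  proof -
    have "emeasure (levy_ext \<mu>) (?A n) = emeasure (levy_ext \<mu>) ({z \<in> UNIV. 1 \<le> of_nat n * ennreal (min ((norm z)\<^sup>2) 1)})"
      by simp
    also have "\<dots> \<le> of_nat n * (\<integral>\<^sup>+ z. ennreal (min ((norm z)\<^sup>2) 1) * indicator UNIV z \<partial>levy_ext \<mu>)"
      by (rule nn_integral_Markov_inequality) (auto simp: levy_ext_def)
    also have "\<dots> < \<infinity>" using fin by (simp add: ennreal_mult_less_top of_nat_less_top)
    finally show ?thesis by simp
  qed
  have em0: "emeasure (levy_ext \<mu>) {0} = 0"
    unfolding levy_ext_def using sp by (subst emeasure_distr) (auto simp: vimage_def)
  have cover: "(\<Union>n. ?A n) \<union> {0} = UNIV"
  proof -
    have "\<exists>n. z \<in> ?A n" if "z \<noteq> 0" for z :: "real^'a"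
    proof -
      have m: "min ((norm z)\<^sup>2) 1 > 0" using that by simp
      obtain n :: nat where "1 / min ((norm z)\<^sup>2) 1 < of_nat n" using reals_Archimedean2 by blast
      then have "1 \<le> of_nat n * min ((norm z)\<^sup>2) 1" using m by (simp add: field_simps)
      then have "ennreal 1 \<le> ennreal (of_nat n * min ((norm z)\<^sup>2) 1)" by (rule ennreal_leI)
      then have "z \<in> ?A n" using m by (simp add: ennreal_mult ennreal_of_nat_eq_real_of_nat)
      then show ?thesis by blast
    qed
    then show ?thesis by auto
  qed
  have "sigma_finite_measure (levy_ext \<mu>)"
  proof
    show "\<exists>A. countable A \<and> A \<subseteq> sets (levy_ext \<mu>) \<and> \<Union> A = space (levy_ext \<mu>) \<and> (\<forall>a\<in>A. emeasure (levy_ext \<mu>) a \<noteq> \<infinity>)"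
    proof (intro exI[of _ "insert {0} (range ?A)"] conjI ballI)
      have [measurable]: "?A n \<in> sets borel" for n by measurable
      show "insert {0} (range ?A) \<subseteq> sets (levy_ext \<mu>)" by (auto simp: levy_ext_def)
      show "\<Union> (insert {0} (range ?A)) = space (levy_ext \<mu>)" using cover by (auto simp: levy_ext_def)
    qed (use emA em0 in auto)
  qed
  then show ?thesis using int by (simp add: levy_kernel_def levy_ext_def)
qed

lemma levy_ext_integral:
  assumes "levy_measure \<mu>" "h \<in> borel_measurable borel"
  shows "(LINT z|levy_ext \<mu>. h z) = (LINT z|\<mu>. (h z :: 'b::{banach, second_countable_topology}))"
  unfolding levy_ext_def using assms levy_measure_space(2) by (subst integral_distr) auto

lemma levy_op_eq_levy_int:
  assumes \<mu>: "levy_measure \<mu>" and g: "g \<in> borel_measurable borel"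
  shows "levy_op \<mu> g x = levy_int (levy_ext \<mu>) g (grad g) x"
proof -
  have "(\<lambda>z. compensated g (grad g) x z) \<in> borel_measurable borel"
    using g unfolding compensated_def by measurable
  then have "levy_int (levy_ext \<mu>) g (grad g) x = (LINT z|\<mu>. compensated g (grad g) x z)"
    unfolding levy_int_def by (rule levy_ext_integral[OF \<mu>])
  also have "\<dots> = levy_op \<mu> g x"
    unfolding levy_op_def set_lebesgue_integral_def
    by (intro Bochner_Integration.integral_cong refl)
      (simp add: compensated_def levy_measure_space(1)[OF \<mu>])
  finally show ?thesis by simp
qed

lemma levy_inner_adjoint_eq_levy_adj:
  assumes \<mu>: "levy_measure \<mu>" and g: "g \<in> borel_measurable borel"
  shows "levy_inner_adjoint \<mu> r g x = levy_adj (small_jumps (levy_ext \<mu>) r) g (grad g) x"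
proof -
  note [measurable] = g closed_ball_sets
  have m: "(\<lambda>z. compensated g (grad g) x (- z)) \<in> borel_measurable borel"
    unfolding compensated_def by measurable
  have m2: "(\<lambda>z. indicator {z. norm z \<le> r} z *\<^sub>R compensated g (grad g) x (- z)) \<in> borel_measurable borel"
    using m by measurable
  show ?thesis
    unfolding levy_adj_def levy_int_restr[OF levy_kernel_ext[OF \<mu>] m] levy_inner_adjoint_def set_lebesgue_integral_def
      levy_ext_integral[OF \<mu> m2]
    by (auto intro!: Bochner_Integration.integral_cong simp: compensated_def indicator_def)
qed

lemma levy_outer_eq_jump_part:
  assumes \<mu>: "levy_measure \<mu>" and g: "g \<in> borel_measurable borel"
  shows "levy_outer \<mu> r g x = jump_part (levy_ext \<mu>) r g x"
proof -
  note [measurable] = g closed_ball_sets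
  have m2: "(\<lambda>z. indicator {z. norm z > r} z *\<^sub>R (g (x + z) - g x)) \<in> borel_measurable borel"
    by measurable
  show ?thesis
    unfolding levy_outer_def jump_part_def set_lebesgue_integral_def levy_ext_integral[OF \<mu> m2] ..
qed

lemma levy_drift_eq_jump_drift:
  assumes \<mu>: "levy_measure \<mu>"
  shows "levy_drift \<mu> r = jump_drift (levy_ext \<mu>) r"
proof -
  note [measurable] = closed_ball_sets
  have m2: "(\<lambda>z::real^'a. indicator {z. r < norm z \<and> norm z < 1} z *\<^sub>R z) \<in> borel_measurable borel"
    by measurable
  show ?thesis
    unfolding levy_drift_def jump_drift_def set_lebesgue_integral_def levy_ext_integral[OF \<mu> m2] ..
qed

section \<open>A smooth convex approximation of the absolute value\<close>

text \<open>
  The width \<open>a\<close> of the smoothing is chosen such that the derivative of the approximation reaches one exactly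
  at \<open>B\<close>.
\<close>
definition smoothing_width :: "real \<Rightarrow> real \<Rightarrow> real" where
  "smoothing_width B c = B / sinh (1 / c)"

text \<open>
  An approximation of the absolute value on \<open>{-B..B}\<close> with second derivative \<open>c / sqrt (w\<^sup>2 + a\<^sup>2)\<close>, for which
  \<open>\<bar>w\<bar>\<close> times the second derivative is at most \<open>c\<close>. For the usual choice \<open>sqrt (w\<^sup>2 + a\<^sup>2)\<close> this product
  is bounded, but not small, and the flux term of the comparison would not vanish uniformly. The price is
  logarithmic growth of the derivative, which is harmless on a bounded interval.
\<close>
definition sabs :: "real \<Rightarrow> real \<Rightarrow> real \<Rightarrow> real" where
  "sabs B c w = c * (w * arsinh (w / smoothing_width B c) - sqrt (w\<^sup>2 + (smoothing_width B c)\<^sup>2))"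

definition sabs' :: "real \<Rightarrow> real \<Rightarrow> real \<Rightarrow> real" where
  "sabs' B c w = c * arsinh (w / smoothing_width B c)"

definition sabs'' :: "real \<Rightarrow> real \<Rightarrow> real \<Rightarrow> real" where
  "sabs'' B c w = c / sqrt (w\<^sup>2 + (smoothing_width B c)\<^sup>2)"

context
  fixes B c :: real
  assumes B: "B > 0" and c: "c > 0"
begin

lemma smoothing_width_pos: "smoothing_width B c > 0"
  using B c by (simp add: smoothing_width_def)

lemma sinh_ge_self: "x \<ge> 0 \<Longrightarrow> sinh x \<ge> (x::real)"
proof -
  assume x: "x \<ge> 0"
  have "(\<lambda>x. sinh x - x) 0 \<le> (\<lambda>x. sinh x - x) x"
  proof (rule DERIV_nonneg_imp_nondecreasing[OF x])
    fix y :: real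
    have "((\<lambda>x. sinh x - x) has_real_derivative cosh y - 1) (at y)"
      by (auto intro!: derivative_eq_intros)
    then show "\<exists>z. ((\<lambda>x. sinh x - x) has_real_derivative z) (at y) \<and> 0 \<le> z"
      using cosh_real_ge_1[of y] by (intro exI[of _ "cosh y - 1"]) auto
  qed
  then show ?thesis by simp
qed

lemma smoothing_width_le: "smoothing_width B c \<le> B * c"
proof -
  have "sinh (1 / c) \<ge> 1 / c" using c by (intro sinh_ge_self) simp
  moreover have "1 / c > 0" using c by simp
  ultimately have "B / sinh (1 / c) \<le> B / (1 / c)"
    using B by (intro divide_left_mono) (auto intro: mult_pos_pos less_le_trans)
  then show ?thesis by (simp add: smoothing_width_def)
qed

lemma root_pos: "sqrt (w\<^sup>2 + (smoothing_width B c)\<^sup>2) > 0"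
  using smoothing_width_pos by (simp add: add_nonneg_pos)

lemma sabs'_deriv: "(sabs' B c has_real_derivative sabs'' B c w) (at w)"
proof -
  let ?a = "smoothing_width B c"
  have a: "?a > 0" by (rule smoothing_width_pos)
  have s: "sqrt ((w / ?a)\<^sup>2 + 1) * ?a = sqrt (w\<^sup>2 + ?a\<^sup>2)"
  proof -
    have "sqrt (w\<^sup>2 + ?a\<^sup>2) = sqrt (((w / ?a)\<^sup>2 + 1) * ?a\<^sup>2)"
      using a by (simp add: field_simps)
    then show ?thesis using a by (simp add: real_sqrt_mult)
  qed
  have "((\<lambda>w. c * arsinh (w / ?a)) has_real_derivative c * (1 / sqrt ((w / ?a)\<^sup>2 + 1) * (1 / ?a))) (at w)"
    using a by (intro DERIV_cmult DERIV_chain2[OF arsinh_real_has_field_derivative])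
      (auto intro!: derivative_eq_intros)
  moreover have "c * (1 / sqrt ((w / ?a)\<^sup>2 + 1) * (1 / ?a)) = sabs'' B c w"
    unfolding sabs''_def s[symmetric] by simp
  ultimately show ?thesis by (simp add: sabs'_def[abs_def])
qed

lemma sabs_deriv: "(sabs B c has_real_derivative sabs' B c w) (at w)"
proof -
  let ?a = "smoothing_width B c"
  have r: "sqrt (w\<^sup>2 + ?a\<^sup>2) > 0" by (rule root_pos)
  then have r': "w\<^sup>2 + ?a\<^sup>2 > 0" by simp
  have d1: "((\<lambda>w. w * sabs' B c w) has_real_derivative sabs' B c w + w * sabs'' B c w) (at w)"
    by (auto intro!: derivative_eq_intros sabs'_deriv)
  have d2: "((\<lambda>w. c * sqrt (w\<^sup>2 + ?a\<^sup>2)) has_real_derivative w * sabs'' B c w) (at w)"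
    using r r' by (auto intro!: derivative_eq_intros simp: sabs''_def field_simps)
  have "sabs B c = (\<lambda>w. w * sabs' B c w - c * sqrt (w\<^sup>2 + ?a\<^sup>2))"
    by (auto simp: sabs_def sabs'_def fun_eq_iff algebra_simps)
  then show ?thesis using DERIV_diff[OF d1 d2] by simp
qed

lemma sabs''_nonneg: "sabs'' B c w \<ge> 0"
  using c root_pos[of w] by (simp add: sabs''_def)

lemma sabs''_bound: "sabs'' B c w \<le> c / smoothing_width B c"
proof -
  have "smoothing_width B c = sqrt ((smoothing_width B c)\<^sup>2)" using smoothing_width_pos by simp
  also have "\<dots> \<le> sqrt (w\<^sup>2 + (smoothing_width B c)\<^sup>2)" by (intro real_sqrt_le_mono) simp
  finally show ?thesis unfolding sabs''_def using smoothing_width_pos c root_pos[of w]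
    by (intro divide_left_mono) auto
qed

lemma sabs''_weighted: "\<bar>w\<bar> * sabs'' B c w \<le> c"
proof -
  have "\<bar>w\<bar> = sqrt (w\<^sup>2)" by simp
  also have "\<dots> \<le> sqrt (w\<^sup>2 + (smoothing_width B c)\<^sup>2)" by (intro real_sqrt_le_mono) simp
  finally show ?thesis using c root_pos[of w] by (simp add: sabs''_def field_simps)
qed

lemma sabs''_continuous: "continuous_on UNIV (sabs'' B c)"
  unfolding sabs''_def[abs_def] using root_pos by (intro continuous_intros) (auto simp: less_imp_neq[symmetric])

lemma sabs'_continuous: "continuous_on UNIV (sabs' B c)"
  using sabs'_deriv by (meson DERIV_isCont continuous_at_imp_continuous_on)

lemma sabs_continuous: "continuous_on UNIV (sabs B c)"
  using sabs_deriv by (meson DERIV_isCont continuous_at_imp_continuous_on)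

lemma sabs'_odd: "sabs' B c (- w) = - sabs' B c w"
  by (simp add: sabs'_def)

lemma sabs'_mono: "v \<le> w \<Longrightarrow> sabs' B c v \<le> sabs' B c w"
  by (rule DERIV_nonneg_imp_nondecreasing[of v w]) (use sabs'_deriv sabs''_nonneg in blast)+

lemma sabs'_lipschitz: "\<bar>sabs' B c v - sabs' B c w\<bar> \<le> c / smoothing_width B c * \<bar>v - w\<bar>"
  using field_differentiable_bound[of UNIV "sabs' B c" "sabs'' B c" "c / smoothing_width B c" v w]
    sabs'_deriv sabs''_bound sabs''_nonneg by auto

lemma sabs_convex: "sabs B c b - sabs B c a \<ge> sabs' B c a * (b - a)"
proof -
  consider "a = b" | "a < b" | "b < a" by linarith
  then show ?thesis
  proof cases
    case 2
    from MVT2[OF 2 sabs_deriv] obtain z where z: "a < z" "sabs B c b - sabs B c a = (b - a) * sabs' B c z" by blast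
    then show ?thesis using sabs'_mono[of a z] 2 by (simp add: mult.commute)
  next
    case 3
    from MVT2[OF 3 sabs_deriv] obtain z where z: "z < a" "sabs B c a - sabs B c b = (a - b) * sabs' B c z" by blast
    have "(a - b) * sabs' B c z \<le> (a - b) * sabs' B c a" using sabs'_mono[of z a] 3 z by (intro mult_left_mono) auto
    then show ?thesis using z by (simp add: algebra_simps)
  qed simp
qed

lemma sabs'_B: "sabs' B c B = 1"
proof -
  have "B / smoothing_width B c = sinh (1 / c)"
    using B c by (simp add: smoothing_width_def)
  then show ?thesis using c by (simp add: sabs'_def arsinh_sinh_real)
qed

lemma sabs'_le_1: "\<bar>w\<bar> \<le> B \<Longrightarrow> \<bar>sabs' B c w\<bar> \<le> 1"
  using sabs'_mono[of w B] sabs'_mono[of "-B" w] sabs'_odd[of B] sabs'_B by (simp add: abs_le_iff)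

text \<open>
  For positive \<open>w\<close> the derivative falls short of its value one at \<open>B\<close> by at most \<open>B - w\<close> times the second
  derivative at an intermediate point, and the second derivative there is at most \<open>c / w\<close>.
\<close>
lemma sabs'_sgn: 
  assumes "\<bar>w\<bar> \<le> B"
  shows "\<bar>w\<bar> * \<bar>sgn w - sabs' B c w\<bar> \<le> c * B"
proof -
  have pos: "w * (1 - sabs' B c w) \<le> c * B \<and> sabs' B c w \<le> 1 \<and> sabs' B c w \<ge> 0" if w: "0 < w" "w \<le> B" for w
  proof -
    have le1: "sabs' B c w \<le> 1" using sabs'_le_1[of w] w by simp
    have ge0: "sabs' B c w \<ge> 0" using sabs'_mono[of 0 w] w by (simp add: sabs'_def)
    have "w * (1 - sabs' B c w) \<le> c * B"
    proof (cases "w = B")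
      case True then show ?thesis using sabs'_B B c by simp
    next
      case False
      then have wB: "w < B" using w by simp
      from MVT2[OF wB sabs'_deriv] obtain z where z: "w < z" "sabs' B c B - sabs' B c w = (B - w) * sabs'' B c z"
        by blast
      have "w * (1 - sabs' B c w) = (B - w) * (w * sabs'' B c z)" using z(2) by (simp add: sabs'_B)
      also have "\<dots> \<le> (B - w) * c"
      proof (rule mult_left_mono)
        have "w * sabs'' B c z \<le> z * sabs'' B c z" using z w sabs''_nonneg by (intro mult_right_mono) auto
        also have "\<dots> \<le> c" using sabs''_weighted[of z] z w by simp
        finally show "w * sabs'' B c z \<le> c" .
      qed (use wB in simp)
      also have "\<dots> \<le> B * c" using w c by (intro mult_right_mono) auto
      finally show ?thesis by (simp add: mult.commute)
    qed
    then show ?thesis using le1 ge0 by simp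
  qed
  consider "w = 0" | "w > 0" | "w < 0" by linarith
  then show ?thesis
  proof cases
    case 1 then show ?thesis using B c by simp
  next
    case 2 then show ?thesis using pos[of w] assms by simp
  next
    case 3 
    have "\<bar>sgn w - sabs' B c w\<bar> = 1 - sabs' B c (-w)" using pos[of "-w"] 3 assms by (simp add: sabs'_odd)
    then show ?thesis using pos[of "-w"] 3 assms by simp
  qed
qed

lemma sabs_abs:
  assumes w: "\<bar>w\<bar> \<le> B"
  shows "\<bar>sabs B c w - \<bar>w\<bar>\<bar> \<le> c * (B * (2 + c))"
proof -
  have r: "sqrt (w\<^sup>2 + (smoothing_width B c)\<^sup>2) \<le> B + B * c"
  proof -
    have "sqrt (w\<^sup>2 + (smoothing_width B c)\<^sup>2) \<le> \<bar>w\<bar> + \<bar>smoothing_width B c\<bar>"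
      by (rule sqrt_sum_squares_le_sum_abs)
    then show ?thesis using w smoothing_width_le smoothing_width_pos by linarith
  qed
  have eq: "sabs B c w - \<bar>w\<bar> = - (w * (sgn w - sabs' B c w)) - c * sqrt (w\<^sup>2 + (smoothing_width B c)\<^sup>2)"
    by (simp add: sabs_def sabs'_def algebra_simps abs_sgn)
  have "\<bar>sabs B c w - \<bar>w\<bar>\<bar> \<le> \<bar>w\<bar> * \<bar>sgn w - sabs' B c w\<bar> + c * sqrt (w\<^sup>2 + (smoothing_width B c)\<^sup>2)"
    unfolding eq abs_mult[symmetric] using c root_pos[of w]
      mult_pos_pos[OF c root_pos[of w]] by linarith
  also have "\<dots> \<le> c * B + c * (B + B * c)"
    using sabs'_sgn[OF w] r c by (intro add_mono mult_left_mono) auto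
  finally show ?thesis by (simp add: algebra_simps)
qed

end

lemma sabs'_tendsto_sgn:
  assumes "B > 0" "\<bar>w\<bar> \<le> B"
  shows "(\<lambda>n. sabs' B (1 / real (Suc n)) w) \<longlonglongrightarrow> sgn w"
proof (cases "w = 0")
  case True then show ?thesis by (simp add: sabs'_def)
next
  case False
  have l: "(\<lambda>n. 1 / real (Suc n) * (B / \<bar>w\<bar>)) \<longlonglongrightarrow> 0 * (B / \<bar>w\<bar>)"
    by (intro tendsto_mult tendsto_const lim_1_over_n[THEN LIMSEQ_Suc])
  have "(\<lambda>n. sabs' B (1 / real (Suc n)) w - sgn w) \<longlonglongrightarrow> 0"
  proof (rule Lim_null_comparison)
    show "(\<lambda>n. 1 / real (Suc n) * (B / \<bar>w\<bar>)) \<longlonglongrightarrow> 0" using l by simp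
    show "\<forall>\<^sub>F n in sequentially. norm (sabs' B (1 / real (Suc n)) w - sgn w) \<le> 1 / real (Suc n) * (B / \<bar>w\<bar>)"
    proof (rule always_eventually, rule allI)
      fix n
      have "\<bar>w\<bar> * \<bar>sgn w - sabs' B (1 / real (Suc n)) w\<bar> \<le> 1 / real (Suc n) * B"
        using assms by (intro sabs'_sgn) auto
      then show "norm (sabs' B (1 / real (Suc n)) w - sgn w) \<le> 1 / real (Suc n) * (B / \<bar>w\<bar>)"
        using False by (simp add: abs_minus_commute pos_le_divide_eq mult_ac del: of_nat_Suc)
    qed
  qed
  then show ?thesis by (simp add: LIM_zero_iff)
qed

lemma sabs_tendsto_abs:
  assumes "B > 0" "\<bar>w\<bar> \<le> B"
  shows "(\<lambda>n. sabs B (1 / real (Suc n)) w) \<longlonglongrightarrow> \<bar>w\<bar>"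
proof -
  have c0: "(\<lambda>n. 1 / real (Suc n)) \<longlonglongrightarrow> 0" by (rule lim_1_over_n[THEN LIMSEQ_Suc])
  have l: "(\<lambda>n. 1 / real (Suc n) * (B * (2 + 1 / real (Suc n)))) \<longlonglongrightarrow> 0 * (B * (2 + 0))"
    by (intro tendsto_intros c0)
  have "(\<lambda>n. sabs B (1 / real (Suc n)) w - \<bar>w\<bar>) \<longlonglongrightarrow> 0"
  proof (rule Lim_null_comparison)
    show "(\<lambda>n. 1 / real (Suc n) * (B * (2 + 1 / real (Suc n)))) \<longlonglongrightarrow> 0" using l by simp
    show "\<forall>\<^sub>F n in sequentially. norm (sabs B (1 / real (Suc n)) w - \<bar>w\<bar>) \<le> 1 / real (Suc n) * (B * (2 + 1 / real (Suc n)))"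
      using sabs_abs[OF assms(1) _ assms(2), of "1 / real (Suc _)"] by (intro always_eventually allI) (simp del: of_nat_Suc)
  qed
  then show ?thesis by (simp add: LIM_zero_iff)
qed

section \<open>Solutions of the viscous equation\<close>

text \<open>
  The rows of the Hessian are separate arguments, so that the Laplacian is the sum of \<open>H j x $ j\<close>.
\<close>
definition periodic_C2 :: "(real^'n::finite \<Rightarrow> real) \<Rightarrow> (real^'n \<Rightarrow> real^'n) \<Rightarrow> ('n \<Rightarrow> real^'n \<Rightarrow> real^'n) \<Rightarrow> bool" where
  "periodic_C2 g G H \<longleftrightarrow> periodic g \<and> periodic G \<and> (\<forall>j. periodic (H j)) \<and>
     (\<forall>x. (g has_derivative (\<lambda>h. h \<bullet> G x)) (at x)) \<and>
     (\<forall>j x. ((\<lambda>x. G x $ j) has_derivative (\<lambda>h. h \<bullet> H j x)) (at x)) \<and>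
     (\<forall>j. continuous_on UNIV (H j))"

lemma lipschitz_of_gradient:
  fixes g :: "real^'n::finite \<Rightarrow> real"
  assumes d: "\<And>x. (g has_derivative (\<lambda>h. h \<bullet> G x)) (at x)" and b: "\<And>x. norm (G x) \<le> K"
  shows "\<bar>g x - g y\<bar> \<le> K * norm (x - y)"
proof -
  have "norm (g x - g y) \<le> K * norm (x - y)"
  proof (rule differentiable_bound[where S=UNIV and f'="\<lambda>x h. h \<bullet> G x"])
    show "onorm (\<lambda>h. h \<bullet> G x) \<le> K" for x
    proof (rule onorm_le)
      fix h show "norm (h \<bullet> G x) \<le> K * norm h"
        using mult_left_mono[OF b[of x], of "norm h"] Cauchy_Schwarz_ineq2[of h "G x"]
        by (simp add: mult.commute)
    qed
  qed (use d in auto)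
  then show ?thesis by simp
qed

lemma gradient_lipschitz:
  fixes G :: "real^'n::finite \<Rightarrow> real^'n"
  assumes d: "\<And>j x. ((\<lambda>x. G x $ j) has_derivative (\<lambda>h. h \<bullet> H j x)) (at x)"
    and b: "\<And>j x. norm (H j x) \<le> K"
  shows "norm (G x - G y) \<le> (real CARD('n) * K) * norm (x - y)"
proof -
  have "norm (G x - G y) \<le> (\<Sum>j\<in>UNIV. \<bar>(G x - G y) $ j\<bar>)" by (rule norm_le_l1_cart)
  also have "\<dots> \<le> (\<Sum>j\<in>(UNIV::'n set). K * norm (x - y))"
    using lipschitz_of_gradient[OF d b] by (intro sum_mono) simp
  finally show ?thesis by simp
qed

lemma periodic_C2_bound:
  assumes "periodic_C2 g G H"
  obtains K where "K > 0" "\<And>j x. norm (H j x) \<le> K"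
proof -
  have "\<forall>j. \<exists>B. B > 0 \<and> (\<forall>x. norm (H j x) \<le> B)"
    using assms periodic_continuous_bounded unfolding periodic_C2_def by metis
  then obtain B where B: "\<And>j. B j > 0" "\<And>j x. norm (H j x) \<le> B j" by metis
  have "norm (H j x) \<le> (\<Sum>i\<in>UNIV. B i)" for j x
    using B(2)[of j x] member_le_sum[of j UNIV B] B(1) by (auto simp: less_imp_le intro: order_trans)
  moreover have "(\<Sum>i\<in>UNIV. B i) > 0" using B(1) by (intro sum_pos) auto
  ultimately show ?thesis using that by blast
qed

lemma periodic_C2_imp_C11:
  assumes "periodic_C2 g G H"
  shows "periodic_C11 g G"
proof -
  obtain K where K: "\<And>j x. norm (H j x) \<le> K" using periodic_C2_bound[OF assms] by blast
  have "norm (G x - G y) \<le> (real CARD('a) * K) * norm (x - y)" for x y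
    using assms K unfolding periodic_C2_def by (intro gradient_lipschitz) auto
  then show ?thesis using assms unfolding periodic_C2_def periodic_C11_def by blast
qed

lemma has_derivative_component_inner:
  assumes "(g has_derivative (\<lambda>h. h \<bullet> G)) (at x)" "(\<eta> has_real_derivative d) (at (g x))"
  shows "((\<lambda>x. \<eta> (g x)) has_derivative (\<lambda>h. h \<bullet> (d *\<^sub>R G))) (at x)"
proof -
  have "(\<eta> has_derivative (\<lambda>y. d * y)) (at (g x))" using assms(2) by (simp add: has_field_derivative_def)
  from has_derivative_compose[OF assms(1) this] show ?thesis by simp
qed

lemma has_derivative_inner_mult:
  assumes "(g has_derivative (\<lambda>h. h \<bullet> G)) (at x)" "(k has_derivative (\<lambda>h. h \<bullet> K)) (at x)"
  shows "((\<lambda>x. g x * k x) has_derivative (\<lambda>h. h \<bullet> (k x *\<^sub>R G + g x *\<^sub>R K))) (at (x :: real^'n::finite))"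
  using has_derivative_mult[OF assms] by (simp add: inner_add_right algebra_simps)

lemma periodic_C11_compose:
  assumes g: "periodic_C11 g G"
    and d: "\<And>a. (\<eta> has_real_derivative \<eta>' a) (at a)"
    and l: "\<And>a b. \<bar>\<eta>' a - \<eta>' b\<bar> \<le> L * \<bar>a - b\<bar>"
  shows "periodic_C11 (\<lambda>x. \<eta> (g x)) (\<lambda>x. \<eta>' (g x) *\<^sub>R G x)"
proof -
  note cont = periodic_C11_continuous[OF g]
  obtain B where B: "\<And>x. norm (G x) \<le> B" "B > 0"
    using periodic_continuous_bounded[OF _ cont(2)] g unfolding periodic_C11_def by blast
  obtain b where b: "\<And>x. norm (g x) \<le> b" "b > 0"
    using periodic_continuous_bounded[OF _ cont(1)] g unfolding periodic_C11_def by blast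
  obtain K where K: "\<And>x y. norm (G x - G y) \<le> K * norm (x - y)"
    using g unfolding periodic_C11_def by blast
  have L0: "L \<ge> 0" using l[of 1 0] by simp
  have K0: "K \<ge> 0" using lipschitz_constant_nonneg[of G K] K by blast
  have e: "\<bar>\<eta>' (g x)\<bar> \<le> \<bar>\<eta>' 0\<bar> + L * b" for x
  proof -
    have "\<bar>\<eta>' (g x)\<bar> \<le> \<bar>\<eta>' 0\<bar> + \<bar>\<eta>' (g x) - \<eta>' 0\<bar>" by linarith
    also have "\<bar>\<eta>' (g x) - \<eta>' 0\<bar> \<le> L * \<bar>g x\<bar>" using l[of "g x" 0] by simp
    also have "\<dots> \<le> L * b" using b(1)[of x] L0 by (intro mult_left_mono) auto
    finally show ?thesis by simp
  qed
  have "norm (\<eta>' (g x) *\<^sub>R G x - \<eta>' (g y) *\<^sub>R G y) \<le> (L * B * B + (\<bar>\<eta>' 0\<bar> + L * b) * K) * norm (x - y)" for x y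
  proof -
    have "\<eta>' (g x) *\<^sub>R G x - \<eta>' (g y) *\<^sub>R G y = (\<eta>' (g x) - \<eta>' (g y)) *\<^sub>R G x + \<eta>' (g y) *\<^sub>R (G x - G y)"
      by (simp add: algebra_simps)
    then have "norm (\<eta>' (g x) *\<^sub>R G x - \<eta>' (g y) *\<^sub>R G y) \<le> \<bar>\<eta>' (g x) - \<eta>' (g y)\<bar> * norm (G x) + \<bar>\<eta>' (g y)\<bar> * norm (G x - G y)"
      by (metis norm_scaleR norm_triangle_ineq)
    also have "\<dots> \<le> (L * (B * norm (x - y))) * B + (\<bar>\<eta>' 0\<bar> + L * b) * (K * norm (x - y))"
    proof (intro add_mono mult_mono)
      have "\<bar>g x - g y\<bar> \<le> B * norm (x - y)"
        using g B unfolding periodic_C11_def by (intro lipschitz_of_gradient) auto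
      then show "\<bar>\<eta>' (g x) - \<eta>' (g y)\<bar> \<le> L * (B * norm (x - y))"
        using l[of "g x" "g y"] mult_left_mono[OF _ L0] by (meson order_trans)
    qed (use B e K L0 K0 b in \<open>auto intro!: mult_nonneg_nonneg add_nonneg_nonneg\<close>)
    finally show ?thesis by (simp add: algebra_simps)
  qed
  then show ?thesis
    using g unfolding periodic_C11_def
    by (auto simp: periodic_def intro!: has_derivative_component_inner[OF _ d] simp del: inner_scaleR_right)
qed

lemma periodic_C11_const: "periodic_C11 (\<lambda>_. k) (\<lambda>_. 0)"
  by (auto simp: periodic_C11_def periodic_def intro!: exI[of _ 0])

text \<open>
  Duality with the constant one.
\<close>
lemma integral_levy_int_zero:
  assumes "levy_kernel \<nu>" "periodic_C11 g G"
  shows "(LINT x|torus. levy_int \<nu> g G x) = 0"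
  using levy_duality[OF assms periodic_C11_const[of 1]] by (simp add: levy_adj_def compensated_def)

text \<open>
  All derivatives are separate arguments, which makes the equation visibly invariant under translations in
  space and time. There is no initial condition, since translates in time have another one.
\<close>
definition viscous_solution ::
  "('n::finite \<Rightarrow> real \<Rightarrow> real) \<Rightarrow> (real^'n) measure \<Rightarrow> real \<Rightarrow> real \<Rightarrow> (real^'n \<Rightarrow> real \<Rightarrow> real) \<Rightarrow>
   (real^'n \<Rightarrow> real \<Rightarrow> real) \<Rightarrow> (real^'n \<Rightarrow> real \<Rightarrow> real^'n) \<Rightarrow> ('n \<Rightarrow> real^'n \<Rightarrow> real \<Rightarrow> real^'n) \<Rightarrow> bool" where
  "viscous_solution f' \<nu> \<epsilon> T v v' D H \<longleftrightarrow>
     (\<forall>t\<in>{0<..<T}. periodic_C2 (\<lambda>x. v x t) (\<lambda>x. D x t) (\<lambda>j x. H j x t) \<and> periodic (\<lambda>x. v' x t)) \<and>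
     (\<forall>x. \<forall>t\<in>{0<..<T}. ((\<lambda>s. v x s) has_real_derivative v' x t) (at t)) \<and>
     continuous_on (UNIV \<times> {0<..<T}) (\<lambda>(x, t). v x t) \<and>
     continuous_on (UNIV \<times> {0<..<T}) (\<lambda>(x, t). v' x t) \<and>
     continuous_on (UNIV \<times> {0<..<T}) (\<lambda>(x, t). D x t) \<and>
     (\<forall>j. continuous_on (UNIV \<times> {0<..<T}) (\<lambda>(x, t). H j x t)) \<and>
     (\<forall>x. \<forall>t\<in>{0<..<T}. v' x t + (\<Sum>j\<in>UNIV. f' j (v x t) * D x t $ j)
        = levy_int \<nu> (\<lambda>x. v x t) (\<lambda>x. D x t) x + \<epsilon> * (\<Sum>j\<in>UNIV. H j x t $ j))"

lemma compact_time_bound: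
  fixes g :: "real^'n::finite \<Rightarrow> real \<Rightarrow> 'b::real_normed_vector"
  assumes c: "continuous_on (UNIV \<times> {0<..<T}) (\<lambda>(x, t). g x t)"
    and p: "\<And>t. 0 < t \<Longrightarrow> t < T \<Longrightarrow> periodic (\<lambda>x. g x t)" and ab: "0 < a" "b < T"
  obtains K where "K > 0" "\<And>x t. a \<le> t \<Longrightarrow> t \<le> b \<Longrightarrow> norm (g x t) \<le> K"
proof -
  let ?C = "cbox 0 (\<chi> j. 2 * pi) :: (real^'n) set"
  have "compact ((\<lambda>(x, t). g x t) ` (?C \<times> {a..b}))"
    using ab by (intro compact_continuous_image continuous_on_subset[OF c] compact_Times compact_cbox) auto
  then obtain B where B: "B > 0" "\<forall>y\<in>(\<lambda>(x, t). g x t) ` (?C \<times> {a..b}). norm y \<le> B"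
    by (meson bounded_pos compact_imp_bounded)
  have "norm (g x t) \<le> B" if t: "a \<le> t" "t \<le> b" for x t
  proof -
    have "x - lattice_vec (cell_index x) \<in> ?C"
      using minus_lattice_in_cell_iff[of x "cell_index x"]
      by (auto simp: half_open_cell_def mem_box_cart intro: less_imp_le)
    then have "norm (g (x - lattice_vec (cell_index x)) t) \<le> B" using t by (intro B(2)[rule_format]) force
    moreover have "g (x - lattice_vec (cell_index x)) t = g x t"
      using periodic_lattice[OF p[of t], of "x - lattice_vec (cell_index x)" "cell_index x"] t ab by simp
    ultimately show ?thesis by simp
  qed
  with that B(1) show ?thesis by blast
qed

lemma continuous_slice:
  assumes "continuous_on (UNIV \<times> {0<..<T::real}) (\<lambda>(x, t). g x t)" "0 < t" "t < T"
  shows "continuous_on UNIV (\<lambda>x. g x t)"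
proof -
  have "continuous_on UNIV (\<lambda>x. (\<lambda>(x, t). g x t) (x, t))"
    by (rule continuous_on_compose2[OF assms(1)]) (use assms in \<open>auto intro!: continuous_intros\<close>)
  then show ?thesis by simp
qed

lemma viscous_solutionD:
  assumes "viscous_solution f' \<nu> \<epsilon> T v v' D H" "0 < t" "t < T"
  shows "periodic_C2 (\<lambda>x. v x t) (\<lambda>x. D x t) (\<lambda>j x. H j x t)" "periodic (\<lambda>x. v' x t)"
    "periodic_C11 (\<lambda>x. v x t) (\<lambda>x. D x t)"
    "((\<lambda>s. v x s) has_real_derivative v' x t) (at t)"
    "continuous_on UNIV (\<lambda>x. v x t)" "continuous_on UNIV (\<lambda>x. v' x t)" "continuous_on UNIV (\<lambda>x. D x t)"
    "continuous_on UNIV (\<lambda>x. H j x t)"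
    "v' x t = - (\<Sum>j\<in>UNIV. f' j (v x t) * D x t $ j)
        + levy_int \<nu> (\<lambda>x. v x t) (\<lambda>x. D x t) x + \<epsilon> * (\<Sum>j\<in>UNIV. H j x t $ j)"
    "periodic (\<lambda>x. v x t)"
proof -
  have t: "t \<in> {0<..<T}" using assms by auto
  show c2: "periodic_C2 (\<lambda>x. v x t) (\<lambda>x. D x t) (\<lambda>j x. H j x t)" and "periodic (\<lambda>x. v' x t)"
    and "((\<lambda>s. v x s) has_real_derivative v' x t) (at t)"
    using assms(1) t unfolding viscous_solution_def by auto
  show "periodic_C11 (\<lambda>x. v x t) (\<lambda>x. D x t)" by (rule periodic_C2_imp_C11[OF c2])
  show "continuous_on UNIV (\<lambda>x. v x t)" "continuous_on UNIV (\<lambda>x. v' x t)" "continuous_on UNIV (\<lambda>x. D x t)"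
    "continuous_on UNIV (\<lambda>x. H j x t)"
    using assms unfolding viscous_solution_def by (auto intro!: continuous_slice)
  have "v' x t + (\<Sum>j\<in>UNIV. f' j (v x t) * D x t $ j)
        = levy_int \<nu> (\<lambda>x. v x t) (\<lambda>x. D x t) x + \<epsilon> * (\<Sum>j\<in>UNIV. H j x t $ j)"
    using assms(1) t unfolding viscous_solution_def by auto
  then show "v' x t = - (\<Sum>j\<in>UNIV. f' j (v x t) * D x t $ j)
        + levy_int \<nu> (\<lambda>x. v x t) (\<lambda>x. D x t) x + \<epsilon> * (\<Sum>j\<in>UNIV. H j x t $ j)" by linarith
  show "periodic (\<lambda>x. v x t)" using c2 by (simp add: periodic_C2_def)
qed

lemma viscous_solution_bounds:
  assumes s: "viscous_solution f' \<nu> \<epsilon> T v v' D H" and ab: "0 < a" "b < T"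
  obtains K where "K > 0"
    "\<And>x t. a \<le> t \<Longrightarrow> t \<le> b \<Longrightarrow> \<bar>v x t\<bar> \<le> K"
    "\<And>x t. a \<le> t \<Longrightarrow> t \<le> b \<Longrightarrow> \<bar>v' x t\<bar> \<le> K"
    "\<And>x t. a \<le> t \<Longrightarrow> t \<le> b \<Longrightarrow> norm (D x t) \<le> K"
    "\<And>j x t. a \<le> t \<Longrightarrow> t \<le> b \<Longrightarrow> norm (H j x t) \<le> K"
proof -
  have c: "continuous_on (UNIV \<times> {0<..<T}) (\<lambda>(x, t). v x t)"
     "continuous_on (UNIV \<times> {0<..<T}) (\<lambda>(x, t). v' x t)"
     "continuous_on (UNIV \<times> {0<..<T}) (\<lambda>(x, t). D x t)"
     "\<And>j. continuous_on (UNIV \<times> {0<..<T}) (\<lambda>(x, t). H j x t)"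
    using s unfolding viscous_solution_def by blast+
  have p: "periodic (\<lambda>x. v x t)" "periodic (\<lambda>x. v' x t)" "periodic (\<lambda>x. D x t)" "periodic (\<lambda>x. H j x t)"
    if "0 < t" "t < T" for t j
    using viscous_solutionD(1,2)[OF s that] by (auto simp: periodic_C2_def)
  obtain K1 where K1: "K1 > 0" "\<And>x t. a \<le> t \<Longrightarrow> t \<le> b \<Longrightarrow> norm (v x t) \<le> K1"
    using compact_time_bound[OF c(1) p(1) ab] by blast
  obtain K2 where K2: "K2 > 0" "\<And>x t. a \<le> t \<Longrightarrow> t \<le> b \<Longrightarrow> norm (v' x t) \<le> K2"
    using compact_time_bound[OF c(2) p(2) ab] by blast
  obtain K3 where K3: "K3 > 0" "\<And>x t. a \<le> t \<Longrightarrow> t \<le> b \<Longrightarrow> norm (D x t) \<le> K3"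
    using compact_time_bound[OF c(3) p(3) ab] by blast
  have "\<forall>j. \<exists>K. K > 0 \<and> (\<forall>x t. a \<le> t \<longrightarrow> t \<le> b \<longrightarrow> norm (H j x t) \<le> K)"
    using compact_time_bound[OF c(4) p(4) ab] by metis
  then obtain K4 where K4: "\<And>j. K4 j > 0" "\<And>j x t. a \<le> t \<Longrightarrow> t \<le> b \<Longrightarrow> norm (H j x t) \<le> K4 j"
    by metis
  have K4': "K4 j \<le> (\<Sum>i\<in>UNIV. K4 i)" for j
    using member_le_sum[of j UNIV K4] K4(1) by (simp add: less_imp_le)
  have K40: "(\<Sum>i\<in>UNIV. K4 i) > 0" using K4(1) by (intro sum_pos) auto
  let ?K = "K1 + K2 + K3 + (\<Sum>i\<in>UNIV. K4 i)"
  show ?thesis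
  proof (rule that[of ?K])
    show "?K > 0" using K1 K2 K3 K40 by simp
    fix x t assume t: "a \<le> t" "t \<le> b"
    show "\<bar>v x t\<bar> \<le> ?K" using K1(2)[OF t, of x] K1(1) K2(1) K3(1) K40 by simp
    show "\<bar>v' x t\<bar> \<le> ?K" using K2(2)[OF t, of x] K1(1) K2(1) K3(1) K40 by simp
    show "norm (D x t) \<le> ?K" using K3(2)[OF t, of x] K1(1) K2(1) K3(1) K40 by simp
    show "norm (H j x t) \<le> ?K" for j
      using K4(2)[OF t, of j x] K4'[of j] K1(1) K2(1) K3(1) by simp
  qed
qed

lemma viscous_solution_const: "viscous_solution f' \<nu> \<epsilon> T (\<lambda>_ _. k) (\<lambda>_ _. 0) (\<lambda>_ _. 0) (\<lambda>_ _ _. 0)"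
  by (auto simp: viscous_solution_def periodic_C2_def periodic_def levy_int_def compensated_def case_prod_beta)

lemma viscous_solution_shift:
  assumes s: "viscous_solution f' \<nu> \<epsilon> T v v' D H" and \<tau>: "\<tau> \<ge> 0"
  shows "viscous_solution f' \<nu> \<epsilon> (T - \<tau>) (\<lambda>x t. v (x + h) (t + \<tau>)) (\<lambda>x t. v' (x + h) (t + \<tau>))
    (\<lambda>x t. D (x + h) (t + \<tau>)) (\<lambda>j x t. H j (x + h) (t + \<tau>))"
proof -
  have c: "continuous_on (UNIV \<times> {0<..<T - \<tau>}) (\<lambda>(x, t). g (x + h) (t + \<tau>))"
    if "continuous_on (UNIV \<times> {0<..<T}) (\<lambda>(x, t). g x t)" for g :: "real^'a \<Rightarrow> real \<Rightarrow> 'b::topological_space"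
  proof -
    have "continuous_on (UNIV \<times> {0<..<T - \<tau>}) (\<lambda>p. (\<lambda>(x, t). g x t) (fst p + h, snd p + \<tau>))"
      by (rule continuous_on_compose2[OF that]) (use \<tau> in \<open>auto intro!: continuous_intros\<close>)
    then show ?thesis by (simp add: case_prod_beta)
  qed
  have d: "((\<lambda>x. g (x + h)) has_derivative g') (at x)" if "(g has_derivative g') (at (x + h))"
    for g :: "real^'a \<Rightarrow> real" and g' x
    by (rule has_derivative_compose[of "\<lambda>x. x + h" "\<lambda>y. y" x UNIV g g'])
      (use that in \<open>auto intro!: derivative_eq_intros\<close>)
  have dt: "((\<lambda>s. v y (s + \<tau>)) has_real_derivative v' y (t + \<tau>)) (at t)"
    if "((\<lambda>s. v y s) has_real_derivative v' y (t + \<tau>)) (at (t + \<tau>))" for y t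
    using that by (simp add: DERIV_shift)
  have l: "levy_int \<nu> (\<lambda>x. g (x + h)) (\<lambda>x. G (x + h)) x = levy_int \<nu> g G (x + h)" for g G x
    by (simp add: levy_int_def compensated_def algebra_simps)
  show ?thesis
    unfolding viscous_solution_def
  proof (intro conjI ballI allI)
    fix t assume "t \<in> {0<..<T - \<tau>}"
    then have t: "0 < t + \<tau>" "t + \<tau> < T" using \<tau> by auto
    note S = viscous_solutionD[OF s t]
    show "periodic_C2 (\<lambda>x. v (x + h) (t + \<tau>)) (\<lambda>x. D (x + h) (t + \<tau>)) (\<lambda>j x. H j (x + h) (t + \<tau>))"
      unfolding periodic_C2_def
    proof (intro conjI allI)
      fix j x
      show "periodic (\<lambda>x. v (x + h) (t + \<tau>))" "periodic (\<lambda>x. D (x + h) (t + \<tau>))"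
        "periodic (\<lambda>x. H j (x + h) (t + \<tau>))"
        using S(1) unfolding periodic_C2_def by (auto intro: periodic_shift)
      show "((\<lambda>x. v (x + h) (t + \<tau>)) has_derivative (\<lambda>k. k \<bullet> D (x + h) (t + \<tau>))) (at x)"
        using S(1) unfolding periodic_C2_def by (intro d[of "\<lambda>x. v x (t + \<tau>)"]) blast
      show "((\<lambda>x. D (x + h) (t + \<tau>) $ j) has_derivative (\<lambda>k. k \<bullet> H j (x + h) (t + \<tau>))) (at x)"
        using S(1) unfolding periodic_C2_def by (intro d[of "\<lambda>x. D x (t + \<tau>) $ j"]) blast
      show "continuous_on UNIV (\<lambda>x. H j (x + h) (t + \<tau>))"
        by (rule continuous_on_compose2[OF S(8)]) (auto intro!: continuous_intros)
    qed
    show "periodic (\<lambda>x. v' (x + h) (t + \<tau>))" using S(2) by (rule periodic_shift)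
    show "((\<lambda>s. v (x + h) (s + \<tau>)) has_real_derivative v' (x + h) (t + \<tau>)) (at t)" for x
      by (rule dt[OF S(4)])
    show "v' (x + h) (t + \<tau>) + (\<Sum>j\<in>UNIV. f' j (v (x + h) (t + \<tau>)) * D (x + h) (t + \<tau>) $ j)
        = levy_int \<nu> (\<lambda>x. v (x + h) (t + \<tau>)) (\<lambda>x. D (x + h) (t + \<tau>)) x + \<epsilon> * (\<Sum>j\<in>UNIV. H j (x + h) (t + \<tau>) $ j)" for x
      using S(9)[of "x + h"] l[of "\<lambda>x. v x (t + \<tau>)" "\<lambda>x. D x (t + \<tau>)" x] by simp
  next
    have H: "continuous_on (UNIV \<times> {0<..<T}) (\<lambda>(x, t). H j x t)" for j
      using s unfolding viscous_solution_def by blast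
    show "continuous_on (UNIV \<times> {0<..<T - \<tau>}) (\<lambda>(x, t). H j (x + h) (t + \<tau>))" for j
      by (rule c[OF H])
  qed (use s c in \<open>auto simp: viscous_solution_def\<close>)
qed

lemma frechet_component:
  assumes "(g has_derivative (\<lambda>h. h \<bullet> G)) (at x)"
  shows "partial j g x = G $ j"
  using frechet_derivative_at[OF assms, symmetric] by (simp add: partial_def inner_axis')

lemma differentiable_grad:
  fixes g :: "real^'n::finite \<Rightarrow> real"
  assumes "g differentiable (at x)"
  shows "(g has_derivative (\<lambda>h. h \<bullet> grad g x)) (at x)"
proof -
  have d: "(g has_derivative frechet_derivative g (at x)) (at x)"
    using assms frechet_derivative_works by blast
  interpret l: linear "frechet_derivative g (at x)"
    using d has_derivative_linear by blast
  have "frechet_derivative g (at x) h = h \<bullet> grad g x" for h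
  proof -
    have "h = (\<Sum>j\<in>UNIV. (h $ j) *\<^sub>R axis j 1)"
      using basis_expansion[of h] by (simp add: scalar_mult_eq_scaleR)
    then have "frechet_derivative g (at x) h = (\<Sum>j\<in>UNIV. (h $ j) *\<^sub>R frechet_derivative g (at x) (axis j 1))"
      by (metis (mono_tags, lifting) l.sum l.scaleR sum.cong)
    then show ?thesis by (simp add: inner_vec_def grad_def partial_def)
  qed
  then have "frechet_derivative g (at x) = (\<lambda>h. h \<bullet> grad g x)" by (rule ext)
  then show ?thesis using d by simp
qed

lemma periodic_differentiable_grad:
  assumes "periodic g" "\<And>x. (g has_derivative (\<lambda>h. h \<bullet> G x)) (at x)"
  shows "periodic (G :: real^'n::finite \<Rightarrow> real^'n)"
  unfolding periodic_def
proof (intro allI)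
  fix x j
  have "((\<lambda>y. g (y + axis j (2*pi))) has_derivative (\<lambda>h. h \<bullet> G (x + axis j (2*pi)))) (at x)"
    by (rule has_derivative_compose[of "\<lambda>x. x + axis j (2*pi)" "\<lambda>y. y" x UNIV g])
      (use assms(2) in \<open>auto intro!: derivative_eq_intros\<close>)
  moreover have "(\<lambda>y. g (y + axis j (2*pi))) = g" using assms(1) by (auto simp: periodic_def)
  ultimately have "(g has_derivative (\<lambda>h. h \<bullet> G (x + axis j (2*pi)))) (at x)" by simp
  from has_derivative_unique[OF this assms(2)]
  have "(\<lambda>h. h \<bullet> G (x + axis j (2*pi))) = (\<lambda>h. h \<bullet> G x)" .
  then show "G (x + axis j (2*pi)) = G x" by (metis inner_commute vector_eq_rdot)
qed

lemma Ck_2_periodic_C2: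
  fixes g :: "real^'n::finite \<Rightarrow> real"
  assumes c: "Ck_on 2 g UNIV" and p: "periodic g"
  shows "periodic_C2 g (grad g) (\<lambda>j. grad (partial j g))"
proof -
  have d1: "g differentiable (at x)" for x using c by (simp add: numeral_2_eq_2)
  have d2: "partial j g differentiable (at x)" for j x
    using c by (simp add: numeral_2_eq_2 axis_in_Basis_iff partial_def[abs_def])
  have c2: "continuous_on UNIV (partial i (partial j g))" for i j
    using c by (simp add: numeral_2_eq_2 axis_in_Basis_iff partial_def[abs_def])
  note h1 = differentiable_grad[OF d1] and h2 = differentiable_grad[OF d2]
  have pg: "periodic (grad g)" by (rule periodic_differentiable_grad[OF p h1])
  have pp: "periodic (partial j g)" for j
    using pg by (simp add: periodic_def grad_def vec_eq_iff)
  have ph: "periodic (grad (partial j g))" for j by (rule periodic_differentiable_grad[OF pp h2])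
  have "continuous_on UNIV (grad (partial j g))" for j
    unfolding grad_def[abs_def] by (intro continuous_on_vec_lambda c2)
  moreover have "(\<lambda>x. grad g x $ j) = partial j g" for j by (simp add: grad_def)
  ultimately show ?thesis using p pg ph h1 h2 by (auto simp: periodic_C2_def)
qed

lemma classical_imp_viscous_solution:
  assumes cl: "classical_viscous_solution f \<mu> \<epsilon> T u0 v" and \<mu>: "levy_measure \<mu>"
    and f: "\<And>j a. (f j has_real_derivative f' j a) (at a)"
  shows "viscous_solution f' (levy_ext \<mu>) \<epsilon> T v (\<lambda>x t. deriv (\<lambda>s. v x s) t)
     (\<lambda>x t. grad (\<lambda>y. v y t) x) (\<lambda>j x t. grad (partial j (\<lambda>y. v y t)) x)"
proof -
  have C2: "periodic_C2 (\<lambda>x. v x t) (grad (\<lambda>y. v y t)) (\<lambda>j. grad (partial j (\<lambda>y. v y t)))"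
    if "t \<in> {0<..<T}" for t
    using cl that unfolding classical_viscous_solution_def by (intro Ck_2_periodic_C2) auto
  have dt: "((\<lambda>s. v x s) has_real_derivative deriv (\<lambda>s. v x s) t) (at t)" if "t \<in> {0<..<T}" for x t
    using cl that unfolding classical_viscous_solution_def
    by (simp add: DERIV_deriv_iff_real_differentiable)
  have pt: "periodic (\<lambda>x. deriv (\<lambda>s. v x s) t)" if t: "t \<in> {0<..<T}" for t
    unfolding periodic_def
  proof (intro allI)
    fix x j
    have "eventually (\<lambda>s. v (x + axis j (2*pi)) s = v x s) (nhds t)"
    proof -
      have "eventually (\<lambda>s. s \<in> {0<..<T}) (nhds t)" using t by (intro eventually_nhds_in_open) auto
      then show ?thesis
        by (rule eventually_mono) (use cl in \<open>auto simp: periodic_def classical_viscous_solution_def\<close>)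
    qed
    then show "deriv (\<lambda>s. v (x + axis j (2*pi)) s) t = deriv (\<lambda>s. v x s) t"
      by (rule deriv_cong_ev) simp
  qed
  have cD: "continuous_on (UNIV \<times> {0<..<T}) (\<lambda>(x, t). grad (\<lambda>y. v y t) x)"
    using cl unfolding classical_viscous_solution_def grad_def case_prod_beta
    by (intro continuous_on_vec_lambda) (auto simp: case_prod_beta)
  have cH: "continuous_on (UNIV \<times> {0<..<T}) (\<lambda>(x, t). grad (partial j (\<lambda>y. v y t)) x)" for j
    using cl unfolding classical_viscous_solution_def grad_def case_prod_beta
    by (intro continuous_on_vec_lambda) (auto simp: case_prod_beta)
  have pde: "deriv (\<lambda>s. v x s) t + (\<Sum>j\<in>UNIV. f' j (v x t) * grad (\<lambda>y. v y t) x $ j)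
      = levy_int (levy_ext \<mu>) (\<lambda>x. v x t) (grad (\<lambda>y. v y t)) x + \<epsilon> * (\<Sum>j\<in>UNIV. grad (partial j (\<lambda>y. v y t)) x $ j)"
    if t: "t \<in> {0<..<T}" for x t
  proof -
    note c2 = C2[OF t]
    have b: "(\<lambda>x. v x t) \<in> borel_measurable borel"
      by (rule continuous_borel[OF periodic_C11_continuous(1)[OF periodic_C2_imp_C11[OF c2]]])
    have "partial j (\<lambda>y. f j (v y t)) x = f' j (v x t) * grad (\<lambda>y. v y t) x $ j" for j
      using c2 by (subst frechet_component[OF has_derivative_component_inner[OF _ f]])
        (auto simp: periodic_C2_def)
    moreover have "laplacian (\<lambda>y. v y t) x = (\<Sum>j\<in>UNIV. grad (partial j (\<lambda>y. v y t)) x $ j)"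
      by (simp add: laplacian_def grad_def)
    moreover have "deriv (\<lambda>s. v x s) t + (\<Sum>j\<in>UNIV. partial j (\<lambda>y. f j (v y t)) x)
        = levy_op \<mu> (\<lambda>y. v y t) x + \<epsilon> * laplacian (\<lambda>y. v y t) x"
      using cl t unfolding classical_viscous_solution_def by blast
    ultimately show ?thesis using levy_op_eq_levy_int[OF \<mu> b] by simp
  qed
  show ?thesis
    unfolding viscous_solution_def
    using C2 dt pt cD cH pde cl by (auto simp: classical_viscous_solution_def)
qed

section \<open>The Kato inequality and contraction in mean\<close>

lemma integrable_torus_continuous:
  fixes g :: "real^'n::finite \<Rightarrow> real"
  assumes "periodic g" "continuous_on UNIV g"
  shows "integrable torus g"
proof -
  obtain B where B: "\<And>x. norm (g x) \<le> B" using periodic_continuous_bounded[OF assms] by blast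
  then show ?thesis by (intro integrable_torus[where B=B] continuous_borel[OF assms(2)]) auto
qed

lemma periodic_mult: "periodic g \<Longrightarrow> periodic h \<Longrightarrow> periodic (\<lambda>x. g x * h x)"
  and periodic_add: "periodic g \<Longrightarrow> periodic h \<Longrightarrow> periodic (\<lambda>x. g x + h x)"
  and periodic_diff: "periodic g \<Longrightarrow> periodic h \<Longrightarrow> periodic (\<lambda>x. g x - h x)"
  and periodic_scaleR: "periodic a \<Longrightarrow> periodic G \<Longrightarrow> periodic (\<lambda>x. a x *\<^sub>R G x)"
  and periodic_nth: "periodic G \<Longrightarrow> periodic (\<lambda>x. G x $ j)"
  by (simp_all add: periodic_def)

lemma integral_torus_divergence:
  fixes p :: "real^'n::finite \<Rightarrow> real"
  assumes "periodic p" "periodic P" "continuous_on UNIV P"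
    and "\<And>x. (p has_derivative (\<lambda>h. h \<bullet> P x)) (at x)"
  shows "(LINT x|torus. P x $ j) = 0"
  using integral_torus_directional_derivative[OF assms, of "axis j 1"] by (simp add: inner_axis')

lemma periodic_C2_continuous:
  assumes "periodic_C2 g G H"
  shows "continuous_on UNIV g" "continuous_on UNIV G" "\<And>j. continuous_on UNIV (H j)"
    "periodic g" "periodic G" "\<And>j. periodic (H j)"
    "\<And>x. (g has_derivative (\<lambda>h. h \<bullet> G x)) (at x)"
    "\<And>j x. ((\<lambda>x. G x $ j) has_derivative (\<lambda>h. h \<bullet> H j x)) (at x)"
  using periodic_C11_continuous[OF periodic_C2_imp_C11[OF assms]] assms
  by (auto simp: periodic_C2_def)

lemmas torus_intros = integrable_torus_continuous continuous_intros
  periodic_mult periodic_add periodic_diff periodic_scaleR periodic_nth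

text \<open>
  Two integrations by parts. The first also produces the integral of \<open>p\<close> times the second derivative of the
  entropy times \<open>(G x $ j)\<^sup>2\<close>, which has the right sign.
\<close>
lemma viscosity_inequality:
  assumes B: "B > 0" and c: "c > 0"
    and p: "periodic_C2 p P Q" and pos: "\<And>x. p x \<ge> 0"
    and g: "periodic_C2 g G H"
  shows "(LINT x|torus. p x * sabs' B c (g x - k) * (\<Sum>j\<in>UNIV. H j x $ j))
     \<le> (LINT x|torus. sabs B c (g x - k) * (\<Sum>j\<in>UNIV. Q j x $ j))"
proof -
  note P = periodic_C2_continuous[OF p] and G = periodic_C2_continuous[OF g]
  let ?e = "\<lambda>x. sabs B c (g x - k)" and ?e1 = "\<lambda>x. sabs' B c (g x - k)" and ?e2 = "\<lambda>x. sabs'' B c (g x - k)"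
  have per: "periodic ?e" "periodic ?e1" "periodic ?e2"
    using G(4) by (auto simp: periodic_def)
  have cont: "continuous_on UNIV ?e" "continuous_on UNIV ?e1" "continuous_on UNIV ?e2"
    by (auto intro!: continuous_on_compose2[OF sabs_continuous[OF B c]] continuous_on_compose2[OF sabs'_continuous[OF B c]]
      continuous_on_compose2[OF sabs''_continuous[OF B c]] continuous_intros G)
  have de: "(?e has_derivative (\<lambda>h. h \<bullet> (?e1 x *\<^sub>R G x))) (at x)"
    and de1: "(?e1 has_derivative (\<lambda>h. h \<bullet> (?e2 x *\<^sub>R G x))) (at x)" for x
  proof -
    have "((\<lambda>x. g x - k) has_derivative (\<lambda>h. h \<bullet> G x)) (at x)"
      using has_derivative_diff[OF G(7) has_derivative_const] by simp
    from has_derivative_component_inner[OF this sabs_deriv[OF B c]] has_derivative_component_inner[OF this sabs'_deriv[OF B c]]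
    show "(?e has_derivative (\<lambda>h. h \<bullet> (?e1 x *\<^sub>R G x))) (at x)"
     "(?e1 has_derivative (\<lambda>h. h \<bullet> (?e2 x *\<^sub>R G x))) (at x)" by auto
  qed
  have key: "(LINT x|torus. p x * ?e1 x * H j x $ j) \<le> (LINT x|torus. ?e x * Q j x $ j)" for j
  proof -
    have i: "integrable torus (\<lambda>x. p x * ?e1 x * H j x $ j)" "integrable torus (\<lambda>x. ?e x * Q j x $ j)"
      "integrable torus (\<lambda>x. ?e1 x * G x $ j * P x $ j)" "integrable torus (\<lambda>x. p x * ?e2 x * (G x $ j * G x $ j))"
      by (intro torus_intros per cont P G)+
    let ?R = "\<lambda>x. (G x $ j) *\<^sub>R (?e1 x *\<^sub>R P x + p x *\<^sub>R (?e2 x *\<^sub>R G x)) + (p x * ?e1 x) *\<^sub>R H j x"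
    have "(LINT x|torus. ?R x $ j) = 0"
      by (rule integral_torus_divergence[where p="\<lambda>x. (p x * ?e1 x) * G x $ j"])
        (intro torus_intros per cont P G has_derivative_inner_mult de1)+
    also have "(\<lambda>x. ?R x $ j) = (\<lambda>x. ?e1 x * G x $ j * P x $ j + p x * ?e2 x * (G x $ j * G x $ j) + p x * ?e1 x * H j x $ j)"
      by (simp add: algebra_simps)
    finally have 1: "(LINT x|torus. ?e1 x * G x $ j * P x $ j) + (LINT x|torus. p x * ?e2 x * (G x $ j * G x $ j))
        + (LINT x|torus. p x * ?e1 x * H j x $ j) = 0"
      using i by simp
    let ?S = "\<lambda>x. (P x $ j) *\<^sub>R (?e1 x *\<^sub>R G x) + ?e x *\<^sub>R Q j x"
    have "(LINT x|torus. ?S x $ j) = 0"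
      by (rule integral_torus_divergence[where p="\<lambda>x. ?e x * P x $ j"])
        (intro torus_intros per cont P G has_derivative_inner_mult de)+
    also have "(\<lambda>x. ?S x $ j) = (\<lambda>x. ?e1 x * G x $ j * P x $ j + ?e x * Q j x $ j)"
      by (simp add: algebra_simps)
    finally have 2: "(LINT x|torus. ?e1 x * G x $ j * P x $ j) + (LINT x|torus. ?e x * Q j x $ j) = 0"
      using i by simp
    have "(LINT x|torus. p x * ?e2 x * (G x $ j * G x $ j)) \<ge> 0"
      using pos sabs''_nonneg[OF B c] by (intro Bochner_Integration.integral_nonneg) auto
    then show ?thesis using 1 2 by linarith
  qed
  have "(LINT x|torus. p x * ?e1 x * (\<Sum>j\<in>UNIV. H j x $ j)) = (\<Sum>j\<in>UNIV. LINT x|torus. p x * ?e1 x * H j x $ j)"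
    unfolding sum_distrib_left
    by (rule Bochner_Integration.integral_sum) (intro torus_intros per cont P G)
  also have "\<dots> \<le> (\<Sum>j\<in>UNIV. LINT x|torus. ?e x * Q j x $ j)"
    by (intro sum_mono key)
  also have "\<dots> = (LINT x|torus. ?e x * (\<Sum>j\<in>UNIV. Q j x $ j))"
    unfolding sum_distrib_left
    by (rule Bochner_Integration.integral_sum[symmetric]) (intro torus_intros per cont P G)
  finally show ?thesis .
qed

lemma periodic_C2_const: "periodic_C2 (\<lambda>_. k) (\<lambda>_. 0) (\<lambda>_ _. 0)"
  by (auto simp: periodic_C2_def periodic_def)

lemma periodic_C2_diff:
  assumes g: "periodic_C2 g G H" and k: "periodic_C2 k K L"
  shows "periodic_C2 (\<lambda>x. g x - k x) (\<lambda>x. G x - K x) (\<lambda>j x. H j x - L j x)"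
proof -
  note G = periodic_C2_continuous[OF g] and K = periodic_C2_continuous[OF k]
  have "((\<lambda>x. g x - k x) has_derivative (\<lambda>h. h \<bullet> (G x - K x))) (at x)"
    "((\<lambda>x. (G x - K x) $ j) has_derivative (\<lambda>h. h \<bullet> (H j x - L j x))) (at x)" for j x
    using has_derivative_diff[OF G(7) K(7)] has_derivative_diff[OF G(8) K(8)] by (simp_all add: inner_diff_right)
  then show ?thesis using G K unfolding periodic_C2_def by (auto intro!: periodic_diff continuous_intros)
qed

lemma sabs_compose_C11:
  assumes B: "B > 0" and c: "c > 0" and g: "periodic_C11 g G"
  shows "periodic_C11 (\<lambda>x. sabs B c (g x)) (\<lambda>x. sabs' B c (g x) *\<^sub>R G x)"
  by (rule periodic_C11_compose[OF g sabs_deriv[OF B c] sabs'_lipschitz[OF B c]])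

locale viscous_setting =
  fixes f f' :: "'n::finite \<Rightarrow> real \<Rightarrow> real" and \<nu> :: "(real^'n) measure"
  assumes levy: "levy_kernel \<nu>"
    and f_deriv: "\<And>j a. (f j has_real_derivative f' j a) (at a)"
    and f'_cont: "\<And>j. continuous_on UNIV (f' j)"
begin

lemma f_cont: "continuous_on UNIV (f j)"
  using f_deriv by (meson DERIV_isCont continuous_at_imp_continuous_on)

lemma flux_lipschitz_const:
  obtains L where "L > 0" "\<And>j s. \<bar>s\<bar> \<le> M \<Longrightarrow> \<bar>f' j s\<bar> \<le> L"
proof -
  have "\<exists>L. L > 0 \<and> (\<forall>s. \<bar>s\<bar> \<le> M \<longrightarrow> \<bar>f' j s\<bar> \<le> L)" for j
  proof -
    have "compact (f' j ` {-M..M})"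
      by (intro compact_continuous_image continuous_on_subset[OF f'_cont]) auto
    then obtain L where "L > 0" "\<forall>y\<in>f' j ` {-M..M}. norm y \<le> L" by (meson bounded_pos compact_imp_bounded)
    then show ?thesis by (intro exI[of _ L]) (auto simp: abs_le_iff)
  qed
  then obtain L where L: "\<And>j. L j > 0" "\<And>j s. \<bar>s\<bar> \<le> M \<Longrightarrow> \<bar>f' j s\<bar> \<le> L j" by metis
  have "\<bar>f' j s\<bar> \<le> (\<Sum>i\<in>UNIV. L i)" if "\<bar>s\<bar> \<le> M" for j s
    using L(2)[OF that, of j] member_le_sum[of j UNIV L] L(1) by (auto simp: less_imp_le intro: order_trans)
  moreover have "(\<Sum>i\<in>UNIV. L i) > 0" using L(1) by (intro sum_pos) auto
  ultimately show ?thesis using that by blast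
qed

lemma flux_lipschitz:
  assumes L: "\<And>j s. \<bar>s\<bar> \<le> M \<Longrightarrow> \<bar>f' j s\<bar> \<le> L" and ab: "\<bar>a\<bar> \<le> M" "\<bar>b\<bar> \<le> M"
  shows "\<bar>f j a - f j b\<bar> \<le> L * \<bar>a - b\<bar>"
proof -
  have "norm (f j a - f j b) \<le> L * norm (a - b)"
    by (rule field_differentiable_bound[where S="{-M..M}" and f'="f' j"])
      (use L ab f_deriv in \<open>auto simp: abs_le_iff intro: has_field_derivative_at_within\<close>)
  then show ?thesis by simp
qed

definition torus_vol :: real where "torus_vol = measure (torus :: (real^'n) measure) UNIV"

lemma torus_vol_nonneg: "torus_vol \<ge> 0" by (simp add: torus_vol_def)

lemma integral_le_torus_vol:
  assumes "integrable torus g" "\<And>x::real^'n. g x \<le> C"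
  shows "(LINT x|torus. g x) \<le> C * torus_vol"
proof -
  have "(LINT x|torus. g x) \<le> (LINT x|(torus::(real^'n) measure). C)"
    using assms torus.integrable_const by (intro integral_mono) auto
  then show ?thesis by (simp add: torus_vol_def mult.commute)
qed

text \<open>
  By convexity the nonlocal part contributes at most the integral of a nonlocal operator, which is zero. In
  the flux part the derivative moves onto \<open>sabs'\<close>; the factor \<open>\<bar>f u - f v\<bar> \<le> L \<bar>u - v\<bar>\<close> meets the second
  derivative of the approximation, and the product is of order \<open>c\<close>.
\<close>
lemma kato_inequality:
  assumes B: "B > 0" and c: "c > 0"
    and u: "viscous_solution f' \<nu> \<epsilon> T u u' Du Hu" and v: "viscous_solution f' \<nu> \<delta> T v v' Dv Hv"
    and t: "0 < t" "t < T"
    and M: "\<And>x. \<bar>u x t\<bar> \<le> M" "\<And>x. \<bar>v x t\<bar> \<le> M"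
    and K: "\<And>x. norm (Du x t) \<le> K" "\<And>x. norm (Dv x t) \<le> K"
    and L: "\<And>j s. \<bar>s\<bar> \<le> M \<Longrightarrow> \<bar>f' j s\<bar> \<le> L"
  shows "(LINT x|torus. sabs' B c (u x t - v x t) * (u' x t - v' x t))
    \<le> c * (real CARD('n) * (L * (2 * K)) * torus_vol)
      + (LINT x|torus. sabs' B c (u x t - v x t) * (\<epsilon> * (\<Sum>j\<in>UNIV. Hu j x t $ j) - \<delta> * (\<Sum>j\<in>UNIV. Hv j x t $ j)))"
proof -
  note U = viscous_solutionD[OF u t] and V = viscous_solutionD[OF v t]
  note U2 = periodic_C2_continuous[OF U(1)] and V2 = periodic_C2_continuous[OF V(1)]
  let ?w = "\<lambda>x. u x t - v x t" and ?W = "\<lambda>x. Du x t - Dv x t"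
  have w2: "periodic_C2 ?w ?W (\<lambda>j x. Hu j x t - Hv j x t)" by (rule periodic_C2_diff[OF U(1) V(1)])
  note w11 = periodic_C2_imp_C11[OF w2] and W = periodic_C2_continuous[OF w2]
  let ?e1 = "\<lambda>x. sabs' B c (?w x)" and ?e2 = "\<lambda>x. sabs'' B c (?w x)"
  have per: "periodic ?e1" "periodic ?e2" using W(4) by (auto simp: periodic_def)
  have cont: "continuous_on UNIV ?e1" "continuous_on UNIV ?e2"
    by (auto intro!: continuous_on_compose2[OF sabs'_continuous[OF B c]]
      continuous_on_compose2[OF sabs''_continuous[OF B c]] continuous_intros W(1))
  have pf: "periodic (\<lambda>x. f j (u x t))" "periodic (\<lambda>x. f j (v x t))" "periodic (\<lambda>x. f' j (u x t))" "periodic (\<lambda>x. f' j (v x t))" for j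
    using U2(4) V2(4) by (auto simp: periodic_def)
  have cf: "continuous_on UNIV (\<lambda>x. f j (u x t))" "continuous_on UNIV (\<lambda>x. f j (v x t))"
      "continuous_on UNIV (\<lambda>x. f' j (u x t))" "continuous_on UNIV (\<lambda>x. f' j (v x t))" for j
    by (auto intro!: continuous_on_compose2[OF f_cont] continuous_on_compose2[OF f'_cont] U2 V2)
  have de1: "(?e1 has_derivative (\<lambda>h. h \<bullet> (?e2 x *\<^sub>R ?W x))) (at x)" for x
    by (rule has_derivative_component_inner[OF W(7) sabs'_deriv[OF B c]])
  let ?F = "\<lambda>j x. f j (u x t) - f j (v x t)"
  let ?dF = "\<lambda>j x. f' j (u x t) *\<^sub>R Du x t - f' j (v x t) *\<^sub>R Dv x t"
  have dF: "(?F j has_derivative (\<lambda>h. h \<bullet> ?dF j x)) (at x)" for j x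
    using has_derivative_diff[OF has_derivative_component_inner[OF U2(7) f_deriv] has_derivative_component_inner[OF V2(7) f_deriv]]
    by (simp add: inner_diff_right)
  have flux: "- (LINT x|torus. ?e1 x * ?dF j x $ j) \<le> c * (L * (2 * K)) * torus_vol" for j
  proof -
    have i: "integrable torus (\<lambda>x. ?e1 x * ?dF j x $ j)" "integrable torus (\<lambda>x. ?F j x * (?e2 x * ?W x $ j))"
      by (intro torus_intros per cont U2 V2 pf cf)+
    let ?R = "\<lambda>x. ?F j x *\<^sub>R (?e2 x *\<^sub>R ?W x) + ?e1 x *\<^sub>R ?dF j x"
    have "(LINT x|torus. ?R x $ j) = 0"
      by (rule integral_torus_divergence[where p="\<lambda>x. ?e1 x * ?F j x"])
        (intro torus_intros per cont U2 V2 pf cf has_derivative_inner_mult de1 dF)+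
    also have "(\<lambda>x. ?R x $ j) = (\<lambda>x. ?F j x * (?e2 x * ?W x $ j) + ?e1 x * ?dF j x $ j)"
      by (simp add: mult.assoc)
    finally have "- (LINT x|torus. ?e1 x * ?dF j x $ j) = (LINT x|torus. ?F j x * (?e2 x * ?W x $ j))"
      using i by simp
    also have "\<dots> \<le> (c * (L * (2 * K))) * torus_vol"
    proof (rule integral_le_torus_vol[OF i(2)])
      fix x
      have L0: "L \<ge> 0" using L[of 0 undefined] M(1)[of x] abs_ge_zero[of "f' undefined 0"] abs_ge_zero[of "u x t"] by force
      have "\<bar>?W x $ j\<bar> \<le> norm (?W x)" by (rule component_le_norm_cart)
      also have "\<dots> \<le> 2 * K" using norm_triangle_ineq4[of "Du x t" "Dv x t"] K[of x] by linarith
      finally have 1: "\<bar>?W x $ j\<bar> \<le> 2 * K" .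
      have 2: "\<bar>?F j x\<bar> \<le> L * \<bar>?w x\<bar>" by (rule flux_lipschitz[OF L M])
      have 3: "\<bar>?F j x\<bar> * ?e2 x \<le> L * c"
      proof -
        have "\<bar>?F j x\<bar> * ?e2 x \<le> (L * \<bar>?w x\<bar>) * ?e2 x"
          using 2 sabs''_nonneg[OF B c] by (intro mult_right_mono) auto
        also have "\<dots> = L * (\<bar>?w x\<bar> * ?e2 x)" by simp
        also have "\<dots> \<le> L * c" using sabs''_weighted[OF B c] L0 by (intro mult_left_mono) auto
        finally show ?thesis .
      qed
      have "?F j x * (?e2 x * ?W x $ j) \<le> \<bar>?F j x * (?e2 x * ?W x $ j)\<bar>" by simp
      also have "\<dots> = (\<bar>?F j x\<bar> * ?e2 x) * \<bar>?W x $ j\<bar>"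
        using sabs''_nonneg[OF B c, of "?w x"] by (simp add: abs_mult mult.assoc)
      also have "\<dots> \<le> (L * c) * (2 * K)"
        using sabs''_nonneg[OF B c, of "?w x"] L0 c by (intro mult_mono[OF 3 1]) auto
      finally show "?F j x * (?e2 x * ?W x $ j) \<le> c * (L * (2 * K))" by (simp add: mult_ac)
    qed
    finally show ?thesis .
  qed
  note lm = levy_int_measurable_bounded[OF levy w11]
  have ilop: "integrable torus (\<lambda>x. ?e1 x * levy_int \<nu> ?w ?W x)"
  proof -
    obtain B1 where B1: "\<And>x. norm (?e1 x) \<le> B1" "B1 > 0"
      using periodic_continuous_bounded[OF per(1) cont(1)] by blast
    obtain B2 where B2: "\<And>x. \<bar>levy_int \<nu> ?w ?W x\<bar> \<le> B2" using lm(2) by blast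
    show ?thesis
      using B1 B2 order_trans[OF abs_ge_zero B2] lm(1) continuous_borel[OF cont(1)]
      by (intro integrable_torus[where B="B1 * B2"]) (auto simp: abs_mult intro!: mult_mono)
  qed
  have nonlocal: "(LINT x|torus. ?e1 x * levy_int \<nu> ?w ?W x) \<le> 0"
  proof -
    note c11 = sabs_compose_C11[OF B c w11]
    obtain B2 where B2: "\<And>x. \<bar>levy_int \<nu> (\<lambda>x. sabs B c (?w x)) (\<lambda>x. ?e1 x *\<^sub>R ?W x) x\<bar> \<le> B2"
      using levy_int_measurable_bounded(2)[OF levy c11] by blast
    have "(LINT x|torus. ?e1 x * levy_int \<nu> ?w ?W x) \<le> (LINT x|torus. levy_int \<nu> (\<lambda>x. sabs B c (?w x)) (\<lambda>x. ?e1 x *\<^sub>R ?W x) x)"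
    proof (rule integral_mono[OF ilop])
      show "integrable torus (levy_int \<nu> (\<lambda>x. sabs B c (?w x)) (\<lambda>x. ?e1 x *\<^sub>R ?W x))"
        by (rule integrable_torus[OF levy_int_measurable_bounded(1)[OF levy c11] B2])
      show "?e1 x * levy_int \<nu> ?w ?W x \<le> levy_int \<nu> (\<lambda>x. sabs B c (?w x)) (\<lambda>x. ?e1 x *\<^sub>R ?W x) x" for x
        by (rule levy_int_convex[where w="?w" and \<eta>="sabs B c" and \<eta>'="sabs' B c", OF levy w11 c11 sabs_convex[OF B c]])
    qed
    then show ?thesis using integral_levy_int_zero[OF levy c11] by simp
  qed
  have lopd: "levy_int \<nu> ?w ?W x = levy_int \<nu> (\<lambda>x. u x t) (\<lambda>x. Du x t) x - levy_int \<nu> (\<lambda>x. v x t) (\<lambda>x. Dv x t) x" for x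
    by (rule levy_int_diff[OF levy U(3) V(3)])
  let ?S = "\<lambda>x. \<epsilon> * (\<Sum>j\<in>UNIV. Hu j x t $ j) - \<delta> * (\<Sum>j\<in>UNIV. Hv j x t $ j)"
  have iF: "integrable torus (\<lambda>x. - (?e1 x * ?dF j x $ j))" for j
    by (intro torus_intros integrable_minus per cont U2 V2 pf cf)
  have ph: "periodic (\<lambda>x. \<Sum>j\<in>UNIV. Hu j x t $ j)" "periodic (\<lambda>x. \<Sum>j\<in>UNIV. Hv j x t $ j)"
    using U2(6) V2(6) by (auto simp: periodic_def)
  have iS: "integrable torus (\<lambda>x. ?e1 x * ?S x)"
    by (intro integrable_torus_continuous periodic_mult per periodic_diff periodic_compose[of _ "\<lambda>y. _ * y"] ph
        continuous_intros cont U2 V2)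
  have sums: "(\<Sum>j\<in>UNIV. - (?e1 x * ?dF j x $ j))
      = ?e1 x * (- (\<Sum>j\<in>UNIV. f' j (u x t) * Du x t $ j) + (\<Sum>j\<in>UNIV. f' j (v x t) * Dv x t $ j))" for x
    by (simp add: sum_negf sum_distrib_left right_diff_distrib sum_subtractf distrib_left)
  have "?e1 x * (u' x t - v' x t) = (\<Sum>j\<in>UNIV. - (?e1 x * ?dF j x $ j)) + ?e1 x * levy_int \<nu> ?w ?W x + ?e1 x * ?S x" for x
    unfolding U(9) V(9) lopd sums by (simp add: algebra_simps)
  then have "(LINT x|torus. ?e1 x * (u' x t - v' x t))
    = (LINT x|torus. (\<Sum>j\<in>UNIV. - (?e1 x * ?dF j x $ j)) + ?e1 x * levy_int \<nu> ?w ?W x + ?e1 x * ?S x)"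
    by simp
  also have "\<dots> = (\<Sum>j\<in>UNIV. - (LINT x|torus. ?e1 x * ?dF j x $ j)) + (LINT x|torus. ?e1 x * levy_int \<nu> ?w ?W x) + (LINT x|torus. ?e1 x * ?S x)"
    using iF ilop iS
    by (subst Bochner_Integration.integral_add | subst Bochner_Integration.integral_sum
        | intro Bochner_Integration.integrable_add Bochner_Integration.integrable_sum | simp)+
  also have "\<dots> \<le> (\<Sum>j\<in>(UNIV::'n set). c * (L * (2 * K)) * torus_vol) + 0 + (LINT x|torus. ?e1 x * ?S x)"
    by (intro add_mono sum_mono flux nonlocal order_refl)
  finally show ?thesis by (simp add: mult_ac)
qed

lemma limit_parameter_le:
  fixes X Y Z :: real
  assumes "\<And>c. 0 < c \<Longrightarrow> c < 1 \<Longrightarrow> X \<le> Y + c * Z"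
  shows "X \<le> Y"
proof (rule tendsto_lowerbound[of "\<lambda>c. Y + c * Z"])
  show "((\<lambda>c. Y + c * Z) \<longlongrightarrow> Y) (at_right 0)" by (auto intro!: tendsto_eq_intros)
  show "\<forall>\<^sub>F c in at_right 0. X \<le> Y + c * Z"
    unfolding eventually_at_right_field using assms zero_less_one by blast
qed simp

lemma sabs_distance_derivative:
  assumes B: "B > 0" and c: "c > 0"
    and u: "viscous_solution f' \<nu> \<epsilon> T u u' Du Hu" and v: "viscous_solution f' \<nu> \<delta> T v v' Dv Hv"
    and ab: "0 < a" "b < T" and \<tau>: "a < \<tau>" "\<tau> < b"
    and w: "\<And>x \<tau>. a \<le> \<tau> \<Longrightarrow> \<tau> \<le> b \<Longrightarrow> \<bar>u x \<tau> - v x \<tau>\<bar> \<le> B"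
    and w': "\<And>x \<tau>. a \<le> \<tau> \<Longrightarrow> \<tau> \<le> b \<Longrightarrow> \<bar>u' x \<tau> - v' x \<tau>\<bar> \<le> K"
  shows "((\<lambda>\<tau>. LINT x|torus. sabs B c (u x \<tau> - v x \<tau>)) has_real_derivative
      (LINT x|torus. sabs' B c (u x \<tau> - v x \<tau>) * (u' x \<tau> - v' x \<tau>))) (at \<tau>)"
    and "\<bar>LINT x|torus. sabs' B c (u x \<tau> - v x \<tau>) * (u' x \<tau> - v' x \<tau>)\<bar> \<le> K * torus_vol"
    and "integrable torus (\<lambda>x. sabs B c (u x \<tau> - v x \<tau>))"
    and "integrable torus (\<lambda>x. \<bar>u x \<tau> - v x \<tau>\<bar>)"
proof -
  have cw: "continuous_on UNIV (\<lambda>x. u x \<tau> - v x \<tau>)" "periodic (\<lambda>x. u x \<tau> - v x \<tau>)"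
    if \<tau>: "a < \<tau>" "\<tau> < b" for \<tau>
    using viscous_solutionD(5,10)[OF u, of \<tau>] viscous_solutionD(5,10)[OF v, of \<tau>] \<tau> ab
    by (auto intro!: continuous_intros periodic_diff)
  have cw': "continuous_on UNIV (\<lambda>x. u' x \<tau> - v' x \<tau>)"
    if \<tau>: "a < \<tau>" "\<tau> < b" for \<tau>
    using viscous_solutionD(6)[OF u, of \<tau>] viscous_solutionD(6)[OF v, of \<tau>] \<tau> ab
    by (auto intro!: continuous_intros)
  have iE: "integrable torus (\<lambda>x. sabs B c (u x \<tau> - v x \<tau>))" "integrable torus (\<lambda>x. \<bar>u x \<tau> - v x \<tau>\<bar>)"
    if \<tau>: "a < \<tau>" "\<tau> < b" for \<tau>
    by (auto intro!: integrable_torus_continuous continuous_on_compose2[OF sabs_continuous[OF B c]]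
        cw[OF that] periodic_compose[OF cw(2)[OF that], of "\<lambda>y. sabs B c y"] periodic_compose[OF cw(2)[OF that], of abs] continuous_intros)
  show "integrable torus (\<lambda>x. sabs B c (u x \<tau> - v x \<tau>))" "integrable torus (\<lambda>x. \<bar>u x \<tau> - v x \<tau>\<bar>)"
    using iE[OF \<tau>] by auto
  have meas: "(\<lambda>x. sabs' B c (u x \<tau> - v x \<tau>) * (u' x \<tau> - v' x \<tau>)) \<in> borel_measurable borel"
    by (intro continuous_borel continuous_intros
        continuous_on_compose2[OF sabs'_continuous[OF B c]] cw(1)[OF \<tau>] cw'[OF \<tau>]) auto
  have bd: "\<bar>sabs' B c (u x \<sigma> - v x \<sigma>) * (u' x \<sigma> - v' x \<sigma>)\<bar> \<le> K" if \<sigma>: "a < \<sigma>" "\<sigma> < b" for x \<sigma>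
  proof -
    have "\<bar>sabs' B c (u x \<sigma> - v x \<sigma>)\<bar> \<le> 1" using w[of \<sigma> x] \<sigma> by (intro sabs'_le_1[OF B c]) auto
    moreover have "\<bar>u' x \<sigma> - v' x \<sigma>\<bar> \<le> K" using w'[of \<sigma> x] \<sigma> by simp
    ultimately show ?thesis
      using mult_mono[of "\<bar>sabs' B c (u x \<sigma> - v x \<sigma>)\<bar>" 1 "\<bar>u' x \<sigma> - v' x \<sigma>\<bar>" K] by (simp add: abs_mult)
  qed
  show "((\<lambda>\<tau>. LINT x|torus. sabs B c (u x \<tau> - v x \<tau>)) has_real_derivative
      (LINT x|torus. sabs' B c (u x \<tau> - v x \<tau>) * (u' x \<tau> - v' x \<tau>))) (at \<tau>)"
  proof (rule torus.has_derivative_integral[OF \<tau>, where K=K])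
    show "integrable torus (\<lambda>x. sabs B c (u x s - v x s))" if "a < s" "s < b" for s by (rule iE(1)[OF that])
    show "(\<lambda>x. sabs' B c (u x \<tau> - v x \<tau>) * (u' x \<tau> - v' x \<tau>)) \<in> borel_measurable torus"
      using meas by (simp cong: measurable_cong_sets)
    fix \<sigma> x assume \<sigma>: "a < \<sigma>" "\<sigma> < b"
    then have \<sigma>': "0 < \<sigma>" "\<sigma> < T" using ab by auto
    show "((\<lambda>\<tau>. sabs B c (u x \<tau> - v x \<tau>)) has_real_derivative sabs' B c (u x \<sigma> - v x \<sigma>) * (u' x \<sigma> - v' x \<sigma>)) (at \<sigma>)"
      by (rule DERIV_chain2[OF sabs_deriv[OF B c]])
        (intro DERIV_diff viscous_solutionD(4)[OF u \<sigma>'] viscous_solutionD(4)[OF v \<sigma>'])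
    show "\<bar>sabs' B c (u x \<sigma> - v x \<sigma>) * (u' x \<sigma> - v' x \<sigma>)\<bar> \<le> K" by (rule bd[OF \<sigma>])
  qed
  have i: "integrable torus (\<lambda>x. sabs' B c (u x \<tau> - v x \<tau>) * (u' x \<tau> - v' x \<tau>))"
    by (rule integrable_torus[OF meas bd[OF \<tau>]])
  have "\<bar>LINT x|torus. sabs' B c (u x \<tau> - v x \<tau>) * (u' x \<tau> - v' x \<tau>)\<bar>
      \<le> (LINT x|torus. \<bar>sabs' B c (u x \<tau> - v x \<tau>) * (u' x \<tau> - v' x \<tau>)\<bar>)"
    by (rule integral_abs_bound)
  also have "\<dots> \<le> K * torus_vol"
    using i bd[OF \<tau>] by (intro integral_le_torus_vol) auto
  finally show "\<bar>LINT x|torus. sabs' B c (u x \<tau> - v x \<tau>) * (u' x \<tau> - v' x \<tau>)\<bar> \<le> K * torus_vol" .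
qed

lemma sabs_abs_integral:
  assumes B: "B > 0" and c: "c > 0" "c < 1" and i: "integrable torus (\<lambda>x. sabs B c (g x))" "integrable torus (\<lambda>x. \<bar>g x\<bar>)"
    and g: "\<And>x::real^'n. \<bar>g x\<bar> \<le> B"
  shows "(LINT x|torus. \<bar>g x\<bar>) \<le> (LINT x|torus. sabs B c (g x)) + c * (3 * B) * torus_vol"
    and "(LINT x|torus. sabs B c (g x)) \<le> (LINT x|torus. \<bar>g x\<bar>) + c * (3 * B) * torus_vol"
proof -
  have b: "\<bar>sabs B c (g x) - \<bar>g x\<bar>\<bar> \<le> c * (3 * B)" for x
  proof -
    have "\<bar>sabs B c (g x) - \<bar>g x\<bar>\<bar> \<le> c * (B * (2 + c))" by (intro sabs_abs[OF B c(1)] g)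
    also have "\<dots> \<le> c * (B * 3)" using c B by (intro mult_left_mono) auto
    finally show ?thesis by (simp add: mult.commute)
  qed
  have "(LINT x|torus. \<bar>g x\<bar> - sabs B c (g x)) \<le> (c * (3 * B)) * torus_vol"
    using i b by (intro integral_le_torus_vol) (auto simp: abs_le_iff)
  then show "(LINT x|torus. \<bar>g x\<bar>) \<le> (LINT x|torus. sabs B c (g x)) + c * (3 * B) * torus_vol" using i by simp
  have "(LINT x|torus. sabs B c (g x) - \<bar>g x\<bar>) \<le> (c * (3 * B)) * torus_vol"
    using i b by (intro integral_le_torus_vol) (auto simp: abs_le_iff)
  then show "(LINT x|torus. sabs B c (g x)) \<le> (LINT x|torus. \<bar>g x\<bar>) + c * (3 * B) * torus_vol" using i by simp
qed

text \<open>
  For equal viscosities the diffusion terms combine to the Laplacian of \<open>u - v\<close>, and the viscosity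
  inequality with weight one bounds them by zero. The smoothed distance thus grows at most at a rate of
  order \<open>c\<close>, and \<open>c\<close> is arbitrary.
\<close>
lemma L1_contraction:
  assumes u: "viscous_solution f' \<nu> \<epsilon> T u u' Du Hu" and v: "viscous_solution f' \<nu> \<epsilon> T v v' Dv Hv"
    and \<epsilon>: "\<epsilon> \<ge> 0" and st: "0 < s" "s \<le> t" "t < T"
  shows "(LINT x|torus. \<bar>u x t - v x t\<bar>) \<le> (LINT x|torus. \<bar>u x s - v x s\<bar>)"
proof -
  define a b where "a = s / 2" and "b = (t + T) / 2"
  have ab: "0 < a" "a < s" "t < b" "b < T" using st by (auto simp: a_def b_def)
  obtain K1 where K1: "K1 > 0" "\<And>x \<tau>. a \<le> \<tau> \<Longrightarrow> \<tau> \<le> b \<Longrightarrow> \<bar>u x \<tau>\<bar> \<le> K1" "\<And>x \<tau>. a \<le> \<tau> \<Longrightarrow> \<tau> \<le> b \<Longrightarrow> \<bar>u' x \<tau>\<bar> \<le> K1"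
    "\<And>x \<tau>. a \<le> \<tau> \<Longrightarrow> \<tau> \<le> b \<Longrightarrow> norm (Du x \<tau>) \<le> K1"
    using viscous_solution_bounds[OF u ab(1,4)] by metis
  obtain K2 where K2: "K2 > 0" "\<And>x \<tau>. a \<le> \<tau> \<Longrightarrow> \<tau> \<le> b \<Longrightarrow> \<bar>v x \<tau>\<bar> \<le> K2" "\<And>x \<tau>. a \<le> \<tau> \<Longrightarrow> \<tau> \<le> b \<Longrightarrow> \<bar>v' x \<tau>\<bar> \<le> K2"
    "\<And>x \<tau>. a \<le> \<tau> \<Longrightarrow> \<tau> \<le> b \<Longrightarrow> norm (Dv x \<tau>) \<le> K2"
    using viscous_solution_bounds[OF v ab(1,4)] by metis
  let ?K = "K1 + K2"
  obtain L where L: "L > 0" "\<And>j s. \<bar>s\<bar> \<le> ?K \<Longrightarrow> \<bar>f' j s\<bar> \<le> L" using flux_lipschitz_const by blast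
  let ?C = "real CARD('n) * (L * (2 * ?K)) * torus_vol"
  have B: "?K > 0" using K1 K2 by simp
  have w: "\<bar>u x \<tau> - v x \<tau>\<bar> \<le> ?K" if "a \<le> \<tau>" "\<tau> \<le> b" for x \<tau>
    using K1(2)[OF that, of x] K2(2)[OF that, of x] by linarith
  have main: "(LINT x|torus. \<bar>u x t - v x t\<bar>) \<le> (LINT x|torus. \<bar>u x s - v x s\<bar>) + c * ((t - s) * ?C + 6 * ?K * torus_vol)"
    if c: "0 < c" "c < 1" for c
  proof -
    let ?E = "\<lambda>\<tau>. LINT x|torus. sabs ?K c (u x \<tau> - v x \<tau>)"
    let ?E' = "\<lambda>\<tau>. LINT x|torus. sabs' ?K c (u x \<tau> - v x \<tau>) * (u' x \<tau> - v' x \<tau>)"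
    have w': "\<bar>u' x \<tau> - v' x \<tau>\<bar> \<le> ?K" if "a \<le> \<tau>" "\<tau> \<le> b" for x \<tau>
      using K1(3)[OF that, of x] K2(3)[OF that, of x] by linarith
    note SD = sabs_distance_derivative[OF B c(1) u v ab(1,4) _ _ w w']
    note iE = SD(3,4) and dE = SD(1)
    have E'le: "?E' \<tau> \<le> c * ?C" if \<tau>: "a < \<tau>" "\<tau> < b" for \<tau>
    proof -
      have \<tau>': "0 < \<tau>" "\<tau> < T" using \<tau> ab by auto
      have "?E' \<tau> \<le> c * ?C + (LINT x|torus. sabs' ?K c (u x \<tau> - v x \<tau>) * (\<epsilon> * (\<Sum>j\<in>UNIV. Hu j x \<tau> $ j) - \<epsilon> * (\<Sum>j\<in>UNIV. Hv j x \<tau> $ j)))"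
      proof (rule kato_inequality[OF B c(1) u v \<tau>' _ _ _ _ L(2)])
        fix x show "\<bar>u x \<tau>\<bar> \<le> ?K" "\<bar>v x \<tau>\<bar> \<le> ?K" "norm (Du x \<tau>) \<le> ?K" "norm (Dv x \<tau>) \<le> ?K"
          using K1(1,2,4) K2(1,2,4) \<tau> by (auto intro: add_increasing add_increasing2 less_imp_le)
      qed
      also have "(LINT x|torus. sabs' ?K c (u x \<tau> - v x \<tau>) * (\<epsilon> * (\<Sum>j\<in>UNIV. Hu j x \<tau> $ j) - \<epsilon> * (\<Sum>j\<in>UNIV. Hv j x \<tau> $ j)))
        = \<epsilon> * (LINT x|torus. 1 * sabs' ?K c ((u x \<tau> - v x \<tau>) - 0) * (\<Sum>j\<in>UNIV. (Hu j x \<tau> - Hv j x \<tau>) $ j))"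
        unfolding Bochner_Integration.integral_mult_right_zero[symmetric]
        by (simp add: sum_subtractf algebra_simps)
      also have "\<dots> \<le> \<epsilon> * 0"
      proof (rule mult_left_mono[OF _ \<epsilon>])
        show "(LINT x|torus. 1 * sabs' ?K c ((u x \<tau> - v x \<tau>) - 0) * (\<Sum>j\<in>UNIV. (Hu j x \<tau> - Hv j x \<tau>) $ j)) \<le> 0"
          using viscosity_inequality[OF B c(1) periodic_C2_const[of 1] _ periodic_C2_diff[OF viscous_solutionD(1)[OF u \<tau>'] viscous_solutionD(1)[OF v \<tau>']], of 0]
          by simp
      qed
      finally show ?thesis by simp
    qed
    have "?E t - ?E s \<le> (t - s) * (c * ?C)"
    proof (cases "s = t")
      case False
      then have "s < t" using st by simp
      then obtain z where z: "s < z" "z < t" "?E t - ?E s = (t - s) * ?E' z"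
        using MVT2[of s t ?E ?E'] dE ab by (smt (verit))
      then show ?thesis using E'le[of z] ab st by (auto intro!: mult_left_mono)
    qed simp
    moreover have "(LINT x|torus. \<bar>u x t - v x t\<bar>) \<le> ?E t + c * (3 * ?K) * torus_vol"
      using ab st by (intro sabs_abs_integral(1)[OF B c] iE w) auto
    moreover have "?E s \<le> (LINT x|torus. \<bar>u x s - v x s\<bar>) + c * (3 * ?K) * torus_vol"
      using ab st by (intro sabs_abs_integral(2)[OF B c] iE w) auto
    ultimately have "(LINT x|torus. \<bar>u x t - v x t\<bar>) \<le> (LINT x|torus. \<bar>u x s - v x s\<bar>) + (t - s) * (c * ?C) + 2 * (c * (3 * ?K) * torus_vol)"
      by linarith
    also have "\<dots> = (LINT x|torus. \<bar>u x s - v x s\<bar>) + c * ((t - s) * ?C + 6 * ?K * torus_vol)"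
      by (simp add: algebra_simps)
    finally show ?thesis .
  qed
  then show ?thesis by (rule limit_parameter_le)
qed

end

section \<open>Comparison of solutions with different viscosities\<close>

text \<open>
  Translating a point where \<open>g\<close> does not vanish to the centre of the cell gives a nonempty open subset of
  the cell, hence a set of positive measure.
\<close>
lemma continuous_AE_torus:
  fixes g :: "real^'n::finite \<Rightarrow> real"
  assumes p: "periodic g" and c: "continuous_on UNIV g" and ae: "AE x in torus. g x = 0"
  shows "g x = 0"
proof (rule ccontr)
  assume gx: "g x \<noteq> 0"
  note [measurable] = continuous_borel[OF c]
  let ?c = "(\<chi> j. pi) :: real^'n"
  have "{y. g y \<noteq> 0} \<in> sets borel" by measurable
  have "(\<integral>\<^sup>+y. indicator {y. g y \<noteq> 0} (y + (x - ?c)) \<partial>torus) = (\<integral>\<^sup>+y. indicator {y. g y \<noteq> 0} y \<partial>torus)"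
    using p by (intro nn_integral_torus_shift) (auto simp: periodic_def indicator_def)
  also have "\<dots> = 0"
    using ae by (subst nn_integral_0_iff_AE) (auto simp: indicator_def elim!: eventually_mono)
  finally have "AE y in torus. g (y + (x - ?c)) = 0"
    by (subst (asm) nn_integral_0_iff_AE) (auto simp: indicator_def elim!: eventually_mono split: if_splits)
  then have "AE y in lborel. y \<in> torus_cell \<longrightarrow> g (y + (x - ?c)) = 0"
    unfolding torus_def by (subst (asm) AE_density) (auto simp: indicator_def elim!: eventually_mono)
  then have "AE y in lebesgue. y \<notin> {y \<in> torus_cell. g (y + (x - ?c)) \<noteq> 0}"
    by (intro AE_completion) (auto elim!: eventually_mono)
  then have "negligible {y \<in> torus_cell. g (y + (x - ?c)) \<noteq> 0}"
    by (auto simp: negligible_iff_null_sets AE_iff_null_sets completion.complete_sets_sandwich intro!: iffD2[OF AE_iff_null_sets])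
  moreover have "open {y \<in> torus_cell. g (y + (x - ?c)) \<noteq> 0}"
  proof -
    have "open ({y. g (y + (x - ?c)) \<noteq> 0})"
      by (intro open_Collect_neq continuous_on_compose2[OF c] continuous_intros) auto
    moreover have "open (torus_cell :: (real^'n) set)" by (simp add: torus_cell_box open_box)
    ultimately have "open (torus_cell \<inter> {y. g (y + (x - ?c)) \<noteq> 0})" by (rule open_Int[rotated])
    then show ?thesis by (simp add: Int_def)
  qed
  moreover have "?c \<in> {y \<in> torus_cell. g (y + (x - ?c)) \<noteq> 0}"
    using gx by (simp add: torus_cell_def)
  ultimately show False using open_not_negligible by blast
qed

context viscous_setting
begin

lemma torus_Fubini:
  fixes k :: "real^'n \<Rightarrow> real^'n \<Rightarrow> real"
  assumes c: "continuous_on UNIV (\<lambda>(h, x). k h x)" and b: "\<And>h x. \<bar>k h x\<bar> \<le> C"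
  shows "(LINT h|torus. LINT x|torus. k h x) = (LINT x|torus. LINT h|torus. k h x)"
    and "(\<lambda>h. LINT x|torus. k h x) \<in> borel_measurable borel"
    and "\<bar>LINT x|torus. k h x\<bar> \<le> C * torus_vol"
    and "integrable torus (\<lambda>h. LINT x|torus. k h x)"
    and "integrable torus (\<lambda>x. k h x)"
proof -
  have [measurable]: "(\<lambda>(h, x). k h x) \<in> borel_measurable (borel \<Otimes>\<^sub>M borel)"
    unfolding borel_prod by (rule continuous_borel[OF c])
  have fin: "finite_measure (torus \<Otimes>\<^sub>M (torus :: (real^'n) measure))"
    by (intro finite_measure_pair_measure finite_measure_torus)
  have I: "integrable (torus \<Otimes>\<^sub>M torus) (\<lambda>(h, x). k h x)"
    by (rule finite_measure.integrable_const_bound[OF fin, where B=C]) (use b in auto)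
  show "(LINT h|torus. LINT x|torus. k h x) = (LINT x|torus. LINT h|torus. k h x)"
    using torus2.Fubini_integral[OF I] by simp
  show m: "(\<lambda>h. LINT x|torus. k h x) \<in> borel_measurable borel"
    by measurable
  show i: "integrable torus (\<lambda>x. k h x)" for h
    using b by (intro integrable_torus[where B=C]) measurable
  have bd: "\<bar>LINT x|torus. k h x\<bar> \<le> C * torus_vol" for h
  proof -
    have "\<bar>LINT x|torus. k h x\<bar> \<le> (LINT x|torus. \<bar>k h x\<bar>)" by (rule integral_abs_bound)
    also have "\<dots> \<le> C * torus_vol" using i b by (intro integral_le_torus_vol) auto
    finally show ?thesis .
  qed
  then show "\<bar>LINT x|torus. k h x\<bar> \<le> C * torus_vol" .
  show "integrable torus (\<lambda>h. LINT x|torus. k h x)"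
    by (rule integrable_torus[OF m bd])
qed

text \<open>
  The function \<open>\<bar>s - M\<bar> + \<bar>s + M\<bar>\<close> has the minimum \<open>2 M\<close>, attained exactly for \<open>\<bar>s\<bar> \<le> M\<close>. Its integral along the
  solution decreases in time, by contraction against the constant solutions \<open>M\<close> and \<open>- M\<close>, and tends to the
  minimal value at time zero.
\<close>
lemma max_principle:
  assumes u: "viscous_solution f' \<nu> \<epsilon> T u u' Du Hu" and \<epsilon>: "\<epsilon> \<ge> 0"
    and [measurable]: "b \<in> borel_measurable borel" and b: "\<And>x. \<bar>b x\<bar> \<le> M"
    and ini: "((\<lambda>t. LINT x|torus. \<bar>u x t - b x\<bar>) \<longlongrightarrow> 0) (at_right 0)" and t: "0 < t" "t < T"
  shows "\<bar>u x t\<bar> \<le> M"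
proof -
  have cu: "continuous_on UNIV (\<lambda>x. u x t)" "periodic (\<lambda>x. u x t)" if "0 < t" "t < T" for t
    using viscous_solutionD(5,10)[OF u that] by auto
  have M0: "M \<ge> 0" using b[of 0] by linarith
  have i: "integrable torus (\<lambda>x. \<bar>u x t - k\<bar>)" if "0 < t" "t < T" for t k
    by (intro integrable_torus_continuous continuous_intros cu that periodic_compose[OF cu(2)[OF that], of "\<lambda>y. \<bar>y - k\<bar>"])
  let ?g = "\<lambda>x t. \<bar>u x t - M\<bar> + \<bar>u x t - (- M)\<bar> - 2 * M"
  have le: "(LINT x|torus. ?g x t) \<le> 2 * (LINT x|torus. \<bar>u x s - b x\<bar>)" if s: "0 < s" "s < t" for s
  proof -
    have sT: "0 < s" "s < T" using s t by auto
    have "integrable torus b" using b by (rule integrable_torus[rotated]) measurable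
    moreover have "integrable torus (\<lambda>x. u x s)" by (intro integrable_torus_continuous cu sT)
    ultimately have i2: "integrable torus (\<lambda>x. \<bar>u x s - b x\<bar>)" by simp
    have "(LINT x|torus. ?g x t) = (LINT x|torus. \<bar>u x t - M\<bar>) + (LINT x|torus. \<bar>u x t - (- M)\<bar>) - (LINT x|(torus::(real^'n) measure). 2 * M)"
      using i[OF t, of M] i[OF t, of "- M"] torus.integrable_const by (simp del: diff_minus_eq_add)
    also have "\<dots> \<le> (LINT x|torus. \<bar>u x s - M\<bar>) + (LINT x|torus. \<bar>u x s - (- M)\<bar>) - (LINT x|(torus::(real^'n) measure). 2 * M)"
      using L1_contraction[OF u viscous_solution_const \<epsilon> s(1) less_imp_le[OF s(2)] t(2)]
      by (intro add_mono diff_mono order_refl)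
    also have "\<dots> = (LINT x|torus. ?g x s)"
      using i[OF sT, of M] i[OF sT, of "- M"] torus.integrable_const by (simp del: diff_minus_eq_add)
    also have "\<dots> \<le> (LINT x|torus. 2 * \<bar>u x s - b x\<bar>)"
    proof (rule integral_mono)
      show "integrable torus (\<lambda>x. ?g x s)" using i[OF sT, of M] i[OF sT, of "- M"] torus.integrable_const by simp
      show "?g x s \<le> 2 * \<bar>u x s - b x\<bar>" for x using b[of x] by (smt (verit))
    qed (use i2 in simp)
    finally show ?thesis by simp
  qed
  have "(LINT x|torus. ?g x t) \<le> 0"
  proof (rule tendsto_lowerbound[of "\<lambda>s. 2 * (LINT x|torus. \<bar>u x s - b x\<bar>)" _ "at_right 0"])
    show "((\<lambda>s. 2 * (LINT x|torus. \<bar>u x s - b x\<bar>)) \<longlongrightarrow> 0) (at_right 0)"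
      using tendsto_mult_left[OF ini, of 2] by simp
    show "\<forall>\<^sub>F s in at_right 0. (LINT x|torus. ?g x t) \<le> 2 * (LINT x|torus. \<bar>u x s - b x\<bar>)"
      unfolding eventually_at_right_field using le t by blast
  qed simp
  moreover have ge: "?g x t \<ge> 0" for x by linarith
  moreover have ig: "integrable torus (\<lambda>x. ?g x t)" using i[OF t, of M] i[OF t, of "- M"] torus.integrable_const by simp
  moreover have "(LINT x|torus. ?g x t) \<ge> 0" by (rule Bochner_Integration.integral_nonneg[OF ge])
  ultimately have "AE x in torus. ?g x t = 0"
    using integral_nonneg_eq_0_iff_AE[OF ig] by (simp del: diff_minus_eq_add)
  then have "?g x t = 0"
    by (rule continuous_AE_torus[rotated 2])
      (auto intro!: continuous_intros cu[OF t] periodic_compose[OF cu(2)[OF t], of "\<lambda>y. \<bar>y - M\<bar> + \<bar>y - (- M)\<bar> - 2 * M", simplified])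
  then show ?thesis using M0 by linarith
qed

text \<open>
  With \<open>y = x + h\<close> the average over \<open>h\<close> has the weight \<open>r (y - x)\<close>. The other point being fixed, this is a test
  function of the variable in which the Laplacian acts, and the viscosity inequality moves the Laplacian
  onto it. That \<open>r\<close> is even makes both variables equivalent.
\<close>
lemma doubled_viscosity:
  fixes r g k :: "real^'n \<Rightarrow> real"
  assumes M: "M > 0" and c: "0 < c" "c < 1"
    and r: "periodic_C2 r R Q" "\<And>x. r x \<ge> 0" "\<And>x. r (- x) = r x" and Lr: "\<And>x. \<bar>\<Sum>j\<in>UNIV. Q j x $ j\<bar> \<le> Lr"
    and g: "periodic_C2 g G H" and k: "continuous_on UNIV k" "periodic k"
    and bd: "\<And>x. \<bar>g x\<bar> \<le> M" "\<And>x. \<bar>k x\<bar> \<le> M"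
  shows "(LINT h|torus. LINT x|torus. r h * (sabs' (2*M) c (g x - k (x + h)) * (\<Sum>j\<in>UNIV. H j x $ j))) \<le> 8 * M * Lr * torus_vol * torus_vol"
    and "(LINT h|torus. LINT x|torus. r h * (- sabs' (2*M) c (k x - g (x + h)) * (\<Sum>j\<in>UNIV. H j (x + h) $ j))) \<le> 8 * M * Lr * torus_vol * torus_vol"
proof -
  let ?B = "2 * M"
  have B: "?B > 0" using M by simp
  note R = periodic_C2_continuous[OF r(1)] and G = periodic_C2_continuous[OF g]
  let ?L = "\<lambda>x. \<Sum>j\<in>UNIV. H j x $ j"
  have cL: "continuous_on UNIV ?L" by (intro continuous_intros G)
  have pL: "periodic ?L" using G(6) by (simp add: periodic_def)
  obtain b1 where b1: "\<And>x. norm (r x) \<le> b1" "b1 > 0" using periodic_continuous_bounded[OF R(4,1)] by blast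
  obtain b2 where b2: "\<And>x. norm (?L x) \<le> b2" "b2 > 0" using periodic_continuous_bounded[OF pL cL] by blast
  have b3: "\<bar>sabs' ?B c (g x - k y)\<bar> \<le> 1" "\<bar>sabs' ?B c (k y - g x)\<bar> \<le> 1" for x y
    using bd(1)[of x] bd(2)[of y] by (auto intro!: sabs'_le_1[OF B c(1)])
  have b4: "\<bar>a * (d * e)\<bar> \<le> b1 * b2" if "\<bar>a\<bar> \<le> b1" "\<bar>d\<bar> \<le> 1" "\<bar>e\<bar> \<le> b2" for a d e :: real
  proof -
    have "\<bar>a * (d * e)\<bar> \<le> b1 * (1 * b2)"
      unfolding abs_mult using that b1(2) b2(2) by (intro mult_mono) auto
    then show ?thesis by simp
  qed
  note cc = continuous_on_compose2[OF R(1)] continuous_on_compose2[OF G(1)] continuous_on_compose2[OF k(1)]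
    continuous_on_compose2[OF cL] continuous_on_compose2[OF G(3)] continuous_on_compose2[OF sabs'_continuous[OF B c(1)]]
  let ?m = "\<lambda>y x. r (x - y) * (sabs' ?B c (g x - k y) * ?L x)"
  have mid: "(LINT y|torus. LINT x|torus. ?m y x) \<le> 8 * M * Lr * torus_vol * torus_vol"
  proof (rule integral_le_torus_vol)
    have cm: "continuous_on UNIV (\<lambda>(y, x). ?m y x)"
      unfolding case_prod_beta by (auto intro!: continuous_intros cc)
    show "integrable torus (\<lambda>y. LINT x|torus. ?m y x)"
      by (rule torus_Fubini(4)[OF cm, where C="b1 * b2"]) (intro b4; use b1 b2 b3 in auto)
    fix y
    have sh: "periodic_C2 (\<lambda>x. r (x - y)) (\<lambda>x. R (x - y)) (\<lambda>j x. Q j (x - y))"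
    proof -
      have d: "((\<lambda>x. q (x - y)) has_derivative q') (at x)" if "(q has_derivative q') (at (x - y))"
        for q :: "real^'n \<Rightarrow> real" and q' x
        by (rule has_derivative_compose[of "\<lambda>x. x - y" "\<lambda>z. z" x UNIV q q'])
          (use that in \<open>auto intro!: derivative_eq_intros\<close>)
      have p: "periodic (\<lambda>x. q (x - y))" if "periodic q" for q :: "real^'n \<Rightarrow> 'b"
        using periodic_shift[OF that, of "- y"] by simp
      show ?thesis
        unfolding periodic_C2_def
        using p[OF R(4)] p[OF R(5)] p[OF R(6)] d[OF R(7)] d[of "\<lambda>x. R x $ _", OF R(8)]
          continuous_on_compose2[OF R(3), of UNIV "\<lambda>x. x - y", OF continuous_on_diff[OF continuous_on_id continuous_on_const]]
        by auto
    qed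
    have "(LINT x|torus. ?m y x) = (LINT x|torus. r (x - y) * sabs' ?B c (g x - k y) * ?L x)"
      by (simp add: mult.assoc)
    also have "\<dots> \<le> (LINT x|torus. sabs ?B c (g x - k y) * (\<Sum>j\<in>UNIV. Q j (x - y) $ j))"
      by (rule viscosity_inequality[OF B c(1) sh r(2) g])
    also have "\<dots> \<le> (8 * M * Lr) * torus_vol"
    proof (rule integral_le_torus_vol)
      show "integrable torus (\<lambda>x. sabs ?B c (g x - k y) * (\<Sum>j\<in>UNIV. Q j (x - y) $ j))"
        using G(4) periodic_C2_continuous(6)[OF sh]
        by (intro integrable_torus_continuous)
          (auto simp: periodic_def intro!: continuous_intros continuous_on_compose2[OF sabs_continuous[OF B c(1)]]
            continuous_on_compose2[OF G(1)] continuous_on_compose2[OF R(3)])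
      fix x
      have "\<bar>g x - k y\<bar> \<le> ?B" using bd(1)[of x] bd(2)[of y] by linarith
      moreover from sabs_abs[OF B c(1) this] have "\<bar>sabs ?B c (g x - k y)\<bar> \<le> ?B + c * (?B * (2 + c))"
        using \<open>\<bar>g x - k y\<bar> \<le> ?B\<close> by linarith
      moreover have "c * (?B * (2 + c)) \<le> 1 * (?B * 3)" using c B by (intro mult_mono) auto
      ultimately have "\<bar>sabs ?B c (g x - k y)\<bar> \<le> 8 * M" by linarith
      then have "\<bar>sabs ?B c (g x - k y) * (\<Sum>j\<in>UNIV. Q j (x - y) $ j)\<bar> \<le> 8 * M * Lr"
        unfolding abs_mult using Lr[of "x - y"] M by (intro mult_mono) auto
      then show "sabs ?B c (g x - k y) * (\<Sum>j\<in>UNIV. Q j (x - y) $ j) \<le> 8 * M * Lr" by linarith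
    qed
    finally show "(LINT x|torus. ?m y x) \<le> 8 * M * Lr * torus_vol" .
  qed
  have shh: "(LINT h|torus. q h) = (LINT y|torus. q (y - x))"
    if q: "continuous_on UNIV q" "periodic q" for q :: "real^'n \<Rightarrow> real" and x
  proof -
    obtain C where "\<And>x. norm (q x) \<le> C" using periodic_continuous_bounded[OF q(2,1)] by blast
    then show ?thesis
      using integral_torus_shift[OF continuous_borel[OF q(1)] q(2), of C "- x"] by simp
  qed
  have pk: "periodic (\<lambda>h. k (x + h))" "periodic (\<lambda>h. g (x + h))" "periodic (\<lambda>h. ?L (x + h))" for x
    using periodic_shift[OF k(2), of x] periodic_shift[OF G(4), of x] periodic_shift[OF pL, of x] by (simp_all add: add.commute)
  show "(LINT h|torus. LINT x|torus. r h * (sabs' ?B c (g x - k (x + h)) * ?L x)) \<le> 8 * M * Lr * torus_vol * torus_vol"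
  proof -
    have "(LINT h|torus. LINT x|torus. r h * (sabs' ?B c (g x - k (x + h)) * ?L x))
        = (LINT x|torus. LINT h|torus. r h * (sabs' ?B c (g x - k (x + h)) * ?L x))"
      by (rule torus_Fubini(1)[where C="b1 * b2"])
        (auto simp: case_prod_beta intro!: continuous_intros cc b4 b1(1)[simplified] b2(1)[simplified] b3)
    also have "\<dots> = (LINT x|torus. LINT y|torus. r (y - x) * (sabs' ?B c (g x - k (x + (y - x))) * ?L x))"
    proof (rule Bochner_Integration.integral_cong[OF refl])
      fix x
      show "(LINT h|torus. r h * (sabs' ?B c (g x - k (x + h)) * ?L x))
        = (LINT y|torus. r (y - x) * (sabs' ?B c (g x - k (x + (y - x))) * ?L x))"
        by (rule shh[of "\<lambda>h. r h * (sabs' ?B c (g x - k (x + h)) * ?L x)" x])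
         (use pk(1)[of x] R(4) in \<open>auto simp: periodic_def intro!: continuous_intros cc\<close>)
    qed
    also have "\<dots> = (LINT x|torus. LINT y|torus. ?m y x)"
      using r(3)[of "x - y" for x y] by simp
    also have "\<dots> = (LINT y|torus. LINT x|torus. ?m y x)"
      by (rule torus_Fubini(1)[where C="b1 * b2" and k="\<lambda>x y. ?m y x"])
        (auto simp: case_prod_beta intro!: continuous_intros cc b4 b1(1)[simplified] b2(1)[simplified] b3)
    finally show ?thesis using mid by simp
  qed
  have odd: "- sabs' ?B c (k x - g y) = sabs' ?B c (g y - k x)" for x y
    using sabs'_odd[OF B c(1), of "k x - g y"] by simp
  show "(LINT h|torus. LINT x|torus. r h * (- sabs' ?B c (k x - g (x + h)) * ?L (x + h))) \<le> 8 * M * Lr * torus_vol * torus_vol"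
    unfolding odd
  proof -
    have "(LINT h|torus. LINT x|torus. r h * (sabs' ?B c (g (x + h) - k x) * ?L (x + h)))
        = (LINT x|torus. LINT h|torus. r h * (sabs' ?B c (g (x + h) - k x) * ?L (x + h)))"
      by (rule torus_Fubini(1)[where C="b1 * b2"])
        (auto simp: case_prod_beta intro!: continuous_intros cc b4 b1(1)[simplified] b2(1)[simplified] b3)
    also have "\<dots> = (LINT x|torus. LINT y|torus. r (y - x) * (sabs' ?B c (g (x + (y - x)) - k x) * ?L (x + (y - x))))"
    proof (rule Bochner_Integration.integral_cong[OF refl])
      fix x
      show "(LINT h|torus. r h * (sabs' ?B c (g (x + h) - k x) * ?L (x + h)))
        = (LINT y|torus. r (y - x) * (sabs' ?B c (g (x + (y - x)) - k x) * ?L (x + (y - x))))"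
        by (rule shh[of "\<lambda>h. r h * (sabs' ?B c (g (x + h) - k x) * ?L (x + h))" x])
         (use pk(2,3)[of x] R(4) in \<open>auto simp: periodic_def intro!: continuous_intros cc\<close>)
    qed
    also have "\<dots> = (LINT x|torus. LINT y|torus. ?m x y)" by simp
    finally show "(LINT h|torus. LINT x|torus. r h * (sabs' ?B c (g (x + h) - k x) * ?L (x + h))) \<le> 8 * M * Lr * torus_vol * torus_vol"
      using mid by simp
  qed
qed

text \<open>
  For each \<open>h\<close> the translate of \<open>v\<close> is a solution, so that the Kato inequality applies before averaging; only
  the diffusion, whose parts no longer combine, needs the average.
\<close>
lemma doubling:
  fixes r :: "real^'n \<Rightarrow> real"
  assumes u: "viscous_solution f' \<nu> \<epsilon> T u u' Du Hu" and v: "viscous_solution f' \<nu> \<delta> T v v' Dv Hv"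
    and \<epsilon>\<delta>: "\<epsilon> \<ge> 0" "\<delta> \<ge> 0" and M: "M > 0"
    and bd: "\<And>x t. 0 < t \<Longrightarrow> t < T \<Longrightarrow> \<bar>u x t\<bar> \<le> M" "\<And>x t. 0 < t \<Longrightarrow> t < T \<Longrightarrow> \<bar>v x t\<bar> \<le> M"
    and r: "periodic_C2 r R Q" "\<And>x. r x \<ge> 0" "\<And>x. r (- x) = r x" and Lr: "\<And>x. \<bar>\<Sum>j\<in>UNIV. Q j x $ j\<bar> \<le> Lr"
    and st: "0 < s" "s \<le> t" "t < T"
  shows "(LINT h|torus. r h * (LINT x|torus. \<bar>u x t - v (x + h) t\<bar>))
     \<le> (LINT h|torus. r h * (LINT x|torus. \<bar>u x s - v (x + h) s\<bar>)) + (t - s) * ((\<epsilon> + \<delta>) * (8 * M * Lr * torus_vol * torus_vol))"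
proof -
  define a b where "a = s / 2" and "b = (t + T) / 2"
  have ab: "0 < a" "a < s" "t < b" "b < T" using st by (auto simp: a_def b_def)
  obtain K1 where K1: "K1 > 0" "\<And>x \<tau>. a \<le> \<tau> \<Longrightarrow> \<tau> \<le> b \<Longrightarrow> \<bar>u x \<tau>\<bar> \<le> K1" "\<And>x \<tau>. a \<le> \<tau> \<Longrightarrow> \<tau> \<le> b \<Longrightarrow> \<bar>u' x \<tau>\<bar> \<le> K1"
    "\<And>x \<tau>. a \<le> \<tau> \<Longrightarrow> \<tau> \<le> b \<Longrightarrow> norm (Du x \<tau>) \<le> K1"
    using viscous_solution_bounds[OF u ab(1,4)] by metis
  obtain K2 where K2: "K2 > 0" "\<And>x \<tau>. a \<le> \<tau> \<Longrightarrow> \<tau> \<le> b \<Longrightarrow> \<bar>v x \<tau>\<bar> \<le> K2" "\<And>x \<tau>. a \<le> \<tau> \<Longrightarrow> \<tau> \<le> b \<Longrightarrow> \<bar>v' x \<tau>\<bar> \<le> K2"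
    "\<And>x \<tau>. a \<le> \<tau> \<Longrightarrow> \<tau> \<le> b \<Longrightarrow> norm (Dv x \<tau>) \<le> K2"
    using viscous_solution_bounds[OF v ab(1,4)] by metis
  let ?K = "K1 + K2" and ?B = "2 * M"
  obtain L where L: "L > 0" "\<And>j s. \<bar>s\<bar> \<le> M \<Longrightarrow> \<bar>f' j s\<bar> \<le> L" using flux_lipschitz_const by blast
  let ?C = "real CARD('n) * (L * (2 * ?K)) * torus_vol"
  have B: "?B > 0" using M by simp
  note R = periodic_C2_continuous[OF r(1)]
  obtain b1 where b1: "\<And>x. norm (r x) \<le> b1" "b1 > 0" using periodic_continuous_bounded[OF R(4,1)] by blast
  have [measurable]: "r \<in> borel_measurable borel" by (rule continuous_borel[OF R(1)])
  have rint: "integrable torus (\<lambda>h. r h * k h)" if "k \<in> borel_measurable borel" "\<And>h. \<bar>k h\<bar> \<le> C" for k C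
    using that b1 by (intro integrable_torus[where B="b1 * C"]) (auto simp: abs_mult intro!: mult_mono)
  have ir: "integrable torus r" by (intro integrable_torus_continuous R)
  have vs: "viscous_solution f' \<nu> \<delta> T (\<lambda>x t. v (x + h) t) (\<lambda>x t. v' (x + h) t) (\<lambda>x t. Dv (x + h) t) (\<lambda>j x t. Hv j (x + h) t)" for h
    using viscous_solution_shift[OF v, of 0 h] by simp
  have w: "\<bar>u x \<tau> - v (x + h) \<tau>\<bar> \<le> ?B" if "a \<le> \<tau>" "\<tau> \<le> b" for x h \<tau>
    using bd(1)[of \<tau> x] bd(2)[of \<tau> "x + h"] that ab by linarith
  have w': "\<bar>u' x \<tau> - v' (x + h) \<tau>\<bar> \<le> ?K" if "a \<le> \<tau>" "\<tau> \<le> b" for x h \<tau>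
    using K1(3)[OF that, of x] K2(3)[OF that, of "x + h"] by linarith
  let ?Y = "\<lambda>\<tau>. LINT h|torus. r h * (LINT x|torus. \<bar>u x \<tau> - v (x + h) \<tau>\<bar>)"
  have "?Y t \<le> (?Y s + (t - s) * ((\<epsilon> + \<delta>) * (8 * M * Lr * torus_vol * torus_vol)))
     + c * ((t - s) * (?C * (LINT h|torus. r h)) + 2 * ((3 * ?B) * torus_vol * (LINT h|torus. r h)))"
    if c: "0 < c" "c < 1" for c
  proof -
    let ?e = "\<lambda>\<tau> h. LINT x|torus. sabs ?B c (u x \<tau> - v (x + h) \<tau>)"
    let ?e' = "\<lambda>\<tau> h. LINT x|torus. sabs' ?B c (u x \<tau> - v (x + h) \<tau>) * (u' x \<tau> - v' (x + h) \<tau>)"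
    note SD = sabs_distance_derivative[OF B c(1) u vs ab(1,4) _ _ w w']
    have cont: "continuous_on UNIV (\<lambda>x. u x \<tau>)" "continuous_on UNIV (\<lambda>x. v x \<tau>)" "continuous_on UNIV (\<lambda>x. u' x \<tau>)"
      "continuous_on UNIV (\<lambda>x. v' x \<tau>)" "continuous_on UNIV (\<lambda>x. Hu j x \<tau>)" "continuous_on UNIV (\<lambda>x. Hv j x \<tau>)"
      if "a < \<tau>" "\<tau> < b" for \<tau> j
      using viscous_solutionD(5,6,8)[OF u, of \<tau>] viscous_solutionD(5,6,8)[OF v, of \<tau>] that ab by auto
    note cc = continuous_on_compose2[OF cont(1)] continuous_on_compose2[OF cont(2)] continuous_on_compose2[OF cont(3)]
      continuous_on_compose2[OF cont(4)] continuous_on_compose2[OF cont(5)] continuous_on_compose2[OF cont(6)]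
      continuous_on_compose2[OF sabs_continuous[OF B c(1)]] continuous_on_compose2[OF sabs'_continuous[OF B c(1)]]
    have saB: "\<bar>sabs ?B c (u x \<tau> - v (x + h) \<tau>)\<bar> \<le> ?B + c * (?B * (2 + c))" if "a < \<tau>" "\<tau> < b" for x h \<tau>
    proof -
      have "\<bar>u x \<tau> - v (x + h) \<tau>\<bar> \<le> ?B" using that by (intro w) auto
      from sabs_abs[OF B c(1) this] this show ?thesis by linarith
    qed
    have sgn1: "\<bar>sabs' ?B c (u x \<tau> - v (x + h) \<tau>)\<bar> \<le> 1" if "a < \<tau>" "\<tau> < b" for x h \<tau>
      using that by (intro sabs'_le_1[OF B c(1)] w) auto
    have int_e: "integrable torus (\<lambda>h. r h * ?e \<tau> h)" if \<tau>: "a < \<tau>" "\<tau> < b" for \<tau>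
      by (intro rint[where C="(?B + c * (?B * (2 + c))) * torus_vol"]
            torus_Fubini(2)[where k="\<lambda>h x. sabs ?B c (u x \<tau> - v (x + h) \<tau>)" and C="?B + c * (?B * (2 + c))"]
            torus_Fubini(3)[where k="\<lambda>h x. sabs ?B c (u x \<tau> - v (x + h) \<tau>)" and C="?B + c * (?B * (2 + c))"])
        (auto simp: case_prod_beta intro!: continuous_intros cc \<tau> saB simp del: abs_le_iff)
    have int_abs: "integrable torus (\<lambda>h. r h * (LINT x|torus. \<bar>u x \<tau> - v (x + h) \<tau>\<bar>))" if \<tau>: "a < \<tau>" "\<tau> < b" for \<tau>
      by (intro rint[where C="?B * torus_vol"]
            torus_Fubini(2)[where k="\<lambda>h x. \<bar>u x \<tau> - v (x + h) \<tau>\<bar>" and C="?B"]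
            torus_Fubini(3)[where k="\<lambda>h x. \<bar>u x \<tau> - v (x + h) \<tau>\<bar>" and C="?B"])
        (use \<tau> in \<open>auto simp: case_prod_beta intro!: continuous_intros cc w\<close>)
    have meas_e': "?e' \<tau> \<in> borel_measurable borel" if \<tau>: "a < \<tau>" "\<tau> < b" for \<tau>
    proof (rule torus_Fubini(2)[where C="1 * ?K"])
      show "continuous_on UNIV (\<lambda>(h, x). sabs' ?B c (u x \<tau> - v (x + h) \<tau>) * (u' x \<tau> - v' (x + h) \<tau>))"
        by (auto simp: case_prod_beta intro!: continuous_intros cc \<tau>)
      show "\<bar>sabs' ?B c (u x \<tau> - v (x + h) \<tau>) * (u' x \<tau> - v' (x + h) \<tau>)\<bar> \<le> 1 * ?K" for h x
        unfolding abs_mult using \<tau> by (intro mult_mono sgn1 w') auto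
    qed
    let ?E = "\<lambda>\<tau>. LINT h|torus. r h * ?e \<tau> h" and ?E' = "\<lambda>\<tau>. LINT h|torus. r h * ?e' \<tau> h"
    have dE: "(?E has_real_derivative ?E' \<tau>) (at \<tau>)" if \<tau>: "a < \<tau>" "\<tau> < b" for \<tau>
    proof (rule torus.has_derivative_integral[OF \<tau>, where K="b1 * (?K * torus_vol)"])
      show "integrable torus (\<lambda>h. r h * ?e s h)" if "a < s" "s < b" for s by (rule int_e[OF that])
      show "(\<lambda>h. r h * ?e' \<tau> h) \<in> borel_measurable torus"
        using meas_e'[OF \<tau>] by (simp cong: measurable_cong_sets)
      fix \<sigma> h assume \<sigma>: "a < \<sigma>" "\<sigma> < b"
      show "((\<lambda>\<tau>. r h * ?e \<tau> h) has_real_derivative r h * ?e' \<sigma> h) (at \<sigma>)"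
        by (intro DERIV_cmult SD(1) \<sigma>)
      show "\<bar>r h * ?e' \<sigma> h\<bar> \<le> b1 * (?K * torus_vol)"
        unfolding abs_mult using b1 by (intro mult_mono SD(2) \<sigma>) auto
    qed
    have E'le: "?E' \<tau> \<le> c * (?C * (LINT h|torus. r h)) + (\<epsilon> + \<delta>) * (8 * M * Lr * torus_vol * torus_vol)" if \<tau>: "a < \<tau>" "\<tau> < b" for \<tau>
    proof -
      have \<tau>': "0 < \<tau>" "\<tau> < T" using \<tau> ab by auto
      let ?Lu = "\<lambda>x. \<Sum>j\<in>UNIV. Hu j x \<tau> $ j" and ?Lv = "\<lambda>x. \<Sum>j\<in>UNIV. Hv j x \<tau> $ j"
      note u2 = viscous_solutionD(1)[OF u \<tau>'] and v2 = viscous_solutionD(1)[OF v \<tau>']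
      have pLu: "periodic ?Lu" using periodic_C2_continuous(6)[OF u2] by (simp add: periodic_def)
      have pLv: "periodic ?Lv" using periodic_C2_continuous(6)[OF v2] by (simp add: periodic_def)
      have cLu: "continuous_on UNIV ?Lu" and cLv: "continuous_on UNIV ?Lv"
        by (auto intro!: continuous_intros cont \<tau>)
      obtain bu where bu: "\<And>x. norm (?Lu x) \<le> bu" using periodic_continuous_bounded[OF pLu cLu] by blast
      obtain bv where bv: "\<And>x. norm (?Lv x) \<le> bv" using periodic_continuous_bounded[OF pLv cLv] by blast
      let ?A = "\<lambda>h x. sabs' ?B c (u x \<tau> - v (x + h) \<tau>) * ?Lu x"
      let ?D = "\<lambda>h x. - sabs' ?B c (u x \<tau> - v (x + h) \<tau>) * ?Lv (x + h)"
      have cA: "continuous_on UNIV (\<lambda>(h, x). ?A h x)" and cD: "continuous_on UNIV (\<lambda>(h, x). ?D h x)"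
        by (auto simp: case_prod_beta intro!: continuous_intros cc \<tau>)
      have bA: "\<bar>?A h x\<bar> \<le> 1 * bu" for h x
        unfolding abs_mult using bu by (intro mult_mono sgn1 \<tau>) auto
      have bD: "\<bar>?D h x\<bar> \<le> 1 * bv" for h x
        unfolding abs_mult abs_minus_cancel using bv by (intro mult_mono sgn1 \<tau>) auto
      note FA = torus_Fubini[OF cA bA] and FD = torus_Fubini[OF cD bD]
      have pt: "?e' \<tau> h \<le> c * ?C + \<epsilon> * (LINT x|torus. ?A h x) + \<delta> * (LINT x|torus. ?D h x)" for h
      proof -
        have "?e' \<tau> h \<le> c * ?C + (LINT x|torus. sabs' ?B c (u x \<tau> - v (x + h) \<tau>) * (\<epsilon> * ?Lu x - \<delta> * ?Lv (x + h)))"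
        proof (rule kato_inequality[OF B c(1) u vs \<tau>' _ _ _ _ L(2)])
          fix x show "\<bar>u x \<tau>\<bar> \<le> M" "\<bar>v (x + h) \<tau>\<bar> \<le> M" "norm (Du x \<tau>) \<le> ?K" "norm (Dv (x + h) \<tau>) \<le> ?K"
            using K1(1,2,4) K2(1,2,4) \<tau> \<tau>' bd by (auto intro: add_increasing add_increasing2 less_imp_le)
        qed
        also have "(LINT x|torus. sabs' ?B c (u x \<tau> - v (x + h) \<tau>) * (\<epsilon> * ?Lu x - \<delta> * ?Lv (x + h)))
            = (LINT x|torus. \<epsilon> * ?A h x + \<delta> * ?D h x)"
          by (rule Bochner_Integration.integral_cong) (auto simp: algebra_simps)
        also have "\<dots> = \<epsilon> * (LINT x|torus. ?A h x) + \<delta> * (LINT x|torus. ?D h x)"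
          using FA(5)[of h] FD(5)[of h] by simp
        finally show ?thesis by simp
      qed
      have iA: "integrable torus (\<lambda>h. r h * (LINT x|torus. ?A h x))" and iD: "integrable torus (\<lambda>h. r h * (LINT x|torus. ?D h x))"
        by (rule rint[OF FA(2,3)], rule rint[OF FD(2,3)])
      have "?E' \<tau> \<le> (LINT h|torus. (c * ?C) * r h + \<epsilon> * (r h * (LINT x|torus. ?A h x)) + \<delta> * (r h * (LINT x|torus. ?D h x)))"
      proof (rule integral_mono)
        show "integrable torus (\<lambda>h. r h * ?e' \<tau> h)" by (rule rint[OF meas_e'[OF \<tau>], where C="?K * torus_vol"], rule SD(2)[OF \<tau>])
        show "integrable torus (\<lambda>h. (c * ?C) * r h + \<epsilon> * (r h * (LINT x|torus. ?A h x)) + \<delta> * (r h * (LINT x|torus. ?D h x)))"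
          using ir iA iD by (intro Bochner_Integration.integrable_add integrable_mult_right)
        show "r h * ?e' \<tau> h \<le> (c * ?C) * r h + \<epsilon> * (r h * (LINT x|torus. ?A h x)) + \<delta> * (r h * (LINT x|torus. ?D h x))" for h
          using mult_left_mono[OF pt[of h] r(2)[of h]] by (simp add: algebra_simps)
      qed
      also have "\<dots> = (c * ?C) * (LINT h|torus. r h) + \<epsilon> * (LINT h|torus. r h * (LINT x|torus. ?A h x)) + \<delta> * (LINT h|torus. r h * (LINT x|torus. ?D h x))"
        using ir iA iD by (subst Bochner_Integration.integral_add | intro Bochner_Integration.integrable_add integrable_mult_right | subst Bochner_Integration.integral_mult_right_zero | simp)+
      also have "\<dots> \<le> (c * ?C) * (LINT h|torus. r h) + \<epsilon> * (8 * M * Lr * torus_vol * torus_vol) + \<delta> * (8 * M * Lr * torus_vol * torus_vol)"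
      proof (intro add_mono order_refl mult_left_mono \<epsilon>\<delta>)
        show "(LINT h|torus. r h * (LINT x|torus. ?A h x)) \<le> 8 * M * Lr * torus_vol * torus_vol"
          using doubled_viscosity(1)[OF M c r Lr u2 viscous_solutionD(5,10)[OF v \<tau>'] bd(1)[OF \<tau>'] bd(2)[OF \<tau>']] by simp
        show "(LINT h|torus. r h * (LINT x|torus. ?D h x)) \<le> 8 * M * Lr * torus_vol * torus_vol"
          using doubled_viscosity(2)[OF M c r Lr v2 viscous_solutionD(5,10)[OF u \<tau>'] bd(2)[OF \<tau>'] bd(1)[OF \<tau>']] by simp
      qed
      finally show ?thesis by (simp add: algebra_simps)
    qed
    have 1: "?E t - ?E s \<le> (t - s) * (c * (?C * (LINT h|torus. r h)) + (\<epsilon> + \<delta>) * (8 * M * Lr * torus_vol * torus_vol))"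
    proof (cases "s = t")
      case False
      then have lt: "s < t" using st by simp
      have "\<exists>z>s. z < t \<and> ?E t - ?E s = (t - s) * ?E' z"
        by (rule MVT2[OF lt]) (use dE ab in auto)
      then obtain z where z: "s < z" "z < t" "?E t - ?E s = (t - s) * ?E' z" by blast
      show ?thesis unfolding z(3) using z ab st by (intro mult_left_mono E'le) auto
    qed simp
    have 2: "?Y t \<le> ?E t + c * ((3 * ?B) * torus_vol * (LINT h|torus. r h))"
    proof -
      have t': "a < t" "t < b" using ab st by auto
      have "?Y t \<le> (LINT h|torus. r h * ?e t h + (c * ((3 * ?B) * torus_vol)) * r h)"
      proof (rule integral_mono[OF int_abs[OF t']])
        show "integrable torus (\<lambda>h. r h * ?e t h + (c * ((3 * ?B) * torus_vol)) * r h)"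
          using int_e[OF t'] ir by simp
        fix h
        have "(LINT x|torus. \<bar>u x t - v (x + h) t\<bar>) \<le> ?e t h + c * (3 * ?B) * torus_vol"
          using t' by (intro sabs_abs_integral(1)[OF B c] SD(3,4) w) auto
        from mult_left_mono[OF this r(2)[of h]]
        show "r h * (LINT x|torus. \<bar>u x t - v (x + h) t\<bar>) \<le> r h * ?e t h + (c * ((3 * ?B) * torus_vol)) * r h"
          by (simp add: algebra_simps)
      qed
      then show ?thesis using int_e[OF t'] ir by (simp add: mult_ac)
    qed
    have 3: "?E s \<le> ?Y s + c * ((3 * ?B) * torus_vol * (LINT h|torus. r h))"
    proof -
      have t': "a < s" "s < b" using ab st by auto
      have "?E s \<le> (LINT h|torus. r h * (LINT x|torus. \<bar>u x s - v (x + h) s\<bar>) + (c * ((3 * ?B) * torus_vol)) * r h)"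
      proof (rule integral_mono[OF int_e[OF t']])
        show "integrable torus (\<lambda>h. r h * (LINT x|torus. \<bar>u x s - v (x + h) s\<bar>) + (c * ((3 * ?B) * torus_vol)) * r h)"
          using int_abs[OF t'] ir by simp
        fix h
        have "?e s h \<le> (LINT x|torus. \<bar>u x s - v (x + h) s\<bar>) + c * (3 * ?B) * torus_vol"
          using t' by (intro sabs_abs_integral(2)[OF B c] SD(3,4) w) auto
        from mult_left_mono[OF this r(2)[of h]]
        show "r h * ?e s h \<le> r h * (LINT x|torus. \<bar>u x s - v (x + h) s\<bar>) + (c * ((3 * ?B) * torus_vol)) * r h"
          by (simp add: algebra_simps)
      qed
      then show ?thesis using int_abs[OF t'] ir by (simp add: mult_ac)
    qed
    have "?Y t \<le> ?Y s + (t - s) * (c * (?C * (LINT h|torus. r h)) + (\<epsilon> + \<delta>) * (8 * M * Lr * torus_vol * torus_vol))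
        + 2 * (c * ((3 * ?B) * torus_vol * (LINT h|torus. r h)))" using 1 2 3 by linarith
    also have "\<dots> = (?Y s + (t - s) * ((\<epsilon> + \<delta>) * (8 * M * Lr * torus_vol * torus_vol)))
     + c * ((t - s) * (?C * (LINT h|torus. r h)) + 2 * ((3 * ?B) * torus_vol * (LINT h|torus. r h)))"
      by (simp only: distrib_left distrib_right mult_ac add_ac)
    finally show ?thesis .
  qed
  then show ?thesis by (rule limit_parameter_le)
qed

end

section \<open>Trigonometric mollifiers\<close>

lemma periodic_C2_compose:
  assumes g: "periodic_C2 g G H"
    and d1: "\<And>a. (\<eta> has_real_derivative \<eta>1 a) (at a)" and d2: "\<And>a. (\<eta>1 has_real_derivative \<eta>2 a) (at a)"
    and c2: "continuous_on UNIV \<eta>2"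
  shows "periodic_C2 (\<lambda>x. \<eta> (g x)) (\<lambda>x. \<eta>1 (g x) *\<^sub>R G x)
     (\<lambda>j x. (G x $ j) *\<^sub>R (\<eta>2 (g x) *\<^sub>R G x) + \<eta>1 (g x) *\<^sub>R H j x)"
proof -
  note G = periodic_C2_continuous[OF g]
  have c1: "continuous_on UNIV \<eta>1"
    using d2 by (meson DERIV_isCont continuous_at_imp_continuous_on)
  have dd: "((\<lambda>x. (\<eta>1 (g x) *\<^sub>R G x) $ j) has_derivative (\<lambda>h. h \<bullet> ((G x $ j) *\<^sub>R (\<eta>2 (g x) *\<^sub>R G x) + \<eta>1 (g x) *\<^sub>R H j x))) (at x)" for j x
    using has_derivative_inner_mult[OF has_derivative_component_inner[OF G(7) d2] G(8)] by simp
  have "periodic (\<lambda>x. \<eta> (g x))" "periodic (\<lambda>x. \<eta>1 (g x) *\<^sub>R G x)"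
    "periodic (\<lambda>x. (G x $ j) *\<^sub>R (\<eta>2 (g x) *\<^sub>R G x) + \<eta>1 (g x) *\<^sub>R H j x)" for j
    using G(4,5,6) by (auto simp: periodic_def)
  moreover have "continuous_on UNIV (\<lambda>x. (G x $ j) *\<^sub>R (\<eta>2 (g x) *\<^sub>R G x) + \<eta>1 (g x) *\<^sub>R H j x)" for j
    by (auto intro!: continuous_intros G continuous_on_compose2[OF c1] continuous_on_compose2[OF c2])
  ultimately show ?thesis
    unfolding periodic_C2_def using dd has_derivative_component_inner[OF G(7) d1] by blast
qed

text \<open>
  A smooth even function with values between zero and one that equals one exactly on the lattice; its
  normalised powers are mollifiers on the torus.
\<close>
definition cos_mean :: "real^'n::finite \<Rightarrow> real" where
  "cos_mean x = (\<Sum>j\<in>UNIV. 1 + cos (x $ j)) / (2 * real CARD('n))"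

lemma cos_mean_C2: "periodic_C2 (cos_mean :: real^'n::finite \<Rightarrow> real) (\<lambda>x. \<chi> j. - sin (x $ j) / (2 * real CARD('n)))
    (\<lambda>j x. axis j (- cos (x $ j) / (2 * real CARD('n))))"
proof -
  have cp: "cos ((x + axis j (2 * pi)) $ i) = cos (x $ i)" "sin ((x + axis j (2 * pi)) $ i) = sin (x $ i)" for x :: "real^'n" and i j
    by (auto simp: axis_def)
  have d: "((\<lambda>x. x $ i) has_derivative (\<lambda>h. h $ i)) (at x)" for i and x :: "real^'n"
    by (rule bounded_linear.has_derivative[OF bounded_linear_vec_nth]) (rule has_derivative_ident)
  have "((\<lambda>x. (\<Sum>j\<in>UNIV. 1 + cos (x $ j)) / (2 * real CARD('n))) has_derivative
      (\<lambda>h. (\<Sum>j\<in>UNIV. - sin (x $ j) * h $ j) / (2 * real CARD('n)))) (at x)" for x :: "real^'n"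
    by (auto intro!: derivative_eq_intros d simp: sum_negf algebra_simps)
  then have 1: "((cos_mean :: real^'n \<Rightarrow> real) has_derivative (\<lambda>h. h \<bullet> (\<chi> j. - sin (x $ j) / (2 * real CARD('n))))) (at x)" for x
    by (simp add: cos_mean_def[abs_def] inner_vec_def sum_divide_distrib mult.commute)
  have 2: "((\<lambda>x. - sin (x $ j) / (2 * real CARD('n))) has_derivative
      (\<lambda>h. h \<bullet> axis j (- cos (x $ j) / (2 * real CARD('n))))) (at x)" for j and x :: "real^'n"
    by (auto intro!: derivative_eq_intros d simp: inner_axis algebra_simps)
  have 3: "continuous_on UNIV (\<lambda>x::real^'n. axis j (- cos (x $ j) / (2 * real CARD('n))) :: real^'n)" for j
  proof -
    have "continuous_on UNIV (\<lambda>x::real^'n. if i = j then - cos (x $ j) / (2 * real CARD('n)) else 0)" for i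
      by (cases "i = j") (auto intro!: continuous_intros)
    then show ?thesis unfolding axis_def by (rule continuous_on_vec_lambda)
  qed
  show ?thesis
    unfolding periodic_C2_def using 1 2 3 by (auto simp: periodic_def cos_mean_def cp simp del: vector_add_component)
qed

lemma cos_mean_bounds: "0 \<le> cos_mean x" "cos_mean x \<le> 1"
proof -
  have "0 \<le> 1 + cos (x $ j)" for j using cos_ge_minus_one[of "x $ j"] by linarith
  then show "0 \<le> cos_mean x"
    unfolding cos_mean_def by (intro divide_nonneg_nonneg sum_nonneg) auto
  have "(\<Sum>j\<in>UNIV. 1 + cos (x $ j)) \<le> (\<Sum>j\<in>(UNIV :: 'a set). 2)"
    by (intro sum_mono) (use cos_le_one in \<open>simp add: add.commute\<close>)
  then show "cos_mean x \<le> 1" by (simp add: cos_mean_def)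
qed

lemma cos_mean_eq_1:
  assumes "cos_mean x = 1"
  shows "\<exists>k. x = lattice_vec k"
proof -
  have "(\<Sum>j\<in>UNIV. 1 - cos (x $ j)) = (\<Sum>j\<in>UNIV. 2 - (1 + cos (x $ j)))" by simp
  also have "\<dots> = 2 * real CARD('a) - (\<Sum>j\<in>UNIV. 1 + cos (x $ j))"
    by (simp only: sum_subtractf) simp
  also have "\<dots> = 0" using assms by (simp add: cos_mean_def field_simps)
  finally have "\<forall>j\<in>UNIV. 1 - cos (x $ j) = 0"
    by (subst (asm) sum_nonneg_eq_0_iff) auto
  then have "\<forall>j. \<exists>n::int. x $ j = of_int n * 2 * pi"
    using cos_one_2pi_int by (metis UNIV_I eq_iff_diff_eq_0)
  then obtain k where "\<And>j. x $ j = of_int (k j) * 2 * pi" by metis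
  then have "x = lattice_vec k" by (simp add: lattice_vec_def vec_eq_iff)
  then show ?thesis by blast
qed

text \<open>
  By compactness \<open>cos_mean\<close> is at most some \<open>q < 1\<close> where \<open>m\<close> is at least \<open>e / 2\<close>. For \<open>q < q' < 1\<close> it exceeds \<open>q'\<close> on
  a set of positive measure, so that the share of its \<open>N\<close>-th power in the former set is of order
  \<open>(q / q') ^ N\<close>.
\<close>
lemma cos_mean_mollifier:
  fixes m :: "real^'n::finite \<Rightarrow> real"
  assumes mc: "continuous_on UNIV m" and mp: "periodic m" and m0: "\<And>x. m x \<ge> 0" "m 0 = 0" and e: "e > 0"
  obtains r R Q where "periodic_C2 r R Q" "\<And>x. r x \<ge> 0" "\<And>x. r (- x) = r x"
    "(LINT h|torus. r h) = 1" "(LINT h|torus. r h * m h) < e"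
proof -
  let ?k = "cos_mean :: real^'n \<Rightarrow> real" and ?C = "cbox 0 (\<chi> j. 2 * pi) :: (real^'n) set"
  note K = periodic_C2_continuous[OF cos_mean_C2]
  have kc: "continuous_on UNIV ?k" and kp: "periodic ?k" by (rule K(1), rule K(4))
  have red: "\<exists>y\<in>?C. m x = m y \<and> ?k x = ?k y" for x
  proof -
    have "x - lattice_vec (cell_index x) \<in> ?C"
      using minus_lattice_in_cell_iff[of x "cell_index x"]
      by (auto simp: half_open_cell_def mem_box_cart intro: less_imp_le)
    then show ?thesis
      using periodic_lattice[OF mp, of "x - lattice_vec (cell_index x)" "cell_index x"]
        periodic_lattice[OF kp, of "x - lattice_vec (cell_index x)" "cell_index x"]
      by (intro bexI[of _ "x - lattice_vec (cell_index x)"]) auto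
  qed
  obtain Mb where Mb: "\<And>x. norm (m x) \<le> Mb" "Mb > 0" using periodic_continuous_bounded[OF mp mc] by blast
  have "\<exists>q. 0 \<le> q \<and> q < 1 \<and> (\<forall>x. q < ?k x \<longrightarrow> m x < e / 2)"
  proof -
    let ?S = "{y \<in> ?C. e / 2 \<le> m y}"
    have "?S = ?C \<inter> {y. e / 2 \<le> m y}" by auto
    moreover have "closed {y. e / 2 \<le> m y}" by (intro closed_Collect_le mc continuous_intros)
    ultimately have S: "compact ?S" by (simp add: compact_Int_closed)
    show ?thesis
    proof (cases "?S = {}")
      case True
      have "m x < e / 2" for x using red[of x] True by auto
      then show ?thesis by (intro exI[of _ 0]) auto
    next
      case False
      obtain y0 where y0: "y0 \<in> ?S" "\<forall>y\<in>?S. ?k y \<le> ?k y0"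
        using continuous_attains_sup[OF S False continuous_on_subset[OF kc]] by auto
      have "?k y0 \<noteq> 1"
      proof
        assume "?k y0 = 1"
        then obtain k where "y0 = lattice_vec k" using cos_mean_eq_1 by blast
        then have "m y0 = m 0" using periodic_lattice[OF mp, of 0 k] by simp
        then show False using y0(1) m0(2) e by simp
      qed
      then have "?k y0 < 1" using cos_mean_bounds(2)[of y0] by simp
      moreover have "m x < e / 2" if "?k y0 < ?k x" for x
        using red[of x] y0(2) that by fastforce
      ultimately show ?thesis using cos_mean_bounds(1)[of y0] by blast
    qed
  qed
  then obtain q where q: "0 \<le> q" "q < 1" "\<And>x. q < ?k x \<Longrightarrow> m x < e / 2" by blast
  define q' where "q' = (q + 1) / 2"
  have q': "q < q'" "q' < 1" "0 < q'" using q by (auto simp: q'_def)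
  let ?U = "{x. q' < ?k x}"
  have U [measurable]: "?U \<in> sets borel"
    by (intro borel_open open_Collect_less kc continuous_intros)
  define w where "w = measure torus ?U"
  have w: "w > 0"
  proof (rule ccontr)
    assume "\<not> w > 0"
    then have "measure torus ?U = 0" using measure_nonneg[of torus ?U] by (simp add: w_def)
    then have "emeasure torus ?U = 0" by (simp add: torus.emeasure_eq_measure)
    then have "?U \<in> null_sets torus" by auto
    then have ae: "AE x in torus. max (?k x - q') 0 = 0"
      by (rule AE_I'[where N="?U", simplified]) auto
    have "max (?k 0 - q') 0 = 0"
      by (rule continuous_AE_torus[OF _ _ ae])
        (auto intro!: continuous_intros kc periodic_compose[OF kp, of "\<lambda>y. max (y - q') 0"])
    moreover have "?k 0 = 1" by (simp add: cos_mean_def)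
    ultimately show False using q' by simp
  qed
  define v where "v = measure torus (UNIV :: (real^'n) set)"
  have v0: "v \<ge> 0" by (simp add: v_def)
  have "(\<lambda>N. (q / q') ^ N * (Mb * v / w)) \<longlonglongrightarrow> 0 * (Mb * v / w)"
    using q q' by (intro tendsto_mult LIMSEQ_realpow_zero tendsto_const) auto
  then have "\<forall>\<^sub>F N in sequentially. (q / q') ^ N * (Mb * v / w) < e / 2"
    using e by (intro order_tendstoD(2)[of _ "0 * (Mb * v / w)"]) auto
  then obtain N where N: "(q / q') ^ N * (Mb * v / w) < e / 2" by (auto simp: eventually_sequentially)
  define Z where "Z = (LINT h|torus. ?k h ^ N)"
  have ikN: "integrable torus (\<lambda>h. ?k h ^ N)"
    by (intro integrable_torus_continuous continuous_intros kc periodic_compose[OF kp, of "\<lambda>y. y ^ N"])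
  have Zge: "q' ^ N * w \<le> Z"
  proof -
    have "(LINT h|torus. q' ^ N * indicator ?U h) \<le> Z"
      unfolding Z_def
    proof (rule integral_mono[OF _ ikN])
      show "integrable torus (\<lambda>h. q' ^ N * indicator ?U h)" 
      proof (rule integrable_torus)
        show "(\<lambda>h. q' ^ N * indicator ?U h) \<in> borel_measurable borel" by measurable
        show "\<bar>q' ^ N * indicator ?U h\<bar> \<le> q' ^ N" for h using q' by (simp add: indicator_def)
      qed
      show "q' ^ N * indicator ?U h \<le> ?k h ^ N" for h
        using q' cos_mean_bounds(1)[of h] by (cases "h \<in> ?U") (auto intro: power_mono)
    qed
    then show ?thesis by (simp add: w_def)
  qed
  have "0 < q' ^ N * w" using w q' by simp
  then have Zpos: "Z > 0" using Zge by linarith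
  have ikm: "integrable torus (\<lambda>h. ?k h ^ N * m h)"
    by (intro integrable_torus_continuous periodic_mult mp continuous_intros kc mc periodic_compose[OF kp, of "\<lambda>y. y ^ N"])
  have "(LINT h|torus. ?k h ^ N * m h) \<le> (LINT h|torus. (e / 2) * ?k h ^ N + q ^ N * Mb)"
  proof (rule integral_mono[OF ikm])
    show "integrable torus (\<lambda>h. (e / 2) * ?k h ^ N + q ^ N * Mb)" using ikN torus.integrable_const by simp
    fix h
    show "?k h ^ N * m h \<le> (e / 2) * ?k h ^ N + q ^ N * Mb"
    proof (cases "q < ?k h")
      case True
      have "?k h ^ N * m h \<le> ?k h ^ N * (e / 2)"
        using q(3)[OF True] cos_mean_bounds(1)[of h] by (intro mult_left_mono) auto
      then show ?thesis using q Mb(2) by (simp add: mult.commute add_increasing2)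
    next
      case False
      have "?k h ^ N * m h \<le> q ^ N * Mb"
        using False Mb(1)[of h] cos_mean_bounds(1)[of h] m0(1)[of h] q by (intro mult_mono power_mono) auto
      then show ?thesis using e cos_mean_bounds(1)[of h] by (simp add: add_increasing)
    qed
  qed
  also have "\<dots> = (e / 2) * Z + q ^ N * Mb * v"
    using ikN torus.integrable_const by (simp add: Z_def v_def mult_ac)
  finally have main: "(LINT h|torus. ?k h ^ N * m h) \<le> (e / 2) * Z + q ^ N * Mb * v" .
  have "q ^ N * Mb * v < (e / 2) * Z"
  proof -
    have "q ^ N * Mb * v = ((q / q') ^ N * (Mb * v / w)) * (q' ^ N * w)"
      using q' w by (simp add: power_divide)
    also have "\<dots> < (e / 2) * (q' ^ N * w)"
      using N q' w by (intro mult_strict_right_mono mult_pos_pos) auto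
    also have "\<dots> \<le> (e / 2) * Z" using Zge e by (intro mult_left_mono) auto
    finally show ?thesis .
  qed
  with main have lt: "(LINT h|torus. ?k h ^ N * m h) < e * Z" by (simp add: field_simps)
  let ?r = "\<lambda>x. ?k x ^ N / Z"
  have c2: "periodic_C2 ?r (\<lambda>x. (real N * ?k x ^ (N - 1) / Z) *\<^sub>R (\<chi> j. - sin (x $ j) / (2 * real CARD('n))))
      (\<lambda>j x. ((\<chi> j. - sin (x $ j) / (2 * real CARD('n))) $ j) *\<^sub>R ((real N * (real (N - 1) * ?k x ^ (N - 1 - 1)) / Z) *\<^sub>R (\<chi> j. - sin (x $ j) / (2 * real CARD('n))))
        + (real N * ?k x ^ (N - 1) / Z) *\<^sub>R axis j (- cos (x $ j) / (2 * real CARD('n))))"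
    by (rule periodic_C2_compose[OF cos_mean_C2, where \<eta>="\<lambda>y. y ^ N / Z"])
      (use Zpos in \<open>auto intro!: derivative_eq_intros continuous_intros\<close>)
  show ?thesis
  proof (rule that[OF c2])
    show "0 \<le> ?r x" for x using Zpos cos_mean_bounds(1)[of x] by simp
    show "?r (- x) = ?r x" for x by (simp add: cos_mean_def)
    show "(LINT h|torus. ?r h) = 1" using Zpos by (simp add: Z_def)
    have "(LINT h|torus. ?r h * m h) = (LINT h|torus. ?k h ^ N * m h) / Z"
      by (simp add: divide_inverse mult_ac)
    also have "\<dots> < e" using lt Zpos by (simp add: field_simps)
    finally show "(LINT h|torus. ?r h * m h) < e" .
  qed
qed

definition torus_dist :: "(real^'n::finite \<Rightarrow> real) \<Rightarrow> (real^'n \<Rightarrow> real) \<Rightarrow> real" where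
  "torus_dist g k = (LINT x|torus. \<bar>g x - k x\<bar>)"

lemma torus_dist_nonneg: "torus_dist g k \<ge> 0" by (simp add: torus_dist_def)

lemma torus_dist_commute: "torus_dist g k = torus_dist k g" by (simp add: torus_dist_def abs_minus_commute)

lemma torus_dist_triangle:
  assumes "integrable torus g" "integrable torus k" "integrable torus l"
  shows "torus_dist g l \<le> torus_dist g k + torus_dist k l"
proof -
  have "(LINT x|torus. \<bar>g x - l x\<bar>) \<le> (LINT x|torus. \<bar>g x - k x\<bar> + \<bar>k x - l x\<bar>)"
    using assms by (intro integral_mono) auto
  then show ?thesis using assms by (simp add: torus_dist_def)
qed

lemma torus_dist_shift:
  assumes "continuous_on UNIV g" "periodic g" "continuous_on UNIV k" "periodic k"
  shows "torus_dist (\<lambda>x. g (x + h)) (\<lambda>x. k (x + h)) = torus_dist g k"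
proof -
  have c: "continuous_on UNIV (\<lambda>x. \<bar>g x - k x\<bar>)" by (intro continuous_intros assms)
  have p: "periodic (\<lambda>x. \<bar>g x - k x\<bar>)" using assms by (simp add: periodic_def)
  obtain B where "\<And>x. norm \<bar>g x - k x\<bar> \<le> B" using periodic_continuous_bounded[OF p c] by blast
  then show ?thesis
    unfolding torus_dist_def using integral_torus_shift[OF continuous_borel[OF c] p, of B h] by simp
qed

definition translation_modulus :: "(real^'n::finite \<Rightarrow> real) \<Rightarrow> real^'n \<Rightarrow> real" where
  "translation_modulus g h = torus_dist (\<lambda>x. g (x + h)) g"

lemma translation_modulus:
  assumes c: "continuous_on UNIV g" and p: "periodic g"
  shows "continuous_on UNIV (translation_modulus g)" "periodic (translation_modulus g)"
    "translation_modulus g h \<ge> 0" "translation_modulus g 0 = 0"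
proof -
  obtain B where B: "\<And>x. norm (g x) \<le> B" using periodic_continuous_bounded[OF p c] by blast
  note [measurable] = continuous_borel[OF c]
  show "translation_modulus g h \<ge> 0" "translation_modulus g 0 = 0"
    by (simp_all add: translation_modulus_def torus_dist_def)
  have "g (x + (y + axis j (2 * pi))) = g (x + y)" for x y j
    using p by (simp add: periodic_def add.assoc[symmetric])
  then show "periodic (translation_modulus g)"
    by (simp add: translation_modulus_def torus_dist_def periodic_def)
  show "continuous_on UNIV (translation_modulus g)"
    unfolding continuous_on_sequentially
  proof (intro allI ballI impI)
    fix X a assume X: "(\<forall>n. X n \<in> UNIV) \<and> X \<longlonglongrightarrow> (a :: real^'a)"
    have "(\<lambda>n. LINT x|torus. \<bar>g (x + X n) - g x\<bar>) \<longlonglongrightarrow> (LINT x|torus. \<bar>g (x + a) - g x\<bar>)"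
    proof (rule integral_dominated_convergence[where w="\<lambda>_. 2 * B"])
      show "AE x in torus. (\<lambda>n. \<bar>g (x + X n) - g x\<bar>) \<longlonglongrightarrow> \<bar>g (x + a) - g x\<bar>"
      proof (rule AE_I2)
        fix x
        have "(\<lambda>n. g (x + X n)) \<longlonglongrightarrow> g (x + a)"
          by (rule continuous_on_tendsto_compose[OF c]) (use X in \<open>auto intro!: tendsto_intros\<close>)
        then show "(\<lambda>n. \<bar>g (x + X n) - g x\<bar>) \<longlonglongrightarrow> \<bar>g (x + a) - g x\<bar>" by (intro tendsto_intros)
      qed
      show "AE x in torus. norm \<bar>g (x + X n) - g x\<bar> \<le> 2 * B" for n
      proof (rule AE_I2)
        fix x show "norm \<bar>g (x + X n) - g x\<bar> \<le> 2 * B" using B[of "x + X n"] B[of x] by (simp add: abs_le_iff)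
      qed
    qed (auto intro: torus.integrable_const)
    then show "(translation_modulus g \<circ> X) \<longlonglongrightarrow> translation_modulus g a"
      by (simp add: comp_def translation_modulus_def torus_dist_def)
  qed
qed

context viscous_setting
begin

lemma mollified_distance:
  fixes r p q :: "real^'n \<Rightarrow> real"
  assumes r: "continuous_on UNIV r" "periodic r" "\<And>x. r x \<ge> 0" "(LINT h|torus. r h) = 1"
    and p: "continuous_on UNIV p" "periodic p" and q: "continuous_on UNIV q" "periodic q"
  shows "torus_dist p q \<le> (LINT h|torus. r h * (LINT x|torus. \<bar>p x - q (x + h)\<bar>)) + (LINT h|torus. r h * translation_modulus q h)"
    and "(LINT h|torus. r h * (LINT x|torus. \<bar>p x - q (x + h)\<bar>)) \<le> torus_dist p q + (LINT h|torus. r h * translation_modulus q h)"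
proof -
  note tm = translation_modulus[OF q]
  have i1: "integrable torus (\<lambda>h. r h * translation_modulus q h)"
    by (intro integrable_torus_continuous periodic_mult continuous_intros r tm)
  have ir: "integrable torus r" by (intro integrable_torus_continuous r)
  obtain b1 where b1: "\<And>x. norm (r x) \<le> b1" "b1 > 0" using periodic_continuous_bounded[OF r(2,1)] by blast
  obtain b2 where b2: "\<And>x. norm (p x) \<le> b2" using periodic_continuous_bounded[OF p(2,1)] by blast
  obtain b3 where b3: "\<And>x. norm (q x) \<le> b3" using periodic_continuous_bounded[OF q(2,1)] by blast
  have k: "continuous_on UNIV (\<lambda>(h, x). \<bar>p x - q (x + h)\<bar>)"
    by (auto simp: case_prod_beta intro!: continuous_intros continuous_on_compose2[OF p(1)] continuous_on_compose2[OF q(1)])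
  have bk: "\<bar>\<bar>p x - q (x + h)\<bar>\<bar> \<le> b2 + b3" for x h
    using b2[of x] b3[of "x + h"] by simp
  note F = torus_Fubini[OF k bk]
  have i2: "integrable torus (\<lambda>h. r h * (LINT x|torus. \<bar>p x - q (x + h)\<bar>))"
    using F(2,3) b1 continuous_borel[OF r(1)]
    by (intro integrable_torus[where B="b1 * ((b2 + b3) * torus_vol)"]) (auto simp: abs_mult intro!: mult_mono)
  have ip: "integrable torus p" and iq: "integrable torus q" and iqh: "integrable torus (\<lambda>x. q (x + h))" for h
    by (auto intro!: integrable_torus_continuous p q periodic_shift continuous_on_compose2[OF q(1)] continuous_intros)
  have t1: "torus_dist p q \<le> (LINT x|torus. \<bar>p x - q (x + h)\<bar>) + translation_modulus q h" for h
    using torus_dist_triangle[OF ip iqh iq, of h] by (simp add: torus_dist_def translation_modulus_def)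
  have t2: "(LINT x|torus. \<bar>p x - q (x + h)\<bar>) \<le> torus_dist p q + translation_modulus q h" for h
    using torus_dist_triangle[OF ip iq iqh, of h] by (simp add: torus_dist_def translation_modulus_def abs_minus_commute)
  have one: "(LINT h|torus. torus_dist p q * r h) = torus_dist p q" using r(4) by simp
  have "(LINT h|torus. torus_dist p q * r h) \<le> (LINT h|torus. r h * (LINT x|torus. \<bar>p x - q (x + h)\<bar>) + r h * translation_modulus q h)"
  proof (rule integral_mono)
    show "torus_dist p q * r h \<le> r h * (LINT x|torus. \<bar>p x - q (x + h)\<bar>) + r h * translation_modulus q h" for h
      using mult_left_mono[OF t1[of h] r(3)[of h]] by (simp add: algebra_simps)
  qed (use i1 i2 ir in auto)
  then show "torus_dist p q \<le> (LINT h|torus. r h * (LINT x|torus. \<bar>p x - q (x + h)\<bar>)) + (LINT h|torus. r h * translation_modulus q h)"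
    using i1 i2 r(4) by simp
  have "(LINT h|torus. r h * (LINT x|torus. \<bar>p x - q (x + h)\<bar>)) \<le> (LINT h|torus. torus_dist p q * r h + r h * translation_modulus q h)"
  proof (rule integral_mono)
    show "r h * (LINT x|torus. \<bar>p x - q (x + h)\<bar>) \<le> torus_dist p q * r h + r h * translation_modulus q h" for h
      using mult_left_mono[OF t2[of h] r(3)[of h]] by (simp add: algebra_simps)
  qed (use i1 i2 ir in auto)
  then show "(LINT h|torus. r h * (LINT x|torus. \<bar>p x - q (x + h)\<bar>)) \<le> torus_dist p q + (LINT h|torus. r h * translation_modulus q h)"
    using i1 ir r(4) by simp
qed

lemma translation_modulus_perturb:
  fixes q g :: "real^'n \<Rightarrow> real"
  assumes q: "continuous_on UNIV q" "periodic q" and g: "continuous_on UNIV g" "periodic g"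
  shows "translation_modulus q h \<le> 2 * torus_dist q g + translation_modulus g h"
proof -
  have i: "integrable torus q" "integrable torus g" "integrable torus (\<lambda>x. q (x + h))" "integrable torus (\<lambda>x. g (x + h))"
    by (auto intro!: integrable_torus_continuous q g periodic_shift continuous_on_compose2[OF q(1)] continuous_on_compose2[OF g(1)] continuous_intros)
  show ?thesis
    using torus_dist_triangle[OF i(3,4,1)] torus_dist_triangle[OF i(4,2,1)] torus_dist_shift[OF q g, of h]
    by (simp add: translation_modulus_def torus_dist_commute[of g q])
qed

end

section \<open>The vanishing viscosity limit\<close>

lemma pair_slice:
  assumes "(\<lambda>(x, t). w x t) \<in> borel_measurable (borel \<Otimes>\<^sub>M borel)"
  shows "(\<lambda>x. w x t) \<in> borel_measurable borel"
  using measurable_compose[OF measurable_Pair2'[of t borel borel] assms] by simp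

text \<open>
  Measurable in parameters and bounded along with the sequence without any case distinction, and equal to
  the limit where that exists.
\<close>
definition limsup_real :: "(nat \<Rightarrow> real) \<Rightarrow> real" where
  "limsup_real X = real_of_ereal (limsup (\<lambda>n. ereal (X n)))"

lemma limsup_real_limit: "X \<longlonglongrightarrow> l \<Longrightarrow> limsup_real X = l"
  using lim_imp_Limsup[of sequentially "\<lambda>n. ereal (X n)" "ereal l"] by (simp add: limsup_real_def)

lemma limsup_real_bound:
  assumes "\<And>n. \<bar>X n\<bar> \<le> M"
  shows "\<bar>limsup_real X\<bar> \<le> M"
proof -
  have 1: "limsup (\<lambda>n. ereal (X n)) \<le> ereal M"
    using assms by (intro Limsup_bounded always_eventually) (auto simp: abs_le_iff)
  have 2: "ereal (- M) \<le> limsup (\<lambda>n. ereal (X n))"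
  proof (rule le_Limsup)
    show "\<forall>\<^sub>F n in sequentially. ereal (- M) \<le> ereal (X n)"
      using assms by (intro always_eventually) (auto simp: abs_le_iff minus_le_iff)
  qed simp
  show ?thesis
    using 1 2 unfolding limsup_real_def by (cases "limsup (\<lambda>n. ereal (X n))") (auto simp: abs_le_iff)
qed

lemma limsup_real_measurable [measurable (raw)]:
  assumes [measurable]: "\<And>n. f n \<in> borel_measurable M"
  shows "(\<lambda>x. limsup_real (\<lambda>n. f n x)) \<in> borel_measurable M"
  unfolding limsup_real_def by measurable

text \<open>
  The increments are summable in mean, hence absolutely summable at almost every point.
\<close>
lemma fast_L1_cauchy_limit:
  fixes g :: "nat \<Rightarrow> real^'n::finite \<Rightarrow> real"
  assumes m [measurable]: "\<And>n. g n \<in> borel_measurable borel" and b: "\<And>n x. \<bar>g n x\<bar> \<le> M"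
    and d: "\<And>n. torus_dist (g (Suc n)) (g n) \<le> (1/2) ^ n"
  shows "AE x in torus. (\<lambda>n. g n x) \<longlonglongrightarrow> limsup_real (\<lambda>n. g n x)"
    and "(\<lambda>n. torus_dist (g n) (\<lambda>x. limsup_real (\<lambda>n. g n x))) \<longlonglongrightarrow> 0"
proof -
  have i: "integrable torus (g n)" for n using b by (intro integrable_torus[where B=M] m)
  have nn: "(\<integral>\<^sup>+x. ennreal \<bar>g (Suc n) x - g n x\<bar> \<partial>torus) \<le> ennreal ((1/2) ^ n)" for n
    using i[of n] i[of "Suc n"] d[of n] by (subst nn_integral_eq_integral) (auto simp: torus_dist_def intro: ennreal_leI)
  have "(\<integral>\<^sup>+x. (\<Sum>n. ennreal \<bar>g (Suc n) x - g n x\<bar>) \<partial>torus) = (\<Sum>n. \<integral>\<^sup>+x. ennreal \<bar>g (Suc n) x - g n x\<bar> \<partial>torus)"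
    by (rule nn_integral_suminf) measurable
  also have "\<dots> \<le> (\<Sum>n. ennreal ((1/2) ^ n))"
    by (intro suminf_le nn) auto
  also have "\<dots> = ennreal (\<Sum>n. (1/2) ^ n)"
    by (intro suminf_ennreal2) (auto intro: summable_geometric)
  also have "\<dots> < \<infinity>" by simp
  finally have "(\<integral>\<^sup>+x. (\<Sum>n. ennreal \<bar>g (Suc n) x - g n x\<bar>) \<partial>torus) \<noteq> \<infinity>" by simp
  then have "AE x in torus. (\<Sum>n. ennreal \<bar>g (Suc n) x - g n x\<bar>) \<noteq> \<infinity>"
    by (intro nn_integral_PInf_AE) measurable
  then show ae: "AE x in torus. (\<lambda>n. g n x) \<longlonglongrightarrow> limsup_real (\<lambda>n. g n x)"
  proof eventually_elim
    fix x assume "(\<Sum>n. ennreal \<bar>g (Suc n) x - g n x\<bar>) \<noteq> \<infinity>"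
    then have "summable (\<lambda>n. \<bar>g (Suc n) x - g n x\<bar>)"
      by (intro summable_suminf_not_top) auto
    then have "summable (\<lambda>n. g (Suc n) x - g n x)" by (rule summable_rabs_cancel)
    then obtain l where "(\<lambda>n. \<Sum>k<n. g (Suc k) x - g k x) \<longlonglongrightarrow> l"
      by (auto simp: summable_def sums_def)
    then have "(\<lambda>n. g n x - g 0 x) \<longlonglongrightarrow> l" by (simp add: sum_lessThan_telescope[of "\<lambda>k. g k x"])
    then have "(\<lambda>n. g n x - g 0 x + g 0 x) \<longlonglongrightarrow> l + g 0 x" by (intro tendsto_intros)
    then have "(\<lambda>n. g n x) \<longlonglongrightarrow> l + g 0 x" by simp
    then show "(\<lambda>n. g n x) \<longlonglongrightarrow> limsup_real (\<lambda>n. g n x)" using limsup_real_limit by force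
  qed
  have "(\<lambda>n. LINT x|torus. \<bar>g n x - limsup_real (\<lambda>n. g n x)\<bar>) \<longlonglongrightarrow> (LINT x|(torus :: (real^'n) measure). 0)"
  proof (rule integral_dominated_convergence[where w="\<lambda>_. 2 * M"])
    show "AE x in torus. (\<lambda>n. \<bar>g n x - limsup_real (\<lambda>n. g n x)\<bar>) \<longlonglongrightarrow> 0"
      using ae by eventually_elim (intro tendsto_rabs_zero, simp add: LIM_zero)
    show "AE x in torus. norm \<bar>g n x - limsup_real (\<lambda>n. g n x)\<bar> \<le> 2 * M" for n
    proof (rule AE_I2)
      fix x show "norm \<bar>g n x - limsup_real (\<lambda>n. g n x)\<bar> \<le> 2 * M"
      proof -
        have "\<bar>limsup_real (\<lambda>n. g n x)\<bar> \<le> M" by (rule limsup_real_bound) (rule b)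
        then have "\<bar>g n x - limsup_real (\<lambda>n. g n x)\<bar> \<le> 2 * M" using b[of n x] by linarith
        then show ?thesis by simp
      qed
    qed
  qed (auto intro: torus.integrable_const)
  then show "(\<lambda>n. torus_dist (g n) (\<lambda>x. limsup_real (\<lambda>n. g n x))) \<longlonglongrightarrow> 0"
    by (simp add: torus_dist_def)
qed

text \<open>
  Values for the endpoints of the time interval: the curve is sampled at times that approach \<open>z\<close> so fast that
  the samples converge almost everywhere.
\<close>
lemma endpoint_limit:
  fixes U :: "real^'n::finite \<Rightarrow> real \<Rightarrow> real"
  assumes T: "T > 0" and z: "z = 0 \<or> z = T"
    and m: "\<And>t. 0 < t \<Longrightarrow> t < T \<Longrightarrow> (\<lambda>x. U x t) \<in> borel_measurable borel"
    and p: "\<And>t. 0 < t \<Longrightarrow> t < T \<Longrightarrow> periodic (\<lambda>x. U x t)"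
    and b: "\<And>t x. 0 < t \<Longrightarrow> t < T \<Longrightarrow> \<bar>U x t\<bar> \<le> M"
    and mod: "\<And>e. e > 0 \<Longrightarrow> \<exists>\<sigma>>0. \<forall>s t. 0 < s \<longrightarrow> s < T \<longrightarrow> 0 < t \<longrightarrow> t < T \<longrightarrow> \<bar>s - t\<bar> < \<sigma> \<longrightarrow>
        torus_dist (\<lambda>x. U x s) (\<lambda>x. U x t) \<le> e"
  obtains G where "G \<in> borel_measurable borel" "periodic G" "\<And>x. \<bar>G x\<bar> \<le> M"
    "\<And>e. e > 0 \<Longrightarrow> \<exists>\<sigma>>0. \<forall>t. 0 < t \<longrightarrow> t < T \<longrightarrow> \<bar>t - z\<bar> < \<sigma> \<longrightarrow> torus_dist (\<lambda>x. U x t) G \<le> e"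
proof -
  have "\<forall>n. \<exists>\<sigma>>0. \<forall>s t. 0 < s \<longrightarrow> s < T \<longrightarrow> 0 < t \<longrightarrow> t < T \<longrightarrow> \<bar>s - t\<bar> < \<sigma> \<longrightarrow>
        torus_dist (\<lambda>x. U x s) (\<lambda>x. U x t) \<le> (1/2) ^ n"
    using mod by simp
  then obtain \<sigma> where \<sigma>: "\<And>n::nat. \<sigma> n > 0" "\<And>n s t. 0 < s \<Longrightarrow> s < T \<Longrightarrow> 0 < t \<Longrightarrow> t < T \<Longrightarrow> \<bar>s - t\<bar> < \<sigma> n \<Longrightarrow>
        torus_dist (\<lambda>x. U x s) (\<lambda>x. U x t) \<le> (1/2) ^ n" by metis
  \<comment> \<open>Dividing by \<open>n + 2\<close> makes the distances tend to zero and keeps them below half of \<open>\<sigma> n\<close> and of \<open>T\<close>.\<close>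
  define d where "d n = Min (insert T (\<sigma> ` {..n})) / real (n + 2)" for n
  have minpos: "Min (insert T (\<sigma> ` {..n})) > 0" for n using T \<sigma>(1) by (subst Min_gr_iff) auto
  have dpos: "d n > 0" for n using minpos[of n] by (simp add: d_def)
  have dle: "d n \<le> Min (insert T (\<sigma> ` {..n})) / 2" for n
    unfolding d_def by (intro divide_left_mono less_imp_le[OF minpos]) auto
  have dT: "d n \<le> T / 2" for n using dle[of n] Min_le[of "insert T (\<sigma> ` {..n})" T] by simp
  have d\<sigma>: "d k \<le> \<sigma> n / 2" if "n \<le> k" for n k
    using dle[of k] Min_le[of "insert T (\<sigma> ` {..k})" "\<sigma> n"] that by simp
  have d0: "d \<longlonglongrightarrow> 0"
  proof (rule Lim_null_comparison)
    show "\<forall>\<^sub>F n in sequentially. norm (d n) \<le> T / real (n + 2)"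
    proof (rule always_eventually, rule allI)
      fix n show "norm (d n) \<le> T / real (n + 2)"
      proof -
        have "d n \<le> T / real (n + 2)" unfolding d_def by (intro divide_right_mono Min_le) auto
        then show ?thesis using dpos[of n] by simp
      qed
    qed
    show "(\<lambda>n. T / real (n + 2)) \<longlonglongrightarrow> 0"
      using LIMSEQ_ignore_initial_segment[OF tendsto_divide_0[OF tendsto_const filterlim_real_sequentially[THEN filterlim_at_top_imp_at_infinity], of T], of 2]
      by simp
  qed
  define \<tau> where "\<tau> n = (if z = 0 then d n else T - d n)" for n
  have \<tau>: "0 < \<tau> n" "\<tau> n < T" "\<bar>\<tau> n - z\<bar> = d n" for n
    using dpos[of n] dT[of n] T z by (auto simp: \<tau>_def)
  have \<tau>d: "\<bar>\<tau> (Suc n) - \<tau> n\<bar> < \<sigma> n" for n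
    using dpos[of n] dpos[of "Suc n"] d\<sigma>[of n n] d\<sigma>[of n "Suc n"] \<sigma>(1)[of n] by (auto simp: \<tau>_def abs_less_iff)
  define G where "G x = limsup_real (\<lambda>n. U x (\<tau> n))" for x
  have mU [measurable]: "(\<lambda>x. U x (\<tau> n)) \<in> borel_measurable borel" for n using m \<tau> by blast
  have bU: "\<bar>U x (\<tau> n)\<bar> \<le> M" for x n using b \<tau> by blast
  have lim: "(\<lambda>n. torus_dist (\<lambda>x. U x (\<tau> n)) G) \<longlonglongrightarrow> 0"
    unfolding G_def[abs_def]
    by (rule fast_L1_cauchy_limit(2)[OF mU bU]) (use \<sigma>(2) \<tau> \<tau>d in blast)
  have Gm: "G \<in> borel_measurable borel" unfolding G_def[abs_def] by measurable
  have Gb: "\<bar>G x\<bar> \<le> M" for x unfolding G_def by (rule limsup_real_bound) (rule bU)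
  have Gp: "periodic G" unfolding G_def[abs_def] periodic_def using p \<tau> by (auto simp: periodic_def)
  have iU: "integrable torus (\<lambda>x. U x t)" if "0 < t" "t < T" for t
    using m[OF that] b[OF that] by (intro integrable_torus[where B=M]) auto
  have iG: "integrable torus G" by (rule integrable_torus[OF Gm Gb])
  show ?thesis
  proof (rule that[OF Gm Gp Gb])
    fix e :: real assume e: "e > 0"
    then obtain s where s: "s > 0" "\<And>s' t. 0 < s' \<Longrightarrow> s' < T \<Longrightarrow> 0 < t \<Longrightarrow> t < T \<Longrightarrow> \<bar>s' - t\<bar> < s \<Longrightarrow>
        torus_dist (\<lambda>x. U x s') (\<lambda>x. U x t) \<le> e / 2" using mod[of "e / 2"] by auto
    have "torus_dist (\<lambda>x. U x t) G \<le> e" if t: "0 < t" "t < T" "\<bar>t - z\<bar> < s / 2" for t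
    proof -
      have "\<forall>\<^sub>F n in sequentially. torus_dist (\<lambda>x. U x (\<tau> n)) G < e / 2"
        using lim e by (intro order_tendstoD(2)) auto
      moreover have "\<forall>\<^sub>F n in sequentially. d n < s / 2"
        using d0 s by (intro order_tendstoD(2)) auto
      ultimately have "\<forall>\<^sub>F n in sequentially. torus_dist (\<lambda>x. U x (\<tau> n)) G < e / 2 \<and> d n < s / 2"
        by (rule eventually_conj)
      then obtain n where n: "torus_dist (\<lambda>x. U x (\<tau> n)) G < e / 2" "d n < s / 2"
        by (auto simp: eventually_sequentially)
      have "\<bar>t - \<tau> n\<bar> < s" using t(3) \<tau>(3)[of n] n(2) by linarith
      then have "torus_dist (\<lambda>x. U x t) (\<lambda>x. U x (\<tau> n)) \<le> e / 2" using t \<tau> by (intro s(2)) auto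
      then show ?thesis
        using torus_dist_triangle[OF iU[OF t(1,2)] iU[OF \<tau>(1,2)] iG, of n] n(1) by linarith
    qed
    then show "\<exists>\<sigma>>0. \<forall>t. 0 < t \<longrightarrow> t < T \<longrightarrow> \<bar>t - z\<bar> < \<sigma> \<longrightarrow> torus_dist (\<lambda>x. U x t) G \<le> e"
      using s(1) by (intro exI[of _ "s / 2"]) auto
  qed
qed

text \<open>
  Here \<open>b\<close> stands for a bounded Borel representative of the datum.
\<close>
locale viscous_family = viscous_setting f f' \<nu>
  for f f' :: "'n::finite \<Rightarrow> real \<Rightarrow> real" and \<nu> :: "(real^'n) measure" +
  fixes T M :: real and b :: "real^'n \<Rightarrow> real"
    and V V' :: "real \<Rightarrow> real^'n \<Rightarrow> real \<Rightarrow> real" and D :: "real \<Rightarrow> real^'n \<Rightarrow> real \<Rightarrow> real^'n"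
    and H :: "real \<Rightarrow> 'n \<Rightarrow> real^'n \<Rightarrow> real \<Rightarrow> real^'n"
  assumes T: "T > 0" and M: "M > 0"
    and b_meas [measurable]: "b \<in> borel_measurable borel" and b_bound: "\<And>x. \<bar>b x\<bar> \<le> M"
    and solution: "\<And>\<epsilon>. \<epsilon> > 0 \<Longrightarrow> viscous_solution f' \<nu> \<epsilon> T (V \<epsilon>) (V' \<epsilon>) (D \<epsilon>) (H \<epsilon>)"
    and initial: "\<And>\<epsilon>. \<epsilon> > 0 \<Longrightarrow> ((\<lambda>t. torus_dist (\<lambda>x. V \<epsilon> x t) b) \<longlongrightarrow> 0) (at_right 0)"
begin

lemma V_cont: "\<epsilon> > 0 \<Longrightarrow> 0 < t \<Longrightarrow> t < T \<Longrightarrow> continuous_on UNIV (\<lambda>x. V \<epsilon> x t)"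
  and V_periodic: "\<epsilon> > 0 \<Longrightarrow> 0 < t \<Longrightarrow> t < T \<Longrightarrow> periodic (\<lambda>x. V \<epsilon> x t)"
  using viscous_solutionD(5,10)[OF solution] by blast+

lemma V_bound: "\<epsilon> > 0 \<Longrightarrow> 0 < t \<Longrightarrow> t < T \<Longrightarrow> \<bar>V \<epsilon> x t\<bar> \<le> M"
  using max_principle[OF solution _ b_meas b_bound] initial by (simp add: torus_dist_def)

lemma V_integrable: "\<epsilon> > 0 \<Longrightarrow> 0 < t \<Longrightarrow> t < T \<Longrightarrow> integrable torus (\<lambda>x. V \<epsilon> x t)"
  by (intro integrable_torus_continuous V_cont V_periodic)

lemma b_integrable: "integrable torus b"
  by (rule integrable_torus[OF b_meas b_bound])

text \<open>
  A translate in time is a solution, so that by contraction the distance between the times \<open>t\<close> and \<open>t + \<tau>\<close> is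
  at most that between \<open>s\<close> and \<open>s + \<tau>\<close> for small \<open>s\<close>, when both states are close to the datum.
\<close>
lemma V_time_modulus:
  assumes \<epsilon>: "\<epsilon> > 0" and e: "e > 0"
  shows "\<exists>\<sigma>>0. \<forall>s t. 0 < s \<longrightarrow> s < T \<longrightarrow> 0 < t \<longrightarrow> t < T \<longrightarrow> \<bar>s - t\<bar> < \<sigma> \<longrightarrow>
        torus_dist (\<lambda>x. V \<epsilon> x s) (\<lambda>x. V \<epsilon> x t) \<le> e"
proof -
  have "\<forall>\<^sub>F t in at_right 0. torus_dist (\<lambda>x. V \<epsilon> x t) b < e / 2"
    using initial[OF \<epsilon>] e by (intro order_tendstoD(2)) auto
  then obtain \<sigma> where \<sigma>: "\<sigma> > 0" "\<And>t. 0 < t \<Longrightarrow> t < \<sigma> \<Longrightarrow> torus_dist (\<lambda>x. V \<epsilon> x t) b < e / 2"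
    unfolding eventually_at_right_field by auto
  have le: "torus_dist (\<lambda>x. V \<epsilon> x (t + \<tau>)) (\<lambda>x. V \<epsilon> x t) \<le> e" if t: "0 < t" "0 \<le> \<tau>" "\<tau> < \<sigma> / 2" "t + \<tau> < T" for t \<tau>
  proof -
    \<comment> \<open>Both \<open>s\<close> and \<open>s + \<tau>\<close> are below \<open>\<sigma>\<close>.\<close>
    define s where "s = min t (\<sigma> / 2) / 2"
    have s: "0 < s" "s \<le> t" "s < \<sigma> / 2" using t \<sigma> by (auto simp: s_def)
    have sh1: "viscous_solution f' \<nu> \<epsilon> (T - \<tau>) (\<lambda>x t. V \<epsilon> x (t + \<tau>)) (\<lambda>x t. V' \<epsilon> x (t + \<tau>))
       (\<lambda>x t. D \<epsilon> x (t + \<tau>)) (\<lambda>j x t. H \<epsilon> j x (t + \<tau>))"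
      using viscous_solution_shift[OF solution[OF \<epsilon>] t(2), of 0] by simp
    have sh0: "viscous_solution f' \<nu> \<epsilon> (T - \<tau>) (V \<epsilon>) (V' \<epsilon>) (D \<epsilon>) (H \<epsilon>)"
      using solution[OF \<epsilon>] t unfolding viscous_solution_def
      by (auto intro: continuous_on_subset)
    have "torus_dist (\<lambda>x. V \<epsilon> x (t + \<tau>)) (\<lambda>x. V \<epsilon> x t) \<le> torus_dist (\<lambda>x. V \<epsilon> x (s + \<tau>)) (\<lambda>x. V \<epsilon> x s)"
      unfolding torus_dist_def using \<epsilon> s t by (intro L1_contraction[OF sh1 sh0]) auto
    also have "\<dots> \<le> torus_dist (\<lambda>x. V \<epsilon> x (s + \<tau>)) b + torus_dist b (\<lambda>x. V \<epsilon> x s)"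
      using s t \<epsilon> by (intro torus_dist_triangle V_integrable b_integrable) auto
    also have "\<dots> \<le> e / 2 + e / 2"
      unfolding torus_dist_commute[of b] using s t \<sigma>(1) by (intro add_mono less_imp_le \<sigma>(2)) auto
    finally show ?thesis by simp
  qed
  have "torus_dist (\<lambda>x. V \<epsilon> x s) (\<lambda>x. V \<epsilon> x t) \<le> e" if "0 < s" "s < T" "0 < t" "t < T" "\<bar>s - t\<bar> < \<sigma> / 2" for s t
  proof (cases "s \<le> t")
    case True
    then show ?thesis using le[of s "t - s"] that by (simp add: torus_dist_commute)
  next
    case False
    then show ?thesis using le[of t "s - t"] that by simp
  qed
  then show ?thesis using \<sigma>(1) by (intro exI[of _ "\<sigma> / 2"]) auto
qed

text \<open>
  Doubling compares the mollified distances at the times \<open>s\<close> and \<open>t\<close>. Passing between these and the plain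
  distances costs the translation modulus of the solution, which by contraction is largest at time \<open>s\<close>, and
  there is controlled by that of any \<open>g\<close> near the datum. Then \<open>s\<close> tends to zero.
\<close>
lemma doubling_estimate:
  fixes r g :: "real^'n \<Rightarrow> real"
  assumes \<epsilon>: "\<epsilon> > 0" "\<delta> > 0" and t: "0 < t" "t < T"
    and r: "periodic_C2 r R Q" "\<And>x. r x \<ge> 0" "\<And>x. r (- x) = r x" "(LINT h|torus. r h) = 1"
    and Lr: "\<And>x. \<bar>\<Sum>j\<in>UNIV. Q j x $ j\<bar> \<le> Lr"
    and g: "continuous_on UNIV g" "periodic g"
  shows "torus_dist (\<lambda>x. V \<epsilon> x t) (\<lambda>x. V \<delta> x t) \<le> 4 * torus_dist g b + 2 * (LINT h|torus. r h * translation_modulus g h)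
     + T * ((\<epsilon> + \<delta>) * (8 * M * Lr * torus_vol * torus_vol))"
proof -
  note R = periodic_C2_continuous[OF r(1)]
  let ?A = "LINT h|torus. r h * translation_modulus g h" and ?Z = "(\<epsilon> + \<delta>) * (8 * M * Lr * torus_vol * torus_vol)"
  have Lr0: "Lr \<ge> 0" using Lr[of 0] by linarith
  have Z0: "?Z \<ge> 0" using \<epsilon> M Lr0 torus_vol_nonneg by simp
  have ir: "integrable torus r" by (intro integrable_torus_continuous R)
  have ig: "integrable torus g" by (intro integrable_torus_continuous g)
  have im: "integrable torus (\<lambda>h. r h * translation_modulus q h)" if "continuous_on UNIV q" "periodic q" for q
    by (intro integrable_torus_continuous periodic_mult continuous_intros R translation_modulus that)
  let ?P = "\<lambda>s x. V \<epsilon> x s" and ?Q = "\<lambda>s x. V \<delta> x s"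
  have main: "torus_dist (?P t) (?Q t) \<le> torus_dist (?P s) b + 5 * torus_dist (?Q s) b + 4 * torus_dist g b + 2 * ?A + T * ?Z"
    if s: "0 < s" "s < t" for s
  proof -
    have sT: "0 < s" "s < T" using s t by auto
    note P = V_cont[OF \<epsilon>(1)] V_periodic[OF \<epsilon>(1)] V_cont[OF \<epsilon>(2)] V_periodic[OF \<epsilon>(2)]
    have 1: "torus_dist (?P t) (?Q t) \<le> (LINT h|torus. r h * (LINT x|torus. \<bar>V \<epsilon> x t - V \<delta> (x + h) t\<bar>))
        + (LINT h|torus. r h * translation_modulus (?Q t) h)"
      by (intro mollified_distance(1) R r P t)
    have 2: "(LINT h|torus. r h * (LINT x|torus. \<bar>V \<epsilon> x t - V \<delta> (x + h) t\<bar>))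
        \<le> (LINT h|torus. r h * (LINT x|torus. \<bar>V \<epsilon> x s - V \<delta> (x + h) s\<bar>)) + (t - s) * ?Z"
      using \<epsilon> s t by (intro doubling[OF solution[OF \<epsilon>(1)] solution[OF \<epsilon>(2)] _ _ M V_bound V_bound r(1,2,3) Lr]) auto
    have 3: "(LINT h|torus. r h * (LINT x|torus. \<bar>V \<epsilon> x s - V \<delta> (x + h) s\<bar>))
        \<le> torus_dist (?P s) (?Q s) + (LINT h|torus. r h * translation_modulus (?Q s) h)"
      by (intro mollified_distance(2) R r P sT)
    have 4: "(LINT h|torus. r h * translation_modulus (?Q t) h) \<le> (LINT h|torus. r h * translation_modulus (?Q s) h)"
    proof (intro integral_mono im P t sT mult_left_mono r(2))
      fix h
      have "viscous_solution f' \<nu> \<delta> T (\<lambda>x t. V \<delta> (x + h) t) (\<lambda>x t. V' \<delta> (x + h) t) (\<lambda>x t. D \<delta> (x + h) t) (\<lambda>j x t. H \<delta> j (x + h) t)"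
        using viscous_solution_shift[OF solution[OF \<epsilon>(2)], of 0 h] by simp
      from L1_contraction[OF this solution[OF \<epsilon>(2)]]
      show "translation_modulus (?Q t) h \<le> translation_modulus (?Q s) h"
        using \<epsilon> s t by (simp add: translation_modulus_def torus_dist_def)
    qed
    have 5: "(LINT h|torus. r h * translation_modulus (?Q s) h) \<le> 2 * torus_dist (?Q s) g + ?A"
    proof -
      have "(LINT h|torus. r h * translation_modulus (?Q s) h) \<le> (LINT h|torus. (2 * torus_dist (?Q s) g) * r h + r h * translation_modulus g h)"
      proof (rule integral_mono)
        show "r h * translation_modulus (?Q s) h \<le> (2 * torus_dist (?Q s) g) * r h + r h * translation_modulus g h" for h
          using mult_left_mono[OF translation_modulus_perturb[OF P(3,4)[OF sT] g, of h] r(2)[of h]] by (simp add: algebra_simps)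
      qed (use im[OF g] im[OF P(3,4)[OF sT]] ir in auto)
      then show ?thesis using ir im[OF g] r(4) by simp
    qed
    have 6: "torus_dist (?P s) (?Q s) \<le> torus_dist (?P s) b + torus_dist (?Q s) b"
      using torus_dist_triangle[OF V_integrable[OF \<epsilon>(1) sT] b_integrable V_integrable[OF \<epsilon>(2) sT]] by (simp add: torus_dist_commute[of b])
    have 7: "torus_dist (?Q s) g \<le> torus_dist (?Q s) b + torus_dist g b"
      using torus_dist_triangle[OF V_integrable[OF \<epsilon>(2) sT] b_integrable ig] by (simp add: torus_dist_commute[of b])
    have "(t - s) * ?Z \<le> T * ?Z" using t s Z0 by (intro mult_right_mono) auto
    with 1 2 3 4 5 6 7 show ?thesis by linarith
  qed
  show ?thesis
  proof (rule tendsto_lowerbound[of "\<lambda>s. torus_dist (?P s) b + 5 * torus_dist (?Q s) b + 4 * torus_dist g b + 2 * ?A + T * ?Z" _ "at_right 0"])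
    show "((\<lambda>s. torus_dist (?P s) b + 5 * torus_dist (?Q s) b + 4 * torus_dist g b + 2 * ?A + T * ?Z) \<longlongrightarrow>
        4 * torus_dist g b + 2 * ?A + T * ?Z) (at_right 0)"
      by (auto intro!: tendsto_eq_intros initial \<epsilon>)
    show "\<forall>\<^sub>F s in at_right 0. torus_dist (?P t) (?Q t) \<le> torus_dist (?P s) b + 5 * torus_dist (?Q s) b + 4 * torus_dist g b + 2 * ?A + T * ?Z"
      unfolding eventually_at_right_field using main t by blast
  qed simp
qed

text \<open>
  The auxiliary function is the solution with viscosity one at a small time: it is continuous and close to
  the datum in mean. The mollifier depends on it alone, so that \<open>\<epsilon>\<close> and \<open>\<delta>\<close> can be chosen last.
\<close>
lemma viscosity_cauchy:
  assumes e: "e > 0"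
  shows "\<exists>\<epsilon>0>0. \<forall>\<epsilon> \<delta> t. 0 < \<epsilon> \<longrightarrow> \<epsilon> < \<epsilon>0 \<longrightarrow> 0 < \<delta> \<longrightarrow> \<delta> < \<epsilon>0 \<longrightarrow> 0 < t \<longrightarrow> t < T \<longrightarrow>
    torus_dist (\<lambda>x. V \<epsilon> x t) (\<lambda>x. V \<delta> x t) \<le> e"
proof -
  have "\<forall>\<^sub>F t in at_right 0. torus_dist (\<lambda>x. V 1 x t) b < e / 16"
    using initial[of 1] e by (intro order_tendstoD(2)) auto
  then obtain \<sigma> where \<sigma>: "\<sigma> > 0" "\<And>t. 0 < t \<Longrightarrow> t < \<sigma> \<Longrightarrow> torus_dist (\<lambda>x. V 1 x t) b < e / 16"
    unfolding eventually_at_right_field by auto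
  \<comment> \<open>The budget: \<open>4 (e / 16) + 2 (e / 8)\<close> for auxiliary function and mollifier, and \<open>e / 4\<close> for the diffusion.\<close>
  define s where "s = min \<sigma> T / 2"
  have s: "0 < s" "s < \<sigma>" "s < T" using \<sigma> T by (auto simp: s_def)
  define g where "g x = V 1 x s" for x
  have g: "continuous_on UNIV g" "periodic g"
    unfolding g_def[abs_def] using s by (auto intro!: V_cont V_periodic)
  have gb: "torus_dist g b < e / 16" unfolding g_def[abs_def] by (rule \<sigma>(2)[OF s(1,2)])
  have e8: "e / 8 > 0" using e by simp
  obtain r R Q where r: "periodic_C2 r R Q" "\<And>x. r x \<ge> 0" "\<And>x. r (- x) = r x"
    "(LINT h|torus. r h) = 1" "(LINT h|torus. r h * translation_modulus g h) < e / 8"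
    using cos_mean_mollifier[OF translation_modulus[OF g] e8] by blast
  note R = periodic_C2_continuous[OF r(1)]
  have pQ: "periodic (\<lambda>x. \<Sum>j\<in>UNIV. Q j x $ j)" using R(6) by (simp add: periodic_def)
  have cQ: "continuous_on UNIV (\<lambda>x. \<Sum>j\<in>UNIV. Q j x $ j)" by (intro continuous_intros R)
  obtain Lr where Lr: "\<And>x. norm (\<Sum>j\<in>UNIV. Q j x $ j) \<le> Lr" "Lr > 0"
    using periodic_continuous_bounded[OF pQ cQ] by blast
  let ?Z = "8 * M * Lr * torus_vol * torus_vol"
  have Z0: "?Z \<ge> 0" using M Lr torus_vol_nonneg by simp
  define \<epsilon>0 where "\<epsilon>0 = e / (8 * (T * ?Z + 1))"
  have TZ: "T * ?Z + 1 > 0" using mult_nonneg_nonneg[OF less_imp_le[OF T] Z0] by linarith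
  have "\<epsilon>0 > 0" using e TZ by (simp add: \<epsilon>0_def)
  moreover have "torus_dist (\<lambda>x. V \<epsilon> x t) (\<lambda>x. V \<delta> x t) \<le> e"
    if ed: "0 < \<epsilon>" "\<epsilon> < \<epsilon>0" "0 < \<delta>" "\<delta> < \<epsilon>0" and t: "0 < t" "t < T" for \<epsilon> \<delta> t
  proof -
    have "torus_dist (\<lambda>x. V \<epsilon> x t) (\<lambda>x. V \<delta> x t) \<le> 4 * torus_dist g b + 2 * (LINT h|torus. r h * translation_modulus g h)
     + T * ((\<epsilon> + \<delta>) * ?Z)"
      using Lr by (intro doubling_estimate[OF ed(1,3) t r(1,2,3,4) _ g]) auto
    moreover have "T * ((\<epsilon> + \<delta>) * ?Z) \<le> (\<epsilon>0 + \<epsilon>0) * (T * ?Z + 1)"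
    proof -
      have "T * ((\<epsilon> + \<delta>) * ?Z) = (\<epsilon> + \<delta>) * (T * ?Z)" by simp
      also have "\<dots> \<le> (\<epsilon>0 + \<epsilon>0) * (T * ?Z + 1)"
        using ed T Z0 by (intro mult_mono) auto
      finally show ?thesis .
    qed
    moreover have "(\<epsilon>0 + \<epsilon>0) * (T * ?Z + 1) = e / 4"
    proof -
      have "(e / (8 * X) + e / (8 * X)) * X = e / 4" if "X > 0" for X using that by (simp add: field_simps)
      from this[OF TZ] show ?thesis by (simp only: \<epsilon>0_def)
    qed
    ultimately show ?thesis using gb r(5) e by linarith
  qed
  ultimately show ?thesis by blast
qed

text \<open>
  Extended by zero in time, the solutions are Borel functions on the whole of space-time.
\<close>
definition W :: "real \<Rightarrow> real^'n \<Rightarrow> real \<Rightarrow> real" where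
  "W \<epsilon> x t = indicator {0<..<T} t * V \<epsilon> x t"

lemma W_eq: "0 < t \<Longrightarrow> t < T \<Longrightarrow> W \<epsilon> x t = V \<epsilon> x t"
  by (simp add: W_def)

lemma W_measurable:
  assumes "\<epsilon> > 0"
  shows "(\<lambda>(x, t). W \<epsilon> x t) \<in> borel_measurable (borel \<Otimes>\<^sub>M borel)"
proof -
  have "continuous_on (UNIV \<times> {0<..<T}) (\<lambda>(x, t). V \<epsilon> x t)"
    using solution[OF assms] unfolding viscous_solution_def by blast
  then have "(\<lambda>p. indicator (UNIV \<times> {0<..<T}) p *\<^sub>R (case p of (x, t) \<Rightarrow> V \<epsilon> x t)) \<in> borel_measurable borel"
    by (intro borel_measurable_continuous_on_indicator) (auto intro!: borel_open open_Times)
  also have "(\<lambda>p. indicator (UNIV \<times> {0<..<T}) p *\<^sub>R (case p of (x, t) \<Rightarrow> V \<epsilon> x t)) = (\<lambda>(x, t). W \<epsilon> x t)"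
    by (auto simp: W_def fun_eq_iff indicator_def)
  finally show ?thesis by (simp add: borel_prod)
qed

lemma W_bound: "\<epsilon> > 0 \<Longrightarrow> \<bar>W \<epsilon> x t\<bar> \<le> M"
  using V_bound[of \<epsilon> t x] M by (auto simp: W_def indicator_def)

lemma W_periodic: "\<epsilon> > 0 \<Longrightarrow> periodic (\<lambda>x. W \<epsilon> x t)"
  using V_periodic[of \<epsilon> t] by (auto simp: W_def periodic_def indicator_def)

text \<open>
  Along viscosities that decrease so fast that the \<open>n\<close>-th solution is within \<open>(1/2) ^ n\<close> of all later ones,
  the solutions converge almost everywhere at every single time. The moduli of continuity in time pass to
  the limit and give the values at the endpoints.
\<close>
lemma vanishing_viscosity_limit:
  obtains E u where "\<And>n. E n > 0" "E \<longlonglongrightarrow> 0"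
    "(\<lambda>(x, t). u x t) \<in> borel_measurable borel"
    "\<And>t. periodic (\<lambda>x. u x t)" "\<And>x t. \<bar>u x t\<bar> \<le> M"
    "\<And>t. 0 < t \<Longrightarrow> t < T \<Longrightarrow> AE x in torus. (\<lambda>n. V (E n) x t) \<longlonglongrightarrow> u x t"
    "\<And>t. t \<in> {0..T} \<Longrightarrow> ((\<lambda>s. torus_dist (\<lambda>x. u x s) (\<lambda>x. u x t)) \<longlongrightarrow> 0) (at t within {0..T})"
    "((\<lambda>t. torus_dist (\<lambda>x. u x t) b) \<longlongrightarrow> 0) (at_right 0)"
proof -
  have "\<forall>n::nat. \<exists>\<epsilon>0>0. \<forall>\<epsilon> \<delta> t. 0 < \<epsilon> \<longrightarrow> \<epsilon> < \<epsilon>0 \<longrightarrow> 0 < \<delta> \<longrightarrow> \<delta> < \<epsilon>0 \<longrightarrow> 0 < t \<longrightarrow> t < T \<longrightarrow>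
    torus_dist (\<lambda>x. V \<epsilon> x t) (\<lambda>x. V \<delta> x t) \<le> (1/2) ^ n"
    using viscosity_cauchy by simp
  then obtain \<rho> where \<rho>: "\<And>n::nat. \<rho> n > 0" "\<And>n \<epsilon> \<delta> t. 0 < \<epsilon> \<Longrightarrow> \<epsilon> < \<rho> n \<Longrightarrow> 0 < \<delta> \<Longrightarrow> \<delta> < \<rho> n \<Longrightarrow> 0 < t \<Longrightarrow> t < T \<Longrightarrow>
    torus_dist (\<lambda>x. V \<epsilon> x t) (\<lambda>x. V \<delta> x t) \<le> (1/2) ^ n" by metis
  define E where "E n = Min (insert 1 (\<rho> ` {..n})) / real (n + 2)" for n
  have minpos: "Min (insert 1 (\<rho> ` {..n})) > 0" for n using \<rho>(1) by (subst Min_gr_iff) auto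
  have Epos: "E n > 0" for n using minpos[of n] by (simp add: E_def)
  have Ele: "E n \<le> Min (insert 1 (\<rho> ` {..n})) / 2" for n
    unfolding E_def by (intro divide_left_mono less_imp_le[OF minpos]) auto
  have E\<rho>: "E k < \<rho> n" if "n \<le> k" for n k
  proof -
    have "Min (insert 1 (\<rho> ` {..k})) \<le> \<rho> n" using that by (intro Min_le) auto
    then show ?thesis using Ele[of k] \<rho>(1)[of n] by linarith
  qed
  have E0: "E \<longlonglongrightarrow> 0"
  proof (rule Lim_null_comparison)
    show "\<forall>\<^sub>F n in sequentially. norm (E n) \<le> 1 / real (n + 2)"
    proof (rule always_eventually, rule allI)
      fix n
      have "E n \<le> 1 / real (n + 2)" unfolding E_def by (intro divide_right_mono Min_le) auto
      then show "norm (E n) \<le> 1 / real (n + 2)" using Epos[of n] by simp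
    qed
    show "(\<lambda>n. 1 / real (n + 2)) \<longlonglongrightarrow> 0"
      using LIMSEQ_ignore_initial_segment[OF lim_1_over_n, of 2] by simp
  qed
  define w where "w n = W (E n)" for n
  have Wm: "(\<lambda>(x, t). w n x t) \<in> borel_measurable (borel \<Otimes>\<^sub>M borel)" for n
    unfolding w_def by (rule W_measurable[OF Epos])
  have W_eq: "w n x t = V (E n) x t" if "0 < t" "t < T" for n x t unfolding w_def by (rule W_eq[OF that])
  have Wb: "\<bar>w n x t\<bar> \<le> M" for n x t unfolding w_def by (rule W_bound[OF Epos])
  define U where "U x t = limsup_real (\<lambda>n. w n x t)" for x t
  have Um': "(\<lambda>(x, t). U x t) \<in> borel_measurable (borel \<Otimes>\<^sub>M borel)"
    using limsup_real_measurable[of "\<lambda>n (x, t). w n x t", OF Wm] by (simp add: U_def case_prod_beta)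
  then have Um: "(\<lambda>(x, t). U x t) \<in> borel_measurable borel" by (simp add: borel_prod)
  have Ub: "\<bar>U x t\<bar> \<le> M" for x t unfolding U_def by (rule limsup_real_bound) (rule Wb)
  have Up: "periodic (\<lambda>x. U x t)" for t
    using W_periodic[OF Epos, of _ t] by (simp add: U_def w_def periodic_def)
  have fast: "torus_dist (\<lambda>x. w m x t) (\<lambda>x. w n x t) \<le> (1/2) ^ n" if "n \<le> m" "0 < t" "t < T" for m n t
    using \<rho>(2)[OF Epos E\<rho>[OF that(1)] Epos E\<rho>[OF order_refl] that(2,3)] by (simp add: W_eq[OF that(2,3)])
  note FL = fast_L1_cauchy_limit[where g="\<lambda>n x. w n x t" for t, OF pair_slice[OF Wm] Wb fast[OF le_SucI[OF order_refl]]]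
  have iW: "integrable torus (\<lambda>x. w n x t)" for n t by (rule integrable_torus[OF pair_slice[OF Wm] Wb])
  have iU: "integrable torus (\<lambda>x. U x t)" for t by (rule integrable_torus[OF pair_slice[OF Um'] Ub])
  have ae: "AE x in torus. (\<lambda>n. V (E n) x t) \<longlonglongrightarrow> U x t" if t: "0 < t" "t < T" for t
    using FL(1)[OF t] by (simp add: W_eq[OF t] U_def)
  have UW: "torus_dist (\<lambda>x. U x t) (\<lambda>x. w n x t) \<le> (1/2) ^ n" if t: "0 < t" "t < T" for t n
  proof -
    have lim: "(\<lambda>m. torus_dist (\<lambda>x. w m x t) (\<lambda>x. U x t) + (1/2) ^ n) \<longlonglongrightarrow> 0 + (1/2) ^ n"
      using FL(2)[OF t] unfolding U_def[abs_def] by (intro tendsto_intros)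
    show ?thesis
    proof (rule tendsto_lowerbound[of "\<lambda>m. torus_dist (\<lambda>x. w m x t) (\<lambda>x. U x t) + (1/2) ^ n" _ sequentially])
      show "\<forall>\<^sub>F m in sequentially. torus_dist (\<lambda>x. U x t) (\<lambda>x. w n x t) \<le> torus_dist (\<lambda>x. w m x t) (\<lambda>x. U x t) + (1/2) ^ n"
      proof (rule eventually_sequentiallyI[of n])
        fix m assume "n \<le> m"
        from fast[OF this t] torus_dist_triangle[OF iU[of t] iW[of m t] iW[of n t]]
        show "torus_dist (\<lambda>x. U x t) (\<lambda>x. w n x t) \<le> torus_dist (\<lambda>x. w m x t) (\<lambda>x. U x t) + (1/2) ^ n"
          by (simp add: torus_dist_commute[of "\<lambda>x. U x t" "\<lambda>x. w m x t"])
      qed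
    qed (use lim in simp_all)
  qed
  have small: "\<exists>n. (1/2 :: real) ^ n < e" if "e > 0" for e
    using real_arch_pow_inv[OF that, of "1/2"] by simp
  have Umod: "\<exists>\<sigma>>0. \<forall>s t. 0 < s \<longrightarrow> s < T \<longrightarrow> 0 < t \<longrightarrow> t < T \<longrightarrow> \<bar>s - t\<bar> < \<sigma> \<longrightarrow>
        torus_dist (\<lambda>x. U x s) (\<lambda>x. U x t) \<le> e" if e: "e > 0" for e
  proof -
    obtain n where n: "(1/2 :: real) ^ n < e / 3" using small[of "e / 3"] e by auto
    obtain \<sigma> where \<sigma>: "\<sigma> > 0" "\<And>s t. 0 < s \<Longrightarrow> s < T \<Longrightarrow> 0 < t \<Longrightarrow> t < T \<Longrightarrow> \<bar>s - t\<bar> < \<sigma> \<Longrightarrow>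
        torus_dist (\<lambda>x. V (E n) x s) (\<lambda>x. V (E n) x t) \<le> e / 3"
      using V_time_modulus[OF Epos[of n], of "e / 3"] e by auto
    have "torus_dist (\<lambda>x. U x s) (\<lambda>x. U x t) \<le> e" if st: "0 < s" "s < T" "0 < t" "t < T" "\<bar>s - t\<bar> < \<sigma>" for s t
      using torus_dist_triangle[OF iU[of s] iW[of n s] iU[of t]] torus_dist_triangle[OF iW[of n s] iW[of n t] iU[of t]]
        UW[OF st(1,2), of n] UW[OF st(3,4), of n] \<sigma>(2)[OF st] n
      by (simp add: W_eq[OF st(1,2)] W_eq[OF st(3,4)] torus_dist_commute[of "\<lambda>x. V (E n) x t" "\<lambda>x. U x t"])
    then show ?thesis using \<sigma>(1) by blast
  qed
  have Uini: "\<exists>\<sigma>>0. \<forall>t. 0 < t \<longrightarrow> t < \<sigma> \<longrightarrow> torus_dist (\<lambda>x. U x t) b < e" if e: "e > 0" for e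
  proof -
    obtain n where n: "(1/2 :: real) ^ n < e / 2" using small[of "e / 2"] e by auto
    have "\<forall>\<^sub>F t in at_right 0. torus_dist (\<lambda>x. V (E n) x t) b < e / 2"
      using initial[OF Epos[of n]] e by (intro order_tendstoD(2)) auto
    then obtain \<sigma> where \<sigma>: "\<sigma> > 0" "\<And>t. 0 < t \<Longrightarrow> t < \<sigma> \<Longrightarrow> torus_dist (\<lambda>x. V (E n) x t) b < e / 2"
      unfolding eventually_at_right_field by auto
    have "torus_dist (\<lambda>x. U x t) b < e" if t: "0 < t" "t < min \<sigma> T" for t
    proof -
      have t': "0 < t" "t < T" "t < \<sigma>" using t by auto
      show ?thesis
        using torus_dist_triangle[OF iU[of t] iW[of n t] b_integrable] UW[OF t'(1,2), of n] \<sigma>(2)[OF t'(1,3)] n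
        by (simp add: W_eq[OF t'(1,2)])
    qed
    then show ?thesis using \<sigma>(1) T by (intro exI[of _ "min \<sigma> T"]) auto
  qed
  obtain G0 where G0: "G0 \<in> borel_measurable borel" "periodic G0" "\<And>x. \<bar>G0 x\<bar> \<le> M"
    "\<And>e. e > 0 \<Longrightarrow> \<exists>\<sigma>>0. \<forall>t. 0 < t \<longrightarrow> t < T \<longrightarrow> \<bar>t - 0\<bar> < \<sigma> \<longrightarrow> torus_dist (\<lambda>x. U x t) G0 \<le> e"
    using endpoint_limit[OF T _ pair_slice[OF Um'] Up Ub Umod, of 0] by auto
  obtain GT where GT: "GT \<in> borel_measurable borel" "periodic GT" "\<And>x. \<bar>GT x\<bar> \<le> M"
    "\<And>e. e > 0 \<Longrightarrow> \<exists>\<sigma>>0. \<forall>t. 0 < t \<longrightarrow> t < T \<longrightarrow> \<bar>t - T\<bar> < \<sigma> \<longrightarrow> torus_dist (\<lambda>x. U x t) GT \<le> e"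
    using endpoint_limit[OF T _ pair_slice[OF Um'] Up Ub Umod, of T] by auto
  define u where "u x t = (if t = 0 then G0 x else if t = T then GT x else U x t)" for x t
  have uU: "u x t = U x t" if "0 < t" "t < T" for x t using that by (simp add: u_def)
  have um: "(\<lambda>(x, t). u x t) \<in> borel_measurable borel"
  proof -
    note [measurable] = G0(1) GT(1) Um[unfolded borel_prod[symmetric] case_prod_unfold]
    have "(\<lambda>p. if snd p = 0 then G0 (fst p) else if snd p = T then GT (fst p) else U (fst p) (snd p))
      \<in> borel_measurable (borel \<Otimes>\<^sub>M borel)" by measurable
    then show ?thesis by (simp add: u_def case_prod_unfold borel_prod)
  qed
  show ?thesis
  proof (rule that[OF Epos E0 um])
    show "periodic (\<lambda>x. u x t)" for t using G0(2) GT(2) Up by (cases "t = 0"; cases "t = T"; simp add: u_def)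
    show "\<bar>u x t\<bar> \<le> M" for x t using G0(3) GT(3) Ub by (simp add: u_def)
    show "AE x in torus. (\<lambda>n. V (E n) x t) \<longlonglongrightarrow> u x t" if "0 < t" "t < T" for t
      using ae[OF that] by (simp add: uU[OF that])
    show "((\<lambda>t. torus_dist (\<lambda>x. u x t) b) \<longlongrightarrow> 0) (at_right 0)"
    proof (rule tendstoI)
      fix e :: real assume "e > 0"
      then obtain \<sigma> where \<sigma>: "\<sigma> > 0" "\<And>t. 0 < t \<Longrightarrow> t < \<sigma> \<Longrightarrow> torus_dist (\<lambda>x. U x t) b < e" using Uini by blast
      show "\<forall>\<^sub>F t in at_right 0. dist (torus_dist (\<lambda>x. u x t) b) 0 < e"
        unfolding eventually_at_right_field
        by (rule exI[of _ "min \<sigma> T"]) (use \<sigma> T in \<open>auto simp: uU torus_dist_nonneg abs_of_nonneg\<close>)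
    qed
    show "((\<lambda>s. torus_dist (\<lambda>x. u x s) (\<lambda>x. u x t)) \<longlongrightarrow> 0) (at t within {0..T})" if t: "t \<in> {0..T}" for t
    proof (rule tendstoI)
      fix e :: real assume e: "e > 0"
      then have e2: "e / 2 > 0" by simp
      have "\<exists>d>0. \<forall>s\<in>{0..T}. 0 < \<bar>s - t\<bar> \<and> \<bar>s - t\<bar> < d \<longrightarrow> torus_dist (\<lambda>x. u x s) (\<lambda>x. u x t) \<le> e / 2"
      proof -
        consider "t = 0" | "t = T" | "0 < t" "t < T" using t by fastforce
        then show ?thesis
        proof cases
          case 1
          obtain \<sigma> where \<sigma>: "\<sigma> > 0" "\<And>s. 0 < s \<Longrightarrow> s < T \<Longrightarrow> \<bar>s - 0\<bar> < \<sigma> \<Longrightarrow> torus_dist (\<lambda>x. U x s) G0 \<le> e / 2"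
            using G0(4)[OF e2] by blast
          have "(\<lambda>x. u x t) = G0" using 1 by (simp add: u_def)
          then show ?thesis using 1 \<sigma> T by (intro exI[of _ "min \<sigma> T"]) (auto simp: uU)
        next
          case 2
          obtain \<sigma> where \<sigma>: "\<sigma> > 0" "\<And>s. 0 < s \<Longrightarrow> s < T \<Longrightarrow> \<bar>s - T\<bar> < \<sigma> \<Longrightarrow> torus_dist (\<lambda>x. U x s) GT \<le> e / 2"
            using GT(4)[OF e2] by blast
          have "(\<lambda>x. u x t) = GT" using 2 T by (simp add: u_def)
          then show ?thesis using 2 \<sigma> T by (intro exI[of _ "min \<sigma> T"]) (auto simp: uU)
        next
          case 3
          obtain \<sigma> where \<sigma>: "\<sigma> > 0" "\<And>s t. 0 < s \<Longrightarrow> s < T \<Longrightarrow> 0 < t \<Longrightarrow> t < T \<Longrightarrow> \<bar>s - t\<bar> < \<sigma> \<Longrightarrow>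
            torus_dist (\<lambda>x. U x s) (\<lambda>x. U x t) \<le> e / 2"
            using Umod[OF e2] by blast
          then show ?thesis using 3 by (intro exI[of _ "min \<sigma> (min t (T - t))"]) (auto simp: uU)
        qed
      qed
      then obtain d where d: "d > 0" "\<And>s. s \<in> {0..T} \<Longrightarrow> 0 < \<bar>s - t\<bar> \<Longrightarrow> \<bar>s - t\<bar> < d \<Longrightarrow> torus_dist (\<lambda>x. u x s) (\<lambda>x. u x t) \<le> e / 2"
        by blast
      show "\<forall>\<^sub>F s in at t within {0..T}. dist (torus_dist (\<lambda>x. u x s) (\<lambda>x. u x t)) 0 < e"
        unfolding eventually_at
      proof (intro exI[of _ d] conjI ballI impI d(1))
        fix s assume s: "s \<in> {0..T}" "s \<noteq> t \<and> dist s t < d"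
        then have "torus_dist (\<lambda>x. u x s) (\<lambda>x. u x t) \<le> e / 2" by (intro d(2)) (auto simp: dist_real_def)
        then show "dist (torus_dist (\<lambda>x. u x s) (\<lambda>x. u x t)) 0 < e"
          using e torus_dist_nonneg[of "\<lambda>x. u x s" "\<lambda>x. u x t"] by (simp add: dist_real_def)
      qed
    qed
  qed
qed

end

section \<open>Entropy production of a smooth solution\<close>

lemma jump_part_bound:
  assumes \<nu>: "levy_kernel \<nu>" and r: "r > 0" and m: "w \<in> borel_measurable borel" and b: "\<And>x. \<bar>w x\<bar> \<le> M"
  shows "\<bar>jump_part \<nu> r w x\<bar> \<le> (2 * M) * (LINT z:{z. norm z > r}|\<nu>. 1)"
proof -
  note [measurable] = m
  have "norm (w (x + z) - w x) \<le> 2 * M" for z using b[of "x + z"] b[of x] by (auto simp: abs_le_iff)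
  then have "norm (LINT z:{z. norm z > r}|\<nu>. w (x + z) - w x) \<le> (2 * M) * (LINT z:{z. norm z > r}|\<nu>. 1)"
    by (intro levy_kernel_outer(2)[OF \<nu> r]) measurable
  then show ?thesis by (simp add: jump_part_def)
qed

lemma jump_part_measurable:
  assumes \<nu>: "levy_kernel \<nu>" and m: "(\<lambda>(x, t). w x t) \<in> borel_measurable (borel \<Otimes>\<^sub>M (borel :: real measure))"
  shows "(\<lambda>(x, t). jump_part \<nu> r (\<lambda>y. w y t) x) \<in> borel_measurable (borel \<Otimes>\<^sub>M borel)"
proof -
  have [measurable_cong]: "sets \<nu> = sets borel" using \<nu> by (auto simp: levy_kernel_def)
  interpret \<nu>: sigma_finite_measure \<nu> using \<nu> by (simp add: levy_kernel_def)
  note [measurable] = m closed_ball_sets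
  have w: "(\<lambda>p. w (fst p) (snd p)) \<in> borel_measurable (borel \<Otimes>\<^sub>M borel)" using m by (simp add: case_prod_unfold)
  have [measurable]: "(\<lambda>q. w (fst (fst q) + snd q) (snd (fst q))) \<in> borel_measurable ((borel \<Otimes>\<^sub>M borel) \<Otimes>\<^sub>M \<nu>)"
    "(\<lambda>q. w (fst (fst q)) (snd (fst q))) \<in> borel_measurable ((borel \<Otimes>\<^sub>M borel) \<Otimes>\<^sub>M \<nu>)"
    using measurable_compose[OF _ w, of "\<lambda>q. (fst (fst q) + snd q, snd (fst q))"]
      measurable_compose[OF _ w, of "\<lambda>q. (fst (fst q), snd (fst q))"] by simp_all
  have "(\<lambda>q. indicator {z. norm z > r} (snd q) *\<^sub>R (w (fst (fst q) + snd q) (snd (fst q)) - w (fst (fst q)) (snd (fst q))))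
      \<in> borel_measurable ((borel \<Otimes>\<^sub>M borel) \<Otimes>\<^sub>M \<nu>)" by measurable
  from \<nu>.borel_measurable_lebesgue_integral[of "\<lambda>p z. indicator {z. norm z > r} z *\<^sub>R (w (fst p + z) (snd p) - w (fst p) (snd p))"] this
  show ?thesis by (simp add: jump_part_def set_lebesgue_integral_def case_prod_unfold)
qed

lemma levy_adj_measurable:
  assumes \<nu>: "levy_kernel \<nu>" and m: "(\<lambda>(x, t). p x t) \<in> borel_measurable (borel \<Otimes>\<^sub>M (borel :: real measure))"
     "(\<lambda>(x, t). P x t) \<in> borel_measurable (borel \<Otimes>\<^sub>M borel)"
  shows "(\<lambda>(x, t). levy_adj \<nu> (\<lambda>y. p y t) (\<lambda>y. P y t) x) \<in> borel_measurable (borel \<Otimes>\<^sub>M borel)"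
proof -
  have [measurable_cong]: "sets \<nu> = sets borel" using \<nu> by (auto simp: levy_kernel_def)
  interpret \<nu>: sigma_finite_measure \<nu> using \<nu> by (simp add: levy_kernel_def)
  note [measurable] = closed_ball_sets
  have p: "(\<lambda>p'. p (fst p') (snd p')) \<in> borel_measurable (borel \<Otimes>\<^sub>M borel)" using m by (simp add: case_prod_unfold)
  have P: "(\<lambda>p'. P (fst p') (snd p')) \<in> borel_measurable (borel \<Otimes>\<^sub>M borel)" using m by (simp add: case_prod_unfold)
  have [measurable]: "(\<lambda>q. p (fst (fst q) + - snd q) (snd (fst q))) \<in> borel_measurable ((borel \<Otimes>\<^sub>M borel) \<Otimes>\<^sub>M \<nu>)"
    "(\<lambda>q. p (fst (fst q)) (snd (fst q))) \<in> borel_measurable ((borel \<Otimes>\<^sub>M borel) \<Otimes>\<^sub>M \<nu>)"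
    "(\<lambda>q. P (fst (fst q)) (snd (fst q))) \<in> borel_measurable ((borel \<Otimes>\<^sub>M borel) \<Otimes>\<^sub>M \<nu>)"
    using measurable_compose[OF _ p, of "\<lambda>q. (fst (fst q) + - snd q, snd (fst q))"]
      measurable_compose[OF measurable_fst p] measurable_compose[OF measurable_fst P] by simp_all
  have "(\<lambda>q. p (fst (fst q) + - snd q) (snd (fst q)) - p (fst (fst q)) (snd (fst q)) -
      (- snd q \<bullet> P (fst (fst q)) (snd (fst q))) * indicator {z. norm z < 1} (- snd q))
      \<in> borel_measurable ((borel \<Otimes>\<^sub>M borel) \<Otimes>\<^sub>M \<nu>)" by measurable
  from \<nu>.borel_measurable_lebesgue_integral[of "\<lambda>p' z. compensated (\<lambda>y. p y (snd p')) (\<lambda>y. P y (snd p')) (fst p') (- z)"] this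
  show ?thesis by (simp add: levy_adj_def compensated_def case_prod_unfold)
qed

lemma has_real_derivative_shift:
  assumes "(F has_real_derivative d) (at (a - k))"
  shows "((\<lambda>s. F (s - k)) has_real_derivative d) (at a)"
  using assms DERIV_shift[of F d a "- k"] by simp

text \<open>
  The flux that belongs to the smoothed entropy, normalised to vanish at \<open>k\<close>.
\<close>
definition flux_primitive :: "('n \<Rightarrow> real \<Rightarrow> real) \<Rightarrow> real \<Rightarrow> real \<Rightarrow> real \<Rightarrow> 'n \<Rightarrow> real \<Rightarrow> real" where
  "flux_primitive f' B c k = (SOME q. \<forall>j. q j k = 0 \<and> (\<forall>s. (q j has_real_derivative sabs' B c (s - k) * f' j s) (at s)))"

text \<open>
  The contributions of flux, small jumps, large jumps and drift to the entropy inequality.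
\<close>
definition smooth_entropy_terms ::
  "('n::finite \<Rightarrow> real \<Rightarrow> real) \<Rightarrow> (real^'n) measure \<Rightarrow> real \<Rightarrow> real \<Rightarrow> real \<Rightarrow> real \<Rightarrow>
   (real^'n \<Rightarrow> real) \<Rightarrow> (real^'n \<Rightarrow> real) \<Rightarrow> (real^'n \<Rightarrow> real^'n) \<Rightarrow> real^'n \<Rightarrow> real" where
  "smooth_entropy_terms f' \<nu> B c k r v p P x =
     (\<Sum>j\<in>UNIV. flux_primitive f' B c k j (v x) * P x $ j)
     + sabs B c (v x - k) * levy_adj (small_jumps \<nu> r) p P x
     + sabs' B c (v x - k) * jump_part \<nu> r v x * p x
     + sabs B c (v x - k) * (jump_drift \<nu> r \<bullet> P x)"

context viscous_setting
begin

lemma flux_primitive: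
  assumes B: "B > 0" and c: "c > 0"
  shows "flux_primitive f' B c k j k = 0"
    and "(flux_primitive f' B c k j has_real_derivative sabs' B c (s - k) * f' j s) (at s)"
proof -
  have "\<exists>q. q k = 0 \<and> (\<forall>s. (q has_real_derivative sabs' B c (s - k) * f' j s) (at s))" for j
  proof -
    have "continuous_on UNIV (\<lambda>s. sabs' B c (s - k) * f' j s)"
      by (auto intro!: continuous_intros continuous_on_compose2[OF sabs'_continuous[OF B c]] f'_cont)
    then have "isCont (\<lambda>s. sabs' B c (s - k) * f' j s) s" for s by (simp add: continuous_on_eq_continuous_at)
    then obtain F where "\<And>s. (F has_vector_derivative sabs' B c (s - k) * f' j s) (at s)"
      using einterval_antiderivative[of "-\<infinity>" "\<infinity>" "\<lambda>s. sabs' B c (s - k) * f' j s"] by auto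
    then have "((\<lambda>s. F s - F k) has_real_derivative sabs' B c (s - k) * f' j s) (at s)" for s
      by (auto simp: has_real_derivative_iff_has_vector_derivative intro!: derivative_eq_intros)
    then show ?thesis by (intro exI[of _ "\<lambda>s. F s - F k"]) auto
  qed
  then have "\<exists>q. \<forall>j. q j k = 0 \<and> (\<forall>s. (q j has_real_derivative sabs' B c (s - k) * f' j s) (at s))" by metis
  from someI_ex[OF this]
  show "flux_primitive f' B c k j k = 0"
    "(flux_primitive f' B c k j has_real_derivative sabs' B c (s - k) * f' j s) (at s)"
    unfolding flux_primitive_def by auto
qed

lemma flux_primitive_cont:
  assumes B: "B > 0" and c: "c > 0"
  shows "continuous_on UNIV (flux_primitive f' B c k j)"
  using flux_primitive(2)[OF B c] by (meson DERIV_isCont continuous_at_imp_continuous_on)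

text \<open>
  The difference vanishes at \<open>k\<close> and has the derivative \<open>- sabs'' (s - k) (f s - f k)\<close>, which is of order \<open>c\<close> by
  the weighted bound on the second derivative.
\<close>
lemma flux_primitive_approx:
  assumes B: "B > 0" and c: "c > 0" and L: "\<And>j s. \<bar>s\<bar> \<le> m \<Longrightarrow> \<bar>f' j s\<bar> \<le> L" and m: "\<bar>s\<bar> \<le> m" "\<bar>k\<bar> \<le> m"
  shows "\<bar>flux_primitive f' B c k j s - sabs' B c (s - k) * (f j s - f j k)\<bar> \<le> c * (L * \<bar>s - k\<bar>)"
proof -
  let ?d = "\<lambda>s. flux_primitive f' B c k j s - sabs' B c (s - k) * (f j s - f j k)"
  have L0: "L \<ge> 0" using L[of s j] m by linarith
  have "norm (?d s - ?d k) \<le> (c * L) * norm (s - k)"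
  proof (rule field_differentiable_bound[where S="{-m..m}" and f'="\<lambda>s. - (sabs'' B c (s - k) * (f j s - f j k))"])
    fix z assume z: "z \<in> {-m..m}"
    have "((\<lambda>s. sabs' B c (s - k)) has_real_derivative sabs'' B c (z - k)) (at z)"
      by (rule has_real_derivative_shift[OF sabs'_deriv[OF B c]])
    then have "(?d has_real_derivative - (sabs'' B c (z - k) * (f j z - f j k))) (at z)"
      by (auto intro!: derivative_eq_intros flux_primitive(2)[OF B c] f_deriv)
    then show "(?d has_real_derivative - (sabs'' B c (z - k) * (f j z - f j k))) (at z within {-m..m})"
      by (rule has_field_derivative_at_within)
    have "\<bar>sabs'' B c (z - k) * (f j z - f j k)\<bar> \<le> sabs'' B c (z - k) * (L * \<bar>z - k\<bar>)"
      unfolding abs_mult using sabs''_nonneg[OF B c, of "z - k"] z m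
      by (simp add: abs_of_nonneg) (intro mult_left_mono flux_lipschitz[OF L], auto)
    also have "\<dots> = L * (\<bar>z - k\<bar> * sabs'' B c (z - k))" by simp
    also have "\<dots> \<le> L * c" by (intro mult_left_mono sabs''_weighted[OF B c] L0)
    finally show "norm (- (sabs'' B c (z - k) * (f j z - f j k))) \<le> c * L" by (simp add: mult.commute)
  qed (use m in auto)
  then show ?thesis using flux_primitive(1)[OF B c, of k j] by (simp add: mult.assoc)
qed

text \<open>
  Each term of the equation is treated on its own: flux and drift by integration by parts, the small jumps
  by convexity and duality, the diffusion by the viscosity inequality, while the large jumps stay as they
  are.
\<close>
lemma entropy_production:
  assumes B: "B > 0" and c: "c > 0" and r: "r > 0"
    and g: "periodic_C2 g G H" and p: "periodic_C2 p P Q" and pos: "\<And>x. p x \<ge> 0" and \<epsilon>: "\<epsilon> \<ge> 0"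
    and pde: "\<And>x. gt x = - (\<Sum>j\<in>UNIV. f' j (g x) * G x $ j) + levy_int \<nu> g G x + \<epsilon> * (\<Sum>j\<in>UNIV. H j x $ j)"
    and gt: "continuous_on UNIV gt" "periodic gt"
  shows "(LINT x|torus. sabs' B c (g x - k) * gt x * p x)
     \<le> (LINT x|torus. smooth_entropy_terms f' \<nu> B c k r g p P x) + \<epsilon> * (LINT x|torus. sabs B c (g x - k) * (\<Sum>j\<in>UNIV. Q j x $ j))"
    and "integrable torus (smooth_entropy_terms f' \<nu> B c k r g p P)"
proof -
  note GG = periodic_C2_continuous[OF g] and PP = periodic_C2_continuous[OF p]
  note g11 = periodic_C2_imp_C11[OF g] and p11 = periodic_C2_imp_C11[OF p]
  note \<nu>r = levy_kernel_small_jumps[OF levy, of r]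
  let ?e = "\<lambda>x. sabs B c (g x - k)" and ?e1 = "\<lambda>x. sabs' B c (g x - k)"
  let ?q = "flux_primitive f' B c k"
  have per: "periodic ?e" "periodic ?e1" "periodic (\<lambda>x. ?q j (g x))" "periodic (\<lambda>x. f' j (g x))" for j
    using GG(4) by (auto simp: periodic_def)
  have cont: "continuous_on UNIV ?e" "continuous_on UNIV ?e1" "continuous_on UNIV (\<lambda>x. ?q j (g x))" "continuous_on UNIV (\<lambda>x. f' j (g x))" for j
    by (auto intro!: continuous_on_compose2[OF sabs_continuous[OF B c]] continuous_on_compose2[OF sabs'_continuous[OF B c]]
      continuous_on_compose2[OF flux_primitive_cont[OF B c]] continuous_on_compose2[OF f'_cont] continuous_intros GG)
  obtain Bg where Bg: "\<And>x. norm (g x) \<le> Bg" using periodic_continuous_bounded[OF GG(4,1)] by blast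
  obtain Bp where Bp: "\<And>x. norm (p x) \<le> Bp" "Bp > 0" using periodic_continuous_bounded[OF PP(4,1)] by blast
  obtain Be where Be: "\<And>x. norm (?e x) \<le> Be" "Be > 0" using periodic_continuous_bounded[OF per(1) cont(1)] by blast
  obtain Be1 where Be1: "\<And>x. norm (?e1 x) \<le> Be1" "Be1 > 0" using periodic_continuous_bounded[OF per(2) cont(2)] by blast
  note meas [measurable] = continuous_borel[OF GG(1)] continuous_borel[OF GG(2)] continuous_borel[OF PP(1)]
    continuous_borel[OF PP(2)] continuous_borel[OF cont(1)] continuous_borel[OF cont(2)]
  have de: "(?e has_derivative (\<lambda>h. h \<bullet> (?e1 x *\<^sub>R G x))) (at x)" for x
  proof -
    have "((\<lambda>x. g x - k) has_derivative (\<lambda>h. h \<bullet> G x)) (at x)"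
      using has_derivative_diff[OF GG(7) has_derivative_const] by simp
    from has_derivative_component_inner[OF this sabs_deriv[OF B c]] show ?thesis .
  qed
  have dq: "((\<lambda>x. ?q j (g x)) has_derivative (\<lambda>h. h \<bullet> ((?e1 x * f' j (g x)) *\<^sub>R G x))) (at x)" for j x
    by (rule has_derivative_component_inner[OF GG(7) flux_primitive(2)[OF B c]])
  have iflux: "integrable torus (\<lambda>x. ?q j (g x) * P x $ j)" "integrable torus (\<lambda>x. ?e1 x * p x * (f' j (g x) * G x $ j))" for j
    by (intro torus_intros per cont PP GG)+
  have flux: "- (LINT x|torus. ?e1 x * p x * (f' j (g x) * G x $ j)) = (LINT x|torus. ?q j (g x) * P x $ j)" for j
  proof -
    let ?R = "\<lambda>x. p x *\<^sub>R ((?e1 x * f' j (g x)) *\<^sub>R G x) + ?q j (g x) *\<^sub>R P x"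
    have "(LINT x|torus. ?R x $ j) = 0"
      by (rule integral_torus_divergence[where p="\<lambda>x. ?q j (g x) * p x"])
        (intro torus_intros per cont PP GG has_derivative_inner_mult dq)+
    also have "(\<lambda>x. ?R x $ j) = (\<lambda>x. ?e1 x * p x * (f' j (g x) * G x $ j) + ?q j (g x) * P x $ j)"
      by (simp add: algebra_simps)
    finally show ?thesis using iflux by simp
  qed
  \<comment> \<open>Only the small jumps are moved onto the test function; there convexity of the smoothed entropy gives the sign.\<close>
  note lm = levy_int_measurable_bounded[OF \<nu>r g11] and am = levy_int_measurable_bounded[OF \<nu>r p11]
  have ilop: "integrable torus (\<lambda>x. p x * (?e1 x * levy_int (small_jumps \<nu> r) g G x))"
  proof -
    obtain B2 where B2: "\<And>x. \<bar>levy_int (small_jumps \<nu> r) g G x\<bar> \<le> B2" using lm(2) by blast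
    show ?thesis
      using B2 order_trans[OF abs_ge_zero B2] lm(1) Bp Be1
      by (intro integrable_torus[where B="Bp * (Be1 * B2)"]) (auto simp: abs_mult intro!: mult_mono)
  qed
  have iadj: "integrable torus (\<lambda>x. ?e x * levy_adj (small_jumps \<nu> r) p P x)"
  proof -
    obtain B2 where B2: "\<And>x. \<bar>levy_adj (small_jumps \<nu> r) p P x\<bar> \<le> B2" using am(4) by blast
    show ?thesis
      using B2 order_trans[OF abs_ge_zero B2] am(3) Be
      by (intro integrable_torus[where B="Be * B2"]) (auto simp: abs_mult intro!: mult_mono)
  qed
  have inner: "(LINT x|torus. p x * (?e1 x * levy_int (small_jumps \<nu> r) g G x)) \<le> (LINT x|torus. ?e x * levy_adj (small_jumps \<nu> r) p P x)"
  proof -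
    have c11: "periodic_C11 ?e (\<lambda>x. ?e1 x *\<^sub>R G x)"
    proof (rule periodic_C11_compose[OF g11, where \<eta>="\<lambda>s. sabs B c (s - k)" and \<eta>'="\<lambda>s. sabs' B c (s - k)"])
      show "((\<lambda>s. sabs B c (s - k)) has_real_derivative sabs' B c (a - k)) (at a)" for a
        by (rule has_real_derivative_shift[OF sabs_deriv[OF B c]])
      show "\<bar>sabs' B c (a - k) - sabs' B c (b - k)\<bar> \<le> (c / smoothing_width B c) * \<bar>a - b\<bar>" for a b
        using sabs'_lipschitz[OF B c, of "a - k" "b - k"] by simp
    qed
    obtain B2 where B2: "\<And>x. \<bar>levy_int (small_jumps \<nu> r) ?e (\<lambda>x. ?e1 x *\<^sub>R G x) x\<bar> \<le> B2"
      using levy_int_measurable_bounded(2)[OF \<nu>r c11] by blast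
    have i2: "integrable torus (\<lambda>x. p x * levy_int (small_jumps \<nu> r) ?e (\<lambda>x. ?e1 x *\<^sub>R G x) x)"
      using B2 order_trans[OF abs_ge_zero B2] levy_int_measurable_bounded(1)[OF \<nu>r c11] Bp
      by (intro integrable_torus[where B="Bp * B2"]) (auto simp: abs_mult intro!: mult_mono)
    have "(LINT x|torus. p x * (?e1 x * levy_int (small_jumps \<nu> r) g G x)) \<le> (LINT x|torus. p x * levy_int (small_jumps \<nu> r) ?e (\<lambda>x. ?e1 x *\<^sub>R G x) x)"
    proof (rule integral_mono[OF ilop i2])
      fix x
      have "?e1 x * levy_int (small_jumps \<nu> r) g G x \<le> levy_int (small_jumps \<nu> r) ?e (\<lambda>x. ?e1 x *\<^sub>R G x) x"
      proof (rule levy_int_convex[where w=g and \<eta>="\<lambda>s. sabs B c (s - k)" and \<eta>'="\<lambda>s. sabs' B c (s - k)", OF \<nu>r g11 c11])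
        show "sabs' B c (a - k) * (b - a) \<le> sabs B c (b - k) - sabs B c (a - k)" for a b
          using sabs_convex[OF B c, of "a - k" "b - k"] by simp
      qed
      then show "p x * (?e1 x * levy_int (small_jumps \<nu> r) g G x) \<le> p x * levy_int (small_jumps \<nu> r) ?e (\<lambda>x. ?e1 x *\<^sub>R G x) x"
        by (rule mult_left_mono[OF _ pos])
    qed
    also have "\<dots> = (LINT x|torus. ?e x * levy_adj (small_jumps \<nu> r) p P x)"
      by (rule levy_duality[OF \<nu>r c11 p11])
    finally show ?thesis .
  qed
  have om: "jump_part \<nu> r g \<in> borel_measurable borel"
  proof -
    have g0: "(\<lambda>(x, t). (\<lambda>x t. g x) x t) \<in> borel_measurable (borel \<Otimes>\<^sub>M (borel :: real measure))" by measurable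
    have "(\<lambda>(x, t). jump_part \<nu> r (\<lambda>y. (\<lambda>x t. g x) y t) x) \<in> borel_measurable (borel \<Otimes>\<^sub>M (borel :: real measure))"
      by (rule jump_part_measurable[OF levy g0])
    from pair_slice[OF this] show ?thesis by simp
  qed
  let ?lam = "LINT z:{z. norm z > r}|\<nu>. 1 :: real"
  have ob: "\<bar>jump_part \<nu> r g x\<bar> \<le> (2 * Bg) * ?lam" for x
    using jump_part_bound[OF levy r meas(1), of Bg x] Bg by simp
  have iout: "integrable torus (\<lambda>x. ?e1 x * jump_part \<nu> r g x * p x)"
    using ob order_trans[OF abs_ge_zero ob] om Bp Be1
    by (intro integrable_torus[where B="Be1 * ((2 * Bg) * ?lam) * Bp"]) (auto simp: abs_mult simp del: mult.assoc intro!: mult_mono)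
  let ?d = "jump_drift \<nu> r"
  have idr: "integrable torus (\<lambda>x. ?e x * (?d \<bullet> P x))" "integrable torus (\<lambda>x. ?e1 x * p x * (?d \<bullet> G x))"
    using GG(5) PP(5) by (auto intro!: integrable_torus_continuous periodic_mult per PP GG continuous_intros cont simp: periodic_def)
  have dr: "- (LINT x|torus. ?e1 x * p x * (?d \<bullet> G x)) = (LINT x|torus. ?e x * (?d \<bullet> P x))"
  proof -
    have "(LINT x|torus. ?d \<bullet> (p x *\<^sub>R (?e1 x *\<^sub>R G x) + ?e x *\<^sub>R P x)) = 0"
      by (rule integral_torus_directional_derivative[where p="\<lambda>x. ?e x * p x"])
        (intro torus_intros per cont PP GG has_derivative_inner_mult de)+
    also have "(\<lambda>x. ?d \<bullet> (p x *\<^sub>R (?e1 x *\<^sub>R G x) + ?e x *\<^sub>R P x)) = (\<lambda>x. ?e1 x * p x * (?d \<bullet> G x) + ?e x * (?d \<bullet> P x))"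
      by (simp add: inner_add_right algebra_simps)
    finally show ?thesis using idr by simp
  qed
  have visc: "(LINT x|torus. p x * ?e1 x * (\<Sum>j\<in>UNIV. H j x $ j)) \<le> (LINT x|torus. ?e x * (\<Sum>j\<in>UNIV. Q j x $ j))"
    by (rule viscosity_inequality[OF B c p pos g])
  have ivisc: "integrable torus (\<lambda>x. p x * ?e1 x * (\<Sum>j\<in>UNIV. H j x $ j))"
    using GG(6) by (intro integrable_torus_continuous periodic_mult PP per) (auto simp: periodic_def intro!: continuous_intros PP GG cont)
  have split: "levy_int \<nu> g G x = levy_int (small_jumps \<nu> r) g G x + jump_part \<nu> r g x - ?d \<bullet> G x" for x
    by (rule levy_int_split[OF levy g11 r])
  have "?e1 x * gt x * p x = (\<Sum>j\<in>UNIV. - (?e1 x * p x * (f' j (g x) * G x $ j))) + p x * (?e1 x * levy_int (small_jumps \<nu> r) g G x)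
     + ?e1 x * jump_part \<nu> r g x * p x + - (?e1 x * p x * (?d \<bullet> G x)) + \<epsilon> * (p x * ?e1 x * (\<Sum>j\<in>UNIV. H j x $ j))" for x
  proof -
    have "(\<Sum>j\<in>UNIV. - (?e1 x * p x * (f' j (g x) * G x $ j))) = - (?e1 x * p x * (\<Sum>j\<in>UNIV. f' j (g x) * G x $ j))"
      by (simp add: sum_negf sum_distrib_left)
    then show ?thesis unfolding pde split by (simp add: algebra_simps)
  qed
  then have "(LINT x|torus. ?e1 x * gt x * p x) = (LINT x|torus. (\<Sum>j\<in>UNIV. - (?e1 x * p x * (f' j (g x) * G x $ j))) + p x * (?e1 x * levy_int (small_jumps \<nu> r) g G x)
     + ?e1 x * jump_part \<nu> r g x * p x + - (?e1 x * p x * (?d \<bullet> G x)) + \<epsilon> * (p x * ?e1 x * (\<Sum>j\<in>UNIV. H j x $ j)))" by simp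
  also have "\<dots> = (\<Sum>j\<in>UNIV. - (LINT x|torus. ?e1 x * p x * (f' j (g x) * G x $ j))) + (LINT x|torus. p x * (?e1 x * levy_int (small_jumps \<nu> r) g G x))
     + (LINT x|torus. ?e1 x * jump_part \<nu> r g x * p x) + - (LINT x|torus. ?e1 x * p x * (?d \<bullet> G x)) + \<epsilon> * (LINT x|torus. p x * ?e1 x * (\<Sum>j\<in>UNIV. H j x $ j))"
    using iflux(2) ilop iout idr(2) ivisc
    by (subst Bochner_Integration.integral_add | subst Bochner_Integration.integral_sum
        | intro Bochner_Integration.integrable_add Bochner_Integration.integrable_sum integrable_minus integrable_mult_right
        | subst Bochner_Integration.integral_minus | subst Bochner_Integration.integral_mult_right_zero | simp)+
  also have "\<dots> \<le> (\<Sum>j\<in>UNIV. LINT x|torus. ?q j (g x) * P x $ j) + (LINT x|torus. ?e x * levy_adj (small_jumps \<nu> r) p P x)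
     + (LINT x|torus. ?e1 x * jump_part \<nu> r g x * p x) + (LINT x|torus. ?e x * (?d \<bullet> P x)) + \<epsilon> * (LINT x|torus. ?e x * (\<Sum>j\<in>UNIV. Q j x $ j))"
    unfolding flux dr by (intro add_mono order_refl inner mult_left_mono visc \<epsilon>)
  also have "(\<Sum>j\<in>UNIV. LINT x|torus. ?q j (g x) * P x $ j) + (LINT x|torus. ?e x * levy_adj (small_jumps \<nu> r) p P x)
     + (LINT x|torus. ?e1 x * jump_part \<nu> r g x * p x) + (LINT x|torus. ?e x * (?d \<bullet> P x))
     = (LINT x|torus. smooth_entropy_terms f' \<nu> B c k r g p P x)"
    unfolding smooth_entropy_terms_def using iflux(1) iadj iout idr(1) by simp
  finally show "(LINT x|torus. ?e1 x * gt x * p x)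
     \<le> (LINT x|torus. smooth_entropy_terms f' \<nu> B c k r g p P x) + \<epsilon> * (LINT x|torus. ?e x * (\<Sum>j\<in>UNIV. Q j x $ j))" .
  show "integrable torus (smooth_entropy_terms f' \<nu> B c k r g p P)"
    unfolding smooth_entropy_terms_def[abs_def] using iflux(1) iadj iout idr(1) by simp
qed

end

section \<open>The entropy inequality with smoothed entropies\<close>

text \<open>
  A test function with its derivatives, extended by zero in time so that all of them are bounded Borel
  functions on the whole of space-time.
\<close>
definition test_data ::
  "real \<Rightarrow> (real^'n::finite \<Rightarrow> real \<Rightarrow> real) \<Rightarrow> (real^'n \<Rightarrow> real \<Rightarrow> real) \<Rightarrow> (real^'n \<Rightarrow> real \<Rightarrow> real^'n) \<Rightarrow>
   ('n \<Rightarrow> real^'n \<Rightarrow> real \<Rightarrow> real^'n) \<Rightarrow> real \<Rightarrow> real \<Rightarrow> real \<Rightarrow> bool" where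
  "test_data T p p' P Q a b K \<longleftrightarrow>
     (\<lambda>(x, t). p x t) \<in> borel_measurable (borel \<Otimes>\<^sub>M borel) \<and>
     (\<lambda>(x, t). p' x t) \<in> borel_measurable (borel \<Otimes>\<^sub>M borel) \<and>
     (\<lambda>(x, t). P x t) \<in> borel_measurable (borel \<Otimes>\<^sub>M borel) \<and>
     0 < a \<and> a \<le> b \<and> b < T \<and> 0 < K \<and>
     (\<forall>x t. t \<notin> {a..b} \<longrightarrow> p x t = 0 \<and> p' x t = 0 \<and> P x t = 0 \<and> (\<forall>j. Q j x t = 0)) \<and>
     (\<forall>x t. 0 \<le> p x t \<and> p x t \<le> K \<and> \<bar>p' x t\<bar> \<le> K \<and> norm (P x t) \<le> K \<and> (\<forall>j. norm (Q j x t) \<le> K)) \<and>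
     (\<forall>t\<in>{0<..<T}. periodic_C2 (\<lambda>x. p x t) (\<lambda>x. P x t) (\<lambda>j x. Q j x t) \<and>
        (\<forall>x. ((\<lambda>s. p x s) has_real_derivative p' x t) (at t)))"

text \<open>
  The entropy \<open>\<eta>\<close>, its derivative \<open>\<eta>1\<close> and its flux \<open>q\<close> are parameters, so that the smoothed inequality and its
  limit share measurability and bounds.
\<close>
definition entropy_terms ::
  "(real \<Rightarrow> real) \<Rightarrow> (real \<Rightarrow> real) \<Rightarrow> ('n::finite \<Rightarrow> real \<Rightarrow> real) \<Rightarrow> (real^'n) measure \<Rightarrow> real \<Rightarrow>
   (real^'n \<Rightarrow> real \<Rightarrow> real) \<Rightarrow> (real^'n \<Rightarrow> real \<Rightarrow> real) \<Rightarrow> (real^'n \<Rightarrow> real \<Rightarrow> real) \<Rightarrow> (real^'n \<Rightarrow> real \<Rightarrow> real^'n) \<Rightarrow>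
   real^'n \<Rightarrow> real \<Rightarrow> real" where
  "entropy_terms \<eta> \<eta>1 q \<nu> r w p p' P x t =
     \<eta> (w x t) * p' x t + ((\<Sum>j\<in>UNIV. q j (w x t) * P x t $ j)
     + \<eta> (w x t) * levy_adj (small_jumps \<nu> r) (\<lambda>y. p y t) (\<lambda>y. P y t) x
     + \<eta>1 (w x t) * jump_part \<nu> r (\<lambda>y. w y t) x * p x t
     + \<eta> (w x t) * (jump_drift \<nu> r \<bullet> P x t))"

lemma entropy_terms_measurable:
  assumes \<nu>: "levy_kernel \<nu>" and \<eta> [measurable]: "\<eta> \<in> borel_measurable borel" "\<eta>1 \<in> borel_measurable borel"
    "\<And>j. q j \<in> borel_measurable borel"
    and w: "(\<lambda>(x, t). w x t) \<in> borel_measurable (borel \<Otimes>\<^sub>M borel)" and td: "test_data T p p' P Q a b K"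
  shows "(\<lambda>(x, t). entropy_terms \<eta> \<eta>1 q \<nu> r w p p' P x t) \<in> borel_measurable (borel \<Otimes>\<^sub>M borel)"
proof -
  have m: "(\<lambda>(x, t). p x t) \<in> borel_measurable (borel \<Otimes>\<^sub>M borel)"
     "(\<lambda>(x, t). p' x t) \<in> borel_measurable (borel \<Otimes>\<^sub>M borel)"
     "(\<lambda>(x, t). P x t) \<in> borel_measurable (borel \<Otimes>\<^sub>M borel)"
    using td by (auto simp: test_data_def)
  note mm = m[unfolded case_prod_unfold] jump_part_measurable[OF \<nu> w, of r, unfolded case_prod_unfold]
    levy_adj_measurable[OF levy_kernel_small_jumps[OF \<nu>, of r] m(1,3), unfolded case_prod_unfold]
  have ww: "(\<lambda>p. \<eta> (w (fst p) (snd p))) \<in> borel_measurable (borel \<Otimes>\<^sub>M borel)"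
    "(\<lambda>p. \<eta>1 (w (fst p) (snd p))) \<in> borel_measurable (borel \<Otimes>\<^sub>M borel)"
    "(\<lambda>p. q j (w (fst p) (snd p))) \<in> borel_measurable (borel \<Otimes>\<^sub>M borel)" for j
    using measurable_compose[OF w[unfolded case_prod_unfold] \<eta>(1)] measurable_compose[OF w[unfolded case_prod_unfold] \<eta>(2)]
      measurable_compose[OF w[unfolded case_prod_unfold] \<eta>(3)] by auto
  have nth: "(\<lambda>v :: real^'a. v $ j) \<in> borel_measurable borel" "(\<lambda>v :: real^'a. jump_drift \<nu> r \<bullet> v) \<in> borel_measurable borel" for j
    by (auto intro!: continuous_borel continuous_intros)
  show ?thesis unfolding entropy_terms_def case_prod_unfold
    by (intro borel_measurable_add borel_measurable_times borel_measurable_sum ww mm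
        measurable_compose[OF mm(3) nth(1)] measurable_compose[OF mm(3) nth(2)])
qed

lemma entropy_terms_bound:
  assumes \<nu>: "levy_kernel \<nu>" and r: "r > 0" and w: "\<And>x t. \<bar>w x t\<bar> \<le> M" and wm: "\<And>t. (\<lambda>x. w x t) \<in> borel_measurable borel"
    and td: "test_data T p p' P Q a b K"
    and \<eta>: "\<And>s. \<bar>s\<bar> \<le> M \<Longrightarrow> \<bar>\<eta> s\<bar> \<le> b0" "\<And>s. \<bar>s\<bar> \<le> M \<Longrightarrow> \<bar>\<eta>1 s\<bar> \<le> 1" "\<And>j s. \<bar>s\<bar> \<le> M \<Longrightarrow> \<bar>q j s\<bar> \<le> b1"
  shows "\<bar>entropy_terms \<eta> \<eta>1 q \<nu> r w p p' P (x :: real^'n::finite) t\<bar>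
    \<le> b0 * K + real CARD('n) * (b1 * K) + b0 * ((real CARD('n) * K + 2 * K) * (LINT z|small_jumps \<nu> r. min ((norm z)\<^sup>2) 1))
      + 1 * (2 * M * (LINT z:{z. norm z > r}|\<nu>. 1)) * K + b0 * (norm (jump_drift \<nu> r) * K)"
proof -
  have K: "0 \<le> p x t" "p x t \<le> K" "\<bar>p' x t\<bar> \<le> K" "norm (P x t) \<le> K" "norm (Q j x t) \<le> K" for x t j
    using td by (auto simp: test_data_def)
  have K0: "K > 0" using td by (simp add: test_data_def)
  have M0: "M \<ge> 0" using w[of 0 0] by linarith
  have b00: "b0 \<ge> 0" using \<eta>(1)[of 0] M0 by simp
  have b10: "b1 \<ge> 0" using \<eta>(3)[of 0 undefined] M0 by simp
  let ?I = "LINT z|small_jumps \<nu> r. min ((norm z)\<^sup>2) 1"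
  have levy_adj: "\<bar>levy_adj (small_jumps \<nu> r) (\<lambda>y. p y t) (\<lambda>y. P y t) x\<bar> \<le> (real CARD('n) * K + 2 * K) * ?I"
  proof -
    have bd: "\<bar>compensated (\<lambda>y. p y t) (\<lambda>y. P y t) x (- z)\<bar> \<le> (real CARD('n) * K + 2 * K) * min ((norm z)\<^sup>2) 1" for z x
    proof (cases "t \<in> {0<..<T}")
      case True
      then have c2: "periodic_C2 (\<lambda>x. p x t) (\<lambda>x. P x t) (\<lambda>j x. Q j x t)" using td by (simp add: test_data_def)
      have "\<bar>compensated (\<lambda>y. p y t) (\<lambda>y. P y t) x (- z)\<bar> \<le> (real CARD('n) * K + 2 * K) * min ((norm (- z))\<^sup>2) 1"
      proof (rule compensated_bound)
        show "((\<lambda>y. p y t) has_derivative (\<lambda>h. h \<bullet> P y t)) (at y)" for y using c2 by (simp add: periodic_C2_def)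
        show "norm (P y t - P y' t) \<le> (real CARD('n) * K) * norm (y - y')" for y y'
          by (rule gradient_lipschitz[of "\<lambda>y. P y t" "\<lambda>j y. Q j y t" K]) (use c2 K(5) in \<open>auto simp: periodic_C2_def\<close>)
        show "\<bar>p y t\<bar> \<le> K" for y using K(1,2)[of y t] by simp
      qed
      then show ?thesis by simp
    next
      case False
      then have "t \<notin> {a..b}" using td by (auto simp: test_data_def)
      then have "p y t = 0" "P y t = 0" for y using td by (auto simp: test_data_def)
      then show ?thesis using K0 by (simp add: compensated_def)
    qed
    have "(\<lambda>(x, t). p x t) \<in> borel_measurable (borel \<Otimes>\<^sub>M borel)" "(\<lambda>(x, t). P x t) \<in> borel_measurable (borel \<Otimes>\<^sub>M borel)"
      using td by (auto simp: test_data_def)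
    note [measurable] = this[THEN pair_slice]
    have m: "(\<lambda>(x, z). compensated (\<lambda>y. p y t) (\<lambda>y. P y t) x (- z)) \<in> borel_measurable (borel \<Otimes>\<^sub>M borel)"
      unfolding compensated_def by measurable
    show ?thesis
      unfolding levy_adj_def by (rule torus_levy_Fubini(3)[OF levy_kernel_small_jumps[OF \<nu>] m bd])
  qed
  have P: "\<bar>P x t $ j\<bar> \<le> K" for j using component_le_norm_cart[of "P x t" j] K(4)[of x t] by linarith
  have 1: "\<bar>\<eta> (w x t) * p' x t\<bar> \<le> b0 * K" unfolding abs_mult by (intro mult_mono \<eta> w K b00) auto
  have 2: "\<bar>\<Sum>j\<in>UNIV. q j (w x t) * P x t $ j\<bar> \<le> real CARD('n) * (b1 * K)"
  proof -
    have "\<bar>\<Sum>j\<in>UNIV. q j (w x t) * P x t $ j\<bar> \<le> (\<Sum>j\<in>UNIV. \<bar>q j (w x t) * P x t $ j\<bar>)" by (rule sum_abs)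
    also have "\<dots> \<le> (\<Sum>j\<in>(UNIV::'n set). b1 * K)"
      unfolding abs_mult by (intro sum_mono mult_mono \<eta> w P b10) auto
    finally show ?thesis by simp
  qed
  have 3: "\<bar>\<eta> (w x t) * levy_adj (small_jumps \<nu> r) (\<lambda>y. p y t) (\<lambda>y. P y t) x\<bar> \<le> b0 * ((real CARD('n) * K + 2 * K) * ?I)"
    unfolding abs_mult by (intro mult_mono \<eta> w levy_adj b00) auto
  have 4: "\<bar>\<eta>1 (w x t) * jump_part \<nu> r (\<lambda>y. w y t) x * p x t\<bar> \<le> 1 * (2 * M * (LINT z:{z. norm z > r}|\<nu>. 1)) * K"
  proof -
    have o: "\<bar>jump_part \<nu> r (\<lambda>y. w y t) x\<bar> \<le> 2 * M * (LINT z:{z. norm z > r}|\<nu>. 1)"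
      by (rule jump_part_bound[OF \<nu> r wm w])
    have "\<bar>\<eta>1 (w x t) * jump_part \<nu> r (\<lambda>y. w y t) x\<bar> \<le> 1 * (2 * M * (LINT z:{z. norm z > r}|\<nu>. 1))"
      unfolding abs_mult by (intro mult_mono \<eta> w o) auto
    then show ?thesis
      unfolding abs_mult[of _ "p x t"] using K(1,2)[of x t] by (intro mult_mono) (auto intro: order_trans[OF abs_ge_zero])
  qed
  have 5: "\<bar>\<eta> (w x t) * (jump_drift \<nu> r \<bullet> P x t)\<bar> \<le> b0 * (norm (jump_drift \<nu> r) * K)"
    unfolding abs_mult using order_trans[OF Cauchy_Schwarz_ineq2 mult_left_mono[OF K(4)[of x t] norm_ge_zero[of "jump_drift \<nu> r"]]]
    by (intro mult_mono \<eta> w b00) auto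
  show ?thesis using 1 2 3 4 5 unfolding entropy_terms_def by linarith
qed

lemma entropy_terms_outside:
  assumes "test_data T p p' P Q a b K" "t \<notin> {a..b}"
  shows "entropy_terms \<eta> \<eta>1 q \<nu> r w p p' P x t = 0"
proof -
  have "p y t = 0" "p' y t = 0" "P y t = 0" for y using assms by (auto simp: test_data_def)
  then show ?thesis by (simp add: entropy_terms_def levy_adj_def compensated_def)
qed

lemma torus_integral_measurable:
  fixes F :: "real^'n::finite \<Rightarrow> real \<Rightarrow> real"
  assumes m: "(\<lambda>(x, t). F x t) \<in> borel_measurable (borel \<Otimes>\<^sub>M borel)"
  shows "(\<lambda>t. LINT x|torus. F x t) \<in> borel_measurable borel"
proof -
  have "(\<lambda>(t, x). F x t) \<in> borel_measurable (borel \<Otimes>\<^sub>M torus)"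
    using measurable_compose[OF measurable_pair_swap'[of borel borel] m] by (simp add: case_prod_unfold cong: measurable_cong_sets)
  from torus.borel_measurable_lebesgue_integral[OF this] show ?thesis by simp
qed

lemma torus_integral_bound:
  assumes "(\<lambda>x. F x) \<in> borel_measurable borel" "\<And>x::real^'n::finite. \<bar>F x\<bar> \<le> C"
  shows "\<bar>LINT x|torus. F x\<bar> \<le> C * measure torus (UNIV :: (real^'n) set)"
proof -
  have i: "integrable torus F" by (rule integrable_torus[OF assms])
  have "\<bar>LINT x|torus. F x\<bar> \<le> (LINT x|torus. \<bar>F x\<bar>)" by (rule integral_abs_bound)
  also have "\<dots> \<le> (LINT x|(torus :: (real^'n) measure). C)"
    using i assms(2) torus.integrable_const by (intro integral_mono) auto
  finally show ?thesis by (simp add: mult.commute)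
qed

lemma set_integrable_time:
  fixes F :: "real \<Rightarrow> real"
  assumes "F \<in> borel_measurable borel" "\<And>t. \<bar>F t\<bar> \<le> C" "A \<in> sets borel" "emeasure lborel A < \<infinity>"
  shows "set_integrable lborel A F"
proof -
  have "integrable lborel (\<lambda>t. C * indicator A t)" using assms(3,4) by (simp add: integrable_real_indicator)
  then show ?thesis unfolding set_integrable_def
    by (rule Bochner_Integration.integrable_bound)
      (use assms in \<open>auto simp: indicator_def intro!: AE_I2 order_trans[OF assms(2)]\<close>)
qed

context viscous_setting
begin

abbreviation "smoothed_terms B c k \<equiv> entropy_terms (\<lambda>s. sabs B c (s - k)) (\<lambda>s. sabs' B c (s - k)) (flux_primitive f' B c k) \<nu>"

text \<open>
  The weighted entropy \<open>E\<close> vanishes at times before and after the support of the test function, so that the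
  integral of its derivative is zero; entropy production bounds this derivative from above. The function
  \<open>w\<close> is an extension of \<open>v\<close> for which the integrals over all of space-time make sense.
\<close>
lemma smoothed_entropy_inequality:
  assumes v: "viscous_solution f' \<nu> \<epsilon> T v v' D H" and \<epsilon>: "\<epsilon> \<ge> 0" and k: "\<bar>k\<bar> < B" and c: "0 < c" "c < 1" and r: "r > 0"
    and vb: "\<And>x t. 0 < t \<Longrightarrow> t < T \<Longrightarrow> \<bar>v x t - k\<bar> \<le> B"
    and td: "test_data T p p' P Q a b K"
    and w: "(\<lambda>(x, t). w x t) \<in> borel_measurable (borel \<Otimes>\<^sub>M borel)" "\<And>x t. \<bar>w x t\<bar> \<le> M" "\<And>x t. 0 < t \<Longrightarrow> t < T \<Longrightarrow> w x t = v x t"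
    and C: "\<And>x t. \<bar>smoothed_terms B c k r w p p' P x t\<bar> \<le> C"
  shows "0 \<le> (LINT t:{0<..<T}|lborel. LINT x|torus. smoothed_terms B c k r w p p' P x t)
      + \<epsilon> * (4 * B * (real CARD('n) * K) * torus_vol * T)"
proof -
  have B: "B > 0" using k by linarith
  have ab: "0 < a" "a \<le> b" "b < T" and K0: "K > 0" using td by (auto simp: test_data_def)
  have KK: "0 \<le> p x t" "p x t \<le> K" "\<bar>p' x t\<bar> \<le> K" "norm (P x t) \<le> K" "norm (Q j x t) \<le> K" for x t j
    using td by (auto simp: test_data_def)
  have zero: "p x t = 0" if "t \<notin> {a..b}" for x t using td that by (auto simp: test_data_def)
  have c2: "periodic_C2 (\<lambda>x. p x t) (\<lambda>x. P x t) (\<lambda>j x. Q j x t)" if "0 < t" "t < T" for t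
    using td that by (auto simp: test_data_def)
  have pdt: "((\<lambda>s. p x s) has_real_derivative p' x t) (at t)" if "0 < t" "t < T" for x t
    using td that by (auto simp: test_data_def)
  have p'm: "(\<lambda>x. p' x t) \<in> borel_measurable borel" for t
    by (rule pair_slice) (use td in \<open>auto simp: test_data_def\<close>)
  define \<alpha> \<beta> where "\<alpha> = a / 2" and "\<beta> = (b + T) / 2"
  have \<alpha>\<beta>: "0 < \<alpha>" "\<alpha> < a" "b < \<beta>" "\<beta> < T" "\<alpha> \<le> \<beta>" using ab by (auto simp: \<alpha>_def \<beta>_def)
  let ?S = "smoothed_terms B c k r w p p' P"
  let ?F = "\<lambda>t. LINT x|torus. ?S x t"
  let ?Z = "4 * B * (real CARD('n) * K) * torus_vol"
  have Z0: "?Z \<ge> 0" using B K0 torus_vol_nonneg by simp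
  let ?E = "\<lambda>t. LINT x|torus. sabs B c (v x t - k) * p x t"
  let ?E' = "\<lambda>t. LINT x|torus. sabs' B c (v x t - k) * v' x t * p x t + sabs B c (v x t - k) * p' x t"
  have sab: "\<bar>sabs B c (v x t - k)\<bar> \<le> 4 * B" if "0 < t" "t < T" for x t
  proof -
    from sabs_abs[OF B c(1) vb[OF that, of x]] have "\<bar>sabs B c (v x t - k)\<bar> \<le> B + c * (B * (2 + c))"
      using vb[OF that, of x] by linarith
    also have "c * (B * (2 + c)) \<le> 1 * (B * 3)" using c B by (intro mult_mono) auto
    finally show ?thesis by simp
  qed
  have sgnb: "\<bar>sabs' B c (v x t - k)\<bar> \<le> 1" if "0 < t" "t < T" for x t
    by (rule sabs'_le_1[OF B c(1) vb[OF that]])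
  have cont: "continuous_on UNIV (\<lambda>x. sabs B c (v x t - k))" "continuous_on UNIV (\<lambda>x. sabs' B c (v x t - k))"
     "continuous_on UNIV (\<lambda>x. p x t)" "continuous_on UNIV (\<lambda>x. v' x t)"
    "periodic (\<lambda>x. sabs B c (v x t - k))" "periodic (\<lambda>x. sabs' B c (v x t - k))" "periodic (\<lambda>x. p x t)" "periodic (\<lambda>x. v' x t)"
    if "0 < t" "t < T" for t
    using viscous_solutionD(2,5,6,10)[OF v that] periodic_C2_continuous[OF c2[OF that]]
    by (auto intro!: continuous_on_compose2[OF sabs_continuous[OF B c(1)]] continuous_on_compose2[OF sabs'_continuous[OF B c(1)]]
        continuous_intros simp: periodic_def)
  have i1: "integrable torus (\<lambda>x. sabs' B c (v x t - k) * v' x t * p x t)" if "0 < t" "t < T" for t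
    by (intro integrable_torus_continuous periodic_mult continuous_intros cont that)
  have i2: "integrable torus (\<lambda>x. sabs B c (v x t - k) * p' x t)" if t: "0 < t" "t < T" for t
    using p'm[of t] continuous_borel[OF cont(1)[OF t]] sab[OF t] KK(3) B
    by (intro integrable_torus[where B="4 * B * K"]) (auto simp: abs_mult intro!: mult_mono)
  have dE: "(?E has_real_derivative ?E' t) (at t)" if t: "0 < t" "t < T" for t
  proof -
    have ts: "0 < t / 2" "(t + T) / 2 < T" "t / 2 < t" "t < (t + T) / 2" using t by auto
    obtain K1 where K1: "K1 > 0" "\<And>x \<tau>. t / 2 \<le> \<tau> \<Longrightarrow> \<tau> \<le> (t + T) / 2 \<Longrightarrow> \<bar>v' x \<tau>\<bar> \<le> K1"
      using viscous_solution_bounds[OF v ts(1,2)] by metis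
    show ?thesis
    proof (rule torus.has_derivative_integral[OF ts(3,4), where K="1 * K1 * K + 4 * B * K"])
      show "integrable torus (\<lambda>x. sabs B c (v x s - k) * p x s)" if "t / 2 < s" "s < (t + T) / 2" for s
        using that t by (intro integrable_torus_continuous periodic_mult continuous_intros cont) auto
      show "(\<lambda>x. sabs' B c (v x t - k) * v' x t * p x t + sabs B c (v x t - k) * p' x t) \<in> borel_measurable torus"
        using i1[OF t] i2[OF t] by (intro borel_measurable_integrable) simp
      fix s x assume s: "t / 2 < s" "s < (t + T) / 2"
      then have s': "0 < s" "s < T" using t by auto
      have "((\<lambda>s. v x s - k) has_real_derivative v' x s) (at s)"
        using viscous_solutionD(4)[OF v s', of x] by (auto intro!: derivative_eq_intros)
      from DERIV_mult[OF DERIV_chain2[OF sabs_deriv[OF B c(1)] this] pdt[OF s', of x]]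
      show "((\<lambda>s. sabs B c (v x s - k) * p x s) has_real_derivative sabs' B c (v x s - k) * v' x s * p x s + sabs B c (v x s - k) * p' x s) (at s)"
        by (simp add: algebra_simps)
      have "\<bar>sabs' B c (v x s - k) * v' x s\<bar> \<le> 1 * K1"
        unfolding abs_mult using s K1 by (intro mult_mono sgnb s') auto
      then have "\<bar>sabs' B c (v x s - k) * v' x s * p x s\<bar> \<le> 1 * K1 * K"
        unfolding abs_mult[of _ "p x s"] using KK(1,2)[of x s] K1 by (intro mult_mono) auto
      moreover have "\<bar>sabs B c (v x s - k) * p' x s\<bar> \<le> 4 * B * K"
        unfolding abs_mult using B by (intro mult_mono sab s' KK) auto
      ultimately show "\<bar>sabs' B c (v x s - k) * v' x s * p x s + sabs B c (v x s - k) * p' x s\<bar> \<le> 1 * K1 * K + 4 * B * K"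
        by linarith
    qed
  qed
  have E'le: "?E' t \<le> ?F t + \<epsilon> * ?Z" if t: "0 < t" "t < T" for t
  proof -
    note EP = entropy_production[OF B c(1) r viscous_solutionD(1)[OF v t] c2[OF t] KK(1) \<epsilon> viscous_solutionD(9)[OF v t]
        viscous_solutionD(6)[OF v t] viscous_solutionD(2)[OF v t], of k]
    have cQ: "continuous_on UNIV (\<lambda>x. \<Sum>j\<in>UNIV. Q j x t $ j)" and pQ: "periodic (\<lambda>x. \<Sum>j\<in>UNIV. Q j x t $ j)"
      using periodic_C2_continuous(3,6)[OF c2[OF t]] by (auto intro!: continuous_intros simp: periodic_def)
    have lap: "(LINT x|torus. sabs B c (v x t - k) * (\<Sum>j\<in>UNIV. Q j x t $ j)) \<le> ?Z"
    proof (rule integral_le_torus_vol)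
      show "integrable torus (\<lambda>x. sabs B c (v x t - k) * (\<Sum>j\<in>UNIV. Q j x t $ j))"
        by (intro integrable_torus_continuous periodic_mult continuous_on_mult cont t cQ pQ)
      fix x
      have "\<bar>\<Sum>j\<in>UNIV. Q j x t $ j\<bar> \<le> (\<Sum>j\<in>UNIV. \<bar>Q j x t $ j\<bar>)" by (rule sum_abs)
      also have "\<dots> \<le> (\<Sum>j\<in>(UNIV::'n set). K)"
        by (intro sum_mono order_trans[OF component_le_norm_cart KK(5)])
      finally have "\<bar>\<Sum>j\<in>UNIV. Q j x t $ j\<bar> \<le> real CARD('n) * K" by simp
      then have "\<bar>sabs B c (v x t - k) * (\<Sum>j\<in>UNIV. Q j x t $ j)\<bar> \<le> 4 * B * (real CARD('n) * K)"
        unfolding abs_mult using B by (intro mult_mono sab t) auto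
      then show "sabs B c (v x t - k) * (\<Sum>j\<in>UNIV. Q j x t $ j) \<le> 4 * B * (real CARD('n) * K)" by linarith
    qed
    have wv: "(\<lambda>x. w x t) = (\<lambda>x. v x t)" using w(3)[OF t] by auto
    have S: "?S x t = sabs B c (v x t - k) * p' x t + smooth_entropy_terms f' \<nu> B c k r (\<lambda>x. v x t) (\<lambda>x. p x t) (\<lambda>x. P x t) x" for x
      unfolding entropy_terms_def smooth_entropy_terms_def wv w(3)[OF t] by simp
    have "?E' t = (LINT x|torus. sabs' B c (v x t - k) * v' x t * p x t) + (LINT x|torus. sabs B c (v x t - k) * p' x t)"
      using i1[OF t] i2[OF t] by simp
    also have "\<dots> \<le> (LINT x|torus. smooth_entropy_terms f' \<nu> B c k r (\<lambda>x. v x t) (\<lambda>x. p x t) (\<lambda>x. P x t) x) + \<epsilon> * ?Z + (LINT x|torus. sabs B c (v x t - k) * p' x t)"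
      using EP(1) mult_left_mono[OF lap \<epsilon>] by linarith
    also have "\<dots> = ?F t + \<epsilon> * ?Z"
      unfolding S using i2[OF t] EP(2) by simp
    finally show ?thesis .
  qed
  have Sm: "(\<lambda>(x, t). ?S x t) \<in> borel_measurable (borel \<Otimes>\<^sub>M borel)"
    by (rule entropy_terms_measurable[OF levy _ _ _ w(1) td])
      (auto intro!: continuous_borel continuous_on_compose2[OF sabs_continuous[OF B c(1)]]
        continuous_on_compose2[OF sabs'_continuous[OF B c(1)]] flux_primitive_cont[OF B c(1)] continuous_intros)
  have Fm: "?F \<in> borel_measurable borel" by (rule torus_integral_measurable[OF Sm])
  have Fb: "\<bar>?F t\<bar> \<le> C * torus_vol" for t
    unfolding torus_vol_def by (rule torus_integral_bound[OF pair_slice[OF Sm] C])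
  have F0: "?F t = 0" if "t \<notin> {a..b}" for t
    using entropy_terms_outside[OF td that] by simp
  have E0: "?E \<alpha> = 0" "?E \<beta> = 0" using zero[of \<alpha>] zero[of \<beta>] \<alpha>\<beta> by auto
  have "(?E' has_integral (?E \<beta> - ?E \<alpha>)) {\<alpha>..\<beta>}"
  proof (rule fundamental_theorem_of_calculus[OF \<alpha>\<beta>(5)])
    fix t assume "t \<in> {\<alpha>..\<beta>}"
    then show "(?E has_vector_derivative ?E' t) (at t within {\<alpha>..\<beta>})"
      using dE[of t] \<alpha>\<beta> by (auto simp: has_real_derivative_iff_has_vector_derivative intro: has_vector_derivative_at_within)
  qed
  then have hi1: "(?E' has_integral 0) {\<alpha>..\<beta>}" using E0 by simp
  have si: "set_integrable lborel {\<alpha>..\<beta>} ?F" by (rule set_integrable_time[OF Fm Fb]) (use \<alpha>\<beta>(5) in auto)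
  have hi2: "(?F has_integral (LINT t:{\<alpha>..\<beta>}|lborel. ?F t)) {\<alpha>..\<beta>}"
    using set_borel_integral_eq_integral[OF si] by (simp add: has_integral_iff)
  have hi3: "((\<lambda>t. ?F t + \<epsilon> * ?Z) has_integral ((LINT t:{\<alpha>..\<beta>}|lborel. ?F t) + (\<beta> - \<alpha>) * (\<epsilon> * ?Z))) {\<alpha>..\<beta>}"
    using has_integral_add[OF hi2 has_integral_const_real[of "\<epsilon> * ?Z" \<alpha> \<beta>]] \<alpha>\<beta> by simp
  have "0 \<le> (LINT t:{\<alpha>..\<beta>}|lborel. ?F t) + (\<beta> - \<alpha>) * (\<epsilon> * ?Z)"
    by (rule has_integral_le[OF hi1 hi3]) (use E'le \<alpha>\<beta> in auto)
  also have "(\<beta> - \<alpha>) * (\<epsilon> * ?Z) \<le> T * (\<epsilon> * ?Z)"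
    using \<alpha>\<beta> \<epsilon> Z0 by (intro mult_right_mono) auto
  also have "(LINT t:{\<alpha>..\<beta>}|lborel. ?F t) = (LINT t:{0<..<T}|lborel. ?F t)"
    unfolding set_lebesgue_integral_def
  proof (rule Bochner_Integration.integral_cong[OF refl])
    fix t show "indicator {\<alpha>..\<beta>} t *\<^sub>R ?F t = indicator {0<..<T} t *\<^sub>R ?F t"
      using F0[of t] \<alpha>\<beta> by (cases "t \<in> {a..b}") (auto simp: indicator_def)
  qed
  finally show ?thesis by (simp add: mult_ac)
qed

text \<open>
  The upper limit of \<open>\<bar>W n - u\<bar>\<close> is a periodic Borel function with integral zero, hence so are all its translates.
  By Tonelli's theorem, for almost every \<open>x\<close> there is convergence at \<open>x + z\<close> for almost every jump \<open>z\<close>.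
\<close>
lemma jump_part_convergence:
  assumes r: "r > 0" and W: "\<And>n. W n \<in> borel_measurable borel" "\<And>n x. \<bar>W n x\<bar> \<le> M" "\<And>n. periodic (W n)"
    and u: "u \<in> borel_measurable borel" "\<And>x. \<bar>u x\<bar> \<le> M" "periodic u"
    and ae: "AE x in torus. (\<lambda>n. W n x) \<longlonglongrightarrow> u x"
  shows "AE x in torus. (\<lambda>n. jump_part \<nu> r (W n) x) \<longlonglongrightarrow> jump_part \<nu> r u x"
proof -
  have [measurable_cong]: "sets \<nu> = sets borel" using levy by (auto simp: levy_kernel_def)
  interpret \<nu>: sigma_finite_measure \<nu> using levy by (simp add: levy_kernel_def)
  interpret P: pair_sigma_finite torus \<nu> by standard
  note [measurable] = W(1) u(1) closed_ball_sets
  let ?D = "\<lambda>x. limsup (\<lambda>n. ennreal \<bar>W n x - u x\<bar>)"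
  have conv: "(\<lambda>n. W n x) \<longlonglongrightarrow> u x" if "?D x = 0" for x
  proof -
    from tendsto_0_if_Limsup_eq_0_ennreal[OF that] have "(\<lambda>n. ennreal \<bar>W n x - u x\<bar>) \<longlonglongrightarrow> ennreal 0" by simp
    then have "(\<lambda>n. \<bar>W n x - u x\<bar>) \<longlonglongrightarrow> 0" by (subst (asm) tendsto_ennreal_iff) auto
    then have "(\<lambda>n. W n x - u x) \<longlonglongrightarrow> 0" by (simp add: tendsto_rabs_zero_iff)
    then show ?thesis by (simp add: LIM_zero_iff)
  qed
  have "AE x in torus. ?D x = 0"
    using ae
  proof eventually_elim
    fix x assume "(\<lambda>n. W n x) \<longlonglongrightarrow> u x"
    then have "(\<lambda>n. \<bar>W n x - u x\<bar>) \<longlonglongrightarrow> 0" by (simp add: LIM_zero tendsto_rabs_zero)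
    then have "(\<lambda>n. ennreal \<bar>W n x - u x\<bar>) \<longlonglongrightarrow> 0" using tendsto_ennrealI by fastforce
    then show "?D x = 0" by (intro lim_imp_Limsup) auto
  qed
  then have D0: "(\<integral>\<^sup>+x. ?D x \<partial>torus) = 0" by (subst nn_integral_0_iff_AE) measurable
  have Dp: "periodic ?D" using W(3) u(3) by (simp add: periodic_def)
  have Dsh: "(\<integral>\<^sup>+x. ?D (x + z) \<partial>torus) = 0" for z
    using nn_integral_torus_shift[of ?D z, OF _ Dp] D0 by simp
  have "(\<integral>\<^sup>+x. \<integral>\<^sup>+z. ?D (x + z) \<partial>\<nu> \<partial>torus) = (\<integral>\<^sup>+z. \<integral>\<^sup>+x. ?D (x + z) \<partial>torus \<partial>\<nu>)"
    by (rule P.Fubini'[symmetric]) measurable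
  also have "\<dots> = 0" by (simp add: Dsh)
  finally have "AE x in torus. (\<integral>\<^sup>+z. ?D (x + z) \<partial>\<nu>) = 0"
    by (subst (asm) nn_integral_0_iff_AE) measurable
  with ae show ?thesis
  proof eventually_elim
    fix x assume cx: "(\<lambda>n. W n x) \<longlonglongrightarrow> u x" and "(\<integral>\<^sup>+z. ?D (x + z) \<partial>\<nu>) = 0"
    then have az: "AE z in \<nu>. ?D (x + z) = 0" by (subst (asm) nn_integral_0_iff_AE) measurable
    show "(\<lambda>n. jump_part \<nu> r (W n) x) \<longlonglongrightarrow> jump_part \<nu> r u x"
      unfolding jump_part_def set_lebesgue_integral_def
    proof (rule integral_dominated_convergence[where w="\<lambda>z. indicator {z. norm z > r} z *\<^sub>R (2 * M)"])
      show "integrable \<nu> (\<lambda>z. indicator {z. norm z > r} z *\<^sub>R (2 * M))"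
        using levy_kernel_outer(1)[OF levy r, of "\<lambda>_. 2 * M" "\<bar>2 * M\<bar>"] by (simp add: set_integrable_def)
      show "AE z in \<nu>. (\<lambda>n. indicator {z. norm z > r} z *\<^sub>R (W n (x + z) - W n x)) \<longlonglongrightarrow> indicator {z. norm z > r} z *\<^sub>R (u (x + z) - u x)"
        using az
      proof eventually_elim
        fix z assume "?D (x + z) = 0"
        from conv[OF this] cx show "(\<lambda>n. indicator {z. norm z > r} z *\<^sub>R (W n (x + z) - W n x)) \<longlonglongrightarrow> indicator {z. norm z > r} z *\<^sub>R (u (x + z) - u x)"
          by (intro tendsto_intros)
      qed
      show "AE z in \<nu>. norm (indicator {z. norm z > r} z *\<^sub>R (W n (x + z) - W n x)) \<le> indicator {z. norm z > r} z *\<^sub>R (2 * M)" for n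
      proof (rule AE_I2)
        fix z
        have "\<bar>W n (x + z) - W n x\<bar> \<le> 2 * M" using W(2)[of n "x + z"] W(2)[of n x] by linarith
        then show "norm (indicator {z. norm z > r} z *\<^sub>R (W n (x + z) - W n x)) \<le> indicator {z. norm z > r} z *\<^sub>R (2 * M)"
          by (simp add: indicator_def)
      qed
    qed measurable
  qed
qed

end

section \<open>Passage to the limit in the entropy inequality\<close>

lemma time_dominated_convergence:
  fixes F :: "nat \<Rightarrow> real^'n::finite \<Rightarrow> real \<Rightarrow> real"
  assumes Fm: "\<And>n. (\<lambda>(x, t). F n x t) \<in> borel_measurable (borel \<Otimes>\<^sub>M borel)"
    and Gm: "(\<lambda>(x, t). G x t) \<in> borel_measurable (borel \<Otimes>\<^sub>M borel)"
    and C: "\<And>n x t. \<bar>F n x t\<bar> \<le> C"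
    and lim: "\<And>t. 0 < t \<Longrightarrow> t < T \<Longrightarrow> AE x in torus. (\<lambda>n. F n x t) \<longlonglongrightarrow> G x t"
  shows "(\<lambda>n. LINT t:{0<..<T}|lborel. LINT x|torus. F n x t) \<longlonglongrightarrow> (LINT t:{0<..<T}|lborel. LINT x|torus. G x t)"
proof -
  let ?v = "measure torus (UNIV :: (real^'n) set)"
  have l: "(\<lambda>n. LINT x|torus. F n x t) \<longlonglongrightarrow> (LINT x|torus. G x t)" if t: "0 < t" "t < T" for t
  proof (rule integral_dominated_convergence[where w="\<lambda>_. C"])
    show "AE x in torus. norm (F n x t) \<le> C" for n using C by auto
  qed (use lim[OF t] pair_slice[OF Fm] pair_slice[OF Gm] in \<open>auto intro: torus.integrable_const cong: measurable_cong_sets\<close>)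
  show ?thesis
    unfolding set_lebesgue_integral_def
  proof (rule integral_dominated_convergence[where w="\<lambda>t. indicator {0<..<T} t * (C * ?v)"])
    show "(\<lambda>t. indicator {0<..<T} t *\<^sub>R (LINT x|torus. G x t)) \<in> borel_measurable lborel"
      "(\<lambda>t. indicator {0<..<T} t *\<^sub>R (LINT x|torus. F n x t)) \<in> borel_measurable lborel" for n
      using torus_integral_measurable[OF Gm] torus_integral_measurable[OF Fm] by simp_all
    show "integrable lborel (\<lambda>t. indicator {0<..<T} t * (C * ?v))"
      by (intro integrable_mult_left integrable_real_indicator) (cases "0 \<le> T"; simp)+
    show "AE t in lborel. (\<lambda>n. indicator {0<..<T} t *\<^sub>R (LINT x|torus. F n x t)) \<longlonglongrightarrow> indicator {0<..<T} t *\<^sub>R (LINT x|torus. G x t)"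
      using l by (auto simp: indicator_def)
    show "AE t in lborel. norm (indicator {0<..<T} t *\<^sub>R (LINT x|torus. F n x t)) \<le> indicator {0<..<T} t * (C * ?v)" for n
      using torus_integral_bound[OF pair_slice[OF Fm] C] by (auto simp: indicator_def)
  qed
qed

context viscous_family
begin

text \<open>
  The viscosity tends to zero first: the sign in front of the large jumps is not continuous at \<open>k\<close>, whereas its
  smoothed version is.
\<close>
lemma limit_entropy_inequality:
  assumes E: "\<And>n. E n > 0" "E \<longlonglongrightarrow> 0"
    and u: "(\<lambda>(x, t). u x t) \<in> borel_measurable borel" "\<And>t. periodic (\<lambda>x. u x t)" "\<And>x t. \<bar>u x t\<bar> \<le> M"
    and ae: "\<And>t. 0 < t \<Longrightarrow> t < T \<Longrightarrow> AE x in torus. (\<lambda>n. V (E n) x t) \<longlonglongrightarrow> u x t"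
    and r: "r > 0" and td: "test_data T p p' P Q a b' K"
  shows "0 \<le> (LINT t:{0<..<T}|lborel. LINT x|torus.
      entropy_terms (\<lambda>s. \<bar>s - k\<bar>) (\<lambda>s. sgn (s - k)) (\<lambda>j s. sgn (s - k) * (f j s - f j k)) \<nu> r u p p' P x t)"
proof -
  define B where "B = M + \<bar>k\<bar> + 1"
  have B: "B > 0" "\<bar>k\<bar> < B" using M by (auto simp: B_def)
  have wB: "\<bar>s - k\<bar> \<le> B" if "\<bar>s\<bar> \<le> M" for s using that by (auto simp: B_def)
  obtain L where L: "L > 0" "\<And>j s. \<bar>s\<bar> \<le> B \<Longrightarrow> \<bar>f' j s\<bar> \<le> L" using flux_lipschitz_const by blast
  have um: "(\<lambda>(x, t). u x t) \<in> borel_measurable (borel \<Otimes>\<^sub>M borel)" using u(1) by (simp add: borel_prod)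
  define w where "w n = W (E n)" for n
  have Wm: "(\<lambda>(x, t). w n x t) \<in> borel_measurable (borel \<Otimes>\<^sub>M borel)" for n
    unfolding w_def by (rule W_measurable[OF E(1)])
  have W_eq: "w n x t = V (E n) x t" if "0 < t" "t < T" for n x t unfolding w_def by (rule W_eq[OF that])
  have Wb: "\<bar>w n x t\<bar> \<le> M" for n x t unfolding w_def by (rule W_bound[OF E(1)])
  have Wp: "periodic (\<lambda>x. w n x t)" for n t unfolding w_def by (rule W_periodic[OF E(1)])
  have saB: "\<bar>sabs B c (s - k)\<bar> \<le> 4 * B" if c: "0 < c" "c \<le> 1" and s: "\<bar>s\<bar> \<le> M" for c s
  proof -
    from sabs_abs[OF B(1) c(1) wB[OF s]] wB[OF s] have "\<bar>sabs B c (s - k)\<bar> \<le> B + c * (B * (2 + c))" by linarith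
    also have "c * (B * (2 + c)) \<le> 1 * (B * 3)" using c B by (intro mult_mono) auto
    finally show ?thesis by simp
  qed
  have sgnB: "\<bar>sabs' B c (s - k)\<bar> \<le> 1" if "0 < c" "\<bar>s\<bar> \<le> M" for c s
    by (rule sabs'_le_1[OF B(1) that(1) wB[OF that(2)]])
  have ss: "\<bar>s\<bar> \<le> B" "\<bar>k\<bar> \<le> B" "L * \<bar>s - k\<bar> \<le> L * B" if "\<bar>s\<bar> \<le> M" for s
    using that M L wB[OF that] by (auto simp: B_def)
  have flB: "\<bar>f j s - f j k\<bar> \<le> L * B" if s: "\<bar>s\<bar> \<le> M" for s j
    using flux_lipschitz[OF L(2) ss(1,2)[OF s], of j] ss(3)[OF s] by linarith
  have fpa: "\<bar>flux_primitive f' B c k j s - sabs' B c (s - k) * (f j s - f j k)\<bar> \<le> c * (L * B)"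
    if c: "0 < c" and s: "\<bar>s\<bar> \<le> M" for c s j
    using flux_primitive_approx[OF B(1) c L(2) ss(1,2)[OF s], of j] mult_left_mono[OF ss(3)[OF s] less_imp_le[OF c]] by linarith
  have qB: "\<bar>flux_primitive f' B c k j s\<bar> \<le> 2 * (L * B)" if c: "0 < c" "c \<le> 1" and s: "\<bar>s\<bar> \<le> M" for c s j
  proof -
    have "\<bar>sabs' B c (s - k) * (f j s - f j k)\<bar> \<le> 1 * (L * B)"
      unfolding abs_mult by (intro mult_mono sgnB flB c s) auto
    moreover have "c * (L * B) \<le> 1 * (L * B)" using c L B by (intro mult_right_mono) auto
    ultimately show ?thesis using fpa[OF c(1) s, of j] by linarith
  qed
  let ?S = "\<lambda>c. smoothed_terms B c k r"
  let ?C = "4 * B * K + real CARD('n) * (2 * (L * B) * K) + 4 * B * ((real CARD('n) * K + 2 * K) * (LINT z|small_jumps \<nu> r. min ((norm z)\<^sup>2) 1))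
      + 1 * (2 * M * (LINT z:{z. norm z > r}|\<nu>. 1)) * K + 4 * B * (norm (jump_drift \<nu> r) * K)"
  have SB: "\<bar>?S c w p p' P x t\<bar> \<le> ?C"
    if "0 < c" "c \<le> 1" "(\<lambda>(x, t). w x t) \<in> borel_measurable (borel \<Otimes>\<^sub>M borel)" "\<And>x t. \<bar>w x t\<bar> \<le> M" for c w x t
    by (rule entropy_terms_bound[OF levy r that(4) pair_slice[OF that(3)] td saB[OF that(1,2)] sgnB[OF that(1)] qB[OF that(1,2)]])
  have cont: "continuous_on UNIV (\<lambda>s. sabs B c (s - k))" "continuous_on UNIV (\<lambda>s. sabs' B c (s - k))" if "c > 0" for c
    by (auto intro!: continuous_on_compose2[OF sabs_continuous[OF B(1) that]] continuous_on_compose2[OF sabs'_continuous[OF B(1) that]] continuous_intros)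
  have Sm: "(\<lambda>(x, t). ?S c w p p' P x t) \<in> borel_measurable (borel \<Otimes>\<^sub>M borel)"
    if "0 < c" "(\<lambda>(x, t). w x t) \<in> borel_measurable (borel \<Otimes>\<^sub>M borel)" for c w
    by (rule entropy_terms_measurable[OF levy continuous_borel[OF cont(1)[OF that(1)]] continuous_borel[OF cont(2)[OF that(1)]]
      continuous_borel[OF flux_primitive_cont[OF B(1) that(1)]] that(2) td])
  \<comment> \<open>For a fixed smoothing all terms depend continuously on the solution, so that almost everywhere
    convergence of the viscous approximations suffices.\<close>
  have ineq: "0 \<le> (LINT t:{0<..<T}|lborel. LINT x|torus. ?S c u p p' P x t)" if c: "0 < c" "c < 1" for c
  proof -
    let ?Z = "4 * B * (real CARD('n) * K) * torus_vol * T"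
    have "(\<lambda>n. LINT t:{0<..<T}|lborel. LINT x|torus. ?S c (w n) p p' P x t) \<longlonglongrightarrow> (LINT t:{0<..<T}|lborel. LINT x|torus. ?S c u p p' P x t)"
    proof (rule time_dominated_convergence)
      show "(\<lambda>(x, t). ?S c (w n) p p' P x t) \<in> borel_measurable (borel \<Otimes>\<^sub>M borel)" for n by (rule Sm[OF c(1) Wm])
      show "(\<lambda>(x, t). ?S c u p p' P x t) \<in> borel_measurable (borel \<Otimes>\<^sub>M borel)" by (rule Sm[OF c(1) um])
      show "\<bar>?S c (w n) p p' P x t\<bar> \<le> ?C" for n x t using c by (intro SB Wm Wb) auto
      fix t assume t: "0 < t" "t < T"
      have aet: "AE x in torus. (\<lambda>n. w n x t) \<longlonglongrightarrow> u x t" using ae[OF t] by (simp add: W_eq[OF t])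
      from jump_part_convergence[OF r pair_slice[OF Wm] Wb Wp pair_slice[OF um] u(3) u(2) this]
      have "AE x in torus. (\<lambda>n. jump_part \<nu> r (\<lambda>y. w n y t) x) \<longlonglongrightarrow> jump_part \<nu> r (\<lambda>y. u y t) x" .
      with aet show "AE x in torus. (\<lambda>n. ?S c (w n) p p' P x t) \<longlonglongrightarrow> ?S c u p p' P x t"
      proof eventually_elim
        fix x assume l1: "(\<lambda>n. w n x t) \<longlonglongrightarrow> u x t" and l2: "(\<lambda>n. jump_part \<nu> r (\<lambda>y. w n y t) x) \<longlonglongrightarrow> jump_part \<nu> r (\<lambda>y. u y t) x"
        have l3: "(\<lambda>n. h (w n x t)) \<longlonglongrightarrow> h (u x t)" if "continuous_on UNIV h" for h :: "real \<Rightarrow> real"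
          by (rule continuous_on_tendsto_compose[OF that l1]) auto
        show "(\<lambda>n. ?S c (w n) p p' P x t) \<longlonglongrightarrow> ?S c u p p' P x t"
          unfolding entropy_terms_def
          by (intro tendsto_add tendsto_mult tendsto_sum tendsto_const l2 l3[OF cont(1)[OF c(1)]] l3[OF cont(2)[OF c(1)]]
              l3[OF flux_primitive_cont[OF B(1) c(1)]])
      qed
    qed
    then have lim: "(\<lambda>n. (LINT t:{0<..<T}|lborel. LINT x|torus. ?S c (w n) p p' P x t) + E n * ?Z)
        \<longlonglongrightarrow> (LINT t:{0<..<T}|lborel. LINT x|torus. ?S c u p p' P x t) + 0 * ?Z"
      by (intro tendsto_intros E(2))
    have "0 \<le> (LINT t:{0<..<T}|lborel. LINT x|torus. ?S c (w n) p p' P x t) + E n * ?Z" for n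
    proof (rule smoothed_entropy_inequality[OF solution[OF E(1)] less_imp_le[OF E(1)] B(2) c r _ td Wm Wb W_eq])
      show "\<bar>V (E n) x t - k\<bar> \<le> B" if "0 < t" "t < T" for x t by (rule wB[OF V_bound[OF E(1) that]])
      show "\<bar>?S c (w n) p p' P x t\<bar> \<le> ?C" for x t using c by (intro SB Wm Wb) auto
    qed
    then have "0 \<le> (LINT t:{0<..<T}|lborel. LINT x|torus. ?S c u p p' P x t) + 0 * ?Z"
      by (intro tendsto_lowerbound[OF lim]) auto
    then show ?thesis by simp
  qed
  \<comment> \<open>The smoothed entropy and its derivative converge at every point, at \<open>s = k\<close> because the derivative
    is odd. The index is shifted by two so that the smoothing parameter stays below one.\<close>
  let ?c = "\<lambda>n. 1 / real (Suc (Suc n))"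
  let ?N = "entropy_terms (\<lambda>s. \<bar>s - k\<bar>) (\<lambda>s. sgn (s - k)) (\<lambda>j s. sgn (s - k) * (f j s - f j k)) \<nu> r u p p' P"
  have c01: "0 < ?c n" "?c n < 1" for n by auto
  have "(\<lambda>n. LINT t:{0<..<T}|lborel. LINT x|torus. ?S (?c n) u p p' P x t) \<longlonglongrightarrow> (LINT t:{0<..<T}|lborel. LINT x|torus. ?N x t)"
  proof (rule time_dominated_convergence)
    show "(\<lambda>(x, t). ?S (?c n) u p p' P x t) \<in> borel_measurable (borel \<Otimes>\<^sub>M borel)" for n by (rule Sm[OF c01(1) um])
    show "(\<lambda>(x, t). ?N x t) \<in> borel_measurable (borel \<Otimes>\<^sub>M borel)"
    proof (rule entropy_terms_measurable[OF levy _ _ _ um td])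
      note [measurable] = continuous_borel[OF f_cont]
      show "(\<lambda>s. \<bar>s - k\<bar>) \<in> borel_measurable borel" "(\<lambda>s. sgn (s - k)) \<in> borel_measurable borel"
        "(\<lambda>s. sgn (s - k) * (f j s - f j k)) \<in> borel_measurable borel" for j by measurable
    qed
    show "\<bar>?S (?c n) u p p' P x t\<bar> \<le> ?C" for n x t using c01[of n] by (intro SB um u(3)) auto
    fix t assume t: "0 < t" "t < T"
    show "AE x in torus. (\<lambda>n. ?S (?c n) u p p' P x t) \<longlonglongrightarrow> ?N x t"
    proof (rule AE_I2)
      fix x
      let ?s = "u x t"
      have s: "\<bar>?s\<bar> \<le> M" by (rule u(3))
      have l1: "(\<lambda>n. sabs B (?c n) (?s - k)) \<longlonglongrightarrow> \<bar>?s - k\<bar>"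
        by (rule LIMSEQ_Suc[OF sabs_tendsto_abs[OF B(1) wB[OF s]]])
      have l2: "(\<lambda>n. sabs' B (?c n) (?s - k)) \<longlonglongrightarrow> sgn (?s - k)"
        by (rule LIMSEQ_Suc[OF sabs'_tendsto_sgn[OF B(1) wB[OF s]]])
      have l3: "(\<lambda>n. flux_primitive f' B (?c n) k j ?s) \<longlonglongrightarrow> sgn (?s - k) * (f j ?s - f j k)" for j
      proof -
        have c0: "?c \<longlonglongrightarrow> 0" by (rule LIMSEQ_Suc[OF LIMSEQ_Suc[OF lim_1_over_n]])
        have "(\<lambda>n. flux_primitive f' B (?c n) k j ?s - sabs' B (?c n) (?s - k) * (f j ?s - f j k)) \<longlonglongrightarrow> 0"
        proof (rule Lim_null_comparison)
          show "\<forall>\<^sub>F n in sequentially. norm (flux_primitive f' B (?c n) k j ?s - sabs' B (?c n) (?s - k) * (f j ?s - f j k)) \<le> ?c n * (L * B)"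
            using fpa[OF c01(1) s] by (intro always_eventually allI) simp
          show "(\<lambda>n. ?c n * (L * B)) \<longlonglongrightarrow> 0" using tendsto_mult_right[OF c0, of "L * B"] by simp
        qed
        from tendsto_add[OF this tendsto_mult_right[OF l2, of "f j ?s - f j k"]] show ?thesis by simp
      qed
      show "(\<lambda>n. ?S (?c n) u p p' P x t) \<longlonglongrightarrow> ?N x t"
        unfolding entropy_terms_def by (intro tendsto_add tendsto_mult tendsto_sum tendsto_const l1 l2 l3)
    qed
  qed
  then show ?thesis
    by (rule tendsto_lowerbound) (use ineq[OF c01] in auto)
qed

end

lemma Ck_on_continuous: "Ck_on k g S \<Longrightarrow> continuous_on S g"
  by (cases k) (auto intro!: continuous_at_imp_continuous_on differentiable_imp_continuous_within)

lemma frechet_slice: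
  fixes F :: "real^'n::finite \<Rightarrow> real \<Rightarrow> real"
  assumes "(\<lambda>(x, t). F x t) differentiable (at (x, t))"
  shows "((\<lambda>y. F y t) has_derivative (\<lambda>h. frechet_derivative (\<lambda>(x, t). F x t) (at (x, t)) (h, 0))) (at x)"
    and "((\<lambda>s. F x s) has_real_derivative frechet_derivative (\<lambda>(x, t). F x t) (at (x, t)) (0, 1)) (at t)"
    and "partial j (\<lambda>y. F y t) x = frechet_derivative (\<lambda>(x, t). F x t) (at (x, t)) (axis j 1, 0)"
proof -
  let ?F = "\<lambda>(x, t). F x t" and ?D = "frechet_derivative (\<lambda>(x, t). F x t) (at (x, t))"
  have d: "(?F has_derivative ?D) (at (x, t))" using assms frechet_derivative_works by blast
  show 1: "((\<lambda>y. F y t) has_derivative (\<lambda>h. ?D (h, 0))) (at x)"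
  proof -
    have "((\<lambda>y. (y, t)) has_derivative (\<lambda>h. (h, 0))) (at x)" by (intro has_derivative_Pair) auto
    from has_derivative_compose[OF this d] show ?thesis by simp
  qed
  have 2: "((\<lambda>s. F x s) has_derivative (\<lambda>h. ?D (0, h))) (at t)"
  proof -
    have "((\<lambda>s. (x, s)) has_derivative (\<lambda>h. (0, h))) (at t)" by (intro has_derivative_Pair) auto
    from has_derivative_compose[OF this d] show ?thesis by simp
  qed
  interpret l: linear ?D using d has_derivative_linear by blast
  have "?D (0, h) = ?D (0, 1) * h" for h
    using l.scaleR[of h "(0, 1)"] by (simp add: mult.commute)
  then have "(\<lambda>h. ?D (0, h)) = (*) (?D (0, 1))" by (rule ext)
  with 2 show "((\<lambda>s. F x s) has_real_derivative ?D (0, 1)) (at t)"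
    by (simp only: has_field_derivative_def)
  show "partial j (\<lambda>y. F y t) x = ?D (axis j 1, 0)"
    unfolding partial_def using frechet_derivative_at[OF 1] by metis
qed

lemma Ck_on_cong:
  assumes "open S" "\<And>x. x \<in> S \<Longrightarrow> g x = h x" "Ck_on k g S"
  shows "Ck_on k h S"
  using assms(2,3)
proof (induction k arbitrary: g h)
  case 0
  then show ?case by (simp cong: continuous_on_cong)
next
  case (Suc k)
  have D: "(h has_derivative frechet_derivative g (at x)) (at x)" if x: "x \<in> S" for x
  proof -
    have "(g has_derivative frechet_derivative g (at x)) (at x)" using Suc.prems x frechet_derivative_works by force
    then show ?thesis
      by (rule has_derivative_transform_within_open[OF _ assms(1) x]) (use Suc.prems in auto)
  qed
  then have fr: "frechet_derivative g (at x) = frechet_derivative h (at x)" if "x \<in> S" for x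
    using frechet_derivative_at that by blast
  have "Ck_on k (\<lambda>x. frechet_derivative h (at x) i) S" if "i \<in> Basis" for i
    by (rule Suc.IH[of "\<lambda>x. frechet_derivative g (at x) i"]) (use Suc.prems that fr in auto)
  then show ?case using D by (auto simp: differentiable_def)
qed

lemma periodic_test_data:
  fixes \<phi> :: "real^'n::finite \<Rightarrow> real \<Rightarrow> real"
  assumes T: "T > 0" and \<phi>: "periodic_test_function T \<phi>"
  obtains p p' P Q a b K where "test_data T p p' P Q a b K"
    "\<And>x t. 0 < t \<Longrightarrow> t < T \<Longrightarrow> p x t = \<phi> x t" "\<And>x t. 0 < t \<Longrightarrow> t < T \<Longrightarrow> p' x t = deriv (\<lambda>s. \<phi> x s) t"
    "\<And>x t. 0 < t \<Longrightarrow> t < T \<Longrightarrow> P x t = grad (\<lambda>y. \<phi> y t) x"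
proof -
  let ?O = "UNIV \<times> {0<..<T} :: ((real^'n) \<times> real) set"
  let ?F = "\<lambda>(x, t). \<phi> x t"
  have O: "open ?O" by (intro open_Times) auto
  have Om: "?O \<in> sets borel" using O by simp
  have C: "Ck_on 2 ?F ?O" using \<phi> by (auto simp: periodic_test_function_def Cinf_on_def)
  have d1: "?F differentiable (at (x, t))" if "0 < t" "t < T" for x t
    using C that by (auto simp: numeral_2_eq_2)
  have b1: "(axis j 1, 0) \<in> (Basis :: ((real^'n) \<times> real) set)" "(0, 1) \<in> (Basis :: ((real^'n) \<times> real) set)" for j
    by (auto simp: Basis_prod_def axis_in_Basis_iff)
  have per: "periodic (\<lambda>x. \<phi> x t)" if "0 < t" "t < T" for t using \<phi> that by (auto simp: periodic_test_function_def)
  note fs = frechet_slice[OF d1]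
  define g where "g j x t = partial j (\<lambda>y. \<phi> y t) x" for j x t
  have C1: "Ck_on 1 (\<lambda>(x, t). g j x t) ?O" for j
  proof (rule Ck_on_cong[OF O])
    show "Ck_on 1 (\<lambda>z. frechet_derivative ?F (at z) (axis j 1, 0)) ?O" using C b1(1)[of j] by (simp add: numeral_2_eq_2)
  qed (auto simp: g_def fs(3))
  have d2: "(\<lambda>(x, t). g j x t) differentiable (at (x, t))" if "0 < t" "t < T" for x t j
    using C1[of j] that by auto
  note gs = frechet_slice[OF d2]
  have cg: "continuous_on ?O (\<lambda>(x, t). g j x t)" for j by (rule Ck_on_continuous[OF C1])
  have cgg: "continuous_on ?O (\<lambda>(x, t). partial i (\<lambda>y. g j y t) x)" for i j
  proof -
    have "continuous_on ?O (\<lambda>z. frechet_derivative (\<lambda>(x, t). g j x t) (at z) (axis i 1, 0))"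
      using C1[of j] b1(1)[of i] by simp
    then show ?thesis by (rule continuous_on_eq) (auto simp: gs(3))
  qed
  have cF: "continuous_on ?O ?F" by (rule Ck_on_continuous[OF C])
  have dt: "deriv (\<lambda>s. \<phi> x s) t = frechet_derivative ?F (at (x, t)) (0, 1)" if "0 < t" "t < T" for x t
    by (rule DERIV_imp_deriv[OF fs(2)[OF that]])
  have cdt: "continuous_on ?O (\<lambda>(x, t). deriv (\<lambda>s. \<phi> x s) t)"
  proof -
    have "Ck_on 1 (\<lambda>z. frechet_derivative ?F (at z) (0, 1)) ?O" using C b1(2) by (simp add: numeral_2_eq_2)
    from Ck_on_continuous[OF this] show ?thesis by (rule continuous_on_eq) (auto simp: dt)
  qed
  have cgr: "continuous_on ?O (\<lambda>(x, t). grad (\<lambda>y. \<phi> y t) x)"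
    using cg unfolding g_def grad_def case_prod_unfold by (intro continuous_on_vec_lambda)
  have cgr2: "continuous_on ?O (\<lambda>(x, t). grad (\<lambda>y. g j y t) x)" for j
    using cgg unfolding grad_def case_prod_unfold by (intro continuous_on_vec_lambda)
  have c2: "periodic_C2 (\<lambda>x. \<phi> x t) (\<lambda>x. grad (\<lambda>y. \<phi> y t) x) (\<lambda>j x. grad (\<lambda>y. g j y t) x)" if t: "0 < t" "t < T" for t
  proof -
    have h1: "((\<lambda>x. \<phi> x t) has_derivative (\<lambda>h. h \<bullet> grad (\<lambda>y. \<phi> y t) x)) (at x)" for x
      by (rule differentiable_grad) (use fs(1)[OF t] in \<open>auto simp: differentiable_def\<close>)
    have h2: "((\<lambda>x. g j x t) has_derivative (\<lambda>h. h \<bullet> grad (\<lambda>y. g j y t) x)) (at x)" for x j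
      by (rule differentiable_grad) (use gs(1)[OF t] in \<open>auto simp: differentiable_def\<close>)
    have pg: "periodic (\<lambda>x. grad (\<lambda>y. \<phi> y t) x)" by (rule periodic_differentiable_grad[OF per[OF t] h1])
    have pp: "periodic (\<lambda>x. g j x t)" for j using pg by (simp add: periodic_def grad_def vec_eq_iff g_def)
    have ph: "periodic (\<lambda>x. grad (\<lambda>y. g j y t) x)" for j by (rule periodic_differentiable_grad[OF pp h2])
    have "continuous_on UNIV (\<lambda>x. grad (\<lambda>y. g j y t) x)" for j by (rule continuous_slice[OF cgr2 t])
    moreover have "(\<lambda>x. grad (\<lambda>y. \<phi> y t) x $ j) = (\<lambda>x. g j x t)" for j by (simp add: grad_def g_def)
    ultimately show ?thesis using per[OF t] pg ph h1 h2 by (simp add: periodic_C2_def)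
  qed
  have pdt: "periodic (\<lambda>x. deriv (\<lambda>s. \<phi> x s) t)" if t: "0 < t" "t < T" for t
    unfolding periodic_def
  proof (intro allI)
    fix x j
    have "eventually (\<lambda>s. s \<in> {0<..<T}) (nhds t)" using t by (intro eventually_nhds_in_open) auto
    then have "eventually (\<lambda>s. \<phi> (x + axis j (2*pi)) s = \<phi> x s) (nhds t)"
      by (rule eventually_mono) (use per in \<open>auto simp: periodic_def\<close>)
    then show "deriv (\<lambda>s. \<phi> (x + axis j (2*pi)) s) t = deriv (\<lambda>s. \<phi> x s) t" by (rule deriv_cong_ev) simp
  qed
  obtain a0 b0 where ab0: "0 < a0" "b0 < T" "\<And>x t. 0 < t \<Longrightarrow> t < T \<Longrightarrow> t \<notin> {a0..b0} \<Longrightarrow> \<phi> x t = 0"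
    using \<phi> by (auto simp: periodic_test_function_def)
  \<comment> \<open>The given time interval may be empty; enclosing \<open>T / 2\<close> makes it nonempty.\<close>
  define a where "a = min a0 (T / 2)"
  define b where "b = max b0 (T / 2)"
  have ab: "0 < a" "a \<le> b" "b < T" using ab0 T by (auto simp: a_def b_def)
  have z0: "\<phi> x t = 0" if "0 < t" "t < T" "t \<notin> {a..b}" for x t
    using that by (intro ab0(3)) (auto simp: a_def b_def)
  have z1: "deriv (\<lambda>s. \<phi> x s) t = 0" if t: "0 < t" "t < T" "t \<notin> {a..b}" for x t
  proof -
    have "open ({0<..<T} - {a..b})" by (intro open_Diff) auto
    then have "eventually (\<lambda>s. s \<in> {0<..<T} - {a..b}) (nhds t)" using t by (intro eventually_nhds_in_open) auto
    then have "eventually (\<lambda>s. \<phi> x s = 0) (nhds t)" by (rule eventually_mono) (use z0 in auto)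
    then have "deriv (\<lambda>s. \<phi> x s) t = deriv (\<lambda>s. 0) t" by (rule deriv_cong_ev) simp
    then show ?thesis by simp
  qed
  have part0: "partial j (\<lambda>y. 0 :: real) x = 0" for j and x :: "real^'n" by (simp add: partial_def)
  have z2: "g j x t = 0" if "0 < t" "t < T" "t \<notin> {a..b}" for x t j
    using z0[OF that] by (simp add: g_def part0)
  have z3: "grad (\<lambda>y. \<phi> y t) x = 0" "grad (\<lambda>y. g j y t) x = 0" if "0 < t" "t < T" "t \<notin> {a..b}" for x t j
    using z0[OF that] z2[OF that] by (simp_all add: grad_def part0 vec_eq_iff)
  define p where "p x t = (if 0 < t \<and> t < T then \<phi> x t else 0)" for x t
  define p' where "p' x t = (if 0 < t \<and> t < T then deriv (\<lambda>s. \<phi> x s) t else 0)" for x t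
  define P where "P x t = (if 0 < t \<and> t < T then grad (\<lambda>y. \<phi> y t) x else 0)" for x t
  define Q where "Q j x t = (if 0 < t \<and> t < T then grad (\<lambda>y. g j y t) x else 0)" for j x t
  have meas: "(\<lambda>(x, t). if 0 < t \<and> t < T then G x t else 0) \<in> borel_measurable (borel \<Otimes>\<^sub>M borel)"
    if "continuous_on ?O (\<lambda>(x, t). G x t)" for G :: "real^'n \<Rightarrow> real \<Rightarrow> 'c::{second_countable_topology, real_normed_vector}"
  proof -
    have "(\<lambda>p. indicator ?O p *\<^sub>R (case p of (x, t) \<Rightarrow> G x t)) \<in> borel_measurable borel"
      by (rule borel_measurable_continuous_on_indicator[OF Om that])
    also have "(\<lambda>p. indicator ?O p *\<^sub>R (case p of (x, t) \<Rightarrow> G x t)) = (\<lambda>(x, t). if 0 < t \<and> t < T then G x t else 0)"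
      by (auto simp: fun_eq_iff indicator_def)
    finally show ?thesis by (simp add: borel_prod)
  qed
  obtain K1 where K1: "K1 > 0" "\<And>x t. a \<le> t \<Longrightarrow> t \<le> b \<Longrightarrow> norm (\<phi> x t) \<le> K1"
    using compact_time_bound[OF cF per ab(1,3)] by blast
  obtain K2 where K2: "K2 > 0" "\<And>x t. a \<le> t \<Longrightarrow> t \<le> b \<Longrightarrow> norm (deriv (\<lambda>s. \<phi> x s) t) \<le> K2"
    using compact_time_bound[OF cdt pdt ab(1,3)] by blast
  obtain K3 where K3: "K3 > 0" "\<And>x t. a \<le> t \<Longrightarrow> t \<le> b \<Longrightarrow> norm (grad (\<lambda>y. \<phi> y t) x) \<le> K3"
    using compact_time_bound[OF cgr periodic_C2_continuous(5)[OF c2] ab(1,3)] by blast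
  have "\<forall>j. \<exists>K. K > 0 \<and> (\<forall>x t. a \<le> t \<longrightarrow> t \<le> b \<longrightarrow> norm (grad (\<lambda>y. g j y t) x) \<le> K)"
    using compact_time_bound[OF cgr2 periodic_C2_continuous(6)[OF c2] ab(1,3)] by metis
  then obtain K4 where K4: "\<And>j. K4 j > 0" "\<And>j x t. a \<le> t \<Longrightarrow> t \<le> b \<Longrightarrow> norm (grad (\<lambda>y. g j y t) x) \<le> K4 j" by metis
  have K4': "K4 j \<le> (\<Sum>i\<in>UNIV. K4 i)" for j
    using member_le_sum[of j UNIV K4] K4(1) by (simp add: less_imp_le)
  have K40: "(\<Sum>i\<in>UNIV. K4 i) > 0" using K4(1) by (intro sum_pos) auto
  define K where "K = K1 + K2 + K3 + (\<Sum>i\<in>UNIV. K4 i)"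
  have K: "K > 0" "K1 \<le> K" "K2 \<le> K" "K3 \<le> K" "K4 j \<le> K" for j
    using K1(1) K2(1) K3(1) K40 K4'[of j] by (auto simp: K_def)
  have inab: "0 < t \<and> t < T" if "t \<in> {a..b}" for t using that ab by auto
  have zero: "p x t = 0 \<and> p' x t = 0 \<and> P x t = 0 \<and> (\<forall>j. Q j x t = 0)" if "t \<notin> {a..b}" for x t
    using that z0[of t x] z1[of t x] z3[of t] by (auto simp: p_def p'_def P_def Q_def)
  have bounds: "0 \<le> p x t \<and> p x t \<le> K \<and> \<bar>p' x t\<bar> \<le> K \<and> norm (P x t) \<le> K \<and> (\<forall>j. norm (Q j x t) \<le> K)" for x t
  proof (cases "t \<in> {a..b}")
    case True
    then have t: "a \<le> t" "t \<le> b" "0 < t" "t < T" using inab by auto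
    have "0 \<le> \<phi> x t" using \<phi> t by (auto simp: periodic_test_function_def)
    moreover have "norm (\<phi> x t) \<le> K" "norm (deriv (\<lambda>s. \<phi> x s) t) \<le> K" "norm (grad (\<lambda>y. \<phi> y t) x) \<le> K"
      "norm (grad (\<lambda>y. g j y t) x) \<le> K" for j
      using K1(2)[OF t(1,2), of x] K2(2)[OF t(1,2), of x] K3(2)[OF t(1,2), of x] K4(2)[OF t(1,2), of j x] K(2,3,4) K(5)[of j]
      by linarith+
    ultimately show ?thesis using t by (simp add: p_def p'_def P_def Q_def)
  next
    case False
    then show ?thesis using zero[OF False, of x] K(1) by simp
  qed
  have "test_data T p p' P Q a b K"
    unfolding test_data_def
  proof (intro conjI)
    show "(\<lambda>(x, t). p x t) \<in> borel_measurable (borel \<Otimes>\<^sub>M borel)" unfolding p_def by (rule meas[OF cF])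
    show "(\<lambda>(x, t). p' x t) \<in> borel_measurable (borel \<Otimes>\<^sub>M borel)" unfolding p'_def by (rule meas[OF cdt])
    show "(\<lambda>(x, t). P x t) \<in> borel_measurable (borel \<Otimes>\<^sub>M borel)" unfolding P_def by (rule meas[OF cgr])
    show "\<forall>t\<in>{0<..<T}. periodic_C2 (\<lambda>x. p x t) (\<lambda>x. P x t) (\<lambda>j x. Q j x t) \<and>
        (\<forall>x. ((\<lambda>s. p x s) has_real_derivative p' x t) (at t))"
    proof (intro ballI conjI allI)
      fix t x assume "t \<in> {0<..<T}"
      then have t: "0 < t" "t < T" by auto
      show "periodic_C2 (\<lambda>x. p x t) (\<lambda>x. P x t) (\<lambda>j x. Q j x t)" using c2[OF t] t by (simp add: p_def P_def Q_def)
      have "((\<lambda>s. \<phi> x s) has_real_derivative p' x t) (at t)" using fs(2)[OF t] dt[OF t] t by (simp add: p'_def)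
      then show "((\<lambda>s. p x s) has_real_derivative p' x t) (at t)"
        by (rule has_field_derivative_transform_within_open[of _ _ _ "{0<..<T}"]) (use t in \<open>auto simp: p_def\<close>)
    qed
  qed (use ab K(1) zero bounds in auto)
  then show ?thesis by (rule that) (auto simp: p_def p'_def P_def)
qed

section \<open>Existence of periodic entropy solutions\<close>

lemma L1_dist_eq_torus_dist:
  assumes v [measurable]: "v \<in> borel_measurable borel" and b [measurable]: "b \<in> borel_measurable borel"
    and u0: "u0 \<in> borel_measurable lebesgue" "AE x in lebesgue. u0 x = b x"
  shows "L1_dist v u0 = torus_dist v b"
proof -
  have "L1_dist v u0 = (LINT x:torus_cell|lebesgue. \<bar>v x - b x\<bar>)"
    unfolding L1_dist_def set_lebesgue_integral_def
  proof (rule integral_cong_AE)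
    note [measurable] = u0(1)
    have [measurable]: "v \<in> borel_measurable lebesgue" "b \<in> borel_measurable lebesgue" "torus_cell \<in> sets lebesgue"
      using v b by (auto intro: measurable_completion)
    show "(\<lambda>x. indicat_real torus_cell x *\<^sub>R \<bar>v x - u0 x\<bar>) \<in> borel_measurable lebesgue"
      "(\<lambda>x. indicat_real torus_cell x *\<^sub>R \<bar>v x - b x\<bar>) \<in> borel_measurable lebesgue" by measurable
    show "AE x in lebesgue. indicat_real torus_cell x *\<^sub>R \<bar>v x - u0 x\<bar> = indicat_real torus_cell x *\<^sub>R \<bar>v x - b x\<bar>"
      using u0(2) by eventually_elim simp
  qed
  also have "\<dots> = torus_dist v b" unfolding torus_dist_def by (rule integral_torus) measurable
  finally show ?thesis .
qed

lemma L1_dist_borel: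
  assumes "v \<in> borel_measurable borel" "w \<in> borel_measurable borel"
  shows "L1_dist v w = torus_dist v w"
  using assms by (intro L1_dist_eq_torus_dist) (auto intro: measurable_completion)

lemma bounded_borel_representative:
  fixes u0 :: "real^'n::finite \<Rightarrow> real"
  assumes "Linf_periodic u0"
  obtains b M where "b \<in> borel_measurable borel" "M > 0" "\<And>x. \<bar>b x\<bar> \<le> M" "AE x in lebesgue. u0 x = b x"
proof -
  obtain M0 where M0: "AE x in lebesgue. \<bar>u0 x\<bar> \<le> M0" and m: "u0 \<in> borel_measurable lebesgue"
    using assms by (auto simp: Linf_periodic_def)
  obtain g where g: "g \<in> borel_measurable lborel" "AE x in lborel. u0 x = g x"
    using completion_ex_borel_measurable_real[OF m] by blast
  have g' [measurable]: "g \<in> borel_measurable borel" using g(1) by simp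
  define M where "M = max M0 1"
  define b where "b x = max (- M) (min M (g x))" for x
  have "b \<in> borel_measurable borel" unfolding b_def[abs_def] by measurable
  moreover have "M > 0" by (simp add: M_def)
  moreover have "\<bar>b x\<bar> \<le> M" for x by (auto simp: b_def M_def)
  moreover have "AE x in lebesgue. u0 x = b x"
    using AE_completion[OF g(2)] M0 by eventually_elim (auto simp: b_def M_def)
  ultimately show ?thesis using that by blast
qed

text \<open>
  The completed measure on space-time is replaced by iterated integrals over Borel functions.
\<close>
lemma torus_time_integral:
  fixes F :: "real^'n::finite \<Rightarrow> real \<Rightarrow> real"
  assumes m: "(\<lambda>(x, t). F x t) \<in> borel_measurable (borel \<Otimes>\<^sub>M borel)" and C: "\<And>x t. \<bar>F x t\<bar> \<le> C" and T: "T > 0"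
    and eq: "\<And>x t. 0 < t \<Longrightarrow> t < T \<Longrightarrow> G x t = F x t"
  shows "(LINT (x, t):torus_cell \<times> {0<..<T}|lebesgue. G x t) = (LINT t:{0<..<T}|lborel. LINT x|torus. F x t)"
proof -
  have m1: "(\<lambda>p. F (fst p) (snd p)) \<in> borel_measurable (borel \<Otimes>\<^sub>M borel)" using m by (simp add: case_prod_unfold)
  note [measurable] = m1
  let ?h = "\<lambda>p. indicator torus_cell (fst p) * (indicator {0<..<T} (snd p) * F (fst p) (snd p)) :: real"
  have hm: "?h \<in> borel_measurable (borel \<Otimes>\<^sub>M borel)" by measurable
  have hm': "?h \<in> borel_measurable (lborel \<Otimes>\<^sub>M lborel)" using hm by (simp cong: measurable_cong_sets)
  have "(LINT (x, t):torus_cell \<times> {0<..<T}|lebesgue. G x t) = (LINT p|lebesgue. ?h p)"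
    unfolding set_lebesgue_integral_def
    by (rule Bochner_Integration.integral_cong) (auto simp: indicator_def eq)
  also have "\<dots> = (LINT p|lborel. ?h p)"
    using hm by (intro integral_completion) (simp add: borel_prod)
  also have "\<dots> = (LINT p|(lborel \<Otimes>\<^sub>M lborel). ?h p)" by (simp add: lborel_prod)
  also have "\<dots> = (LINT t|lborel. LINT x|lborel. ?h (x, t))"
  proof -
    have fin: "emeasure (lborel :: (real^'n) measure) torus_cell < \<infinity>" "emeasure lborel {0<..<T} < \<infinity>"
      using T unfolding torus_cell_box by (simp_all add: emeasure_lborel_box_eq)
    let ?A = "(torus_cell :: (real^'n) set) \<times> {0<..<T}"
    have A: "?A \<in> sets (lborel \<Otimes>\<^sub>M lborel)" by (intro pair_measureI) auto
    have "emeasure (lborel \<Otimes>\<^sub>M lborel) ?A = emeasure lborel (torus_cell :: (real^'n) set) * emeasure lborel {0<..<T}"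
      by (rule lborel.emeasure_pair_measure_Times) auto
    then have "emeasure (lborel \<Otimes>\<^sub>M lborel) ?A < \<infinity>" using fin by (simp add: ennreal_mult_less_top)
    then have "integrable (lborel \<Otimes>\<^sub>M lborel) (\<lambda>p. C * indicator ?A p :: real)"
      by (intro integrable_mult_right integrable_real_indicator A)
    then have "integrable (lborel \<Otimes>\<^sub>M lborel) ?h"
      by (rule Bochner_Integration.integrable_bound[OF _ hm'])
        (auto simp: indicator_def intro!: AE_I2 order_trans[OF C])
    then have "integrable (lborel \<Otimes>\<^sub>M lborel) (\<lambda>(x, t). ?h (x, t))" by (simp add: case_prod_unfold)
    from lborel_pair.integral_snd[OF this] show ?thesis by (simp add: case_prod_unfold)
  qed
  also have "\<dots> = (LINT t:{0<..<T}|lborel. LINT x|torus. F x t)"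
    unfolding set_lebesgue_integral_def
  proof (rule Bochner_Integration.integral_cong[OF refl])
    fix t
    have mt: "(\<lambda>x. F x t) \<in> borel_measurable borel" by (rule pair_slice[OF m])
    have "(LINT x|lborel. ?h (x, t)) = (LINT x|lborel. indicator {0<..<T} t * (indicator torus_cell x * F x t))"
      by (rule Bochner_Integration.integral_cong) auto
    also have "\<dots> = indicator {0<..<T} t * (LINT x|lborel. indicator torus_cell x * F x t)"
      by (rule integral_mult_right_zero)
    also have "(LINT x|lborel. indicator torus_cell x * F x t) = (LINT x:torus_cell|lebesgue. F x t)"
      unfolding set_lebesgue_integral_def using mt by (subst integral_completion) auto
    also have "\<dots> = (LINT x|torus. F x t)" by (rule integral_torus[OF mt])
    finally show "(LINT x|lborel. ?h (x, t)) = indicator {0<..<T} t *\<^sub>R (LINT x|torus. F x t)" by simp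
  qed
  finally show ?thesis .
qed

theorem corollary2p5:
  fixes f :: "'n::finite \<Rightarrow> real \<Rightarrow> real"
    and \<mu> :: "(real^'n) measure"
    and s :: nat
    and T :: real
    and u0 :: "real^'n \<Rightarrow> real"
  assumes "T > 0"
    and "s > 4 + CARD('n) div 2"
    and "\<And>j. Ck_on s (f j) UNIV"
    and "levy_measure \<mu>"
    and "Linf_periodic u0"
    and "BV torus_cell u0"
    and "\<And>\<epsilon>. \<epsilon> > 0 \<Longrightarrow> viscous_problem_well_posed f \<mu> \<epsilon> T u0"
  shows "\<exists>u. periodic_entropy_solution f \<mu> T u0 u"
proof -
  note T = assms(1) and \<mu> = assms(4)
  obtain b M where b: "b \<in> borel_measurable borel" "M > 0" "\<And>x. \<bar>b x\<bar> \<le> M" "AE x in lebesgue. u0 x = b x"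
    using bounded_borel_representative[OF assms(5)] by blast
  have u0m: "u0 \<in> borel_measurable lebesgue" using assms(5) by (simp add: Linf_periodic_def)
  note L1b = L1_dist_eq_torus_dist[OF _ b(1) u0m b(4)]
  obtain s' where s': "s = Suc s'" using assms(2) by (cases s) auto
  define f' where "f' j x = frechet_derivative (f j) (at x) 1" for j x
  have fd: "(f j has_real_derivative f' j a) (at a)" for j a
  proof -
    have "(f j has_derivative frechet_derivative (f j) (at a)) (at a)"
      using assms(3)[of j] s' frechet_derivative_works by auto
    then have "(f j has_real_derivative frechet_derivative (f j) (at a) 1) (at a)"
      by (metis has_derivative_imp_has_field_derivative has_derivative_linear linear_cmul mult.comm_neutral real_scaleR_def)
    then show ?thesis by (simp add: f'_def)
  qed
  have f'c: "continuous_on UNIV (f' j)" for j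
    using assms(3)[of j] unfolding s' f'_def by (auto intro: Ck_on_continuous)
  have "\<forall>\<epsilon>. \<exists>v. \<epsilon> > 0 \<longrightarrow> classical_viscous_solution f \<mu> \<epsilon> T u0 v"
    using assms(7) unfolding viscous_problem_well_posed_def by blast
  then obtain V where V: "\<And>\<epsilon>. \<epsilon> > 0 \<Longrightarrow> classical_viscous_solution f \<mu> \<epsilon> T u0 (V \<epsilon>)" by metis
  note sol = classical_imp_viscous_solution[OF V \<mu> fd]
  have ini: "((\<lambda>t. torus_dist (\<lambda>x. V \<epsilon> x t) b) \<longlongrightarrow> 0) (at_right 0)" if \<epsilon>: "\<epsilon> > 0" for \<epsilon>
  proof -
    have "((\<lambda>t. L1_dist (\<lambda>x. V \<epsilon> x t) u0) \<longlongrightarrow> 0) (at_right 0)"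
      using V[OF \<epsilon>] by (simp add: classical_viscous_solution_def)
    moreover have "\<forall>\<^sub>F t in at_right 0. L1_dist (\<lambda>x. V \<epsilon> x t) u0 = torus_dist (\<lambda>x. V \<epsilon> x t) b"
      unfolding eventually_at_right_field
      using T L1b continuous_borel[OF viscous_solutionD(5)[OF sol[OF \<epsilon>]]] by (intro exI[of _ T]) auto
    ultimately show ?thesis by (rule Lim_transform_eventually)
  qed
  have family: "viscous_family f f' (levy_ext \<mu>) T M b V (\<lambda>\<epsilon> x t. deriv (\<lambda>s. V \<epsilon> x s) t)
    (\<lambda>\<epsilon> x t. grad (\<lambda>y. V \<epsilon> y t) x) (\<lambda>\<epsilon> j x t. grad (partial j (\<lambda>y. V \<epsilon> y t)) x)"
  proof (intro viscous_family.intro viscous_setting.intro viscous_family_axioms.intro)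
    show "levy_kernel (levy_ext \<mu>)" by (rule levy_kernel_ext[OF \<mu>])
    show "(f j has_real_derivative f' j a) (at a)" for j a by (rule fd)
    show "continuous_on UNIV (f' j)" for j by (rule f'c)
    show "viscous_solution f' (levy_ext \<mu>) \<epsilon> T (V \<epsilon>) (\<lambda>x t. deriv (\<lambda>s. V \<epsilon> x s) t)
      (\<lambda>x t. grad (\<lambda>y. V \<epsilon> y t) x) (\<lambda>j x t. grad (partial j (\<lambda>y. V \<epsilon> y t)) x)" if "\<epsilon> > 0" for \<epsilon>
      by (rule sol[OF that])
    show "((\<lambda>t. torus_dist (\<lambda>x. V \<epsilon> x t) b) \<longlongrightarrow> 0) (at_right 0)" if "\<epsilon> > 0" for \<epsilon> by (rule ini[OF that])
  qed (fact T b(1,2,3))+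
  have setting: "viscous_setting f f' (levy_ext \<mu>)" using family by (simp add: viscous_family_def)
  note levy = levy_kernel_ext[OF \<mu>] and f_cont = viscous_setting.f_cont[OF setting]
  obtain E u where E: "\<And>n. E n > 0" "E \<longlonglongrightarrow> 0"
    and u: "(\<lambda>(x, t). u x t) \<in> borel_measurable borel" "\<And>t. periodic (\<lambda>x. u x t)" "\<And>x t. \<bar>u x t\<bar> \<le> M"
    and ae: "\<And>t. 0 < t \<Longrightarrow> t < T \<Longrightarrow> AE x in torus. (\<lambda>n. V (E n) x t) \<longlonglongrightarrow> u x t"
    and cont: "\<And>t. t \<in> {0..T} \<Longrightarrow> ((\<lambda>s. torus_dist (\<lambda>x. u x s) (\<lambda>x. u x t)) \<longlongrightarrow> 0) (at t within {0..T})"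
    and u_ini: "((\<lambda>t. torus_dist (\<lambda>x. u x t) b) \<longlongrightarrow> 0) (at_right 0)"
    by (rule viscous_family.vanishing_viscosity_limit[OF family]) blast
  have um: "(\<lambda>(x, t). u x t) \<in> borel_measurable (borel \<Otimes>\<^sub>M borel)" using u(1) by (simp add: borel_prod)
  note ut = pair_slice[OF um]
  have "C_Linf_periodic T u"
    unfolding C_Linf_periodic_def
  proof (intro conjI ballI)
    show "(\<lambda>(x, t). u x t) \<in> borel_measurable (restrict_space borel (UNIV \<times> {0..T}))"
      using u(1) by (rule measurable_restrict_space1)
    show "Linf_periodic (\<lambda>x. u x t)" for t
      using u(2,3) ut[of t] unfolding Linf_periodic_def
      by (intro conjI exI[of _ M]) (auto intro: measurable_completion)
    show "\<exists>M. \<forall>t\<in>{0..T}. AE x in lebesgue. \<bar>u x t\<bar> \<le> M" using u(3) by blast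
    show "((\<lambda>s. L1_dist (\<lambda>x. u x s) (\<lambda>x. u x t)) \<longlongrightarrow> 0) (at t within {0..T})" if "t \<in> {0..T}" for t
      using cont[OF that] by (simp add: L1_dist_borel[OF ut ut])
  qed
  moreover have "esslim_at_0 (\<lambda>t. L1_dist (\<lambda>x. u x t) u0) 0"
    unfolding esslim_at_0_def
  proof (intro allI impI)
    fix e :: real assume "e > 0"
    then have "\<forall>\<^sub>F t in at_right 0. torus_dist (\<lambda>x. u x t) b < e" using u_ini by (intro order_tendstoD(2)) auto
    then obtain \<delta> where "\<delta> > 0" "\<And>t. 0 < t \<Longrightarrow> t < \<delta> \<Longrightarrow> torus_dist (\<lambda>x. u x t) b < e"
      unfolding eventually_at_right_field by auto
    then show "\<exists>\<delta>>0. AE t in lebesgue. 0 < t \<and> t < \<delta> \<longrightarrow> \<bar>L1_dist (\<lambda>x. u x t) u0 - 0\<bar> < e"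
      by (intro exI[of _ \<delta>]) (auto simp: L1b[OF ut] abs_of_nonneg[OF torus_dist_nonneg] intro!: AE_I2)
  qed
  moreover have "0 \<le> (LINT (x, t):torus_cell \<times> {0<..<T}|lebesgue. entropy_integrand f \<mu> k r u \<phi> x t)"
    if r: "r > 0" and \<phi>: "periodic_test_function T \<phi>" for k r \<phi>
  proof -
    obtain p p' P Q a b' K where td: "test_data T p p' P Q a b' K"
      and p: "\<And>x t. 0 < t \<Longrightarrow> t < T \<Longrightarrow> p x t = \<phi> x t" "\<And>x t. 0 < t \<Longrightarrow> t < T \<Longrightarrow> p' x t = deriv (\<lambda>s. \<phi> x s) t"
        "\<And>x t. 0 < t \<Longrightarrow> t < T \<Longrightarrow> P x t = grad (\<lambda>y. \<phi> y t) x"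
      using periodic_test_data[OF T \<phi>] by blast
    let ?F = "entropy_terms (\<lambda>s. \<bar>s - k\<bar>) (\<lambda>s. sgn (s - k)) (\<lambda>j s. sgn (s - k) * (f j s - f j k)) (levy_ext \<mu>) r u p p' P"
    have Fm: "(\<lambda>(x, t). ?F x t) \<in> borel_measurable (borel \<Otimes>\<^sub>M borel)"
    proof (rule entropy_terms_measurable[OF levy _ _ _ um td])
      note [measurable] = continuous_borel[OF f_cont]
      show "(\<lambda>s. \<bar>s - k\<bar>) \<in> borel_measurable borel" "(\<lambda>s. sgn (s - k)) \<in> borel_measurable borel"
        "(\<lambda>s. sgn (s - k) * (f j s - f j k)) \<in> borel_measurable borel" for j by measurable
    qed
    obtain L where L: "L > 0" "\<And>j s. \<bar>s\<bar> \<le> M + \<bar>k\<bar> \<Longrightarrow> \<bar>f' j s\<bar> \<le> L" by (rule viscous_setting.flux_lipschitz_const[OF setting]) blast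
    have "\<exists>C. \<forall>x t. \<bar>?F x t\<bar> \<le> C"
    proof (intro exI allI)
      fix x t
      show "\<bar>?F x t\<bar> \<le> (M + \<bar>k\<bar>) * K + real CARD('n) * (L * (M + \<bar>k\<bar>) * K)
        + (M + \<bar>k\<bar>) * ((real CARD('n) * K + 2 * K) * (LINT z|small_jumps (levy_ext \<mu>) r. min ((norm z)\<^sup>2) 1))
        + 1 * (2 * M * (LINT z:{z. norm z > r}|levy_ext \<mu>. 1)) * K + (M + \<bar>k\<bar>) * (norm (jump_drift (levy_ext \<mu>) r) * K)"
      proof (rule entropy_terms_bound[OF levy r u(3) ut td])
        fix s :: real and j assume s: "\<bar>s\<bar> \<le> M"
        show 1: "\<bar>\<bar>s - k\<bar>\<bar> \<le> M + \<bar>k\<bar>" using s by linarith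
        show "\<bar>sgn (s - k)\<bar> \<le> 1" by (simp add: sgn_if)
        have "\<bar>sgn (s - k) * (f j s - f j k)\<bar> \<le> 1 * (L * \<bar>s - k\<bar>)"
          unfolding abs_mult
        proof (rule mult_mono)
          show "\<bar>f j s - f j k\<bar> \<le> L * \<bar>s - k\<bar>"
            by (rule viscous_setting.flux_lipschitz[OF setting L(2), where M="M + \<bar>k\<bar>"]) (use s b(2) in auto)
        qed (simp_all add: sgn_if)
        also have "\<dots> \<le> 1 * (L * (M + \<bar>k\<bar>))" using 1 L(1) by (intro mult_left_mono) auto
        finally show "\<bar>sgn (s - k) * (f j s - f j k)\<bar> \<le> L * (M + \<bar>k\<bar>)" by simp
      qed
    qed
    then obtain C where C: "\<And>x t. \<bar>?F x t\<bar> \<le> C" by blast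
    have eq: "entropy_integrand f \<mu> k r u \<phi> x t = ?F x t" if t: "0 < t" "t < T" for x t
    proof -
      have pe: "(\<lambda>y. p y t) = (\<lambda>y. \<phi> y t)" and Pe: "(\<lambda>y. P y t) = grad (\<lambda>y. \<phi> y t)"
        using p[OF t] by auto
      have "continuous_on UNIV (\<lambda>y. p y t)"
        using td t by (intro periodic_C2_continuous(1)) (auto simp: test_data_def)
      then have bm: "(\<lambda>y. \<phi> y t) \<in> borel_measurable borel" unfolding pe by (rule continuous_borel)
      have "entropy_flux f (u x t) k \<bullet> grad (\<lambda>y. \<phi> y t) x = (\<Sum>j\<in>UNIV. sgn (u x t - k) * (f j (u x t) - f j k) * P x t $ j)"
        by (simp add: entropy_flux_def entropy'_def inner_vec_def p(3)[OF t])
      then show ?thesis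
        unfolding entropy_integrand_def entropy_terms_def levy_inner_adjoint_eq_levy_adj[OF \<mu> bm] levy_outer_eq_jump_part[OF \<mu> ut]
          levy_drift_eq_jump_drift[OF \<mu>] pe Pe
        by (simp add: entropy_def entropy'_def p[OF t])
    qed
    have "(LINT (x, t):torus_cell \<times> {0<..<T}|lebesgue. entropy_integrand f \<mu> k r u \<phi> x t)
        = (LINT t:{0<..<T}|lborel. LINT x|torus. ?F x t)"
      by (rule torus_time_integral[OF Fm C T eq])
    then show ?thesis using viscous_family.limit_entropy_inequality[OF family E u ae r td, of k] by simp
  qed
  ultimately have "periodic_entropy_solution f \<mu> T u0 u"
    unfolding periodic_entropy_solution_def by blast
  then show ?thesis by blast
qed

end
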